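(* Let $(X,d,\mu)$ be a non-homogeneous space and let $T$ be a bilinear Calderón–Zygmund operator on it, i.e. $T$ is associated with a Calderón–Zygmund kernel $K$ and is bounded from $L^{p_1}(X,d,\mu)\times L^{p_2}(X,d,\mu)$ to $L^p(X,d,\mu)$, where $\frac1p=\frac1{p_1}+\frac1{p_2}$ with $1<p,p_1,p_2<\infty$. Then $T$ is bounded from $L^1(X,d,\mu)\times L^1(X,d,\mu)$ to $L^{\frac12,\infty}(X,d,\mu)$.
   Context: **Non-homogeneous space.** A metric measure space $(X,d,\mu)$ ($\mu$ a Borel measure) is a non-homogeneous space if it is both upper doubling and geometrically doubling. *Upper doubling*: there are $\lambda:X\times(0,\infty)\to(0,\infty)$ and $C_\lambda>0$ such that for all $x\in X$, $r>0$: $\mu(B(x,r))\le\lambda(x,r)$; $r\mapsto\lambda(x,r)$ is non-decreasing; $\lambda(x,r)\le C_\lambda\lambda(x,r/2)$. *Geometrically doubling* (with doubling dimension $N$): any ball $B(x,r)$ contains at most $N$ centres $y_i$ of disjoint balls $B(y_i,r/4)$. **Calderón–Zygmund kernel and association.** A Calderón–Zygmund kernel is a $\mu$-locally integrable function $K$ defined on $X^3$ away from the diagonal $x=y_1=y_2$ for which there are $C_K>0$ and a modulus of continuity $\omega$ (non-decreasing, subadditive, $\omega(0)=0$, $\|\omega\|_{Dini(1)}=\int_0^1\omega(t)\,\frac{dt}{t}<\infty$) such that $|K(x,y_1,y_2)|\le C_K(\lambda(x,d(x,y_1))+\lambda(x,d(x,y_2)))^{-2}$ whenever $x\ne y_j$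 for some $j$; $$|K(x,y_1,y_2)-K(x',y_1,y_2)|\le \frac{C_K}{(\lambda(x,d(x,y_1))+\lambda(x,d(x,y_2)))^{2}}\,\omega\Big(\frac{d(x,x')}{d(x,y_1)+d(x,y_2)}\Big)$$ whenever $d(x,x')\le\frac12\max_i d(x,y_i)$; and the analogous bounds hold for differences in $y_1$ and in $y_2$ (with $d(y_j,y_j')\le\frac12\max_i d(x,y_i)$ and $\omega(d(y_j,y_j')/(d(x,y_1)+d(x,y_2)))$). $T$ (bilinear) is associated with $K$ if for compactly supported bounded $f_1,f_2$, $T(f_1,f_2)(x)=\int_{X^2}K(x,y_1,y_2)f_1(y_1)f_2(y_2)\,d\mu(y_1)d\mu(y_2)$ for a.e. $x\notin\operatorname{supp}f_1\cap\operatorname{supp}f_2$. Boundedness into $L^{1/2,\infty}$ means $\sup_{t>0}t\,\mu(\{|T(f_1,f_2)|>t\})^{2}\le C\|f_1\|_{L^1(\mu)}\|f_2\|_{L^1(\mu)}$.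
   Formalization: The Borel measure is assumed inner regular by compact sets (automatic on complete spaces); without this the claim fails, e.g. for Lebesgue outer measure on a Bernstein subset of [0,1], where compactly supported functions vanish a.e. and association with a kernel says nothing. *)

theory Defs
  imports "HOL-Analysis.Analysis"
begin

text \<open>The metric space is the whole type \<open>'a\<close>, and balls are open. Functions, kernels and
  operators take values in a scalar field \<open>'b\<close> of class \<open>real_normed_field\<close> (complete and
  separable), so that the real and the complex case are both covered.\<close>

section \<open>Non-homogeneous spaces\<close>

definition upper_doubling :: "'a::metric_space measure \<Rightarrow> ('a \<Rightarrow> real \<Rightarrow> real) \<Rightarrow> bool" where
  "upper_doubling M lam \<longleftrightarrow>
     (\<forall>x. \<forall>r>0. lam x r > 0 \<and> emeasure M (ball x r) \<le> ennreal (lam x r)) \<and>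
     (\<forall>x. mono_on {0<..} (lam x)) \<and>
     (\<exists>C>0. \<forall>x. \<forall>r>0. lam x r \<le> C * lam x (r / 2))"

definition geometrically_doubling :: "'a::metric_space itself \<Rightarrow> bool" where
  "geometrically_doubling _ \<longleftrightarrow>
     (\<exists>N::nat. \<forall>x::'a. \<forall>r>0. \<forall>Y. Y \<subseteq> ball x r \<and> disjoint_family_on (\<lambda>y. ball y (r / 4)) Y
        \<longrightarrow> finite Y \<and> card Y \<le> N)"

text \<open>The dominating function \<open>lam\<close> is kept as a parameter because kernel bounds refer to it.\<close>

definition non_homogeneous_space ::
    "'a::metric_space measure \<Rightarrow> ('a \<Rightarrow> real \<Rightarrow> real) \<Rightarrow> bool" where
  "non_homogeneous_space M lam \<longleftrightarrow>
     sets M = sets borel \<and> upper_doubling M lam \<and> geometrically_doubling TYPE('a)"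

text \<open>Operators are tested below on compactly supported functions. On an incomplete space a locally
  finite Borel measure may vanish on all compact sets (for example Lebesgue outer measure on a
  Bernstein subset of the unit interval), and then such a test carries no information. The usual
  regularity of Borel measures excludes this; it is automatic for measures that are finite on balls
  if the space is complete and separable.\<close>

definition compact_inner_regular :: "'a::metric_space measure \<Rightarrow> bool" where
  "compact_inner_regular M \<longleftrightarrow>
     (\<forall>A\<in>sets M. emeasure M A = (SUP S\<in>{S. compact S \<and> S \<subseteq> A}. emeasure M S))"

section \<open>Lebesgue spaces and bilinear operators\<close>

text \<open>Elements of Lebesgue spaces are represented by functions. Bilinearity is therefore required
  almost everywhere; together with a norm bound it implies that an operator respects
  almost-everywhere equality of its arguments.\<close>

definition Lp_space ::
    "real \<Rightarrow> 'a measure \<Rightarrow> ('a \<Rightarrow> 'b::{real_normed_field,banach,second_countable_topology}) set" where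
  "Lp_space p M = {f \<in> borel_measurable M. integrable M (\<lambda>x. norm (f x) powr p)}"

definition Lp_norm ::
    "real \<Rightarrow> 'a measure \<Rightarrow> ('a \<Rightarrow> 'b::{real_normed_field,banach,second_countable_topology}) \<Rightarrow> real" where
  "Lp_norm p M f = (\<integral>x. norm (f x) powr p \<partial>M) powr (1 / p)"

type_synonym ('a, 'b) bilinear_op = "('a \<Rightarrow> 'b) \<Rightarrow> ('a \<Rightarrow> 'b) \<Rightarrow> 'a \<Rightarrow> 'b"

definition bilinear_ae ::
    "'a measure \<Rightarrow> ('a \<Rightarrow> 'b::real_normed_field) set \<Rightarrow> ('a \<Rightarrow> 'b) set \<Rightarrow> ('a, 'b) bilinear_op \<Rightarrow> bool" where
  "bilinear_ae M V W T \<longleftrightarrow>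
     (\<forall>f\<in>V. \<forall>g\<in>V. \<forall>h\<in>W. AE x in M. T (\<lambda>y. f y + g y) h x = T f h x + T g h x) \<and>
     (\<forall>c. \<forall>f\<in>V. \<forall>h\<in>W. AE x in M. T (\<lambda>y. c * f y) h x = c * T f h x) \<and>
     (\<forall>f\<in>V. \<forall>g\<in>W. \<forall>h\<in>W. AE x in M. T f (\<lambda>y. g y + h y) x = T f g x + T f h x) \<and>
     (\<forall>c. \<forall>f\<in>V. \<forall>h\<in>W. AE x in M. T f (\<lambda>y. c * h y) x = c * T f h x)"

definition bounded_bilinear_Lp ::
    "'a measure \<Rightarrow> real \<Rightarrow> real \<Rightarrow> real \<Rightarrow>
     ('a, 'b::{real_normed_field,banach,second_countable_topology}) bilinear_op \<Rightarrow> bool" where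
  "bounded_bilinear_Lp M p1 p2 p T \<longleftrightarrow>
     bilinear_ae M (Lp_space p1 M) (Lp_space p2 M) T \<and>
     (\<forall>f1\<in>Lp_space p1 M. \<forall>f2\<in>Lp_space p2 M. T f1 f2 \<in> Lp_space p M) \<and>
     (\<exists>C. \<forall>f1\<in>Lp_space p1 M. \<forall>f2\<in>Lp_space p2 M.
        Lp_norm p M (T f1 f2) \<le> C * Lp_norm p1 M f1 * Lp_norm p2 M f2)"

definition weak_L_half_norm ::
    "'a measure \<Rightarrow> ('a \<Rightarrow> 'b::real_normed_vector) \<Rightarrow> ennreal" where
  "weak_L_half_norm M f =
     (SUP t\<in>{0<..}. ennreal t * (emeasure M {x \<in> space M. norm (f x) > t})\<^sup>2)"

definition bounded_bilinear_L1_weak_L_half ::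
    "'a measure \<Rightarrow> ('a, 'b::{real_normed_field,banach,second_countable_topology}) bilinear_op \<Rightarrow> bool" where
  "bounded_bilinear_L1_weak_L_half M T \<longleftrightarrow>
     bilinear_ae M (Lp_space 1 M) (Lp_space 1 M) T \<and>
     (\<forall>f1\<in>Lp_space 1 M. \<forall>f2\<in>Lp_space 1 M. T f1 f2 \<in> borel_measurable M) \<and>
     (\<exists>C. \<forall>f1\<in>Lp_space 1 M. \<forall>f2\<in>Lp_space 1 M.
        weak_L_half_norm M (T f1 f2) \<le> ennreal (C * Lp_norm 1 M f1 * Lp_norm 1 M f2))"

section \<open>Bilinear Calderon-Zygmund operators\<close>

definition dini_modulus :: "(real \<Rightarrow> real) \<Rightarrow> bool" where
  "dini_modulus \<omega> \<longleftrightarrow>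
     mono_on {0..} \<omega> \<and> (\<forall>s\<ge>0. \<forall>t\<ge>0. \<omega> (s + t) \<le> \<omega> s + \<omega> t) \<and> \<omega> 0 = 0 \<and>
     set_integrable lborel {0<..<1} (\<lambda>t. \<omega> t / t)"

text \<open>The dominating function is only given for positive radii, but off the diagonal one of the two
  distances may still be zero; the corresponding term is then read as zero. Any other
  value between \<open>0\<close> and \<open>lim\<^bsub>r\<rightarrow>0\<^esub> lam x r\<close> changes bounds by at most a constant factor.\<close>

definition lam_sum :: "('a \<Rightarrow> real \<Rightarrow> real) \<Rightarrow> 'a::metric_space \<Rightarrow> 'a \<Rightarrow> 'a \<Rightarrow> real" where
  "lam_sum lam x y1 y2 =
     (if x = y1 then 0 else lam x (dist x y1)) + (if x = y2 then 0 else lam x (dist x y2))"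

text \<open>Values of \<open>K\<close> on the diagonal \<open>x = y1 = y2\<close> are irrelevant. Local integrability on the
  complement of the diagonal is with respect to the triple product measure, and
  includes measurability there.\<close>

definition cz_kernel ::
    "'a::metric_space measure \<Rightarrow> ('a \<Rightarrow> real \<Rightarrow> real) \<Rightarrow>
     ('a \<Rightarrow> 'a \<Rightarrow> 'a \<Rightarrow> 'b::{real_normed_field,banach,second_countable_topology}) \<Rightarrow> bool" where
  "cz_kernel M lam K \<longleftrightarrow>
     (\<forall>q\<in>- range (\<lambda>z. (z, z, z)). \<exists>U\<subseteq>- range (\<lambda>z. (z, z, z)). open U \<and> q \<in> U \<and>
        set_integrable (M \<Otimes>\<^sub>M M \<Otimes>\<^sub>M M) U (\<lambda>(x, y1, y2). K x y1 y2)) \<and>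
     (\<exists>C>0. \<exists>\<omega>. dini_modulus \<omega> \<and>
        (\<forall>x y1 y2. x \<noteq> y1 \<or> x \<noteq> y2 \<longrightarrow>
           norm (K x y1 y2) \<le> C / (lam_sum lam x y1 y2)\<^sup>2 \<and>
           (\<forall>x'. dist x x' \<le> max (dist x y1) (dist x y2) / 2 \<longrightarrow>
              norm (K x y1 y2 - K x' y1 y2)
                \<le> C / (lam_sum lam x y1 y2)\<^sup>2 * \<omega> (dist x x' / (dist x y1 + dist x y2))) \<and>
           (\<forall>y1'. dist y1 y1' \<le> max (dist x y1) (dist x y2) / 2 \<longrightarrow>
              norm (K x y1 y2 - K x y1' y2)
                \<le> C / (lam_sum lam x y1 y2)\<^sup>2 * \<omega> (dist y1 y1' / (dist x y1 + dist x y2))) \<and>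
           (\<forall>y2'. dist y2 y2' \<le> max (dist x y1) (dist x y2) / 2 \<longrightarrow>
              norm (K x y1 y2 - K x y1 y2')
                \<le> C / (lam_sum lam x y1 y2)\<^sup>2 * \<omega> (dist y2 y2' / (dist x y1 + dist x y2)))))"

definition supp :: "('a::topological_space \<Rightarrow> 'b::zero) \<Rightarrow> 'a set" where
  "supp f = closure {x. f x \<noteq> 0}"

text \<open>For \<open>x\<close> outside the common support, the kernel bound makes the integrand
  integrable.\<close>

definition associated_with ::
    "'a::metric_space measure \<Rightarrow>
     ('a, 'b::{real_normed_field,banach,second_countable_topology}) bilinear_op \<Rightarrow>
     ('a \<Rightarrow> 'a \<Rightarrow> 'a \<Rightarrow> 'b) \<Rightarrow> bool" where
  "associated_with M T K \<longleftrightarrow>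
     (\<forall>f1\<in>borel_measurable M. \<forall>f2\<in>borel_measurable M.
        bounded (range f1) \<and> compact (supp f1) \<and> bounded (range f2) \<and> compact (supp f2) \<longrightarrow>
        (AE x in M. x \<notin> supp f1 \<inter> supp f2 \<longrightarrow>
           T f1 f2 x = (\<integral>(y1, y2). K x y1 y2 * f1 y1 * f2 y2 \<partial>(M \<Otimes>\<^sub>M M))))"

definition bilinear_cz_operator ::
    "'a::metric_space measure \<Rightarrow> ('a \<Rightarrow> real \<Rightarrow> real) \<Rightarrow> real \<Rightarrow> real \<Rightarrow> real \<Rightarrow>
     ('a, 'b::{real_normed_field,banach,second_countable_topology}) bilinear_op \<Rightarrow> bool" where
  "bilinear_cz_operator M lam p1 p2 p T \<longleftrightarrow>
     (\<exists>K. cz_kernel M lam K \<and> associated_with M T K) \<and> bounded_bilinear_Lp M p1 p2 p T"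

text \<open>\<open>T\<close>, given on \<open>L\<^sup>p\<^sup>1 \<times> L\<^sup>p\<^sup>2\<close>, is bounded from \<open>L\<^sup>1 \<times> L\<^sup>1\<close> to weak \<open>L\<^sup>1\<^sup>/\<^sup>2\<close> if its restriction
  to \<open>(L\<^sup>1 \<inter> L\<^sup>p\<^sup>1) \<times> (L\<^sup>1 \<inter> L\<^sup>p\<^sup>2)\<close> extends to such a bounded operator on all of \<open>L\<^sup>1 \<times> L\<^sup>1\<close>.\<close>

definition extends_boundedly_L1_weak_L_half ::
    "'a measure \<Rightarrow> real \<Rightarrow> real \<Rightarrow>
     ('a, 'b::{real_normed_field,banach,second_countable_topology}) bilinear_op \<Rightarrow> bool" where
  "extends_boundedly_L1_weak_L_half M p1 p2 T \<longleftrightarrow>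
     (\<exists>T'. bounded_bilinear_L1_weak_L_half M T' \<and>
        (\<forall>f1\<in>Lp_space 1 M \<inter> Lp_space p1 M. \<forall>f2\<in>Lp_space 1 M \<inter> Lp_space p2 M.
           AE x in M. T' f1 f2 x = T f1 f2 x))"

end

theory Submission
  imports Defs
begin

text \<open>After rescaling one has to bound the measure of \<open>{|T(f\<^sub>1, f\<^sub>2)| > 1}\<close> by a multiple of
  \<open>\<parallel>f\<^sub>1\<parallel>\<^sub>1 + \<parallel>f\<^sub>2\<parallel>\<^sub>1\<close>, for bounded functions of compact support. Both functions are decomposed over one
  family of balls \<open>Q\<^sub>i\<close>, on which \<open>|f\<^sub>1| + |f\<^sub>2|\<close> has a large average (relative to the measure of a
  dilated ball) that becomes small on larger balls. Let \<open>R\<^sub>i\<close> be the first doubling dilate of \<open>Q\<^sub>i\<close>, and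
  \<open>\<phi>\<^sub>i\<close> a multiple of the indicator of a subset of \<open>R\<^sub>i\<close> with the same integral as the part
  \<open>f\<^sub>i\<close> of the function on \<open>Q\<^sub>i\<close>, such that \<open>\<Sum> |\<phi>\<^sub>i|\<close> is bounded.

  A bilinear term is estimated with the smoothness of the kernel in one variable only: the other
  function enters through the maximal function \<open>sup\<^sub>r \<nu>(B(x, r)) / \<lambda>(x, r)\<close>, which is bounded outside a
  small set. Therefore the Dini condition suffices for \<open>T(f\<^sub>i - \<phi>\<^sub>i, h)\<close> at points far from \<open>R\<^sub>i\<close>,
  and the size of the kernel suffices for \<open>T(f\<^sub>i, h)\<close> on \<open>2R\<^sub>i \<setminus> 2Q\<^sub>i\<close>, where \<open>1/\<lambda>\<close> has a bounded
  integral.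

  It remains to sum \<open>T(\<phi>\<^sub>i, \<phi>\<^sub>j)\<close> over the pairs for which \<open>x\<close> is not near. If near is decided by
  the larger ball of a pair, the complementary sum consists of terms
  \<open>1\<^bsub>2R\<^sub>i\<^esub> T(\<phi>\<^sub>i, \<Sum>\<^sub>j \<phi>\<^sub>j)\<close>, where \<open>j\<close> runs over all smaller balls independently of \<open>x\<close>. These are controlled by
  the boundedness of \<open>T\<close> on Lebesgue spaces, because \<open>R\<^sub>i\<close> is doubling. No comparison between
  \<open>\<lambda>(x, r)\<close> and \<open>\<lambda>(y, r)\<close> is required beyond \<open>\<mu>(B(y, r)) \<le> C \<lambda>(x, r)\<close> for \<open>d(x, y) \<le> r\<close>.\<close>

section \<open>Covering and doubling\<close>

text \<open>The obstacle is that the measure is not doubling and that the balls carry no dyadic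
  structure. The mass of a selected ball can be spread only over a doubling dilate, which may be
  arbitrarily larger than the ball, and dilates of different balls overlap without control; hence
  the separate estimate between \<open>Q\<^sub>i\<close> and \<open>R\<^sub>i\<close> and the
  allocation of subsets in order of increasing radius. One family of balls serves both functions,
  because a pair has to be compared through one common ordering and because all hypotheses then stay
  symmetric, so that each estimate in the first argument also gives the one in the second. Compact
  inner regularity replaces families of balls by finite ones. Bilinearity then applies to finite
  sums, at the price of a leftover set of small measure on which the functions are still large. Its
  contribution is handled by the Lebesgue-space bound: the norms of the functions are fixed first
  and the size of the leftover is chosen afterwards, so it leaves no trace in the final
  constant.\<close>

lemma finite_vitali:
  fixes x :: "'i \<Rightarrow> 'a::metric_space" and r :: "'i \<Rightarrow> real"
  assumes "finite I" and "\<And>i. i \<in> I \<Longrightarrow> r i > 0"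
  shows "\<exists>J\<subseteq>I. disjoint_family_on (\<lambda>i. ball (x i) (r i)) J \<and>
           (\<forall>i\<in>I. \<exists>j\<in>J. r i \<le> r j \<and> dist (x i) (x j) < r i + r j)"
  using assms
proof (induction I rule: finite_psubset_induct)
  case (psubset I)
  show ?case
  proof (cases "I = {}")
    case True
    then show ?thesis by (auto simp: disjoint_family_on_def)
  next
    case False
    have "Max (r ` I) \<in> r ` I"
      using psubset.hyps False by (intro Max_in) auto
    then obtain i0 where i0: "i0 \<in> I" "r i0 = Max (r ` I)" by auto
    have mx: "r i \<le> r i0" if "i \<in> I" for i
      using psubset.hyps that i0 by simp
    \<comment> \<open>In a metric space two balls can be disjoint although their centres are closer
      than the sum of the radii. Selection is therefore by the distance of the centres; a discarded
      ball then satisfies the required distance bound with \<open>i0\<close>.\<close>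
    define I' where "I' = {i\<in>I. r i + r i0 \<le> dist (x i) (x i0)}"
    have "i0 \<notin> I'"
      using psubset.prems[OF i0(1)] by (simp add: I'_def)
    moreover have "I' \<subseteq> I" by (auto simp: I'_def)
    ultimately have "I' \<subset> I" using i0(1) by blast
    then obtain J where J: "J \<subseteq> I'" "disjoint_family_on (\<lambda>i. ball (x i) (r i)) J"
      and cov: "\<forall>i\<in>I'. \<exists>j\<in>J. r i \<le> r j \<and> dist (x i) (x j) < r i + r j"
      using psubset.IH[of I'] psubset.prems by (auto simp: subset_iff)
    have dj: "ball (x i) (r i) \<inter> ball (x i0) (r i0) = {}" if "i \<in> J" for i
    proof -
      have "r i + r i0 \<le> dist (x i) (x i0)" using that J by (auto simp: I'_def)
      moreover have "dist (x i) (x i0) \<le> dist (x i) z + dist (x i0) z" for z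
        by (metis dist_commute dist_triangle)
      ultimately have False if "z \<in> ball (x i) (r i) \<inter> ball (x i0) (r i0)" for z
        using that by (smt (verit) IntD1 IntD2 mem_ball)
      then show ?thesis by blast
    qed
    have "disjoint_family_on (\<lambda>i. ball (x i) (r i)) (insert i0 J)"
      using J(2) dj by (auto simp: disjoint_family_on_def)
    moreover have "\<exists>j\<in>insert i0 J. r i \<le> r j \<and> dist (x i) (x j) < r i + r j" if "i \<in> I" for i
    proof (cases "i \<in> I'")
      case True then show ?thesis using cov by auto
    next
      case False
      then show ?thesis using that mx[OF that] by (auto simp: I'_def not_le)
    qed
    moreover have "insert i0 J \<subseteq> I" using J i0 by (auto simp: I'_def)
    ultimately show ?thesis by blast
  qed
qed

text \<open>The constants whose existence is assumed become parameters, so that later bounds are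
  explicit in \<open>Cl\<close> and \<open>N\<close>.\<close>

locale nonhom_space =
  fixes M :: "'a::metric_space measure" and lam :: "'a \<Rightarrow> real \<Rightarrow> real" and Cl :: real and N :: nat
  assumes sets_M: "sets M = sets borel"
    and lam_pos: "r > 0 \<Longrightarrow> lam x r > 0"
    and emeasure_ball_lam: "r > 0 \<Longrightarrow> emeasure M (ball x r) \<le> ennreal (lam x r)"
    and lam_mono: "0 < r \<Longrightarrow> r \<le> s \<Longrightarrow> lam x r \<le> lam x s"
    and lam_half: "r > 0 \<Longrightarrow> lam x r \<le> Cl * lam x (r / 2)"
    and geometric: "r > 0 \<Longrightarrow> Y \<subseteq> ball x r \<Longrightarrow> disjoint_family_on (\<lambda>y. ball y (r / 4)) Y \<Longrightarrow>
      finite Y \<and> card Y \<le> N"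
    and inner: "A \<in> sets borel \<Longrightarrow>
      emeasure M A = (SUP S\<in>{S. compact S \<and> S \<subseteq> A}. emeasure M S)"
begin

lemma measurable_M [measurable_cong]: "sets M = sets borel"
  by (rule sets_M)

lemma space_M [simp]: "space M = UNIV"
  using sets_eq_imp_space_eq[OF sets_M] by simp

lemma Cl_ge_1: "Cl \<ge> 1"
proof -
  have "lam undefined (1/2) \<le> Cl * lam undefined (1/2)"
    using lam_half[of 1 undefined] lam_mono[of "1/2" 1 undefined] by simp
  then show ?thesis using lam_pos[of "1/2" undefined] by simp
qed

lemma emeasure_ball_finite [simp]: "emeasure M (ball x r) < top"
proof (cases "r > 0")
  case True
  then show ?thesis
    using emeasure_ball_lam[OF True, of x] by (simp add: le_less_trans[OF _ ennreal_less_top])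
next
  case False
  then have e: "ball x r = {}" by simp
  show ?thesis unfolding e by simp
qed

lemma emeasure_ball_not_top [simp]: "emeasure M (ball x r) \<noteq> top"
  by (metis emeasure_ball_finite less_irrefl)

lemma ball_fmeasurable [simp, measurable]: "ball x r \<in> fmeasurable M"
  by (intro fmeasurableI) (auto simp: sets_M)

lemma emeasure_ball: "emeasure M (ball x r) = ennreal (measure M (ball x r))"
  by (rule emeasure_eq_ennreal_measure) simp

lemma measure_ball_mono: "ball x r \<subseteq> ball y s \<Longrightarrow> measure M (ball x r) \<le> measure M (ball y s)"
  by (rule measure_mono_fmeasurable) (auto simp: sets_M)

lemma measure_ball_lam: "r > 0 \<Longrightarrow> measure M (ball x r) \<le> lam x r"
  using emeasure_ball_lam[of r x] lam_pos[of r x] by (simp add: emeasure_ball)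

lemma sigma_finite: "sigma_finite_measure M"
proof
  define A where "A = range (\<lambda>n::nat. ball (undefined::'a) (real n))"
  have "\<Union>A = UNIV"
  proof -
    have "\<exists>n. x \<in> ball undefined (real n)" for x :: 'a
      using reals_Archimedean2[of "dist undefined x"] by auto
    then show ?thesis by (auto simp: A_def)
  qed
  then show "\<exists>A. countable A \<and> A \<subseteq> sets M \<and> \<Union> A = space M \<and> (\<forall>a\<in>A. emeasure M a \<noteq> \<infinity>)"
    by (intro exI[of _ A]) (auto simp: A_def sets_M)
qed

sublocale sigma_finite_measure M by (rule sigma_finite)

lemma lam_double: "r > 0 \<Longrightarrow> lam x (2 ^ n * r) \<le> Cl ^ n * lam x r"
proof (induction n)
  case (Suc n)
  have "lam x (2 ^ Suc n * r) \<le> Cl * lam x (2 ^ n * r)"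
    using lam_half[of "2 ^ Suc n * r" x] Suc.prems by simp
  also have "\<dots> \<le> Cl * (Cl ^ n * lam x r)"
    using Suc Cl_ge_1 by (intro mult_left_mono) auto
  finally show ?case by simp
qed simp

lemma measure_ball_shift:
  assumes "0 < r" and "dist x z \<le> r"
  shows "measure M (ball z r) \<le> Cl * lam x r"
proof -
  have "ball z r \<subseteq> ball x (2 * r)"
  proof
    fix y assume "y \<in> ball z r"
    then show "y \<in> ball x (2 * r)"
      using dist_triangle[of x y z] assms by simp
  qed
  then have "measure M (ball z r) \<le> measure M (ball x (2 * r))" by (rule measure_ball_mono)
  also have "\<dots> \<le> lam x (2 * r)" using assms by (intro measure_ball_lam) simp
  finally have "measure M (ball z r) \<le> lam x (2 * r)" .
  then show ?thesis using lam_double[of r x 1] assms by simp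
qed

lemma inner_finite:
  assumes A: "A \<in> sets borel" and fin: "emeasure M A < \<infinity>" and "\<epsilon> > 0"
  obtains S where "compact S" "S \<subseteq> A" "measure M A \<le> measure M S + \<epsilon>"
    "emeasure M (A - S) \<le> ennreal \<epsilon>"
proof -
  have "\<exists>S. compact S \<and> S \<subseteq> A \<and> emeasure M A \<le> emeasure M S + ennreal \<epsilon>"
  proof (cases "emeasure M A = 0")
    case True then show ?thesis by (intro exI[of _ "{}"]) auto
  next
    case False
    have "emeasure M A - ennreal \<epsilon> < emeasure M A"
      using False fin \<open>\<epsilon> > 0\<close> by (intro ennreal_between) (auto simp: zero_less_iff_neq_zero)
    also have "emeasure M A = (SUP S\<in>{S. compact S \<and> S \<subseteq> A}. emeasure M S)"
      by (rule inner[OF A])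
    finally obtain S where "compact S" "S \<subseteq> A" "emeasure M A - ennreal \<epsilon> < emeasure M S"
      by (auto simp: less_SUP_iff)
    then show ?thesis
      by (intro exI[of _ S]) (metis add.commute ennreal_minus_le_iff less_imp_le)
  qed
  then obtain S where S: "compact S" "S \<subseteq> A" "emeasure M A \<le> emeasure M S + ennreal \<epsilon>" by blast
  have Sm: "S \<in> sets M" using S(1) by (simp add: sets_M borel_compact)
  have Am: "A \<in> sets M" using A by (simp add: sets_M)
  have finS: "emeasure M S \<noteq> \<infinity>"
    using fin emeasure_mono[OF S(2) Am] by (metis infinity_ennreal_def leD)
  have e: "emeasure M A = ennreal (measure M A)" "emeasure M S = ennreal (measure M S)"
    using fin finS by (simp_all add: emeasure_eq_ennreal_measure less_top)
  have 1: "measure M A \<le> measure M S + \<epsilon>"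
    using S(3) \<open>\<epsilon> > 0\<close> unfolding e by (simp flip: ennreal_plus)
  have "emeasure M (A - S) = emeasure M A - emeasure M S"
    using finS S Sm Am by (intro emeasure_Diff) auto
  also have "\<dots> \<le> ennreal \<epsilon>"
    using S(3) finS by (simp add: ennreal_minus_le_iff)
  finally show thesis using that S 1 by blast
qed

text \<open>Typical use: the set is a union of uncountably many balls. A compact subset is covered
  by finitely many of them, to which \<open>finite_vitali\<close> applies, and the bound passes back
  to the whole union.\<close>

lemma emeasure_le_compactI:
  assumes "A \<in> sets borel" and "\<And>S. compact S \<Longrightarrow> S \<subseteq> A \<Longrightarrow> emeasure M S \<le> c"
  shows "emeasure M A \<le> c"
  unfolding inner[OF assms(1)] using assms(2) by (auto intro: SUP_least)

section \<open>Covers by smaller balls and separability\<close>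

lemma ball_cover_half:
  fixes x :: 'a
  assumes "r > 0"
  shows "\<exists>Y. finite Y \<and> card Y \<le> N \<and> ball x r \<subseteq> (\<Union>y\<in>Y. ball y (r / 2))"
proof -
  \<comment> \<open>Geometric doubling bounds the cardinality of such sets, so one of maximal
    cardinality exists. A point of the ball at distance at least \<open>r / 2\<close> from it could
    be added, hence the balls of radius \<open>r / 2\<close> cover.\<close>
  define P where "P = (\<lambda>Y. Y \<subseteq> ball x r \<and> disjoint_family_on (\<lambda>y. ball y (r / 4)) Y)"
  have "\<exists>Y. P Y \<and> (\<forall>Z. P Z \<longrightarrow> card Z \<le> card Y)"
    using geometric[OF assms, of _ x]
    by (intro ex_has_greatest_nat[of P "{}" card "Suc N"])
      (auto simp: P_def disjoint_family_on_def less_Suc_eq_le)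
  then obtain Y where Y: "P Y" and mx: "\<And>Z. P Z \<Longrightarrow> card Z \<le> card Y" by blast
  have fin: "finite Y" "card Y \<le> N" using geometric[OF assms, of Y x] Y by (auto simp: P_def)
  have "ball x r \<subseteq> (\<Union>y\<in>Y. ball y (r / 2))"
  proof
    fix z assume z: "z \<in> ball x r"
    show "z \<in> (\<Union>y\<in>Y. ball y (r / 2))"
    proof (rule ccontr)
      assume n: "z \<notin> (\<Union>y\<in>Y. ball y (r / 2))"
      have zY: "z \<notin> Y" using n assms by auto
      have dj: "ball y (r / 4) \<inter> ball z (r / 4) = {}" if "y \<in> Y" for y
      proof -
        have "r / 2 \<le> dist y z" using n that by (auto simp: not_less)
        moreover have "dist y z \<le> dist y u + dist z u" for u
          by (metis dist_commute dist_triangle)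
        ultimately have False if "u \<in> ball y (r / 4) \<inter> ball z (r / 4)" for u
        proof -
          have "dist y u < r / 4" "dist z u < r / 4" using that by auto
          then show False using \<open>r / 2 \<le> dist y z\<close> dist_triangle[of y z u] by (simp add: dist_commute)
        qed
        then show ?thesis by blast
      qed
      have "P (insert z Y)" using Y z dj
        by (auto simp: P_def disjoint_family_on_def)
      from mx[OF this] show False using zY fin by simp
    qed
  qed
  then show ?thesis using fin by blast
qed

lemma ball_cover:
  fixes x :: 'a
  assumes "r > 0"
  shows "\<exists>Y. finite Y \<and> card Y \<le> N ^ j \<and> ball x r \<subseteq> (\<Union>y\<in>Y. ball y (r / 2 ^ j))"
proof (induction j)
  case 0 show ?case by (intro exI[of _ "{x}"]) auto
next
  case (Suc j)
  then obtain Y where Y: "finite Y" "card Y \<le> N ^ j" "ball x r \<subseteq> (\<Union>y\<in>Y. ball y (r / 2 ^ j))" by blast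
  define P where "P = (\<lambda>(y::'a) Y. finite Y \<and> card Y \<le> N \<and> ball y (r / 2 ^ j) \<subseteq> (\<Union>z\<in>Y. ball z (r / 2 ^ Suc j)))"
  have "\<exists>Y. P y Y" for y
    using ball_cover_half[of "r / 2 ^ j" y] assms by (simp add: P_def divide_divide_eq_left mult.commute)
  then obtain Z where "\<And>y. P y (Z y)" by metis
  note Z = this[unfolded P_def, THEN conjunct1] this[unfolded P_def, THEN conjunct2, THEN conjunct1]
    this[unfolded P_def, THEN conjunct2, THEN conjunct2]
  have "card (\<Union>y\<in>Y. Z y) \<le> (\<Sum>y\<in>Y. card (Z y))" by (rule card_UN_le[OF Y(1)])
  also have "\<dots> \<le> card Y * N" using sum_bounded_above[of Y "\<lambda>y. card (Z y)" N] Z(2) by simp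
  also have "\<dots> \<le> N ^ Suc j" using Y(2) by (simp add: mult.commute)
  finally have "card (\<Union>y\<in>Y. Z y) \<le> N ^ Suc j" .
  moreover have "ball x r \<subseteq> (\<Union>z\<in>(\<Union>y\<in>Y. Z y). ball z (r / 2 ^ Suc j))"
  proof
    fix u assume "u \<in> ball x r"
    then obtain y where y: "y \<in> Y" "u \<in> ball y (r / 2 ^ j)" using Y(3) by blast
    then obtain z where "z \<in> Z y" "u \<in> ball z (r / 2 ^ Suc j)" using Z(3)[of y] by blast
    with y(1) show "u \<in> (\<Union>z\<in>(\<Union>y\<in>Y. Z y). ball z (r / 2 ^ Suc j))" by blast
  qed
  moreover have "finite (\<Union>y\<in>Y. Z y)" using Y(1) Z(1) by blast
  ultimately show ?case by blast
qed

text \<open>Covers of the balls of radius \<open>Suc n\<close> around one fixed point, at the scales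
  \<open>Suc n / 2 ^ j\<close>, provide the dense set. It supplies the countable family of product
  balls used for the measurability of the kernel.\<close>

lemma countable_dense:
  obtains Q :: "'a set" where "countable Q" "\<And>x \<epsilon>. \<epsilon> > 0 \<Longrightarrow> \<exists>q\<in>Q. dist q x < \<epsilon>"
proof -
  define P where "P = (\<lambda>(n::nat) (j::nat) Y. finite Y \<and>
    ball (undefined::'a) (real (Suc n)) \<subseteq> (\<Union>y\<in>Y. ball y (real (Suc n) / 2 ^ j)))"
  have "\<exists>Y. P n j Y" for n j
    using ball_cover[where r = "real (Suc n)" and j = j and x = undefined]
    by (auto simp: P_def simp del: of_nat_Suc)
  then obtain Y where "\<And>n j. P n j (Y n j)" by metis
  note Y = this[unfolded P_def, THEN conjunct1] this[unfolded P_def, THEN conjunct2]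
  show thesis
  proof
    show "countable (\<Union>n j. Y n j)" using Y(1) by (intro countable_UN) (auto intro: countable_finite)
    fix x :: 'a and \<epsilon> :: real assume "\<epsilon> > 0"
    obtain n where n: "dist undefined x < real n" using reals_Archimedean2 by blast
    obtain j where j: "real (Suc n) / \<epsilon> < 2 ^ j" using real_arch_pow[of 2] by auto
    then have "real (Suc n) / 2 ^ j < \<epsilon>" using \<open>\<epsilon> > 0\<close> by (simp add: field_simps)
    moreover have "x \<in> ball undefined (real (Suc n))" using n by simp
    moreover obtain q where "q \<in> Y n j" "dist q x < real (Suc n) / 2 ^ j"
      using Y(2)[of n j] calculation(2) by (auto simp del: of_nat_Suc)
    ultimately show "\<exists>q\<in>\<Union>n j. Y n j. dist q x < \<epsilon>"
      by (intro bexI[of _ q]) auto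
  qed
qed

section \<open>Doubling balls\<close>

definition beta :: real where "beta = 2 * max (real N ^ 4) (Cl ^ 4)"

text \<open>The doubling test compares radii with ratio 16 = 2^4. One such step multiplies
  \<open>lam\<close> by at most \<open>Cl ^ 4\<close>, and refining a cover by this ratio takes at
  most \<open>N ^ 4\<close> balls for each ball. The extra factor 2 makes a non-doubling measure
  outrun both at a geometric rate.\<close>

lemma beta_ge: "beta \<ge> 2 * Cl ^ 4" "beta \<ge> 2 * real N ^ 4" "beta \<ge> 2"
proof -
  have "Cl ^ 4 \<ge> 1" using Cl_ge_1 by simp
  then show "beta \<ge> 2" by (simp add: beta_def max_def)
qed (auto simp: beta_def)

definition doubling_ball :: "'a \<Rightarrow> real \<Rightarrow> bool" where
  "doubling_ball x r \<longleftrightarrow> measure M (ball x (16 * r)) \<le> beta * measure M (ball x r)"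

lemma non_doubling_iterate:
  assumes "\<And>l. k \<le> l \<Longrightarrow> l < k + m \<Longrightarrow> \<not> doubling_ball x (16 ^ l * r)"
  shows "beta ^ m * measure M (ball x (16 ^ k * r)) \<le> measure M (ball x (16 ^ (k + m) * r))"
  using assms
proof (induction m)
  case (Suc m)
  have "beta * measure M (ball x (16 ^ (k + m) * r)) < measure M (ball x (16 ^ (k + Suc m) * r))"
    using Suc.prems[of "k + m"] by (simp add: doubling_ball_def mult_ac)
  moreover have "beta * (beta ^ m * measure M (ball x (16 ^ k * r)))
      \<le> beta * measure M (ball x (16 ^ (k + m) * r))"
    using Suc beta_ge(3) by (intro mult_left_mono) auto
  ultimately show ?case by simp
qed simp

text \<open>If all dilates failed, the measure would gain a factor of at least
  \<open>2 * Cl ^ 4\<close> at each step, whereas its majorant \<open>lam\<close> gains at most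
  \<open>Cl ^ 4\<close>.\<close>

lemma exists_doubling:
  assumes "r > 0"
  shows "\<exists>k\<ge>1. doubling_ball x (16 ^ k * r)"
proof (rule ccontr)
  assume "\<not> ?thesis"
  then have nd: "\<not> doubling_ball x (16 ^ k * r)" if "k \<ge> 1" for k using that by blast
  \<comment> \<open>The count starts at the second dilate: failure of doubling at the first one is a
    strict inequality and forces \<open>c > 0\<close>, while \<open>ball x r\<close> itself may be
    null.\<close>
  define c where "c = measure M (ball x (16 ^ 2 * r))"
  have "beta * measure M (ball x (16 ^ 1 * r)) < c"
    using nd[of 1] by (simp add: doubling_ball_def c_def)
  then have "c > 0"
    using beta_ge(3) by (smt (verit) measure_nonneg mult_nonneg_nonneg)
  have "2 ^ k * c \<le> lam x (16 ^ 2 * r)" for k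
  proof -
    have "(2 * Cl ^ 4) ^ k * c \<le> beta ^ k * c"
      using beta_ge(1) Cl_ge_1 \<open>c > 0\<close> by (intro mult_right_mono power_mono) auto
    also have "\<dots> \<le> measure M (ball x (16 ^ (2 + k) * r))"
      unfolding c_def by (rule non_doubling_iterate) (use nd in \<open>force\<close>)
    also have "\<dots> \<le> lam x (16 ^ (2 + k) * r)"
      using assms by (intro measure_ball_lam) auto
    also have "\<dots> = lam x (2 ^ (4 * k) * (16 ^ 2 * r))"
      unfolding power_mult by (simp add: power_add mult_ac)
    also have "\<dots> \<le> Cl ^ (4 * k) * lam x (16 ^ 2 * r)"
      using assms by (intro lam_double) auto
    finally have "(Cl ^ 4) ^ k * (2 ^ k * c) \<le> (Cl ^ 4) ^ k * lam x (16 ^ 2 * r)"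
      unfolding power_mult by (simp only: power_mult_distrib mult_ac)
    then show ?thesis using Cl_ge_1 by (simp add: mult_le_cancel_left)
  qed
  moreover obtain k where "lam x (16 ^ 2 * r) / c < 2 ^ k" using real_arch_pow[of 2] by auto
  ultimately show False using \<open>c > 0\<close> by (metis not_le pos_divide_less_eq)
qed

text \<open>Around a point without doubling radii below \<open>1 / 2 ^ m\<close>, the ball that is
  \<open>16 ^ k\<close> times smaller has measure at most \<open>C / beta ^ k\<close>. Up to a fixed
  factor, \<open>N ^ (4 * k)\<close> such balls cover the bounded part of the exceptional set, so
  its measure is at most a multiple of \<open>(1/2) ^ k\<close>.\<close>

lemma doubling_AE:
  "AE x in M. \<forall>\<delta>>0. \<exists>r. 0 < r \<and> r < \<delta> \<and> doubling_ball x r"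
proof -
  define D where "D = (\<lambda>m::nat. {x. \<forall>r. 0 < r \<and> r \<le> 1 / 2 ^ m \<longrightarrow> \<not> doubling_ball x r})"
  \<comment> \<open>\<open>D m\<close> is not known to be measurable, so measurable null supersets
    of its bounded parts are constructed.\<close>
  have cov: "\<exists>A\<in>sets M. D m \<inter> ball xo (2 ^ l / 2 ^ m) \<subseteq> A \<and> emeasure M A = 0" for m l :: nat and xo
  proof -
    define C where "C = measure M (ball xo (2 ^ l / 2 ^ m + 2 / 2 ^ m))"
    define P where "P = (\<lambda>k A. A \<in> sets M \<and> D m \<inter> ball xo (2 ^ l / 2 ^ m) \<subseteq> A \<and>
        emeasure M A \<le> ennreal (N ^ (l + 1) * C * (1/2) ^ k))"
    have "\<exists>A. P k A" for k
    proof -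
      \<comment> \<open>Halving the radius \<open>l\<close> times leads to \<open>1 / 2 ^ m\<close>,
        another \<open>4 * k\<close> halvings to \<open>s\<close>, and one more to
        \<open>s / 2\<close>. The last one pays for recentring the balls of the cover at points of
        \<open>D m\<close>, where the failure of doubling is known.\<close>
      define s :: real where "s = 1 / (2 ^ m * 16 ^ k)"
      have s: "s > 0" "2 ^ l / 2 ^ m / 2 ^ (l + 4 * k + 1) = s / 2"
        by (simp_all add: s_def power_add power_mult)
      obtain Y where Y: "finite Y" "card Y \<le> N ^ (l + 4 * k + 1)"
          "ball xo (2 ^ l / 2 ^ m) \<subseteq> (\<Union>y\<in>Y. ball y (s / 2))"
        using ball_cover[of "2 ^ l / 2 ^ m" "l + 4 * k + 1" xo] unfolding s(2) by auto
      define Y' where "Y' = {y\<in>Y. D m \<inter> ball xo (2 ^ l / 2 ^ m) \<inter> ball y (s / 2) \<noteq> {}}"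
      have "\<forall>y\<in>Y'. \<exists>z. z \<in> D m \<inter> ball xo (2 ^ l / 2 ^ m) \<inter> ball y (s / 2)"
        by (auto simp: Y'_def)
      then obtain z where z: "\<And>y. y \<in> Y' \<Longrightarrow> z y \<in> D m \<inter> ball xo (2 ^ l / 2 ^ m) \<inter> ball y (s / 2)"
        by metis
      define A where "A = (\<Union>y\<in>Y'. ball (z y) s)"
      have Y'f: "finite Y'" "card Y' \<le> N ^ (l + 4 * k + 1)"
        using Y card_mono[of Y Y'] by (auto simp: Y'_def)
      have "D m \<inter> ball xo (2 ^ l / 2 ^ m) \<subseteq> A"
      proof
        fix u assume u: "u \<in> D m \<inter> ball xo (2 ^ l / 2 ^ m)"
        then obtain y where y: "y \<in> Y" "u \<in> ball y (s / 2)" using Y by blast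
        then have "y \<in> Y'" using u by (auto simp: Y'_def)
        from z[OF this] y have "dist (z y) u < s"
          using dist_triangle_half_r[of y "z y" s u] by simp
        then show "u \<in> A" using \<open>y \<in> Y'\<close> by (auto simp: A_def)
      qed
      moreover have "emeasure M A \<le> ennreal (N ^ (l + 1) * C * (1/2) ^ k)"
      proof -
        have b: "beta ^ k * measure M (ball (z y) s) \<le> C" if "y \<in> Y'" for y
        proof -
          have "beta ^ k * measure M (ball (z y) (16 ^ 0 * s)) \<le> measure M (ball (z y) (16 ^ (0 + k) * s))"
          proof (rule non_doubling_iterate)
            fix j :: nat assume "j < 0 + k"
            then have "16 ^ j * s \<le> 1 / 2 ^ m"
              by (simp add: s_def field_simps)
            moreover have "z y \<in> D m" using z[OF that] by simp
            ultimately show "\<not> doubling_ball (z y) (16 ^ j * s)" using s(1) by (simp add: D_def)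
          qed
          also have "16 ^ (0 + k) * s = 1 / 2 ^ m" by (simp add: s_def)
          also have "measure M (ball (z y) (1 / 2 ^ m)) \<le> C"
            unfolding C_def
          proof (rule measure_ball_mono)
            show "ball (z y) (1 / 2 ^ m) \<subseteq> ball xo (2 ^ l / 2 ^ m + 2 / 2 ^ m)"
            proof
              fix u assume "u \<in> ball (z y) (1 / 2 ^ m)"
              moreover have "dist xo (z y) < 2 ^ l / 2 ^ m" using z[OF that] by simp
              moreover have "(1::real) / 2 ^ m \<le> 2 / 2 ^ m" by (simp add: divide_right_mono)
              ultimately show "u \<in> ball xo (2 ^ l / 2 ^ m + 2 / 2 ^ m)"
                using dist_triangle[of xo u "z y"] by simp
            qed
          qed
          finally show ?thesis by simp
        qed
        have bp: "beta ^ k > 0" using beta_ge(3) by simp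
        have "emeasure M A \<le> (\<Sum>y\<in>Y'. emeasure M (ball (z y) s))"
          unfolding A_def by (intro emeasure_subadditive_finite Y'f) (auto simp: sets_M)
        also have "\<dots> = ennreal (\<Sum>y\<in>Y'. measure M (ball (z y) s))"
          by (simp add: emeasure_ball sum_ennreal)
        also have "(\<Sum>y\<in>Y'. measure M (ball (z y) s)) \<le> (\<Sum>y\<in>Y'. C / beta ^ k)"
          using b bp by (intro sum_mono) (simp add: field_simps)
        also have "\<dots> = real (card Y') * (C / beta ^ k)" by simp
        also have "\<dots> \<le> real (N ^ (l + 4 * k + 1)) * (C / beta ^ k)"
        proof (intro mult_right_mono)
          show "real (card Y') \<le> real (N ^ (l + 4 * k + 1))" using Y'f(2) by (rule of_nat_mono)
        qed (use bp in \<open>simp add: C_def\<close>)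
        also have "\<dots> = N ^ (l + 1) * C * ((real N ^ 4) ^ k / beta ^ k)"
        proof -
          have "real N ^ (4 * k) = (real N ^ 4) ^ k" by (rule power_mult)
          then show ?thesis by (simp add: power_add)
        qed
        also have "\<dots> \<le> N ^ (l + 1) * C * (1/2) ^ k"
        proof (intro mult_left_mono)
          have "real N ^ 4 / beta \<le> 1 / 2"
            using beta_ge by (simp add: field_simps)
          then have "(real N ^ 4 / beta) ^ k \<le> (1 / 2) ^ k"
            using beta_ge by (intro power_mono) auto
          then show "(real N ^ 4) ^ k / beta ^ k \<le> (1 / 2) ^ k" by (simp add: power_divide)
        qed (simp add: C_def)
        finally show ?thesis by (simp add: ennreal_leI)
      qed
      moreover have "A \<in> sets M" unfolding A_def sets_M by (intro borel_open open_UN) auto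
      ultimately show ?thesis unfolding P_def by blast
    qed
    then obtain A where "\<And>k. P k (A k)" by metis
    note A = this[unfolded P_def, THEN conjunct1] this[unfolded P_def, THEN conjunct2, THEN conjunct1]
      this[unfolded P_def, THEN conjunct2, THEN conjunct2]
    have "emeasure M (\<Inter>k. A k) \<le> ennreal (N ^ (l + 1) * C * (1/2) ^ k)" for k
      using A emeasure_mono[of "\<Inter>k. A k" "A k" M] order_trans by fastforce
    moreover have "(\<lambda>k. ennreal (N ^ (l + 1) * C * (1/2) ^ k)) \<longlonglongrightarrow> ennreal (N ^ (l + 1) * C * 0)"
      by (intro tendsto_ennrealI tendsto_mult tendsto_const LIMSEQ_power_zero) auto
    ultimately have "emeasure M (\<Inter>k. A k) \<le> ennreal (N ^ (l + 1) * C * 0)"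
      by (meson LIMSEQ_le_const)
    then show ?thesis using A by (intro bexI[of _ "\<Inter>k. A k"]) auto
  qed
  have "AE x in M. x \<notin> D m \<inter> ball undefined (2 ^ l / 2 ^ m)" for m l
  proof -
    from cov[where m = m and l = l and xo = undefined] show ?thesis
    proof (elim bexE conjE)
      fix A assume "A \<in> sets M" "D m \<inter> ball undefined (2 ^ l / 2 ^ m) \<subseteq> A" "emeasure M A = 0"
      then show ?thesis by (intro AE_I[of _ _ A]) auto
    qed
  qed
  then have "AE x in M. \<forall>m l. x \<notin> D m \<inter> ball undefined (2 ^ l / 2 ^ m)"
    unfolding AE_all_countable by blast
  then show ?thesis
  proof (rule AE_mp, intro AE_I2 impI allI)
    fix x and \<delta> :: real assume x: "\<forall>m l. x \<notin> D m \<inter> ball undefined (2 ^ l / 2 ^ m)" and "\<delta> > 0"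
    obtain m where m: "1 / \<delta> < 2 ^ m" using real_arch_pow[of 2] by auto
    then have "1 / 2 ^ m < \<delta>" using \<open>\<delta> > 0\<close> by (simp add: field_simps)
    obtain l where "dist undefined x * 2 ^ m < 2 ^ l" using real_arch_pow[of 2] by auto
    then have "x \<in> ball undefined (2 ^ l / 2 ^ m)" by (simp add: field_simps)
    then have "x \<notin> D m" using x by blast
    then show "\<exists>r. 0 < r \<and> r < \<delta> \<and> doubling_ball x r"
      using \<open>1 / 2 ^ m < \<delta>\<close> by (force simp: D_def)
  qed
qed

end

section \<open>Maximal functions\<close>

text \<open>The \<open>\<theta>\<close>-dilates of all balls lie in the
  \<open>(2 + \<theta>)\<close>-dilates of a disjoint subfamily, over which the values of
  \<open>\<nu>\<close> add up. The value \<open>\<theta> = 1\<close> serves for maximal functions;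
  \<open>\<theta> = 2\<close> measures doubled balls when the 4-fold dilate is compared with the
  ball.\<close>

lemma vitali_measure_bound:
  fixes x :: "'i \<Rightarrow> 'a::metric_space"
  assumes "finite I" and r: "\<And>i. i \<in> I \<Longrightarrow> r i > 0"
    and sets: "sets \<mu> = sets borel" "sets \<nu> = sets borel" and U: "U \<in> sets borel"
    and sub: "\<And>i. i \<in> I \<Longrightarrow> ball (x i) (r i) \<subseteq> U"
    and le: "\<And>i. i \<in> I \<Longrightarrow>
      emeasure \<mu> (ball (x i) ((2 + \<theta>) * r i)) \<le> c * emeasure \<nu> (ball (x i) (r i))"
    and "\<theta> \<ge> 0"
  shows "emeasure \<mu> (\<Union>i\<in>I. ball (x i) (\<theta> * r i)) \<le> c * emeasure \<nu> U"
proof -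
  obtain J where J: "J \<subseteq> I" "disjoint_family_on (\<lambda>i. ball (x i) (r i)) J"
    "\<forall>i\<in>I. \<exists>j\<in>J. r i \<le> r j \<and> dist (x i) (x j) < r i + r j"
    using finite_vitali[OF \<open>finite I\<close>, of r x] r by blast
  have m: "ball y s \<in> sets \<mu>" "ball y s \<in> sets \<nu>" for y s by (simp_all add: sets)
  have fJ: "finite J" using J(1) \<open>finite I\<close> finite_subset by blast
  have "(\<Union>i\<in>I. ball (x i) (\<theta> * r i)) \<subseteq> (\<Union>j\<in>J. ball (x j) ((2 + \<theta>) * r j))"
  proof
    fix y assume "y \<in> (\<Union>i\<in>I. ball (x i) (\<theta> * r i))"
    then obtain i where i: "i \<in> I" "dist (x i) y < \<theta> * r i" by auto
    obtain j where j: "j \<in> J" "r i \<le> r j" "dist (x i) (x j) < r i + r j" using J(3) i by blast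
    have "dist (x j) y \<le> dist (x i) (x j) + dist (x i) y"
      by (metis dist_commute dist_triangle)
    moreover have "\<theta> * r i \<le> \<theta> * r j" using j \<open>\<theta> \<ge> 0\<close> by (intro mult_left_mono)
    ultimately have "dist (x j) y < (2 + \<theta>) * r j" using i j by (simp add: distrib_right)
    then show "y \<in> (\<Union>j\<in>J. ball (x j) ((2 + \<theta>) * r j))" using j by auto
  qed
  then have "emeasure \<mu> (\<Union>i\<in>I. ball (x i) (\<theta> * r i)) \<le> emeasure \<mu> (\<Union>j\<in>J. ball (x j) ((2 + \<theta>) * r j))"
    by (intro emeasure_mono) (auto simp: sets intro!: borel_open)
  also have "\<dots> \<le> (\<Sum>j\<in>J. emeasure \<mu> (ball (x j) ((2 + \<theta>) * r j)))"
    by (intro emeasure_subadditive_finite fJ image_subsetI m)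
  also have "\<dots> \<le> (\<Sum>j\<in>J. c * emeasure \<nu> (ball (x j) (r j)))"
    using le J(1) by (intro sum_mono) auto
  also have "\<dots> = c * (\<Sum>j\<in>J. emeasure \<nu> (ball (x j) (r j)))" by (simp add: sum_distrib_left)
  also have "(\<Sum>j\<in>J. emeasure \<nu> (ball (x j) (r j))) = emeasure \<nu> (\<Union>j\<in>J. ball (x j) (r j))"
    using J(2) by (intro sum_emeasure image_subsetI m fJ)
  also have "c * \<dots> \<le> c * emeasure \<nu> U"
    using sub J(1) U sets by (intro mult_left_mono emeasure_mono) auto
  finally show ?thesis .
qed

section \<open>The Dini modulus in dyadic form\<close>

lemma dini_mono: "dini_modulus \<omega> \<Longrightarrow> 0 \<le> s \<Longrightarrow> s \<le> t \<Longrightarrow> \<omega> s \<le> \<omega> t"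
  unfolding dini_modulus_def by (elim conjE) (erule mono_onD, simp_all)

lemma dini_nonneg: "dini_modulus \<omega> \<Longrightarrow> 0 \<le> t \<Longrightarrow> 0 \<le> \<omega> t"
  using dini_mono[of \<omega> 0 t] by (simp add: dini_modulus_def)

lemma borel_measurable_dist_left [measurable]:
  "dist (x::'a::metric_space) \<in> borel_measurable borel"
  by (intro borel_measurable_continuous_onI continuous_intros)

text \<open>On the interval from \<open>1 / 2 ^ Suc k\<close> to \<open>1 / 2 ^ k\<close> the
  integrand \<open>\<omega> t / t\<close> is at least
  \<open>\<omega> (1 / 2 ^ Suc k) * 2 ^ k\<close>. The interval has length
  \<open>1 / 2 ^ Suc k\<close>, so each term of the series is at most twice the integral over its
  interval.\<close>

lemma dini_sum:
  assumes "dini_modulus \<omega>"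
  obtains S where "S \<ge> 0" "(\<Sum>k. ennreal (\<omega> (1 / 2 ^ Suc k))) \<le> ennreal S"
proof -
  have int: "set_integrable lborel {0<..<1} (\<lambda>t. \<omega> t / t)"
    using assms unfolding dini_modulus_def by (elim conjE)
  note mono = dini_mono[OF assms] and pos = dini_nonneg[OF assms]
  define g where "g = (\<lambda>t::real. indicator {0<..<1} t *\<^sub>R (\<omega> t / t))"
  have gi: "integrable lborel g" using int by (simp add: set_integrable_def g_def)
  then have [measurable]: "g \<in> borel_measurable lborel" by blast
  have fin: "(\<integral>\<^sup>+t. ennreal (g t) \<partial>lborel) < \<infinity>"
  proof -
    have "g t \<ge> 0" for t by (auto simp: g_def indicator_def pos)
    moreover have "(\<integral>\<^sup>+t. ennreal (norm (g t)) \<partial>lborel) < \<infinity>"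
      using gi by (simp only: integrable_iff_bounded)
    ultimately show ?thesis by simp
  qed
  \<comment> \<open>With this density the sum over the disjoint intervals becomes countable
    additivity of one measure.\<close>
  define D where "D = density lborel (\<lambda>t. ennreal (g t))"
  define A where "A = (\<lambda>k::nat. {1 / 2 ^ Suc k<..<1 / 2 ^ k} :: real set)"
  have dj: "disjoint_family A"
  proof -
    have "A m \<inter> A n = {}" if "m < n" for m n
    proof -
      have "(1::real) / 2 ^ n \<le> 1 / 2 ^ Suc m"
        using that by (intro divide_left_mono power_increasing) auto
      then show ?thesis by (auto simp: A_def)
    qed
    then show ?thesis unfolding disjoint_family_on_def by (metis Int_commute nat_neq_iff)
  qed
  have le: "ennreal (\<omega> (1 / 2 ^ Suc k)) \<le> 2 * emeasure D (A k)" for k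
  proof -
    have "ennreal (\<omega> (1 / 2 ^ Suc k)) = 2 * (ennreal (\<omega> (1 / 2 ^ Suc k) * 2 ^ k) * emeasure lborel (A k))"
    proof -
      have "emeasure lborel (A k) = ennreal (1 / 2 ^ Suc k)"
        unfolding A_def by (subst emeasure_lborel_Ioo) (auto simp: field_simps)
      then have "ennreal (\<omega> (1 / 2 ^ Suc k) * 2 ^ k) * emeasure lborel (A k)
          = ennreal (\<omega> (1 / 2 ^ Suc k) / 2)"
        by (simp add: pos flip: ennreal_mult)
      moreover have "2 * ennreal (\<omega> (1 / 2 ^ Suc k) / 2) = ennreal (2 * (\<omega> (1 / 2 ^ Suc k) / 2))"
        by (subst ennreal_mult) (auto simp: pos)
      ultimately show ?thesis by simp
    qed
    also have "ennreal (\<omega> (1 / 2 ^ Suc k) * 2 ^ k) * emeasure lborel (A k)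
        = (\<integral>\<^sup>+t. ennreal (\<omega> (1 / 2 ^ Suc k) * 2 ^ k) * indicator (A k) t \<partial>lborel)"
      by (subst nn_integral_cmult_indicator) (auto simp: A_def)
    also have "\<dots> \<le> (\<integral>\<^sup>+t. ennreal (g t) * indicator (A k) t \<partial>lborel)"
    proof (intro nn_integral_mono)
      fix t :: real
      show "ennreal (\<omega> (1 / 2 ^ Suc k) * 2 ^ k) * indicator (A k) t \<le> ennreal (g t) * indicator (A k) t"
      proof (cases "t \<in> A k")
        case True
        then have t: "1 / 2 ^ Suc k < t" "t < 1 / 2 ^ k" by (auto simp: A_def)
        have "(0::real) < 1 / 2 ^ Suc k" by simp
        then have "0 < t" using t by linarith
        have "(1::real) / 2 ^ k \<le> 1" by simp
        then have "t < 1" using t by linarith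
        have "2 ^ k \<le> 1 / t" using t \<open>0 < t\<close> by (simp add: field_simps)
        then have "\<omega> (1 / 2 ^ Suc k) * 2 ^ k \<le> \<omega> t * (1 / t)"
          using t \<open>0 < t\<close> by (intro mult_mono mono pos) auto
        then show ?thesis using True \<open>0 < t\<close> \<open>t < 1\<close> by (auto simp: g_def intro!: ennreal_leI)
      qed auto
    qed
    also have "\<dots> = emeasure D (A k)"
      unfolding D_def by (subst emeasure_density) (auto simp: A_def)
    finally show ?thesis by (simp add: mult_left_mono)
  qed
  have "(\<Sum>k. ennreal (\<omega> (1 / 2 ^ Suc k))) \<le> (\<Sum>k. 2 * emeasure D (A k))"
    by (intro suminf_le le) auto
  also have "\<dots> = 2 * (\<Sum>k. emeasure D (A k))" by simp
  also have "(\<Sum>k. emeasure D (A k)) = emeasure D (\<Union>k. A k)"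
    using dj by (intro suminf_emeasure) (auto simp: D_def A_def)
  also have "2 * \<dots> \<le> 2 * emeasure D UNIV"
    by (intro mult_left_mono emeasure_mono) (auto simp: D_def)
  also have "emeasure D UNIV = (\<integral>\<^sup>+t. ennreal (g t) \<partial>lborel)"
    unfolding D_def by (subst emeasure_density) auto
  finally have "(\<Sum>k. ennreal (\<omega> (1 / 2 ^ Suc k))) \<le> 2 * (\<integral>\<^sup>+t. ennreal (g t) \<partial>lborel)" .
  moreover have "2 * (\<integral>\<^sup>+t. ennreal (g t) \<partial>lborel) < \<infinity>"
    using fin by (simp add: ennreal_mult_less_top)
  ultimately show thesis
    using that[of "enn2real (2 * (\<integral>\<^sup>+t. ennreal (g t) \<partial>lborel))"] by (simp add: less_top)
qed

context nonhom_space
begin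

text \<open>This is the weak-type bound for the maximal function with \<open>lam\<close> in the
  denominator. On a bad ball, \<open>3 * r\<close> stays below two doublings of \<open>r\<close>, so
  the measure of the tripled ball is at most \<open>Cl\<^sup>2\<close> times the
  \<open>\<nu>\<close>-mass of the ball, as the covering argument requires. \<open>\<Omega>\<close>
  is the union of the bad balls and not the set of their centres, hence open without any
  measurability of \<open>lam\<close> in its first argument.\<close>

lemma maximal_exceptional_set:
  assumes sets: "sets \<nu> = sets borel" and fin: "finite_measure \<nu>"
  obtains \<Omega> where "open \<Omega>" "emeasure M \<Omega> \<le> ennreal (Cl\<^sup>2) * emeasure \<nu> UNIV"
    "\<And>x r. x \<notin> \<Omega> \<Longrightarrow> r > 0 \<Longrightarrow> measure \<nu> (ball x r) \<le> lam x r"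
proof -
  define B where "B = {(x, r). r > 0 \<and> lam x r < measure \<nu> (ball x r)}"
  define \<Omega> where "\<Omega> = (\<Union>b\<in>B. ball (fst b) (snd b))"
  have op: "open \<Omega>" unfolding \<Omega>_def by auto
  have "emeasure M \<Omega> \<le> ennreal (Cl\<^sup>2) * emeasure \<nu> UNIV"
  proof (rule emeasure_le_compactI)
    fix S assume "compact S" "S \<subseteq> \<Omega>"
    then obtain B' where B': "B' \<subseteq> B" "finite B'" "S \<subseteq> (\<Union>b\<in>B'. ball (fst b) (snd b))"
      unfolding \<Omega>_def by (elim compactE_image) auto
    have "emeasure M S \<le> emeasure M (\<Union>b\<in>B'. ball (fst b) (1 * snd b))"
      using B' by (intro emeasure_mono) (auto simp: sets_M)
    also have "\<dots> \<le> ennreal (Cl\<^sup>2) * emeasure \<nu> UNIV"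
    proof (rule vitali_measure_bound[OF B'(2)])
      fix b assume "b \<in> B'"
      then obtain x r where b: "b = (x, r)" "r > 0" "lam x r < measure \<nu> (ball x r)"
        using B'(1) by (auto simp: B_def)
      have "measure M (ball x (3 * r)) \<le> lam x (3 * r)" using b by (intro measure_ball_lam) auto
      also have "\<dots> \<le> lam x (2 ^ 2 * r)" using b by (intro lam_mono) auto
      also have "\<dots> \<le> Cl\<^sup>2 * lam x r" using b by (intro lam_double)
      also have "\<dots> \<le> Cl\<^sup>2 * measure \<nu> (ball x r)" using b by (intro mult_left_mono) auto
      finally show "emeasure M (ball (fst b) ((2 + 1) * snd b)) \<le> ennreal (Cl\<^sup>2) * emeasure \<nu> (ball (fst b) (snd b))"
        using b by (simp add: emeasure_ball finite_measure.emeasure_eq_measure[OF fin] ennreal_leI flip: ennreal_mult)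
    qed (use B' sets sets_M in \<open>auto simp: B_def\<close>)
    finally show "emeasure M S \<le> ennreal (Cl\<^sup>2) * emeasure \<nu> UNIV" .
  qed (use op in auto)
  moreover have "measure \<nu> (ball x r) \<le> lam x r" if "x \<notin> \<Omega>" "r > 0" for x r
  proof (rule ccontr)
    assume "\<not> ?thesis"
    then have "(x, r) \<in> B" using that by (simp add: B_def)
    then have "x \<in> \<Omega>" using that by (force simp: \<Omega>_def)
    then show False using that by simp
  qed
  ultimately show thesis using that op by blast
qed

lemma lam_max_measurable:
  assumes "r > 0"
  shows "(\<lambda>y. lam x (max r (dist x y))) \<in> borel_measurable borel"
proof -
  have "mono (\<lambda>s. lam x (max r s))"
    using assms by (intro monoI lam_mono) auto
  then have "(\<lambda>s. lam x (max r s)) \<in> borel_measurable borel" by (rule borel_measurable_mono)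
  then show ?thesis by measurable
qed

text \<open>Estimating the mass of every dyadic ball by \<open>a n\<close> leaves the sum of all
  \<open>1 / a n\<close>, which may diverge because \<open>lam x\<close> need not grow. The
  increments of the mass have to be kept: \<open>lam x\<close> varies on an annulus by a factor of
  at most \<open>Cl\<close>, and the sum of \<open>(V (Suc n) - V n) / (a n)\<^sup>2\<close> is
  bounded even if \<open>a\<close> grows slowly.\<close>

lemma maximal_integral_bound:
  assumes sets: "sets \<nu> = sets borel" and fin: "finite_measure \<nu>" and "r > 0"
    and le: "\<And>s. s > 0 \<Longrightarrow> measure \<nu> (ball x s) \<le> lam x s"
  shows "(\<integral>\<^sup>+y. ennreal (1 / (lam x (max r (dist x y)))\<^sup>2) \<partial>\<nu>) \<le> ennreal (2 * Cl\<^sup>2 / lam x r)"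
proof -
  interpret \<nu>: finite_measure \<nu> by (rule fin)
  have [measurable_cong]: "sets \<nu> = sets borel" by (rule sets)
  have [measurable]: "(\<lambda>y. lam x (max r (dist x y))) \<in> borel_measurable borel"
    by (rule lam_max_measurable[OF \<open>r > 0\<close>])
  define D where "D = density \<nu> (\<lambda>y. ennreal (1 / (lam x (max r (dist x y)))\<^sup>2))"
  have sD: "sets D = sets borel" by (simp add: D_def sets)
  define a where "a = (\<lambda>n. lam x (2 ^ n * r))"
  define B where "B = (\<lambda>n::nat. ball x (2 ^ n * r))"
  define V where "V = (\<lambda>n. measure \<nu> (B n))"
  have a_pos: "a n > 0" for n using \<open>r > 0\<close> by (simp add: a_def lam_pos)
  have a_mono: "a n \<le> a (Suc n)" for n
    using \<open>r > 0\<close> unfolding a_def by (intro lam_mono) auto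
  have a_dbl: "a (Suc n) \<le> Cl * a n" for n
    using lam_double[of "2 ^ n * r" x 1] \<open>r > 0\<close> by (simp add: a_def mult_ac)
  have Va: "V n \<le> a n" for n using le[of "2 ^ n * r"] \<open>r > 0\<close> by (simp add: V_def B_def a_def)
  have Bm [measurable]: "B n \<in> sets borel" for n by (simp add: B_def)
  have Bmono: "B n \<subseteq> B (Suc n)" for n
    using \<open>r > 0\<close> unfolding B_def by (intro subset_ball) auto
  have bound: "emeasure D A \<le> ennreal (1 / c\<^sup>2 * measure \<nu> A)"
    if "A \<in> sets borel" "c > 0" "\<And>y. y \<in> A \<Longrightarrow> c \<le> lam x (max r (dist x y))" for A c
  proof -
    have "emeasure D A = (\<integral>\<^sup>+y. ennreal (1 / (lam x (max r (dist x y)))\<^sup>2) * indicator A y \<partial>\<nu>)"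
      unfolding D_def using that by (subst emeasure_density) (auto simp: sets)
    also have "\<dots> \<le> (\<integral>\<^sup>+y. ennreal (1 / c\<^sup>2) * indicator A y \<partial>\<nu>)"
    proof (intro nn_integral_mono)
      fix y
      have "1 / (lam x (max r (dist x y)))\<^sup>2 \<le> 1 / c\<^sup>2" if "y \<in> A"
        using \<open>c > 0\<close> \<open>\<And>y. y \<in> A \<Longrightarrow> c \<le> lam x (max r (dist x y))\<close>[OF that]
        by (intro divide_left_mono power_mono mult_pos_pos zero_less_power) auto
      then show "ennreal (1 / (lam x (max r (dist x y)))\<^sup>2) * indicator A y \<le> ennreal (1 / c\<^sup>2) * indicator A y"
        by (cases "y \<in> A") (auto intro: ennreal_leI)
    qed
    also have "\<dots> = ennreal (1 / c\<^sup>2) * emeasure \<nu> A"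
      using that by (subst nn_integral_cmult_indicator) (auto simp: sets)
    also have "\<dots> = ennreal (1 / c\<^sup>2 * measure \<nu> A)"
      by (subst ennreal_mult) (auto simp: \<nu>.emeasure_eq_measure)
    finally show ?thesis .
  qed
  \<comment> \<open>summation by parts, with \<open>V n \<le> a n\<close> and \<open>1 / (a n)\<^sup>2\<close> decreasing\<close>
  have key: "emeasure D (B n) \<le> ennreal (Cl\<^sup>2 * (2 / a 0 - 2 / a n + V n / (a n)\<^sup>2))" for n
  proof (induction n)
    case 0
    have "emeasure D (B 0) \<le> ennreal (1 / (a 0)\<^sup>2 * V 0)"
      unfolding V_def using \<open>r > 0\<close>
      by (intro bound Bm a_pos) (auto simp: a_def intro!: lam_mono)
    also have "1 / (a 0)\<^sup>2 * V 0 \<le> Cl\<^sup>2 * (1 / (a 0)\<^sup>2 * V 0)"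
      using Cl_ge_1 mult_right_mono[of 1 "Cl\<^sup>2" "1 / (a 0)\<^sup>2 * V 0"] by (simp add: V_def)
    finally show ?case by (simp add: ennreal_leI)
  next
    case (Suc n)
    \<comment> \<open>The mass of the new annulus carries the weight \<open>u\<^sup>2\<close>, which
      is at most \<open>Cl\<^sup>2 * v\<^sup>2\<close>. Replacing \<open>u\<^sup>2\<close> by
      \<open>v\<^sup>2\<close> in the old term costs \<open>V n * (u + v) * (u - v)\<close>, at most
      \<open>2 * (u - v)\<close> because \<open>V n * u \<le> 1\<close>, and this
      telescopes.\<close>
    define u where "u = 1 / a n"
    define v where "v = 1 / a (Suc n)"
    have uv: "0 < v" "v \<le> u" "0 < u"
      using a_pos[of n] a_pos[of "Suc n"] a_mono[of n] by (auto simp: u_def v_def frac_le)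
    have u_le: "u \<le> Cl * v"
      using a_dbl[of n] a_pos[of n] a_pos[of "Suc n"] by (simp add: u_def v_def field_simps)
    have Vu: "V n * u \<le> 1" using Va[of n] a_pos[of n] by (simp add: u_def)
    have V0: "V n \<ge> 0" "V n \<le> V (Suc n)"
      using Bmono by (auto simp: V_def intro!: \<nu>.finite_measure_mono)
    have "emeasure D (B (Suc n)) = emeasure D (B n) + emeasure D (B (Suc n) - B n)"
      using Bmono[of n] by (subst plus_emeasure) (auto simp: sD intro!: arg_cong2[where f=emeasure])
    also have "\<dots> \<le> ennreal (Cl\<^sup>2 * (2 / a 0 - 2 / a n + V n / (a n)\<^sup>2)) + ennreal (1 / (a n)\<^sup>2 * (V (Suc n) - V n))"
    proof (intro add_mono Suc.IH)
      have "emeasure D (B (Suc n) - B n) \<le> ennreal (1 / (a n)\<^sup>2 * measure \<nu> (B (Suc n) - B n))"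
        using \<open>r > 0\<close> by (intro bound a_pos) (auto simp: a_def B_def intro!: lam_mono)
      also have "measure \<nu> (B (Suc n) - B n) = V (Suc n) - V n"
        using Bmono[of n] unfolding V_def by (intro \<nu>.finite_measure_Diff) (auto simp: sets)
      finally show "emeasure D (B (Suc n) - B n) \<le> ennreal (1 / (a n)\<^sup>2 * (V (Suc n) - V n))" .
    qed
    also have "\<dots> = ennreal (Cl\<^sup>2 * (2 / a 0 - 2 / a n + V n / (a n)\<^sup>2) + 1 / (a n)\<^sup>2 * (V (Suc n) - V n))"
    proof (rule ennreal_plus[symmetric])
      have "a 0 \<le> a n" by (rule lift_Suc_mono_le) (auto simp: a_mono)
      then have "2 / a n \<le> 2 / a 0" using a_pos by (simp add: frac_le)
      then show "0 \<le> Cl\<^sup>2 * (2 / a 0 - 2 / a n + V n / (a n)\<^sup>2)"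
        using V0 by (intro mult_nonneg_nonneg add_nonneg_nonneg) auto
    qed (use V0 in auto)
    also have "\<dots> \<le> ennreal (Cl\<^sup>2 * (2 / a 0 - 2 / a (Suc n) + V (Suc n) / (a (Suc n))\<^sup>2))"
    proof (rule ennreal_leI)
      have "u\<^sup>2 \<le> (Cl * v)\<^sup>2" using u_le uv by (intro power_mono) auto
      then have "u\<^sup>2 * (V (Suc n) - V n) \<le> Cl\<^sup>2 * (v\<^sup>2 * (V (Suc n) - V n))"
        using V0 mult_right_mono[of "u\<^sup>2" "Cl\<^sup>2 * v\<^sup>2" "V (Suc n) - V n"] by (simp add: power_mult_distrib mult.assoc)
      moreover have "V n * u\<^sup>2 - V n * v\<^sup>2 \<le> 2 * u - 2 * v"
      proof -
        have "V n * (u + v) \<le> V n * u + V n * u" using mult_left_mono[of v u "V n"] uv V0 by (simp add: algebra_simps)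
        also have "\<dots> \<le> 2" using Vu by linarith
        finally have "(V n * (u + v)) * (u - v) \<le> 2 * (u - v)" using uv by (intro mult_right_mono) auto
        then show ?thesis by (simp add: power2_eq_square algebra_simps)
      qed
      then have "Cl\<^sup>2 * (V n * u\<^sup>2 - V n * v\<^sup>2) \<le> Cl\<^sup>2 * (2 * u - 2 * v)"
        by (intro mult_left_mono) auto
      ultimately have "Cl\<^sup>2 * (2 / a 0 - 2 * u + V n * u\<^sup>2) + u\<^sup>2 * (V (Suc n) - V n)
          \<le> Cl\<^sup>2 * (2 / a 0 - 2 * v + V (Suc n) * v\<^sup>2)"
        by (simp add: algebra_simps)
      then show "Cl\<^sup>2 * (2 / a 0 - 2 / a n + V n / (a n)\<^sup>2) + 1 / (a n)\<^sup>2 * (V (Suc n) - V n)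
          \<le> Cl\<^sup>2 * (2 / a 0 - 2 / a (Suc n) + V (Suc n) / (a (Suc n))\<^sup>2)"
        by (simp add: u_def v_def power_divide)
    qed
    finally show ?case .
  qed
  have "emeasure D (B n) \<le> ennreal (2 * Cl\<^sup>2 / lam x r)" for n
  proof -
    have "V n / (a n)\<^sup>2 \<le> 2 / a n"
      using Va[of n] a_pos[of n] by (simp add: field_simps power2_eq_square)
    then have "Cl\<^sup>2 * (2 / a 0 - 2 / a n + V n / (a n)\<^sup>2) \<le> Cl\<^sup>2 * (2 / a 0)"
      by (intro mult_left_mono) auto
    then show ?thesis
      using key[of n] by (auto simp: a_def mult_ac intro: order_trans ennreal_leI)
  qed
  then have "(SUP n. emeasure D (B n)) \<le> ennreal (2 * Cl\<^sup>2 / lam x r)" by (intro SUP_least)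
  moreover have "(SUP n. emeasure D (B n)) = emeasure D (\<Union>n. B n)"
    using Bmono by (intro SUP_emeasure_incseq) (auto simp: sD incseq_Suc_iff)
  moreover have "(\<Union>n. B n) = UNIV"
  proof -
    have "\<exists>n. y \<in> B n" for y
    proof -
      obtain n where "dist x y / r < 2 ^ n" using real_arch_pow[of 2] by auto
      then show ?thesis using \<open>r > 0\<close> by (auto simp: B_def field_simps)
    qed
    then show ?thesis by auto
  qed
  moreover have "emeasure D UNIV = (\<integral>\<^sup>+y. ennreal (1 / (lam x (max r (dist x y)))\<^sup>2) \<partial>\<nu>)"
    unfolding D_def using sets_eq_imp_space_eq[OF sets] by (subst emeasure_density) (auto simp: sets)
  ultimately show ?thesis by simp
qed

text \<open>Trades \<open>1 / lam\<close> at a variable point for the reciprocal measure of a ball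
  with fixed centre. The resulting majorants are constant on balls, hence measurable in
  \<open>x\<close>, and the measure of the ball cancels on integration.\<close>

lemma inverse_lam_le:
  assumes "measure M (ball z (2 * s)) > 0" and "0 < s" and "s \<le> d" and "dist x z \<le> 2 * s"
  shows "1 / lam x d \<le> Cl\<^sup>2 / measure M (ball z (2 * s))"
proof -
  have "measure M (ball z (2 * s)) \<le> Cl * lam x (2 * s)"
    using assms by (intro measure_ball_shift) auto
  also have "\<dots> \<le> Cl * (Cl * lam x s)"
    using lam_double[of s x 1] assms Cl_ge_1 by (intro mult_left_mono) auto
  also have "\<dots> \<le> Cl * (Cl * lam x d)"
    using lam_mono[of s d x] assms Cl_ge_1 by (intro mult_left_mono) auto
  finally show ?thesis
    using assms lam_pos[of d x] by (simp add: field_simps power2_eq_square)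
qed

text \<open>The integrand is split over dyadic annuli around \<open>z\<close>. Each of them
  contributes one value of \<open>\<omega>\<close>, since the measure of the enclosing ball cancels.
  \<open>J\<close> is a measurable majorant because the integrand, through \<open>lam\<close>, need
  not be measurable in \<open>x\<close>.\<close>

lemma dini_kernel_bound:
  assumes om: "dini_modulus \<omega>" and S: "(\<Sum>k. ennreal (\<omega> (1 / 2 ^ Suc k))) \<le> ennreal S"
    and "\<rho> > 0" and pos: "measure M (ball z \<rho>) > 0"
  obtains J where "J \<in> borel_measurable M" "(\<integral>\<^sup>+x. J x \<partial>M) \<le> ennreal (Cl\<^sup>2) * ennreal S"
    "\<And>x. 2 * \<rho> \<le> dist x z \<Longrightarrow> ennreal (\<omega> (\<rho> / dist x z) / lam x (dist x z)) \<le> J x"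
proof -
  note mono = dini_mono[OF om] and om_pos = dini_nonneg[OF om]
  \<comment> \<open>The annulus with number \<open>k\<close> consists of the points with
    \<open>2 ^ Suc k * \<rho> \<le> dist x z < 2 * (2 ^ Suc k * \<rho>)\<close>, and
    \<open>B k\<close> has its outer radius. This fits \<open>inverse_lam_le\<close> with
    \<open>s = 2 ^ Suc k * \<rho>\<close>.\<close>
  define B where "B = (\<lambda>k::nat. ball z (2 * (2 ^ Suc k * \<rho>)))"
  have Bpos: "measure M (B k) > 0" for k
  proof -
    have "(2::real) ^ Suc k \<ge> 1" by (rule one_le_power) simp
    then have "1 * \<rho> \<le> 2 * 2 ^ Suc k * \<rho>" using \<open>\<rho> > 0\<close> by (intro mult_right_mono) linarith+
    then have "measure M (ball z \<rho>) \<le> measure M (B k)"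
      unfolding B_def by (intro measure_ball_mono subset_ball) simp
    then show ?thesis using pos by simp
  qed
  define c where "c = (\<lambda>k. ennreal (\<omega> (1 / 2 ^ Suc k)) * ennreal (Cl\<^sup>2 / measure M (B k)))"
  define J where "J = (\<lambda>x. \<Sum>k. c k * indicator (B k) x)"
  have Bm [measurable]: "B k \<in> sets M" for k by (simp add: B_def sets_M)
  have Jm: "J \<in> borel_measurable M" unfolding J_def by measurable
  have "(\<integral>\<^sup>+x. J x \<partial>M) = (\<Sum>k. (\<integral>\<^sup>+x. c k * indicator (B k) x \<partial>M))"
    unfolding J_def by (intro nn_integral_suminf) measurable
  also have "\<dots> = (\<Sum>k. c k * emeasure M (B k))"
    by (simp add: nn_integral_cmult_indicator)
  also have "\<dots> = (\<Sum>k. ennreal (Cl\<^sup>2) * ennreal (\<omega> (1 / 2 ^ Suc k)))"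
  proof (intro suminf_cong)
    fix k
    have "ennreal (Cl\<^sup>2 / measure M (B k)) * emeasure M (B k) = ennreal (Cl\<^sup>2)"
      using Bpos[of k] by (simp add: B_def emeasure_ball flip: ennreal_mult)
    then show "c k * emeasure M (B k) = ennreal (Cl\<^sup>2) * ennreal (\<omega> (1 / 2 ^ Suc k))"
      unfolding c_def mult.assoc by (simp add: mult.commute)
  qed
  also have "\<dots> = ennreal (Cl\<^sup>2) * (\<Sum>k. ennreal (\<omega> (1 / 2 ^ Suc k)))" by simp
  also have "\<dots> \<le> ennreal (Cl\<^sup>2) * ennreal S" using S by (rule mult_left_mono) simp
  finally have "(\<integral>\<^sup>+x. J x \<partial>M) \<le> ennreal (Cl\<^sup>2) * ennreal S" .
  moreover have "ennreal (\<omega> (\<rho> / dist x z) / lam x (dist x z)) \<le> J x" if "2 * \<rho> \<le> dist x z" for x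
  proof -
    define d where "d = dist x z"
    have d: "2 * \<rho> \<le> d" "d > 0" using that \<open>\<rho> > 0\<close> by (auto simp: d_def)
    define P where "P = (\<lambda>k::nat. d < 2 * (2 ^ Suc k * \<rho>))"
    have "\<exists>k. P k"
    proof -
      obtain k where "d / \<rho> < 2 ^ k" using real_arch_pow[of 2] by auto
      moreover have "(2::real) ^ k \<le> 2 * 2 ^ Suc k" by simp
      ultimately have "d / \<rho> < 2 * 2 ^ Suc k" by linarith
      then show ?thesis using \<open>\<rho> > 0\<close> by (auto simp: P_def field_simps)
    qed
    then obtain k where k: "P k" "\<And>j. j < k \<Longrightarrow> \<not> P j"
      using exists_least_iff[of P] by blast
    have lo: "2 ^ Suc k * \<rho> \<le> d"
    proof (cases k)
      case 0 then show ?thesis using d by simp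
    next
      case (Suc j) then show ?thesis using k(2)[of j] by (simp add: P_def)
    qed
    have "\<omega> (\<rho> / d) / lam x d = \<omega> (\<rho> / d) * (1 / lam x d)" by simp
    also have "\<dots> \<le> \<omega> (1 / 2 ^ Suc k) * (Cl\<^sup>2 / measure M (B k))"
    proof (intro mult_mono)
      show "\<omega> (\<rho> / d) \<le> \<omega> (1 / 2 ^ Suc k)"
        using lo d \<open>\<rho> > 0\<close> by (intro mono) (auto simp: field_simps)
      show "1 / lam x d \<le> Cl\<^sup>2 / measure M (B k)"
        unfolding B_def using Bpos[of k] lo k(1) \<open>\<rho> > 0\<close>
        by (intro inverse_lam_le) (auto simp: B_def P_def d_def)
      show "0 \<le> \<omega> (1 / 2 ^ Suc k)" by (rule om_pos) simp
      show "0 \<le> 1 / lam x d" using lam_pos[OF d(2), of x] by simp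
    qed
    finally have "ennreal (\<omega> (\<rho> / d) / lam x d) \<le> c k"
      unfolding c_def using om_pos[of "1 / 2 ^ Suc k"] by (subst ennreal_mult[symmetric]) (auto intro: ennreal_leI)
    also have "\<dots> = c k * indicator (B k) x"
      using k(1) by (simp add: P_def B_def d_def dist_commute)
    also have "\<dots> \<le> J x"
    proof -
      define f where "f = (\<lambda>k. c k * indicator (B k) x)"
      have "sum f {k} \<le> suminf f" by (rule sum_le_suminf) auto
      then have "f k \<le> suminf f" by simp
      then show ?thesis by (simp only: f_def J_def)
    qed
    finally show ?thesis unfolding d_def .
  qed
  ultimately show thesis using that Jm by blast
qed

end

section \<open>The decomposition into balls\<close>

context nonhom_space
begin

text \<open>A substitute for Lebesgue's differentiation theorem.\<close>

lemma small_average_null: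
  fixes w :: "'a \<Rightarrow> real"
  defines "\<nu> \<equiv> density M (\<lambda>x. ennreal (w x))"
  assumes w: "w \<in> borel_measurable borel" and fin: "finite_measure \<nu>"
    and E: "E \<in> sets borel"
    and avg: "\<And>x r. x \<in> E \<Longrightarrow> r > 0 \<Longrightarrow> measure \<nu> (ball x r) \<le> measure M (ball x (4 * r))"
    and big: "\<And>x. x \<in> E \<Longrightarrow> 2 * beta \<le> w x"
  shows "emeasure M E = 0"
proof -
  have [measurable]: "w \<in> borel_measurable M" using w by measurable
  have sets\<nu>: "sets \<nu> = sets borel" by (simp add: \<nu>_def sets_M)
  obtain B where "{x \<in> space M. \<not> (\<forall>\<delta>>0. \<exists>r. 0 < r \<and> r < \<delta> \<and> doubling_ball x r)} \<subseteq> B"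
      and B: "emeasure M B = 0" "B \<in> sets M"
    by (rule AE_E[OF doubling_AE])
  then have dbl: "\<exists>r. 0 < r \<and> r < \<delta> \<and> doubling_ball x r" if "x \<notin> B" "\<delta> > 0" for x \<delta>
    using that space_M by blast
  have "emeasure M (E - B) \<le> 0"
  proof (rule emeasure_le_compactI)
    show "E - B \<in> sets borel" using E B(2) by (auto simp: sets_M)
    fix K assume K: "compact K" "K \<subseteq> E - B"
    \<comment> \<open>Doubling balls of radius below \<open>1 / Suc n\<close> centred in
      \<open>K\<close> stay inside \<open>U n\<close>. The disjoint ones selected among them
      therefore have total measure at most that of \<open>U n\<close>, which tends to the measure of
      \<open>K\<close>.\<close>
    define U where "U = (\<lambda>n::nat. \<Union>k\<in>K. ball k (1 / real (Suc n)))"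
    have Um: "U n \<in> sets M" for n unfolding U_def sets_M by (intro borel_open open_UN) auto
    have Km: "K \<in> sets M" using K(1) by (simp add: sets_M borel_compact)
    have le: "emeasure \<nu> K \<le> ennreal beta * emeasure M (U n)" for n
    proof -
      have "\<exists>r. 0 < r \<and> r < 1 / real (Suc n) \<and> doubling_ball x r" if "x \<in> K" for x
        using dbl[of x "1 / real (Suc n)"] K(2) that by (auto simp del: of_nat_Suc)
      then obtain r where r: "\<And>x. x \<in> K \<Longrightarrow> 0 < r x" "\<And>x. x \<in> K \<Longrightarrow> r x < 1 / real (Suc n)"
          "\<And>x. x \<in> K \<Longrightarrow> doubling_ball x (r x)" by metis
      have "K \<subseteq> (\<Union>x\<in>K. ball x (r x))" using r(1) by force
      then obtain K' where K': "K' \<subseteq> K" "finite K'" "K \<subseteq> (\<Union>x\<in>K'. ball x (r x))"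
        using K(1) by (elim compactE_image) auto
      have "emeasure \<nu> K \<le> emeasure \<nu> (\<Union>x\<in>K'. ball x (1 * r x))"
        using K'(3) by (intro emeasure_mono) (auto simp: sets\<nu> intro!: borel_open)
      also have "\<dots> \<le> ennreal beta * emeasure M (U n)"
      proof (rule vitali_measure_bound[OF K'(2)])
        fix x assume "x \<in> K'"
        then have xK: "x \<in> K" using K' by blast
        \<comment> \<open>The Vitali dilate \<open>3 * r x\<close> meets the hypothesis on averages
          at radius \<open>12 * r x\<close>. This is below the radius \<open>16 * r x\<close> of the
          doubling test, which leads back to the ball itself.\<close>
        have "measure \<nu> (ball x (3 * r x)) \<le> measure M (ball x (4 * (3 * r x)))"
          using xK K(2) r(1)[OF xK] by (intro avg) auto
        also have "\<dots> \<le> measure M (ball x (16 * r x))"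
          using r(1)[OF xK] by (intro measure_ball_mono subset_ball) simp
        also have "\<dots> \<le> beta * measure M (ball x (r x))"
          using r(3)[OF xK] by (simp add: doubling_ball_def)
        finally show "emeasure \<nu> (ball x ((2 + 1) * r x)) \<le> ennreal beta * emeasure M (ball x (r x))"
          using beta_ge(3) by (simp add: emeasure_ball finite_measure.emeasure_eq_measure[OF fin] ennreal_leI flip: ennreal_mult)
        show "ball x (r x) \<subseteq> U n" using xK r(2)[OF xK] by (force simp: U_def)
      qed (use K' r(1) sets\<nu> sets_M Um in auto)
      finally show ?thesis .
    qed
    have lim: "(\<lambda>n. emeasure M (U n)) \<longlonglongrightarrow> emeasure M (\<Inter>n. U n)"
    proof (rule Lim_emeasure_decseq)
      show "range U \<subseteq> sets M" using Um by blast
      show "decseq U"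
        unfolding decseq_def U_def
      proof (intro allI impI UN_mono subset_ball order_refl)
        fix m n :: nat assume "m \<le> n"
        then show "1 / real (Suc n) \<le> 1 / real (Suc m)" by (intro divide_left_mono) auto
      qed
      show "emeasure M (U n) \<noteq> \<infinity>" for n
      proof -
        obtain R where R: "K \<subseteq> ball undefined R"
          using bounded_subset_ballD[OF compact_imp_bounded[OF K(1)]] by blast
        have "1 / real (Suc n) \<le> 1" by simp
        have "U n \<subseteq> ball undefined (R + 1)"
        proof
          fix y assume "y \<in> U n"
          then obtain k where k: "k \<in> K" "dist k y < 1 / real (Suc n)" by (auto simp: U_def)
          have "dist undefined k < R" using R k by auto
          then have "dist undefined y < R + 1"
            using dist_triangle[of undefined y k] k(2) \<open>1 / real (Suc n) \<le> 1\<close> by linarith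
          then show "y \<in> ball undefined (R + 1)" by simp
        qed
        then have "emeasure M (U n) \<le> emeasure M (ball undefined (R + 1))"
          by (intro emeasure_mono) (auto simp: sets_M)
        then show ?thesis unfolding infinity_ennreal_def using le_less_trans[OF _ emeasure_ball_finite] less_irrefl by metis
      qed
    qed
    have "(\<Inter>n. U n) \<subseteq> K"
    proof
      fix y assume y: "y \<in> (\<Inter>n. U n)"
      show "y \<in> K"
      proof (rule ccontr)
        assume "y \<notin> K"
        moreover have "open (- K)" using K(1) compact_imp_closed by blast
        ultimately obtain e where e: "e > 0" "ball y e \<subseteq> - K" by (meson ComplI open_contains_ball)
        obtain n where n: "1 / real (Suc n) < e" using nat_approx_posE[OF e(1)] by blast
        obtain k where "k \<in> K" "dist k y < 1 / real (Suc n)" using y by (auto simp: U_def simp del: of_nat_Suc)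
        then have "k \<in> ball y e" using n by (simp add: dist_commute del: of_nat_Suc)
        then show False using e \<open>k \<in> K\<close> by auto
      qed
    qed
    then have "emeasure M (\<Inter>n. U n) \<le> emeasure M K" using Km by (intro emeasure_mono)
    moreover have "emeasure \<nu> K \<le> ennreal beta * emeasure M (\<Inter>n. U n)"
      using le by (intro LIMSEQ_le_const[OF ennreal_tendsto_cmult[OF _ lim]]) auto
    ultimately have 1: "emeasure \<nu> K \<le> ennreal beta * emeasure M K"
      by (meson mult_left_mono order_trans zero_le)
    \<comment> \<open>The opposite inequality: the weight is at least \<open>2 * beta\<close> on
      \<open>K\<close>. Against the upper bound with factor \<open>beta\<close>, finiteness forces
      the measure of \<open>K\<close> to vanish.\<close>
    have "ennreal (2 * beta) * emeasure M K = (\<integral>\<^sup>+x. ennreal (2 * beta) * indicator K x \<partial>M)"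
      using Km by (simp add: nn_integral_cmult_indicator)
    also have "\<dots> \<le> (\<integral>\<^sup>+x. ennreal (w x) * indicator K x \<partial>M)"
      using big K(2) by (intro nn_integral_mono) (auto simp: indicator_def intro!: ennreal_leI)
    also have "\<dots> = emeasure \<nu> K"
      unfolding \<nu>_def using Km by (simp add: emeasure_density)
    finally have 2: "ennreal (2 * beta) * emeasure M K \<le> ennreal beta * emeasure M K" using 1 by simp
    obtain R where "K \<subseteq> ball undefined R"
      using bounded_subset_ballD[OF compact_imp_bounded[OF K(1)]] by blast
    then have "emeasure M K \<le> emeasure M (ball undefined R)"
      by (intro emeasure_mono) (auto simp: sets_M)
    then have "emeasure M K < top" using emeasure_ball_finite le_less_trans by blast
    then have e: "emeasure M K = ennreal (measure M K)" by (simp add: emeasure_eq_ennreal_measure less_top)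
    have "2 * beta * measure M K \<le> beta * measure M K"
      using 2 beta_ge(3) unfolding e by (simp flip: ennreal_mult)
    then have "measure M K \<le> 0" using beta_ge(3) by (simp add: mult_le_0_iff)
    then show "emeasure M K \<le> 0" unfolding e by (simp add: ennreal_neg)
  qed
  moreover have "emeasure M E \<le> emeasure M ((E - B) \<union> B)"
    using E B(2) by (intro emeasure_mono) (auto simp: sets_M)
  moreover have "emeasure M ((E - B) \<union> B) \<le> emeasure M (E - B) + emeasure M B"
    using E B(2) by (intro emeasure_subadditive) (auto simp: sets_M)
  ultimately show ?thesis using B(1) by simp
qed

text \<open>Any admissible radius above half the supremum of the admissible ones will do; the
  supremum itself need not be admissible. The comparison of total masses bounds these radii, because
  the measure of large balls exceeds the whole mass of \<open>\<nu>\<close>.\<close>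

lemma stopping_radius:
  assumes sets: "sets \<nu> = sets borel" and fin: "finite_measure \<nu>"
    and big: "emeasure \<nu> UNIV < emeasure M UNIV"
    and s: "s > 0" "measure M (ball x (4 * s)) < measure \<nu> (ball x s)"
  obtains r where "r > 0" "measure M (ball x (4 * r)) < measure \<nu> (ball x r)"
    "\<And>s. 2 * r \<le> s \<Longrightarrow> measure \<nu> (ball x s) \<le> measure M (ball x (4 * s))"
proof -
  interpret \<nu>: finite_measure \<nu> by (rule fin)
  define P where "P = {r. r > 0 \<and> measure M (ball x (4 * r)) < measure \<nu> (ball x r)}"
  have "(SUP n. emeasure M (ball x (real n))) = emeasure M (\<Union>n. ball x (real n))"
    by (intro SUP_emeasure_incseq) (auto simp: sets_M incseq_def)
  also have "(\<Union>n. ball x (real n)) = UNIV"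
    using reals_Archimedean2[of "dist x _"] by auto
  finally have "emeasure \<nu> UNIV < (SUP n. emeasure M (ball x (real n)))"
    using big by simp
  then obtain n where n: "emeasure \<nu> UNIV < emeasure M (ball x (real n))"
    unfolding less_SUP_iff by blast
  have "r \<le> real n" if "r \<in> P" for r
  proof (rule ccontr)
    assume "\<not> r \<le> real n"
    then have "emeasure M (ball x (real n)) \<le> emeasure M (ball x (4 * r))"
      by (intro emeasure_mono subset_ball) (auto simp: sets_M)
    also have "\<dots> < emeasure \<nu> (ball x r)"
      using that by (auto simp: P_def emeasure_ball \<nu>.emeasure_eq_measure ennreal_less_iff)
    also have "\<dots> \<le> emeasure \<nu> UNIV" by (intro emeasure_mono) (auto simp: sets)
    finally show False using n by simp
  qed
  then have bdd: "bdd_above P" by (auto simp: bdd_above_def)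
  have ne: "s \<in> P" using s by (simp add: P_def)
  then have "s \<le> Sup P" using bdd by (intro cSup_upper)
  then have "Sup P / 2 < Sup P" using s(1) by simp
  then obtain r where r: "r \<in> P" "Sup P / 2 < r" using less_cSup_iff[OF _ bdd] ne by blast
  show thesis
  proof
    show "r > 0" "measure M (ball x (4 * r)) < measure \<nu> (ball x r)" using r by (auto simp: P_def)
    fix s assume "2 * r \<le> s"
    then have "s \<notin> P" using r cSup_upper[OF _ bdd, of s] by auto
    then show "measure \<nu> (ball x s) \<le> measure M (ball x (4 * s))"
      using \<open>r > 0\<close> \<open>2 * r \<le> s\<close> by (simp add: P_def)
  qed
qed

text \<open>\<open>\<rho>\<close> is the first doubling radius \<open>16\<^sup>k * r\<close> with \<open>k \<ge> 1\<close>. At the earlier radii the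
  measure grows faster than \<open>lam\<close> can, so the integral of \<open>1 / lam\<close> over the intermediate annuli
  is a geometric series. \<open>J\<close> majorises the integrand because \<open>lam\<close> need not be measurable in
  its first argument.\<close>

lemma doubling_parent:
  assumes "r > 0" and pos: "measure M (ball x r) > 0"
  obtains \<rho> J where "16 * r \<le> \<rho>" "doubling_ball x \<rho>" "measure M (ball x \<rho>) > 0"
    "J \<in> borel_measurable M" "(\<integral>\<^sup>+y. J y \<partial>M) \<le> ennreal (3 * Cl ^ 5)"
    "\<And>y. 2 * r \<le> dist y x \<Longrightarrow> dist y x < 2 * \<rho> \<Longrightarrow> ennreal (1 / lam y (dist y x)) \<le> J y"
proof -
  define k where "k = (LEAST k. k \<ge> 1 \<and> doubling_ball x (16 ^ k * r))"
  have k: "k \<ge> 1" "doubling_ball x (16 ^ k * r)"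
    using LeastI_ex[OF exists_doubling[OF \<open>r > 0\<close>, of x]] by (auto simp: k_def)
  have nd: "\<not> doubling_ball x (16 ^ l * r)" if "1 \<le> l" "l < k" for l
    using not_less_Least[of l "\<lambda>k. k \<ge> 1 \<and> doubling_ball x (16 ^ k * r)"] that by (auto simp: k_def)
  define B where "B = (\<lambda>l::nat. ball x (16 ^ l * r))"
  define \<rho> where "\<rho> = 16 ^ k * r"
  have "(16::real) ^ 1 \<le> 16 ^ k" using k(1) by (intro power_increasing) auto
  then have \<rho>: "16 * r \<le> \<rho>" using \<open>r > 0\<close> by (simp add: \<rho>_def)
  have Bm [measurable]: "B l \<in> sets M" for l by (simp add: B_def sets_M)
  have Bk: "measure M (B k) > 0"
  proof -
    have "measure M (ball x r) \<le> measure M (ball x \<rho>)"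
      using \<rho> \<open>r > 0\<close> by (intro measure_ball_mono subset_ball) simp
    then show ?thesis using pos by (simp add: B_def \<rho>_def)
  qed
  have B2: "measure M (ball x (2 * \<rho>)) > 0"
  proof -
    have "measure M (ball x \<rho>) \<le> measure M (ball x (2 * \<rho>))"
      using \<rho> \<open>r > 0\<close> by (intro measure_ball_mono subset_ball) simp
    then show ?thesis using Bk by (simp add: B_def \<rho>_def)
  qed
  \<comment> \<open>\<open>c l\<close> majorises \<open>1 / lam y\<close> on the annulus from
    \<open>16 ^ l * r\<close> to \<open>16 ^ Suc l * r\<close>: reaching radius
    \<open>16 ^ k * r\<close> takes \<open>4 * (k - l)\<close> doublings, and moving the centre from
    \<open>x\<close> to \<open>y\<close> costs one more factor \<open>Cl\<close>. The number
    \<open>d\<close> plays this role on the last annulus, from \<open>\<rho>\<close> to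
    \<open>2 * \<rho>\<close>.\<close>
  define c where "c = (\<lambda>l. Cl ^ (4 * (k - l) + 1) / measure M (B k))"
  define d where "d = Cl\<^sup>2 / measure M (ball x (2 * \<rho>))"
  have c0: "c l \<ge> 0" for l using Cl_ge_1 by (simp add: c_def)
  define J where "J = (\<lambda>y. (\<Sum>l<k. ennreal (c l) * indicator (B (Suc l)) y) + ennreal d * indicator (ball x (2 * \<rho>)) y)"
  have [measurable]: "ball x (2 * \<rho>) \<in> sets M" by (simp add: sets_M)
  have Jm: "J \<in> borel_measurable M" unfolding J_def by measurable
  \<comment> \<open>Between \<open>16 ^ Suc l * r\<close> and \<open>16 ^ k * r\<close> every step
    is non-doubling and gains \<open>beta \<ge> 2 * Cl ^ 4\<close>. This absorbs the powers of
    \<open>Cl\<close> in \<open>c l\<close> except for \<open>Cl ^ 5\<close>, and the powers of 2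
    remain as decay.\<close>
  have le_geom: "c l * measure M (B (Suc l)) \<le> Cl ^ 5 * (1 / 2) ^ (k - Suc l)" if "l < k" for l
  proof -
    define m where "m = k - Suc l"
    have m: "k = Suc l + m" "k - l = Suc m" using that by (auto simp: m_def)
    have "beta ^ m * measure M (ball x (16 ^ Suc l * r)) \<le> measure M (ball x (16 ^ (Suc l + m) * r))"
      by (rule non_doubling_iterate) (use nd m in auto)
    then have b: "beta ^ m * measure M (B (Suc l)) \<le> measure M (B k)"
      unfolding B_def m(1) .
    have "(2 * Cl ^ 4) ^ m * measure M (B (Suc l)) \<le> beta ^ m * measure M (B (Suc l))"
      using beta_ge(1) Cl_ge_1 by (intro mult_right_mono power_mono) auto
    also note b
    finally have "2 ^ m * ((Cl ^ 4) ^ m * measure M (B (Suc l))) \<le> measure M (B k)"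
      by (simp add: power_mult_distrib mult_ac)
    then have "(Cl ^ 4) ^ m * measure M (B (Suc l)) / measure M (B k) \<le> (1 / 2) ^ m"
      using Bk by (simp add: field_simps power_divide)
    then have "Cl ^ 5 * ((Cl ^ 4) ^ m * measure M (B (Suc l)) / measure M (B k)) \<le> Cl ^ 5 * (1 / 2) ^ m"
      using Cl_ge_1 by (intro mult_left_mono) auto
    moreover have "Cl ^ (4 * (k - l) + 1) = Cl ^ 5 * (Cl ^ 4) ^ m"
    proof -
      have "4 * (k - l) + 1 = 5 + 4 * m" using m(2) by simp
      then show ?thesis by (simp only: power_add power_mult)
    qed
    ultimately show ?thesis by (simp add: c_def m_def)
  qed
  have i1: "(\<integral>\<^sup>+y. J y \<partial>M) = (\<integral>\<^sup>+y. (\<Sum>l<k. ennreal (c l) * indicator (B (Suc l)) y) \<partial>M)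
      + (\<integral>\<^sup>+y. ennreal d * indicator (ball x (2 * \<rho>)) y \<partial>M)"
    unfolding J_def by (rule nn_integral_add) measurable
  have "(\<integral>\<^sup>+y. (\<Sum>l<k. ennreal (c l) * indicator (B (Suc l)) y) \<partial>M)
      = (\<Sum>l<k. (\<integral>\<^sup>+y. ennreal (c l) * indicator (B (Suc l)) y \<partial>M))"
    by (rule nn_integral_sum) measurable
  also have "\<dots> = (\<Sum>l<k. ennreal (c l) * emeasure M (B (Suc l)))"
    by (intro sum.cong refl nn_integral_cmult_indicator) measurable
  finally have i2: "(\<integral>\<^sup>+y. (\<Sum>l<k. ennreal (c l) * indicator (B (Suc l)) y) \<partial>M)
      = (\<Sum>l<k. ennreal (c l) * emeasure M (B (Suc l)))" .
  have i3: "(\<integral>\<^sup>+y. ennreal d * indicator (ball x (2 * \<rho>)) y \<partial>M) = ennreal d * emeasure M (ball x (2 * \<rho>))"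
    by (rule nn_integral_cmult_indicator) measurable
  have "(\<integral>\<^sup>+y. J y \<partial>M) = (\<Sum>l<k. ennreal (c l) * emeasure M (B (Suc l))) + ennreal d * emeasure M (ball x (2 * \<rho>))"
    by (simp only: i1 i2 i3)
  also have "\<dots> = ennreal ((\<Sum>l<k. c l * measure M (B (Suc l))) + d * measure M (ball x (2 * \<rho>)))"
  proof -
    have "ennreal (c l) * emeasure M (B (Suc l)) = ennreal (c l * measure M (B (Suc l)))" for l
      using c0 by (simp add: B_def emeasure_ball ennreal_mult del: power_Suc)
    then have 1: "(\<Sum>l<k. ennreal (c l) * emeasure M (B (Suc l))) = ennreal (\<Sum>l<k. c l * measure M (B (Suc l)))"
      using c0 by (simp add: sum_ennreal)
    have 2: "ennreal d * emeasure M (ball x (2 * \<rho>)) = ennreal (d * measure M (ball x (2 * \<rho>)))"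
      unfolding emeasure_ball d_def by (intro ennreal_mult[symmetric]) auto
    have 3: "0 \<le> (\<Sum>l<k. c l * measure M (B (Suc l)))" using c0 by (simp add: sum_nonneg)
    have 4: "0 \<le> d * measure M (ball x (2 * \<rho>))" by (simp add: d_def)
    show ?thesis unfolding 1 2 by (rule ennreal_plus[symmetric, OF 3 4])
  qed
  also have "\<dots> \<le> ennreal (3 * Cl ^ 5)"
  proof (rule ennreal_leI)
    have "(\<Sum>l<k. c l * measure M (B (Suc l))) \<le> (\<Sum>l<k. Cl ^ 5 * (1 / 2) ^ (k - Suc l))"
      by (intro sum_mono le_geom) auto
    also have "\<dots> = (\<Sum>l<k. Cl ^ 5 * (1 / 2) ^ l)"
      by (rule sum.nat_diff_reindex)
    also have "\<dots> = Cl ^ 5 * (\<Sum>l<k. (1 / 2) ^ l)" by (simp add: sum_distrib_left)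
    also have "\<dots> \<le> Cl ^ 5 * 2"
      using Cl_ge_1 by (intro mult_left_mono) (auto simp: geometric_sum)
    finally have "(\<Sum>l<k. c l * measure M (B (Suc l))) \<le> Cl ^ 5 * 2" .
    moreover have "d * measure M (ball x (2 * \<rho>)) = Cl\<^sup>2" using B2 by (simp add: d_def)
    moreover have "Cl\<^sup>2 \<le> Cl ^ 5" using Cl_ge_1 by (intro power_increasing) auto
    ultimately show "(\<Sum>l<k. c l * measure M (B (Suc l))) + d * measure M (ball x (2 * \<rho>)) \<le> 3 * Cl ^ 5"
      by simp
  qed
  finally have int: "(\<integral>\<^sup>+y. J y \<partial>M) \<le> ennreal (3 * Cl ^ 5)" .
  have "ennreal (1 / lam y (dist y x)) \<le> J y" if y: "2 * r \<le> dist y x" "dist y x < 2 * \<rho>" for y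
  proof (cases "\<rho> \<le> dist y x")
    case True
    have "1 / lam y (dist y x) \<le> d"
      unfolding d_def using B2 True y(2) \<rho> \<open>r > 0\<close> by (intro inverse_lam_le) auto
    then have "ennreal (1 / lam y (dist y x)) \<le> ennreal d * indicator (ball x (2 * \<rho>)) y"
      using y(2) by (simp add: dist_commute ennreal_leI)
    then show ?thesis unfolding J_def by (simp add: add_increasing)
  next
    case False
    \<comment> \<open>The least such index is the number of the annulus containing \<open>y\<close>.
      Its lower bound comes from minimality, except for index 0, where
      \<open>2 * r \<le> dist y x\<close> is used.\<close>
    define P where "P = (\<lambda>l::nat. dist y x < 16 ^ Suc l * r)"
    have "P (k - 1)" using False k(1) by (simp add: P_def \<rho>_def power_eq_if)
    define l where "l = (LEAST l. P l)"
    have l: "P l" "l \<le> k - 1" "\<And>j. j < l \<Longrightarrow> \<not> P j"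
      unfolding l_def by (rule LeastI[of P, OF \<open>P (k - 1)\<close>], rule Least_le[of P, OF \<open>P (k - 1)\<close>], rule not_less_Least)
    have "l < k" using l(2) k(1) by simp
    have lo: "16 ^ l * r \<le> dist y x"
    proof (cases l)
      case 0 then show ?thesis using y \<open>r > 0\<close> by simp
    next
      case (Suc j) then show ?thesis using l(3)[of j] by (simp add: P_def)
    qed
    have "measure M (B k) \<le> Cl * lam y (16 ^ k * r)"
      unfolding B_def using False \<open>r > 0\<close> by (intro measure_ball_shift) (auto simp: \<rho>_def)
    also have "16 ^ k * r = 2 ^ (4 * (k - l)) * (16 ^ l * r)"
    proof -
      have "(2::real) ^ (4 * (k - l)) = 16 ^ (k - l)" unfolding power_mult by simp
      then show ?thesis using \<open>l < k\<close> by (simp flip: power_add)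
    qed
    also have "Cl * lam y (2 ^ (4 * (k - l)) * (16 ^ l * r)) \<le> Cl * (Cl ^ (4 * (k - l)) * lam y (16 ^ l * r))"
      using \<open>r > 0\<close> Cl_ge_1 by (intro mult_left_mono lam_double) auto
    also have "\<dots> \<le> Cl * (Cl ^ (4 * (k - l)) * lam y (dist y x))"
      using \<open>r > 0\<close> Cl_ge_1 lo by (intro mult_left_mono lam_mono) auto
    finally have "measure M (B k) \<le> Cl ^ (4 * (k - l) + 1) * lam y (dist y x)" by (simp add: mult.assoc)
    moreover have "lam y (dist y x) > 0" using y \<open>r > 0\<close> by (intro lam_pos) linarith
    ultimately have "1 / lam y (dist y x) \<le> c l"
      using Bk by (simp add: c_def field_simps)
    then have "ennreal (1 / lam y (dist y x)) \<le> ennreal (c l) * indicator (B (Suc l)) y"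
      using l(1) by (simp add: P_def B_def dist_commute ennreal_leI)
    also have "\<dots> \<le> (\<Sum>l<k. ennreal (c l) * indicator (B (Suc l)) y)"
      using \<open>l < k\<close> by (intro member_le_sum) auto
    finally show ?thesis unfolding J_def by (simp add: add_increasing2)
  qed
  then show thesis using that[of \<rho> J] \<rho> k(2) Bk Jm int by (simp add: \<rho>_def B_def)
qed

text \<open>The balls are treated in order of increasing radius. By then the sum of the earlier
  functions has a small average over the next ball, so it is small on a large part of that ball, and
  \<open>A i\<close> is chosen inside this part.\<close>

lemma allocate_sets:
  fixes x :: "nat \<Rightarrow> 'a"
  assumes sets: "sets \<nu> = sets borel" and fin: "finite_measure \<nu>"
    and "\<And>i. i \<in> {1..n} \<Longrightarrow> \<rho> i > 0 \<and> measure M (ball (x i) (\<rho> i)) > 0 \<and> doubling_ball (x i) (\<rho> i) \<and>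
      measure \<nu> (ball (x i) (3 * \<rho> i)) \<le> measure M (ball (x i) (12 * \<rho> i))"
    and "\<And>i j. i \<in> {1..n} \<Longrightarrow> j \<in> {1..n} \<Longrightarrow> i \<le> j \<Longrightarrow> \<rho> i \<le> \<rho> j"
    and "\<And>i. i \<in> {1..n} \<Longrightarrow> V i \<in> sets borel \<and> V i \<subseteq> ball (x i) (\<rho> i)"
    and "disjoint_family_on V {1..n}"
  shows "\<exists>A. (\<forall>i\<in>{1..n}. compact (A i) \<and> A i \<subseteq> ball (x i) (\<rho> i) \<and>
        measure M (ball (x i) (\<rho> i)) \<le> 4 * measure M (A i)) \<and>
      (\<forall>y. (\<Sum>i\<in>{1..n}. measure \<nu> (V i) / measure M (A i) * indicator (A i) y) \<le> 6 * beta)"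
  using assms(3-)
proof (induction n)
  case 0
  show ?case using beta_ge(3) by auto
next
  case (Suc n)
  interpret \<nu>: finite_measure \<nu> by (rule fin)
  have "\<exists>A. (\<forall>i\<in>{1..n}. compact (A i) \<and> A i \<subseteq> ball (x i) (\<rho> i) \<and>
        measure M (ball (x i) (\<rho> i)) \<le> 4 * measure M (A i)) \<and>
      (\<forall>y. (\<Sum>i\<in>{1..n}. measure \<nu> (V i) / measure M (A i) * indicator (A i) y) \<le> 6 * beta)"
  proof (rule Suc.IH)
    show "disjoint_family_on V {1..n}"
      by (rule disjoint_family_on_mono[OF _ Suc.prems(4)]) auto
  qed (use Suc.prems(1-3) in auto)
  then obtain A where A: "\<And>i. i \<in> {1..n} \<Longrightarrow> compact (A i)" "\<And>i. i \<in> {1..n} \<Longrightarrow> A i \<subseteq> ball (x i) (\<rho> i)"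
      "\<And>i. i \<in> {1..n} \<Longrightarrow> measure M (ball (x i) (\<rho> i)) \<le> 4 * measure M (A i)"
    and \<psi>_le: "\<And>y. (\<Sum>i\<in>{1..n}. measure \<nu> (V i) / measure M (A i) * indicator (A i) y) \<le> 6 * beta"
    by blast
  have Apos: "measure M (A i) > 0" if "i \<in> {1..n}" for i
    using A(3)[OF that] Suc.prems(1)[of i] that by fastforce
  have Am [measurable]: "A i \<in> sets M" if "i \<in> {1..n}" for i
    using A(1)[OF that] by (simp add: sets_M borel_compact)
  define c where "c = (\<lambda>i. measure \<nu> (V i) / measure M (A i))"
  have c0: "c i \<ge> 0" for i by (simp add: c_def)
  define \<psi> where "\<psi> = (\<lambda>y. \<Sum>i\<in>{1..n}. c i * indicator (A i) y)"
  have \<psi>0: "\<psi> y \<ge> 0" for y unfolding \<psi>_def using c0 by (intro sum_nonneg) auto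
  have [measurable]: "\<psi> \<in> borel_measurable M" unfolding \<psi>_def by measurable
  define z where "z = x (Suc n)"
  define s where "s = \<rho> (Suc n)"
  define R where "R = ball z s"
  have s: "s > 0" "measure M R > 0" "doubling_ball z s"
      "measure \<nu> (ball z (3 * s)) \<le> measure M (ball z (12 * s))"
    using Suc.prems(1)[of "Suc n"] by (auto simp: z_def s_def R_def)
  have Rm [measurable]: "R \<in> sets M" by (simp add: R_def sets_M)
  have "(\<integral>\<^sup>+y. ennreal (\<psi> y) * indicator R y \<partial>M) = (\<integral>\<^sup>+y. (\<Sum>i\<in>{1..n}. ennreal (c i) * indicator (A i \<inter> R) y) \<partial>M)"
  proof (intro nn_integral_cong)
    fix y
    have "ennreal (\<psi> y) = (\<Sum>i\<in>{1..n}. ennreal (c i * indicator (A i) y))"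
      unfolding \<psi>_def using c0 by (subst sum_ennreal) auto
    also have "\<dots> = (\<Sum>i\<in>{1..n}. ennreal (c i) * indicator (A i) y)"
      by (intro sum.cong) (auto simp: indicator_def)
    finally show "ennreal (\<psi> y) * indicator R y = (\<Sum>i\<in>{1..n}. ennreal (c i) * indicator (A i \<inter> R) y)"
      by (simp only: sum_distrib_right indicator_inter_arith mult.assoc)
  qed
  also have "\<dots> = (\<Sum>i\<in>{1..n}. ennreal (c i) * emeasure M (A i \<inter> R))"
    by (subst nn_integral_sum) (auto simp: nn_integral_cmult_indicator)
  also have "\<dots> \<le> (\<Sum>i\<in>{i\<in>{1..n}. A i \<inter> R \<noteq> {}}. emeasure \<nu> (V i))"
  proof -
    have "ennreal (c i) * emeasure M (A i \<inter> R) \<le> (if A i \<inter> R \<noteq> {} then emeasure \<nu> (V i) else 0)"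
      if i: "i \<in> {1..n}" for i
    proof (cases "A i \<inter> R = {}")
      case False
      have f: "emeasure M (A i) < top"
        using le_less_trans[OF emeasure_mono[OF A(2)[OF i], of M]] by (simp add: sets_M)
      then have e: "emeasure M (A i) = ennreal (measure M (A i))"
        by (simp add: emeasure_eq_ennreal_measure less_top)
      have "ennreal (c i) * emeasure M (A i \<inter> R) \<le> ennreal (c i) * emeasure M (A i)"
        using i by (intro mult_left_mono emeasure_mono) auto
      also have "\<dots> = emeasure \<nu> (V i)"
        unfolding e using Apos[OF i] by (simp add: c_def \<nu>.emeasure_eq_measure flip: ennreal_mult)
      finally show ?thesis using False by simp
    qed simp
    then have "(\<Sum>i\<in>{1..n}. ennreal (c i) * emeasure M (A i \<inter> R))
        \<le> (\<Sum>i\<in>{1..n}. if A i \<inter> R \<noteq> {} then emeasure \<nu> (V i) else 0)"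
      by (rule sum_mono)
    also have "\<dots> = (\<Sum>i\<in>{i\<in>{1..n}. A i \<inter> R \<noteq> {}}. emeasure \<nu> (V i))"
      by (rule sum.inter_filter[symmetric]) simp
    finally show ?thesis .
  qed
  also have "\<dots> = emeasure \<nu> (\<Union>i\<in>{i\<in>{1..n}. A i \<inter> R \<noteq> {}}. V i)"
  proof (intro sum_emeasure)
    show "disjoint_family_on V {i \<in> {1..n}. A i \<inter> R \<noteq> {}}"
      by (rule disjoint_family_on_mono[OF _ Suc.prems(4)]) auto
  qed (use Suc.prems(3) in \<open>auto simp: sets\<close>)
  also have "\<dots> \<le> emeasure \<nu> (ball z (3 * s))"
  proof (rule emeasure_mono)
    show "(\<Union>i\<in>{i\<in>{1..n}. A i \<inter> R \<noteq> {}}. V i) \<subseteq> ball z (3 * s)"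
    proof
      \<comment> \<open>This is where the ordering by radius enters. An earlier \<open>A i\<close>
        that meets \<open>R\<close> lies in a ball of radius at most \<open>s\<close>, and so does
        \<open>V i\<close>; hence \<open>V i\<close> is within \<open>3 * s\<close> of
        \<open>z\<close>. The average over that ball is controlled by hypothesis, and
        \<open>12 * s\<close> is below the doubling radius \<open>16 * s\<close>.\<close>
      fix y assume "y \<in> (\<Union>i\<in>{i\<in>{1..n}. A i \<inter> R \<noteq> {}}. V i)"
      then obtain i u where i: "i \<in> {1..n}" "u \<in> A i" "u \<in> R" "y \<in> V i" by blast
      have "dist (x i) u < \<rho> i" using A(2)[OF i(1)] i(2) by auto
      moreover have "dist (x i) y < \<rho> i" using Suc.prems(3)[of i] i by auto
      moreover have "\<rho> i \<le> s" using Suc.prems(2)[of i "Suc n"] i(1) by (simp add: s_def)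
      moreover have "dist z u < s" using i(3) by (simp add: R_def)
      moreover have "dist z y \<le> dist z u + dist u y" by (rule dist_triangle)
      moreover have "dist u y \<le> dist (x i) u + dist (x i) y" by (metis dist_commute dist_triangle)
      ultimately show "y \<in> ball z (3 * s)" by simp
    qed
  qed (simp add: sets)
  also have "\<dots> \<le> ennreal (beta * measure M R)"
  proof -
    have "measure M (ball z (12 * s)) \<le> measure M (ball z (16 * s))"
      using s(1) by (intro measure_ball_mono subset_ball) simp
    then show ?thesis using s by (simp add: \<nu>.emeasure_eq_measure doubling_ball_def R_def ennreal_leI)
  qed
  finally have int: "(\<integral>\<^sup>+y. ennreal (\<psi> y) * indicator R y \<partial>M) \<le> ennreal (beta * measure M R)" .
  have "emeasure M {y\<in>R. 1 \<le> ennreal (1 / (2 * beta)) * ennreal (\<psi> y)}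
      \<le> ennreal (1 / (2 * beta)) * (\<integral>\<^sup>+y. ennreal (\<psi> y) * indicator R y \<partial>M)"
    by (intro nn_integral_Markov_inequality) auto
  also have "\<dots> \<le> ennreal (1 / (2 * beta)) * ennreal (beta * measure M R)"
    using int by (rule mult_left_mono) simp
  also have "\<dots> = ennreal (measure M R / 2)"
    using beta_ge(3) by (simp flip: ennreal_mult)
  also have "{y\<in>R. 1 \<le> ennreal (1 / (2 * beta)) * ennreal (\<psi> y)} = {y\<in>R. 2 * beta \<le> \<psi> y}"
    using beta_ge(3) \<psi>0 by (simp add: field_simps flip: ennreal_mult ennreal_1)
  finally have mk: "emeasure M {y\<in>R. 2 * beta \<le> \<psi> y} \<le> ennreal (measure M R / 2)" .
  have Rf: "R \<in> fmeasurable M" by (simp add: R_def)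
  \<comment> \<open>By Markov's inequality at level \<open>2 * beta\<close> at least half of
    \<open>R\<close> remains. A compact subset loses at most another quarter of \<open>R\<close>,
    which explains the factor 4.\<close>
  define A0 where "A0 = R - {y\<in>R. 2 * beta \<le> \<psi> y}"
  have P0: "{y\<in>R. 2 * beta \<le> \<psi> y} \<in> sets M"
  proof -
    have "{y\<in>space M. y \<in> R \<and> 2 * beta \<le> \<psi> y} \<in> sets M" by measurable
    then show ?thesis by simp
  qed
  then have A0m: "A0 \<in> sets M" by (simp add: A0_def)
  have "measure M R / 2 \<le> measure M A0"
  proof -
    have "measure M {y\<in>R. 2 * beta \<le> \<psi> y} \<le> measure M R / 2"
      unfolding measure_def[of M "{y\<in>R. 2 * beta \<le> \<psi> y}"] by (rule enn2real_leI[OF _ mk]) simp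
    moreover have "measure M A0 = measure M R - measure M {y\<in>R. 2 * beta \<le> \<psi> y}"
      unfolding A0_def using Rf P0 by (intro measure_Diff) (auto simp: fmeasurable_def)
    ultimately show ?thesis by simp
  qed
  moreover obtain S where S: "compact S" "S \<subseteq> A0" "measure M A0 \<le> measure M S + measure M R / 4"
  proof (rule inner_finite[of A0 "measure M R / 4"])
    show "A0 \<in> sets borel" using A0m by (simp add: sets_M)
    have "emeasure M A0 \<le> emeasure M R" unfolding A0_def by (intro emeasure_mono) auto
    then show "emeasure M A0 < \<infinity>" using emeasure_ball_finite[of z s] by (auto simp: R_def intro: le_less_trans)
  qed (use s in auto)
  ultimately have S4: "measure M R \<le> 4 * measure M S" by simp
  then have Spos: "measure M S > 0" using s(2) by simp
  have VR: "measure \<nu> (V (Suc n)) \<le> beta * measure M R"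
  proof -
    have "V (Suc n) \<subseteq> ball z s" using Suc.prems(3)[of "Suc n"] by (simp add: z_def s_def)
    also have "\<dots> \<subseteq> ball z (3 * s)" using s(1) by (intro subset_ball) simp
    finally have "measure \<nu> (V (Suc n)) \<le> measure \<nu> (ball z (3 * s))"
      by (intro \<nu>.finite_measure_mono) (auto simp: sets)
    also note s(4)
    also have "measure M (ball z (12 * s)) \<le> measure M (ball z (16 * s))"
      using s(1) by (intro measure_ball_mono subset_ball) simp
    also have "\<dots> \<le> beta * measure M R" using s(3) by (simp add: doubling_ball_def R_def)
    finally show ?thesis .
  qed
  have new: "measure \<nu> (V (Suc n)) / measure M S \<le> 4 * beta"
  proof -
    have "measure \<nu> (V (Suc n)) \<le> beta * (4 * measure M S)"
      using VR S4 beta_ge(3) by (meson mult_left_mono order_trans zero_le_numeral)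
    then show ?thesis using Spos by (simp add: field_simps)
  qed
  show ?case
  proof (intro exI[of _ "A(Suc n := S)"] conjI ballI allI)
    fix i assume i: "i \<in> {1..Suc n}"
    then have i': "i = Suc n \<or> i \<in> {1..n}" by auto
    show "compact ((A(Suc n := S)) i)" using A(1) S(1) i' by auto
    show "(A(Suc n := S)) i \<subseteq> ball (x i) (\<rho> i)"
      using A(2) S(2) i' by (auto simp: A0_def R_def z_def s_def)
    show "measure M (ball (x i) (\<rho> i)) \<le> 4 * measure M ((A(Suc n := S)) i)"
      using A(3) S4 i' by (auto simp: R_def z_def s_def)
  next
    fix y
    have "(\<Sum>i\<in>{1..Suc n}. measure \<nu> (V i) / measure M ((A(Suc n := S)) i) * indicator ((A(Suc n := S)) i) y)
        = \<psi> y + measure \<nu> (V (Suc n)) / measure M S * indicator S y"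
      by (simp add: \<psi>_def c_def)
    \<comment> \<open>On \<open>S\<close> the earlier sum is below \<open>2 * beta\<close> and the
      new term is at most \<open>4 * beta\<close>; off \<open>S\<close> the earlier bound
      persists.\<close>
    also have "\<dots> \<le> 6 * beta"
    proof (cases "y \<in> S")
      case True
      then have "\<psi> y < 2 * beta" using S(2) by (auto simp: A0_def)
      then show ?thesis using new True by simp
    next
      case False
      then show ?thesis using \<psi>_le[of y] by (simp add: \<psi>_def c_def)
    qed
    finally show "(\<Sum>i\<in>{1..Suc n}. measure \<nu> (V i) / measure M ((A(Suc n := S)) i) * indicator ((A(Suc n := S)) i) y) \<le> 6 * beta" .
  qed
qed

text \<open>Data attached to a selected ball: \<open>r\<close> is the stopping radius and
  \<open>\<rho>\<close> its doubling dilate, \<open>V\<close> is the part of the ball assigned to it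
  in a disjoint splitting, \<open>A\<close> the set over which the integral on \<open>V\<close> will
  be spread, and \<open>J\<close> the measurable majorant of \<open>1 / lam\<close> between the two
  balls.\<close>

definition cz_ball :: "'a \<Rightarrow> real \<Rightarrow> real \<Rightarrow> 'a set \<Rightarrow> 'a set \<Rightarrow> ('a \<Rightarrow> ennreal) \<Rightarrow> bool" where
  "cz_ball x r \<rho> V A J \<longleftrightarrow> 0 < r \<and> 16 * r \<le> \<rho> \<and> V \<in> sets borel \<and> V \<subseteq> ball x r \<and>
    compact A \<and> A \<subseteq> ball x \<rho> \<and> 0 < measure M (ball x \<rho>) \<and>
    measure M (ball x \<rho>) \<le> 4 * measure M A \<and> doubling_ball x \<rho> \<and>
    J \<in> borel_measurable M \<and> (\<integral>\<^sup>+y. J y \<partial>M) \<le> ennreal (3 * Cl ^ 5) \<and>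
    (\<forall>y. 2 * r \<le> dist y x \<longrightarrow> dist y x < 2 * \<rho> \<longrightarrow> ennreal (1 / lam y (dist y x)) \<le> J y)"

text \<open>The family is finite so that bilinearity applies to the resulting decomposition. The
  price is the leftover set in the last conjunct, on which \<open>w\<close> is large without being
  covered; \<open>\<epsilon>\<close> is at the disposal of the caller.\<close>

lemma cz_cover:
  fixes w :: "'a \<Rightarrow> real" and \<epsilon> :: real
  defines "\<nu> \<equiv> density M (\<lambda>x. ennreal (w x))"
  assumes w: "w \<in> borel_measurable borel" and fin: "finite_measure \<nu>"
    and big: "emeasure \<nu> UNIV < emeasure M UNIV" and "\<epsilon> > 0"
  shows "\<exists>n (x :: nat \<Rightarrow> 'a) r \<rho> V A J.
    (\<forall>i\<in>{1..n}. cz_ball (x i) (r i) (\<rho> i) (V i) (A i) (J i)) \<and>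
    (\<forall>i\<in>{1..n}. \<forall>j\<in>{1..n}. i \<le> j \<longrightarrow> \<rho> i \<le> \<rho> j) \<and> disjoint_family_on V {1..n} \<and>
    (\<forall>y. (\<Sum>i\<in>{1..n}. measure \<nu> (V i) / measure M (A i) * indicator (A i) y) \<le> 6 * beta) \<and>
    emeasure M (\<Union>i\<in>{1..n}. ball (x i) (2 * r i)) \<le> emeasure \<nu> UNIV \<and>
    emeasure M {y. 2 * beta \<le> w y \<and> y \<notin> (\<Union>i\<in>{1..n}. V i)} \<le> ennreal \<epsilon>"
proof -
  interpret \<nu>: finite_measure \<nu> by (rule fin)
  have [measurable]: "w \<in> borel_measurable M" using w by measurable
  have sets: "sets \<nu> = sets borel" by (simp add: \<nu>_def sets_M)
  \<comment> \<open>The average over the ball, relative to the 4-fold ball, exceeds one, but from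
    twice the radius on it does not. Radius \<open>3 * \<rho>\<close>, as used in the allocation, is
    of the second kind because \<open>16 * r \<le> \<rho>\<close>.\<close>
  define Q where "Q = (\<lambda>x r. 0 < r \<and> measure M (ball x (4 * r)) < measure \<nu> (ball x r) \<and>
    (\<forall>s. 2 * r \<le> s \<longrightarrow> measure \<nu> (ball x s) \<le> measure M (ball x (4 * s))))"
  define X where "X = {x. \<exists>r. Q x r}"
  define rr where "rr = (\<lambda>x. SOME r. Q x r)"
  have rr: "Q x (rr x)" if "x \<in> X" for x
    using that unfolding X_def rr_def by (auto intro: someI)
  have notX: "measure \<nu> (ball x r) \<le> measure M (ball x (4 * r))" if "x \<notin> X" "r > 0" for x r
  proof (rule ccontr)
    assume "\<not> ?thesis"
    then have "measure M (ball x (4 * r)) < measure \<nu> (ball x r)" by simp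
    from stopping_radius[OF sets fin big \<open>r > 0\<close> this] obtain r' where "Q x r'"
      unfolding Q_def by blast
    then show False using that(1) by (auto simp: X_def)
  qed
  \<comment> \<open>\<open>\<nu>\<close> charges the ball and is absolutely continuous with respect
    to \<open>M\<close>, so \<open>M\<close> charges it as well.\<close>
  have ballpos: "0 < measure M (ball x (rr x))" if "x \<in> X" for x
  proof -
    have "emeasure \<nu> (ball x (rr x)) \<noteq> 0"
      using rr[OF that] measure_nonneg[of M "ball x (4 * rr x)"]
      by (auto simp: Q_def \<nu>.emeasure_eq_measure)
    moreover have "absolutely_continuous M \<nu>" unfolding \<nu>_def by (intro absolutely_continuousI_density) measurable
    ultimately have "ball x (rr x) \<notin> null_sets M"
      unfolding absolutely_continuous_def by (meson null_setsD1 subsetD)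
    then show ?thesis
      by (auto simp: null_sets_def sets_M emeasure_ball zero_less_measure_iff)
  qed
  define PQ where "PQ = (\<lambda>x \<rho> J. 16 * rr x \<le> \<rho> \<and> doubling_ball x \<rho> \<and> 0 < measure M (ball x \<rho>) \<and>
    J \<in> borel_measurable M \<and> (\<integral>\<^sup>+y. J y \<partial>M) \<le> ennreal (3 * Cl ^ 5) \<and>
    (\<forall>y. 2 * rr x \<le> dist y x \<longrightarrow> dist y x < 2 * \<rho> \<longrightarrow> ennreal (1 / lam y (dist y x)) \<le> J y))"
  have "\<exists>\<rho> J. PQ x \<rho> J" if "x \<in> X" for x
  proof -
    have "rr x > 0" using rr[OF that] by (simp add: Q_def)
    from doubling_parent[OF this ballpos[OF that]] show ?thesis unfolding PQ_def by metis
  qed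
  then obtain \<rho>\<rho> JJ where PQ: "\<And>x. x \<in> X \<Longrightarrow> PQ x (\<rho>\<rho> x) (JJ x)" by metis
  define \<Omega> where "\<Omega> = (\<Union>x\<in>X. ball x (rr x))"
  have "open \<Omega>" unfolding \<Omega>_def by auto
  then have [measurable]: "\<Omega> \<in> sets M" by (simp add: sets_M)
  define L where "L = {y. 2 * beta \<le> w y}"
  have Lm [measurable]: "L \<in> sets M"
  proof -
    have "{y\<in>space M. 2 * beta \<le> w y} \<in> sets M" by measurable
    then show ?thesis by (simp add: L_def)
  qed
  have Lfin: "emeasure M L < top"
  proof -
    have "emeasure M L \<le> (\<integral>\<^sup>+y. ennreal (w y) \<partial>M)"
    proof -
      have "emeasure M L = (\<integral>\<^sup>+y. indicator L y \<partial>M)" by simp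
      also have "\<dots> \<le> (\<integral>\<^sup>+y. ennreal (w y) \<partial>M)"
      proof (intro nn_integral_mono)
        fix y
        have "1 \<le> w y" if "y \<in> L" using that beta_ge(3) by (simp add: L_def)
        then have "ennreal 1 \<le> ennreal (w y)" if "y \<in> L" using that by (intro ennreal_leI)
        then show "indicator L y \<le> ennreal (w y)" by (auto simp: indicator_def)
      qed
      finally show ?thesis .
    qed
    also have "\<dots> = emeasure \<nu> UNIV" unfolding \<nu>_def by (subst emeasure_density) (auto simp: sets_M)
    also have "\<dots> < top" by (simp add: \<nu>.emeasure_eq_measure)
    finally show ?thesis .
  qed
  \<comment> \<open>A point outside \<open>\<Omega>\<close> is not in \<open>X\<close>, so its
    averages are small at all radii. Among the points where \<open>w\<close> is at least
    \<open>2 * beta\<close>, this can happen only on a null set.\<close>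
  have null: "emeasure M (L - \<Omega>) = 0"
  proof (rule small_average_null[OF w])
    show "finite_measure (density M (\<lambda>x. ennreal (w x)))" using fin unfolding \<nu>_def .
    show "L - \<Omega> \<in> sets borel" using sets.Diff[OF Lm \<open>\<Omega> \<in> sets M\<close>] by (simp add: sets_M)
    fix x r assume "x \<in> L - \<Omega>" "(r::real) > 0"
    have "x \<notin> X"
    proof
      assume "x \<in> X"
      then have "x \<in> \<Omega>" using rr[of x] by (force simp: \<Omega>_def Q_def)
      then show False using \<open>x \<in> L - \<Omega>\<close> by simp
    qed
    then show "measure (density M (\<lambda>x. ennreal (w x))) (ball x r) \<le> measure M (ball x (4 * r))"
      using notX[OF _ \<open>r > 0\<close>] by (simp add: \<nu>_def)
  qed (auto simp: L_def)
  obtain S where S: "compact S" "S \<subseteq> L \<inter> \<Omega>" "emeasure M (L \<inter> \<Omega> - S) \<le> ennreal \<epsilon>"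
  proof (rule inner_finite[of "L \<inter> \<Omega>" \<epsilon>])
    show "L \<inter> \<Omega> \<in> sets borel" using sets.Int[OF Lm \<open>\<Omega> \<in> sets M\<close>] by (simp add: sets_M)
    show "emeasure M (L \<inter> \<Omega>) < \<infinity>"
      using Lfin le_less_trans[OF emeasure_mono[of "L \<inter> \<Omega>" L M]] by simp
  qed (use \<open>\<epsilon> > 0\<close> in auto)
  have "S \<subseteq> (\<Union>x\<in>X. ball x (rr x))" using S(2) by (auto simp: \<Omega>_def)
  then obtain X' where X': "X' \<subseteq> X" "finite X'" "S \<subseteq> (\<Union>x\<in>X'. ball x (rr x))"
    using S(1) by (elim compactE_image) auto
  obtain xs0 where "set xs0 = X'" using finite_list[OF X'(2)] by blast
  define xs where "xs = sort_key \<rho>\<rho> xs0"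
  have xs: "set xs = X'" "sorted (map \<rho>\<rho> xs)" using \<open>set xs0 = X'\<close> by (simp_all add: xs_def)
  define n where "n = length xs"
  define x where "x = (\<lambda>i. xs ! (i - 1))"
  have x_in: "x i \<in> X'" if "i \<in> {1..n}" for i using that xs(1) by (auto simp: x_def n_def)
  have x_img: "x ` {1..n} = X'"
  proof
    show "X' \<subseteq> x ` {1..n}"
    proof
      fix u assume "u \<in> X'"
      then obtain j where "j < length xs" "u = xs ! j" using xs(1) by (auto simp: in_set_conv_nth)
      then show "u \<in> x ` {1..n}" by (intro image_eqI[of _ _ "Suc j"]) (auto simp: x_def n_def)
    qed
  qed (use x_in in blast)
  define r where "r = (\<lambda>i. rr (x i))"
  define \<rho> where "\<rho> = (\<lambda>i. \<rho>\<rho> (x i))"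
  define J where "J = (\<lambda>i. JJ (x i))"
  define V where "V = (\<lambda>i. ball (x i) (r i) - (\<Union>j\<in>{1..<i}. ball (x j) (r j)))"
  have mono: "\<rho> i \<le> \<rho> j" if "i \<in> {1..n}" "j \<in> {1..n}" "i \<le> j" for i j
  proof -
    have "map \<rho>\<rho> xs ! (i - 1) \<le> map \<rho>\<rho> xs ! (j - 1)"
      using that by (intro sorted_nth_mono[OF xs(2)]) (auto simp: n_def)
    then show ?thesis using that by (simp add: \<rho>_def x_def n_def)
  qed
  have Vm: "V i \<in> sets borel" for i unfolding V_def by (intro sets.Diff sets.finite_UN) auto
  have dj: "disjoint_family_on V {1..n}"
  proof -
    have "V i \<inter> V j = {}" if "i < j" "1 \<le> i" for i j using that by (auto simp: V_def)
    then show ?thesis unfolding disjoint_family_on_def by (metis Int_commute atLeastAtMost_iff nat_neq_iff)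
  qed
  have Vun: "(\<Union>i\<in>{1..n}. V i) = (\<Union>u\<in>X'. ball u (rr u))"
  proof -
    have "\<exists>i\<in>{1..n}. y \<in> V i" if "j \<in> {1..n}" "y \<in> ball (x j) (r j)" for y j
      using that
    proof (induction j rule: less_induct)
      case (less j)
      show ?case
      proof (cases "y \<in> V j")
        case False
        then obtain l where "l \<in> {1..<j}" "y \<in> ball (x l) (r l)" using less.prems by (auto simp: V_def)
        then show ?thesis using less.IH[of l] less.prems(1) by auto
      qed (use less.prems in blast)
    qed
    then have "(\<Union>i\<in>{1..n}. ball (x i) (r i)) \<subseteq> (\<Union>i\<in>{1..n}. V i)" by blast
    moreover have "(\<Union>i\<in>{1..n}. V i) \<subseteq> (\<Union>i\<in>{1..n}. ball (x i) (r i))" by (auto simp: V_def)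
    moreover have "(\<Union>i\<in>{1..n}. ball (x i) (r i)) = (\<Union>u\<in>X'. ball u (rr u))"
      unfolding x_img[symmetric] r_def by simp
    ultimately show ?thesis by simp
  qed
  have Qi: "Q (x i) (r i)" "PQ (x i) (\<rho> i) (J i)" "r i = rr (x i)" if "i \<in> {1..n}" for i
    using rr[of "x i"] PQ[of "x i"] x_in[OF that] X'(1) by (auto simp: r_def \<rho>_def J_def)
  have rpos: "r i > 0" "16 * r i \<le> \<rho> i" if "i \<in> {1..n}" for i
    using Qi[OF that] by (simp_all add: Q_def PQ_def)
  have "\<exists>A. (\<forall>i\<in>{1..n}. compact (A i) \<and> A i \<subseteq> ball (x i) (\<rho> i) \<and>
        measure M (ball (x i) (\<rho> i)) \<le> 4 * measure M (A i)) \<and>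
      (\<forall>y. (\<Sum>i\<in>{1..n}. measure \<nu> (V i) / measure M (A i) * indicator (A i) y) \<le> 6 * beta)"
  proof (rule allocate_sets[OF sets fin])
    fix i assume i: "i \<in> {1..n}"
    have "measure \<nu> (ball (x i) (3 * \<rho> i)) \<le> measure M (ball (x i) (4 * (3 * \<rho> i)))"
    proof -
      have "2 * r i \<le> 3 * \<rho> i" using rpos[OF i] by linarith
      then show ?thesis using Qi(1)[OF i] unfolding Q_def by blast
    qed
    then show "\<rho> i > 0 \<and> measure M (ball (x i) (\<rho> i)) > 0 \<and> doubling_ball (x i) (\<rho> i) \<and>
      measure \<nu> (ball (x i) (3 * \<rho> i)) \<le> measure M (ball (x i) (12 * \<rho> i))"
      using Qi(2)[OF i] rpos[OF i] by (simp add: PQ_def)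
    have "ball (x i) (r i) \<subseteq> ball (x i) (\<rho> i)" using rpos[OF i] by (intro subset_ball) simp
    then show "V i \<in> sets borel \<and> V i \<subseteq> ball (x i) (\<rho> i)" using Vm by (auto simp: V_def)
  qed (use mono dj in auto)
  then obtain A where A: "\<forall>i\<in>{1..n}. compact (A i) \<and> A i \<subseteq> ball (x i) (\<rho> i) \<and>
        measure M (ball (x i) (\<rho> i)) \<le> 4 * measure M (A i)"
      "\<forall>y. (\<Sum>i\<in>{1..n}. measure \<nu> (V i) / measure M (A i) * indicator (A i) y) \<le> 6 * beta" by blast
  have exc: "emeasure M (\<Union>i\<in>{1..n}. ball (x i) (2 * r i)) \<le> 1 * emeasure \<nu> UNIV"
  proof (rule vitali_measure_bound)
    fix i assume i: "i \<in> {1..n}"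
    show "emeasure M (ball (x i) ((2 + 2) * r i)) \<le> 1 * emeasure \<nu> (ball (x i) (r i))"
      using Qi(1)[OF i] by (simp add: Q_def emeasure_ball \<nu>.emeasure_eq_measure ennreal_leI)
  qed (use rpos sets sets_M in auto)
  have Sm [measurable]: "S \<in> sets M" using S(1) by (simp add: sets_M borel_compact)
  have "emeasure M {y. 2 * beta \<le> w y \<and> y \<notin> (\<Union>i\<in>{1..n}. V i)} \<le> emeasure M ((L - \<Omega>) \<union> (L \<inter> \<Omega> - S))"
    unfolding Vun using X'(3) Lm Sm by (intro emeasure_mono sets.Un sets.Diff sets.Int) (auto simp: L_def)
  also have "\<dots> \<le> emeasure M (L - \<Omega>) + emeasure M (L \<inter> \<Omega> - S)"
    by (intro emeasure_subadditive) measurable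
  also have "\<dots> \<le> ennreal \<epsilon>" using S(3) null by simp
  finally have small: "emeasure M {y. 2 * beta \<le> w y \<and> y \<notin> (\<Union>i\<in>{1..n}. V i)} \<le> ennreal \<epsilon>" .
  show ?thesis
  proof (intro exI conjI)
    show "\<forall>i\<in>{1..n}. cz_ball (x i) (r i) (\<rho> i) (V i) (A i) (J i)"
    proof
      fix i assume i: "i \<in> {1..n}"
      have "V i \<subseteq> ball (x i) (r i)" by (auto simp: V_def)
      then show "cz_ball (x i) (r i) (\<rho> i) (V i) (A i) (J i)"
        using rpos[OF i] Vm A(1) i Qi[OF i] unfolding PQ_def cz_ball_def by simp
    qed
    show "\<forall>i\<in>{1..n}. \<forall>j\<in>{1..n}. i \<le> j \<longrightarrow> \<rho> i \<le> \<rho> j" using mono by blast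
    show "emeasure M (\<Union>i\<in>{1..n}. ball (x i) (2 * r i)) \<le> emeasure \<nu> UNIV" using exc by simp
  qed (fact dj A(2) small)+
qed

end

section \<open>Operators and kernels\<close>

text \<open>Bounded measurable functions of compact support: the class on which the association of
  \<open>T\<close> with its kernel is tested. It lies in all \<open>Lp_space q M\<close> with
  \<open>q > 0\<close> and is closed under the cuts and sums of the decomposition.\<close>

definition bcs :: "'a::metric_space measure \<Rightarrow> ('a \<Rightarrow> 'b::{real_normed_field,banach,second_countable_topology}) set" where
  "bcs M = {f \<in> borel_measurable M. bounded (range f) \<and> compact (supp f)}"

lemma supp_subset: "{x. f x \<noteq> 0} \<subseteq> supp f"
  unfolding supp_def by (rule closure_subset)

lemma closed_supp: "closed (supp f)"
  by (simp add: supp_def)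

lemma supp_subset_closed: "closed S \<Longrightarrow> (\<And>x. f x \<noteq> 0 \<Longrightarrow> x \<in> S) \<Longrightarrow> supp f \<subseteq> S"
  unfolding supp_def by (rule closure_minimal) auto

lemma bcsI:
  assumes "f \<in> borel_measurable M" "\<And>x. norm (f x) \<le> B" "compact S" "\<And>x. f x \<noteq> 0 \<Longrightarrow> x \<in> S"
  shows "f \<in> bcs M"
proof -
  have "bounded (range f)" using assms(2) by (auto simp: bounded_iff)
  moreover have "supp f \<subseteq> S" using assms by (intro supp_subset_closed compact_imp_closed)
  then have "supp f = S \<inter> supp f" by blast
  then have "compact (supp f)" using compact_Int_closed[OF assms(3) closed_supp] by metis
  ultimately show ?thesis using assms(1) by (simp add: bcs_def)
qed

lemma bcsE:
  assumes "f \<in> bcs M"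
  obtains B S where "f \<in> borel_measurable M" "B > 0" "\<And>x. norm (f x) \<le> B" "compact S"
    "\<And>x. f x \<noteq> 0 \<Longrightarrow> x \<in> S"
proof -
  have "bounded (range f)" using assms by (simp add: bcs_def)
  then obtain B where "B > 0" "\<And>x. norm (f x) \<le> B" by (auto simp: bounded_pos)
  then show thesis
    using that[of B "supp f"] assms supp_subset[of f] by (auto simp: bcs_def)
qed

lemma bcs_measurable: "f \<in> bcs M \<Longrightarrow> f \<in> borel_measurable M"
  by (simp add: bcs_def)

lemma bcs_dominated:
  assumes "f \<in> bcs M" "g \<in> borel_measurable M" "\<And>x. norm (g x) \<le> c * norm (f x)"
  shows "g \<in> bcs M"
proof -
  obtain B S where B: "f \<in> borel_measurable M" "B > 0" "\<And>x. norm (f x) \<le> B" "compact S"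
    "\<And>x. f x \<noteq> 0 \<Longrightarrow> x \<in> S" by (rule bcsE[OF assms(1)]) blast
  show ?thesis
  proof (rule bcsI[OF assms(2) _ B(4)])
    fix x
    have "norm (g x) \<le> c * norm (f x)" by (rule assms)
    also have "\<dots> \<le> \<bar>c\<bar> * B" using B(3)[of x] by (intro mult_mono) auto
    finally show "norm (g x) \<le> \<bar>c\<bar> * B" .
    show "x \<in> S" if "g x \<noteq> 0" using that assms(3)[of x] B(5)[of x] by force
  qed
qed

lemma bcs_add:
  assumes "f \<in> bcs M" "g \<in> bcs M"
  shows "(\<lambda>x. f x + g x) \<in> bcs M"
proof -
  obtain B S where B: "f \<in> borel_measurable M" "B > 0" "\<And>x. norm (f x) \<le> B" "compact S"
    "\<And>x. f x \<noteq> 0 \<Longrightarrow> x \<in> S" by (rule bcsE[OF assms(1)]) blast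
  obtain B' S' where B': "g \<in> borel_measurable M" "B' > 0" "\<And>x. norm (g x) \<le> B'" "compact S'"
    "\<And>x. g x \<noteq> 0 \<Longrightarrow> x \<in> S'" by (rule bcsE[OF assms(2)]) blast
  show ?thesis
  proof (rule bcsI[OF _ _ compact_Un[OF B(4) B'(4)]])
    show "(\<lambda>x. f x + g x) \<in> borel_measurable M" using B(1) B'(1) by measurable
    show "norm (f x + g x) \<le> B + B'" for x using B(3)[of x] B'(3)[of x] norm_triangle_mono by blast
    show "x \<in> S \<union> S'" if "f x + g x \<noteq> 0" for x using that B(5)[of x] B'(5)[of x] by force
  qed
qed

lemma bcs_cmult: "f \<in> bcs M \<Longrightarrow> (\<lambda>x. c * f x) \<in> bcs M"
  by (rule bcs_dominated[where c = "norm c"]) (auto simp: norm_mult bcs_def)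

lemma bcs_uminus: "f \<in> bcs M \<Longrightarrow> (\<lambda>x. - f x) \<in> bcs M"
  using bcs_cmult[of f M "-1"] by simp

lemma bcs_diff: "f \<in> bcs M \<Longrightarrow> g \<in> bcs M \<Longrightarrow> (\<lambda>x. f x - g x) \<in> bcs M"
  using bcs_add[OF _ bcs_uminus, of f M g] by simp

lemma bcs_zero: "(\<lambda>_. 0) \<in> bcs M"
  by (rule bcsI[where B = 0 and S = "{}"]) auto

lemma bcs_sum: "finite I \<Longrightarrow> (\<And>i. i \<in> I \<Longrightarrow> f i \<in> bcs M) \<Longrightarrow> (\<lambda>x. \<Sum>i\<in>I. f i x) \<in> bcs M"
  by (induction I rule: finite_induct) (auto intro: bcs_zero bcs_add)

lemma bcs_indicator: "f \<in> bcs M \<Longrightarrow> A \<in> sets M \<Longrightarrow> (\<lambda>x. indicator A x *\<^sub>R f x) \<in> bcs M"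
  by (rule bcs_dominated[where c = 1]) (auto simp: bcs_def indicator_def)

lemma (in nonhom_space) bcs_const:
  "compact A \<Longrightarrow> (\<lambda>x. indicator A x *\<^sub>R c) \<in> bcs M"
proof (rule bcsI)
  assume "compact A"
  then have [measurable]: "A \<in> sets M" by (simp add: sets_M borel_compact)
  show "(\<lambda>x. indicator A x *\<^sub>R c) \<in> borel_measurable M" by measurable
  show "norm (indicator A x *\<^sub>R c) \<le> norm c" for x by (simp add: indicator_def)
qed (auto simp: indicator_def)

lemma (in nonhom_space) emeasure_compact_finite:
  assumes "compact S"
  shows "emeasure M S < top"
proof -
  obtain R where "S \<subseteq> ball undefined R"
    using bounded_subset_ballD[OF compact_imp_bounded[OF assms]] by blast
  then have "emeasure M S \<le> emeasure M (ball undefined R)"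
    by (intro emeasure_mono) (auto simp: sets_M)
  then show ?thesis using emeasure_ball_finite by (rule le_less_trans)
qed

lemma (in nonhom_space) bcs_powr_integrable:
  assumes "f \<in> bcs M" and "q > 0"
  shows "integrable M (\<lambda>x. norm (f x) powr q)"
proof -
  obtain B S where B: "f \<in> borel_measurable M" "B > 0" "\<And>x. norm (f x) \<le> B" "compact S"
    "\<And>x. f x \<noteq> 0 \<Longrightarrow> x \<in> S" by (rule bcsE[OF assms(1)]) blast
  note [measurable] = B(1)
  show ?thesis
  proof (rule integrableI_bounded_set[where A = S and B = "B powr q"])
    show "S \<in> sets M" using B(4) by (simp add: sets_M borel_compact)
    show "emeasure M S < \<infinity>" using emeasure_compact_finite[OF B(4)] by simp
    show "AE x in M. x \<in> S \<longrightarrow> norm (norm (f x) powr q) \<le> B powr q"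
      using B(3) assms(2) by (auto intro!: AE_I2 powr_mono2)
    show "AE x in M. x \<notin> S \<longrightarrow> norm (f x) powr q = 0"
      using B(5) assms(2) by (intro AE_I2) auto
  qed measurable
qed

lemma (in nonhom_space) bcs_Lp: "f \<in> bcs M \<Longrightarrow> q > 0 \<Longrightarrow> f \<in> Lp_space q M"
  using bcs_powr_integrable[of f q] by (simp add: Lp_space_def bcs_measurable)

lemma (in nonhom_space) bcs_integrable:
  assumes "f \<in> bcs M"
  shows "integrable M f"
proof -
  have "integrable M (\<lambda>x. norm (f x))" using bcs_powr_integrable[OF assms, of 1] by simp
  then show ?thesis using integrable_norm_iff bcs_measurable[OF assms] by blast
qed

text \<open>The kernel bounds are stated through the larger of the two distances. Off the diagonal
  this is positive, so \<open>lam\<close> is never evaluated at radius zero. The assumptions are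
  stable under exchanging the two arguments together with \<open>p1\<close> and
  \<open>p2\<close>.\<close>

locale cz_setting = nonhom_space M lam Cl N
  for M :: "'a::metric_space measure" and lam :: "'a \<Rightarrow> real \<Rightarrow> real" and Cl :: real and N :: nat +
  fixes T :: "('a, 'b::{real_normed_field,banach,second_countable_topology}) bilinear_op"
    and K :: "'a \<Rightarrow> 'a \<Rightarrow> 'a \<Rightarrow> 'b" and p1 p2 p CT CK :: real and \<omega> :: "real \<Rightarrow> real"
  assumes p: "1 < p" "1 < p1" "1 < p2" "1 / p = 1 / p1 + 1 / p2"
    and CT: "CT > 0" and CK: "CK > 0" and om: "dini_modulus \<omega>"
    and T_bilinear: "bilinear_ae M (Lp_space p1 M) (Lp_space p2 M) T"
    and T_Lp: "\<And>f g. f \<in> Lp_space p1 M \<Longrightarrow> g \<in> Lp_space p2 M \<Longrightarrow> T f g \<in> Lp_space p M"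
    and T_bound: "\<And>f g. f \<in> Lp_space p1 M \<Longrightarrow> g \<in> Lp_space p2 M \<Longrightarrow>
      Lp_norm p M (T f g) \<le> CT * Lp_norm p1 M f * Lp_norm p2 M g"
    and K_measurable: "(\<lambda>(x, y1, y2). K x y1 y2) \<in> borel_measurable (M \<Otimes>\<^sub>M M \<Otimes>\<^sub>M M)"
    and K_size: "\<And>x y1 y2. max (dist x y1) (dist x y2) > 0 \<Longrightarrow>
      norm (K x y1 y2) \<le> CK / (lam x (max (dist x y1) (dist x y2)))\<^sup>2"
    and K_smooth1: "\<And>x y1 y1' y2. max (dist x y1) (dist x y2) > 0 \<Longrightarrow>
      dist y1 y1' \<le> max (dist x y1) (dist x y2) / 2 \<Longrightarrow>
      norm (K x y1 y2 - K x y1' y2) \<le> CK / (lam x (max (dist x y1) (dist x y2)))\<^sup>2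
        * \<omega> (dist y1 y1' / max (dist x y1) (dist x y2))"
    and K_smooth2: "\<And>x y1 y2 y2'. max (dist x y1) (dist x y2) > 0 \<Longrightarrow>
      dist y2 y2' \<le> max (dist x y1) (dist x y2) / 2 \<Longrightarrow>
      norm (K x y1 y2 - K x y1 y2') \<le> CK / (lam x (max (dist x y1) (dist x y2)))\<^sup>2
        * \<omega> (dist y2 y2' / max (dist x y1) (dist x y2))"
    and assoc: "\<And>f1 f2. f1 \<in> bcs M \<Longrightarrow> f2 \<in> bcs M \<Longrightarrow>
      AE x in M. x \<notin> supp f1 \<inter> supp f2 \<longrightarrow>
        T f1 f2 x = (\<integral>(y1, y2). K x y1 y2 * f1 y1 * f2 y2 \<partial>(M \<Otimes>\<^sub>M M))"
begin

section \<open>Bilinearity and Lebesgue-space bounds for \<open>T\<close>\<close>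

lemma T_measurable: "f \<in> Lp_space p1 M \<Longrightarrow> g \<in> Lp_space p2 M \<Longrightarrow> T f g \<in> borel_measurable M"
  using T_Lp by (auto simp: Lp_space_def)

lemma bcs_Lp1: "f \<in> bcs M \<Longrightarrow> f \<in> Lp_space p1 M"
  using p by (intro bcs_Lp) auto

lemma bcs_Lp2: "f \<in> bcs M \<Longrightarrow> f \<in> Lp_space p2 M"
  using p by (intro bcs_Lp) auto

lemma T_bcs_measurable: "f \<in> bcs M \<Longrightarrow> g \<in> bcs M \<Longrightarrow> T f g \<in> borel_measurable M"
  using T_measurable bcs_Lp1 bcs_Lp2 by blast

lemma T_add1: "f \<in> bcs M \<Longrightarrow> g \<in> bcs M \<Longrightarrow> h \<in> bcs M \<Longrightarrow>
    AE x in M. T (\<lambda>y. f y + g y) h x = T f h x + T g h x"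
  using T_bilinear bcs_Lp1 bcs_Lp2 unfolding bilinear_ae_def by blast

lemma T_add2: "f \<in> bcs M \<Longrightarrow> g \<in> bcs M \<Longrightarrow> h \<in> bcs M \<Longrightarrow>
    AE x in M. T f (\<lambda>y. g y + h y) x = T f g x + T f h x"
  using T_bilinear bcs_Lp1 bcs_Lp2 unfolding bilinear_ae_def by blast

lemma T_cmult1: "f \<in> bcs M \<Longrightarrow> h \<in> bcs M \<Longrightarrow> AE x in M. T (\<lambda>y. c * f y) h x = c * T f h x"
  using T_bilinear bcs_Lp1 bcs_Lp2 unfolding bilinear_ae_def by blast

lemma T_cmult2: "f \<in> bcs M \<Longrightarrow> h \<in> bcs M \<Longrightarrow> AE x in M. T f (\<lambda>y. c * h y) x = c * T f h x"
  using T_bilinear bcs_Lp1 bcs_Lp2 unfolding bilinear_ae_def by blast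

lemma T_diff1:
  assumes "f \<in> bcs M" "g \<in> bcs M" "h \<in> bcs M"
  shows "AE x in M. T (\<lambda>y. f y - g y) h x = T f h x - T g h x"
proof -
  have "AE x in M. T (\<lambda>y. f y + (- 1) * g y) h x = T f h x + T (\<lambda>y. (- 1) * g y) h x"
    using assms by (intro T_add1 bcs_cmult)
  moreover have "AE x in M. T (\<lambda>y. (- 1) * g y) h x = (- 1) * T g h x"
    using assms by (intro T_cmult1)
  ultimately show ?thesis by eventually_elim simp
qed

lemma T_diff2:
  assumes "f \<in> bcs M" "g \<in> bcs M" "h \<in> bcs M"
  shows "AE x in M. T f (\<lambda>y. g y - h y) x = T f g x - T f h x"
proof -
  have "AE x in M. T f (\<lambda>y. g y + (- 1) * h y) x = T f g x + T f (\<lambda>y. (- 1) * h y) x"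
    using assms by (intro T_add2 bcs_cmult)
  moreover have "AE x in M. T f (\<lambda>y. (- 1) * h y) x = (- 1) * T f h x"
    using assms by (intro T_cmult2)
  ultimately show ?thesis by eventually_elim simp
qed

lemma T_sum1:
  assumes "finite I" "\<And>i. i \<in> I \<Longrightarrow> u i \<in> bcs M" "h \<in> bcs M"
  shows "AE x in M. T (\<lambda>y. \<Sum>i\<in>I. u i y) h x = (\<Sum>i\<in>I. T (u i) h x)"
  using assms(1,2)
proof (induction I rule: finite_induct)
  case empty
  have "AE x in M. T (\<lambda>y. 0 * 0) h x = 0 * T (\<lambda>_. 0) h x"
    using assms by (intro T_cmult1 bcs_zero)
  then show ?case by simp
next
  case (insert i I)
  have "AE x in M. T (\<lambda>y. u i y + (\<Sum>i\<in>I. u i y)) h x = T (u i) h x + T (\<lambda>y. \<Sum>i\<in>I. u i y) h x"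
    using insert assms(3) by (intro T_add1 bcs_sum) auto
  moreover have "AE x in M. T (\<lambda>y. \<Sum>i\<in>I. u i y) h x = (\<Sum>i\<in>I. T (u i) h x)"
    using insert by auto
  ultimately show ?case by eventually_elim (simp add: insert.hyps)
qed

lemma T_sum2:
  assumes "finite I" "\<And>i. i \<in> I \<Longrightarrow> u i \<in> bcs M" "h \<in> bcs M"
  shows "AE x in M. T h (\<lambda>y. \<Sum>i\<in>I. u i y) x = (\<Sum>i\<in>I. T h (u i) x)"
  using assms(1,2)
proof (induction I rule: finite_induct)
  case empty
  have "AE x in M. T h (\<lambda>y. 0 * 0) x = 0 * T h (\<lambda>_. 0) x"
    using assms by (intro T_cmult2 bcs_zero)
  then show ?case by simp
next
  case (insert i I)
  have "AE x in M. T h (\<lambda>y. u i y + (\<Sum>i\<in>I. u i y)) x = T h (u i) x + T h (\<lambda>y. \<Sum>i\<in>I. u i y) x"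
    using insert assms(3) by (intro T_add2 bcs_sum) auto
  moreover have "AE x in M. T h (\<lambda>y. \<Sum>i\<in>I. u i y) x = (\<Sum>i\<in>I. T h (u i) x)"
    using insert by auto
  ultimately show ?case by eventually_elim (simp add: insert.hyps)
qed

lemma T_sum:
  assumes I: "finite I" "\<And>i. i \<in> I \<Longrightarrow> u i \<in> bcs M" and J: "finite J" "\<And>j. j \<in> J \<Longrightarrow> h j \<in> bcs M"
  shows "AE x in M. T (\<lambda>y. \<Sum>i\<in>I. u i y) (\<lambda>y. \<Sum>j\<in>J. h j y) x = (\<Sum>i\<in>I. \<Sum>j\<in>J. T (u i) (h j) x)"
proof -
  have "AE x in M. T (\<lambda>y. \<Sum>i\<in>I. u i y) (\<lambda>y. \<Sum>j\<in>J. h j y) x = (\<Sum>i\<in>I. T (u i) (\<lambda>y. \<Sum>j\<in>J. h j y) x)"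
    using assms by (intro T_sum1 bcs_sum) auto
  moreover have "AE x in M. \<forall>i\<in>I. T (u i) (\<lambda>y. \<Sum>j\<in>J. h j y) x = (\<Sum>j\<in>J. T (u i) (h j) x)"
    using assms by (intro AE_finite_allI T_sum2) auto
  ultimately show ?thesis by eventually_elim simp
qed

text \<open>\<open>A1\<close> and \<open>A2\<close> play the role of heights on a set of measure
  \<open>m\<close>. The relation between the exponents combines the powers of \<open>m\<close> into
  \<open>m powr (1 / p)\<close>, so that \<open>m\<close> enters linearly in the end.\<close>

lemma T_Lp_bound:
  assumes f: "f \<in> Lp_space p1 M" and h: "h \<in> Lp_space p2 M"
    and "(\<integral>x. norm (f x) powr p1 \<partial>M) \<le> A1 powr p1 * m" "(\<integral>x. norm (h x) powr p2 \<partial>M) \<le> A2 powr p2 * m"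
    and pos: "A1 \<ge> 0" "A2 \<ge> 0" "m \<ge> 0"
  shows "(\<integral>x. norm (T f h x) powr p \<partial>M) \<le> (CT * A1 * A2) powr p * m"
proof -
  have n1: "Lp_norm p1 M f \<le> A1 * m powr (1 / p1)"
  proof -
    have "Lp_norm p1 M f \<le> (A1 powr p1 * m) powr (1 / p1)"
      unfolding Lp_norm_def using assms p by (intro powr_mono2) (auto intro!: integral_nonneg_AE)
    also have "\<dots> = A1 * m powr (1 / p1)" using pos p by (simp add: powr_mult powr_powr)
    finally show ?thesis .
  qed
  have n2: "Lp_norm p2 M h \<le> A2 * m powr (1 / p2)"
  proof -
    have "Lp_norm p2 M h \<le> (A2 powr p2 * m) powr (1 / p2)"
      unfolding Lp_norm_def using assms p by (intro powr_mono2) (auto intro!: integral_nonneg_AE)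
    also have "\<dots> = A2 * m powr (1 / p2)" using pos p by (simp add: powr_mult powr_powr)
    finally show ?thesis .
  qed
  have "Lp_norm p M (T f h) \<le> CT * Lp_norm p1 M f * Lp_norm p2 M h" by (rule T_bound[OF f h])
  also have "\<dots> \<le> CT * (A1 * m powr (1 / p1)) * (A2 * m powr (1 / p2))"
    using CT n1 n2 pos by (intro mult_mono mult_nonneg_nonneg) (auto simp: Lp_norm_def)
  also have "\<dots> = CT * A1 * A2 * m powr (1 / p)"
    unfolding p(4) powr_add by simp
  finally have "Lp_norm p M (T f h) powr p \<le> (CT * A1 * A2 * m powr (1 / p)) powr p"
    using p by (intro powr_mono2) (auto simp: Lp_norm_def)
  moreover have "Lp_norm p M (T f h) powr p = (\<integral>x. norm (T f h x) powr p \<partial>M)"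
    using p(1) by (simp add: Lp_norm_def powr_powr integral_nonneg_AE)
  moreover have "(CT * A1 * A2 * m powr (1 / p)) powr p = (CT * A1 * A2) powr p * m"
    using pos CT p(1) by (simp add: powr_mult powr_powr)
  ultimately show ?thesis by simp
qed

lemma T_powr_integrable:
  "f \<in> Lp_space p1 M \<Longrightarrow> h \<in> Lp_space p2 M \<Longrightarrow> integrable M (\<lambda>x. norm (T f h x) powr p)"
  using T_Lp by (auto simp: Lp_space_def)

lemma T_nn_bound:
  assumes f: "f \<in> Lp_space p1 M" and h: "h \<in> Lp_space p2 M"
    and "(\<integral>x. norm (f x) powr p1 \<partial>M) \<le> A1 powr p1 * m" "(\<integral>x. norm (h x) powr p2 \<partial>M) \<le> A2 powr p2 * m"
    and pos: "A1 \<ge> 0" "A2 \<ge> 0" "m \<ge> 0"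
  shows "(\<integral>\<^sup>+x. ennreal (norm (T f h x) powr p) \<partial>M) \<le> ennreal ((CT * A1 * A2) powr p * m)"
  using T_Lp_bound[OF assms] T_powr_integrable[OF f h]
  by (subst nn_integral_eq_integral) (auto intro: ennreal_leI)

lemma T_weak_bound:
  assumes f: "f \<in> Lp_space p1 M" and h: "h \<in> Lp_space p2 M"
    and "(\<integral>x. norm (f x) powr p1 \<partial>M) \<le> A1 powr p1 * m" "(\<integral>x. norm (h x) powr p2 \<partial>M) \<le> A2 powr p2 * m"
    and pos: "A1 \<ge> 0" "A2 \<ge> 0" "m \<ge> 0" and "t > 0"
  shows "emeasure M {x. norm (T f h x) \<ge> t} \<le> ennreal ((CT * A1 * A2 / t) powr p * m)"
proof -
  have [measurable]: "T f h \<in> borel_measurable M" by (rule T_measurable[OF f h])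
  have "{x. norm (T f h x) \<ge> t} \<subseteq> {x\<in>UNIV. 1 \<le> ennreal (1 / t powr p) * ennreal (norm (T f h x) powr p)}"
  proof clarify
    fix x assume "t \<le> norm (T f h x)"
    then have "t powr p \<le> norm (T f h x) powr p" using \<open>t > 0\<close> p by (intro powr_mono2) auto
    then have "1 \<le> 1 / t powr p * norm (T f h x) powr p" using \<open>t > 0\<close> by (simp add: field_simps)
    then have "ennreal 1 \<le> ennreal (1 / t powr p * norm (T f h x) powr p)" by (rule ennreal_leI)
    then show "x \<in> UNIV \<and> 1 \<le> ennreal (1 / t powr p) * ennreal (norm (T f h x) powr p)"
      by (simp flip: ennreal_mult)
  qed
  then have "emeasure M {x. norm (T f h x) \<ge> t} \<le> emeasure M {x\<in>UNIV. 1 \<le> ennreal (1 / t powr p) * ennreal (norm (T f h x) powr p)}"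
  proof (rule emeasure_mono)
    have "{x\<in>space M. 1 \<le> ennreal (1 / t powr p) * ennreal (norm (T f h x) powr p)} \<in> sets M" by measurable
    then show "{x\<in>UNIV. 1 \<le> ennreal (1 / t powr p) * ennreal (norm (T f h x) powr p)} \<in> sets M" by simp
  qed
  also have "\<dots> \<le> ennreal (1 / t powr p) * (\<integral>\<^sup>+x. ennreal (norm (T f h x) powr p) * indicator UNIV x \<partial>M)"
    using sets.top[of M] by (intro nn_integral_Markov_inequality) (auto simp: space_M)
  also have "\<dots> \<le> ennreal (1 / t powr p) * ennreal ((CT * A1 * A2) powr p * m)"
    using T_nn_bound[OF assms(1-7)] by (intro mult_left_mono) auto
  also have "\<dots> = ennreal ((CT * A1 * A2 / t) powr p * m)"
    using pos CT \<open>t > 0\<close> by (simp add: powr_divide flip: ennreal_mult)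
  finally show ?thesis .
qed

text \<open>Hoelder's inequality is avoided by \<open>a \<le> s + a\<^sup>p / s\<^sup>p\<^sup>-\<^sup>1\<close>.\<close>

lemma T_local_bound:
  assumes f: "f \<in> Lp_space p1 M" and h: "h \<in> Lp_space p2 M"
    and "(\<integral>x. norm (f x) powr p1 \<partial>M) \<le> A1 powr p1 * m" "(\<integral>x. norm (h x) powr p2 \<partial>M) \<le> A2 powr p2 * m"
    and pos: "A1 \<ge> 0" "A2 \<ge> 0" "m \<ge> 0" and E: "E \<in> fmeasurable M"
  shows "(\<integral>\<^sup>+x. ennreal (norm (T f h x)) * indicator E x \<partial>M) \<le> ennreal (CT * A1 * A2 * (measure M E + m))"
proof -
  have [measurable]: "T f h \<in> borel_measurable M" by (rule T_measurable[OF f h])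
  have Em [measurable]: "E \<in> sets M" using E by (rule fmeasurableD)
  define s where "s = CT * A1 * A2"
  have "s \<ge> 0" using CT pos by (simp add: s_def)
  show ?thesis
  \<comment> \<open>Since \<open>0 powr (1 - p) = 0\<close>, the pointwise inequality used in the
    other case is false for \<open>s = 0\<close>. Here \<open>T f h\<close> vanishes almost
    everywhere.\<close>
  proof (cases "s = 0")
    case True
    have "(\<integral>\<^sup>+x. ennreal (norm (T f h x) powr p) \<partial>M) \<le> 0"
    proof -
      have z: "(CT * A1 * A2) powr p * m = 0" using True p(1) by (simp flip: s_def)
      show ?thesis using T_nn_bound[OF assms(1-7), unfolded z] by simp
    qed
    then have "AE x in M. ennreal (norm (T f h x) powr p) = 0"
      by (subst (asm) le_zero_eq, subst (asm) nn_integral_0_iff_AE) measurable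
    then have "AE x in M. ennreal (norm (T f h x)) * indicator E x = 0"
      by eventually_elim (auto simp: ennreal_eq_0_iff)
    then have "(\<integral>\<^sup>+x. ennreal (norm (T f h x)) * indicator E x \<partial>M) = 0"
      by (subst nn_integral_0_iff_AE) auto
    then show ?thesis by simp
  next
    case False
    with \<open>s \<ge> 0\<close> have "s > 0" by simp
    \<comment> \<open>The level \<open>s\<close> is the one for which both terms integrate to
      multiples of \<open>s\<close>: the first over \<open>E\<close>, the second because the bound
      for the integral of the power \<open>p\<close> is \<open>s powr p * m\<close>.\<close>
    have le: "a \<le> s + s powr (1 - p) * a powr p" if "a \<ge> 0" for a
    proof (cases "a \<le> s")
      case True
      then show ?thesis by (simp add: add_increasing2)
    next
      case False
      then have "1 \<le> (a / s) powr (p - 1)" using p \<open>s > 0\<close> by (intro ge_one_powr_ge_zero) auto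
      then have "a * 1 \<le> a * (a / s) powr (p - 1)" using that by (intro mult_left_mono)
      also have "\<dots> = s powr (1 - p) * a powr p"
        using False \<open>s > 0\<close> by (simp add: powr_divide powr_diff field_simps)
      finally show ?thesis using \<open>s > 0\<close> by simp
    qed
    have "(\<integral>\<^sup>+x. ennreal (norm (T f h x)) * indicator E x \<partial>M)
        \<le> (\<integral>\<^sup>+x. ennreal s * indicator E x + ennreal (s powr (1 - p)) * ennreal (norm (T f h x) powr p) \<partial>M)"
    proof (intro nn_integral_mono)
      fix x
      have "ennreal (norm (T f h x)) \<le> ennreal (s + s powr (1 - p) * norm (T f h x) powr p)"
        by (intro ennreal_leI le) simp
      also have "\<dots> = ennreal s + ennreal (s powr (1 - p)) * ennreal (norm (T f h x) powr p)"
        using \<open>s > 0\<close> by (subst ennreal_plus) (auto simp: ennreal_mult)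
      finally show "ennreal (norm (T f h x)) * indicator E x
          \<le> ennreal s * indicator E x + ennreal (s powr (1 - p)) * ennreal (norm (T f h x) powr p)"
        by (simp add: indicator_def)
    qed
    also have "\<dots> = ennreal s * emeasure M E + ennreal (s powr (1 - p)) * (\<integral>\<^sup>+x. ennreal (norm (T f h x) powr p) \<partial>M)"
      by (subst nn_integral_add) (auto simp: nn_integral_cmult_indicator nn_integral_cmult)
    also have "\<dots> \<le> ennreal s * emeasure M E + ennreal (s powr (1 - p)) * ennreal (s powr p * m)"
      using T_nn_bound[OF assms(1-7)] by (intro add_left_mono mult_left_mono) (auto simp: s_def)
    also have "\<dots> = ennreal (s * measure M E) + ennreal (s * m)"
    proof -
      have "s powr (1 - p) * (s powr p * m) = s * m"
        using \<open>s > 0\<close> by (simp add: powr_diff)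
      moreover have "emeasure M E = ennreal (measure M E)" using E by (rule emeasure_eq_measure2)
      ultimately show ?thesis using \<open>s > 0\<close> pos by (simp flip: ennreal_mult)
    qed
    also have "\<dots> = ennreal (s * (measure M E + m))"
      using \<open>s > 0\<close> pos by (simp add: distrib_left flip: ennreal_plus)
    finally show ?thesis by (simp add: s_def)
  qed
qed

section \<open>Integrals against the kernel\<close>

sublocale pair: pair_sigma_finite M M ..

lemma K_section: "(\<lambda>z. K x (fst z) (snd z)) \<in> borel_measurable (M \<Otimes>\<^sub>M M)"
proof -
  have "(\<lambda>z. (\<lambda>(x, y1, y2). K x y1 y2) (x, z)) \<in> borel_measurable (M \<Otimes>\<^sub>M M)"
    by (rule measurable_compose[OF measurable_Pair1' K_measurable]) simp
  then show ?thesis by (simp add: case_prod_unfold)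
qed

lemma K_section1: "(\<lambda>y2. K x z y2) \<in> borel_measurable M"
  using measurable_compose[OF measurable_Pair1' K_section, of z x] by simp

text \<open>If the integral on the left does not exist, its value is 0 by convention, so the bound
  covers every measurable \<open>F\<close>.\<close>

lemma norm_integral_pair_le:
  fixes F :: "'a \<Rightarrow> 'a \<Rightarrow> 'b"
  assumes [measurable]: "(\<lambda>z. F (fst z) (snd z)) \<in> borel_measurable (M \<Otimes>\<^sub>M M)"
  shows "ennreal (norm (\<integral>(y1, y2). F y1 y2 \<partial>(M \<Otimes>\<^sub>M M)))
    \<le> (\<integral>\<^sup>+y1. \<integral>\<^sup>+y2. ennreal (norm (F y1 y2)) \<partial>M \<partial>M)"
proof -
  have [measurable]: "(\<lambda>(y1, y2). F y1 y2) \<in> borel_measurable (M \<Otimes>\<^sub>M M)"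
    using assms by (simp add: case_prod_unfold)
  have "ennreal (norm (\<integral>(y1, y2). F y1 y2 \<partial>(M \<Otimes>\<^sub>M M)))
      \<le> (\<integral>\<^sup>+z. ennreal (norm (case z of (y1, y2) \<Rightarrow> F y1 y2)) \<partial>(M \<Otimes>\<^sub>M M))"
  proof (cases "integrable (M \<Otimes>\<^sub>M M) (\<lambda>(y1, y2). F y1 y2)")
    case True
    then show ?thesis by (rule integral_norm_bound_ennreal)
  qed (simp add: not_integrable_integral_eq)
  also have "\<dots> = (\<integral>\<^sup>+y1. \<integral>\<^sup>+y2. ennreal (norm (case (y1, y2) of (y1, y2) \<Rightarrow> F y1 y2)) \<partial>M \<partial>M)"
    by (rule nn_integral_fst[symmetric]) measurable
  finally show ?thesis by simp
qed

text \<open>The maximal function with denominator \<open>lam\<close>, applied to the measure with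
  density \<open>v\<close>, is at most 1 at \<open>x\<close>. By
  \<open>maximal_exceptional_set\<close> this holds outside a set of measure at most
  \<open>Cl\<^sup>2\<close> times the mass of \<open>v\<close>.\<close>

definition tame :: "('a \<Rightarrow> real) \<Rightarrow> 'a \<Rightarrow> bool" where
  "tame v x \<longleftrightarrow> v \<in> borel_measurable M \<and> finite_measure (density M (\<lambda>y. ennreal (v y))) \<and>
    (\<forall>s>0. measure (density M (\<lambda>y. ennreal (v y))) (ball x s) \<le> lam x s)"

lemma tame_integral:
  assumes "tame v x" "r > 0"
  shows "(\<integral>\<^sup>+y. ennreal (v y) * ennreal (1 / (lam x (max r (dist x y)))\<^sup>2) \<partial>M) \<le> ennreal (2 * Cl\<^sup>2 / lam x r)"
proof -
  note [measurable] = lam_max_measurable[OF \<open>r > 0\<close>, of x]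
  have [measurable]: "v \<in> borel_measurable M" using assms by (simp add: tame_def)
  have "(\<integral>\<^sup>+y. ennreal (v y) * ennreal (1 / (lam x (max r (dist x y)))\<^sup>2) \<partial>M)
     = (\<integral>\<^sup>+y. ennreal (1 / (lam x (max r (dist x y)))\<^sup>2) \<partial>density M (\<lambda>y. ennreal (v y)))"
    by (subst nn_integral_density) measurable
  also have "\<dots> \<le> ennreal (2 * Cl\<^sup>2 / lam x r)"
    using assms by (intro maximal_integral_bound) (auto simp: tame_def sets_M)
  finally show ?thesis .
qed

text \<open>The bound for \<open>G\<close> does not involve \<open>y1\<close>, so the integral over
  \<open>y2\<close> comes first and is controlled by \<open>tame\<close> alone; what remains is the
  integral of \<open>u\<close>. The kernel itself and its difference in the first variable are the
  intended choices of \<open>G\<close>.\<close>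

lemma kernel_integral_bound:
  fixes G :: "'a \<Rightarrow> 'a \<Rightarrow> 'b"
  assumes tame: "tame v x" and "s > 0" and "c \<ge> 0"
    and u: "u \<in> borel_measurable M" "\<And>y. 0 \<le> u y" and h: "\<And>y. 0 \<le> h y" "\<And>y. h y \<le> v y"
    and le: "\<And>y1 y2. u y1 \<noteq> 0 \<Longrightarrow> h y2 \<noteq> 0 \<Longrightarrow>
      norm (G y1 y2) \<le> c / (lam x (max s (dist x y2)))\<^sup>2"
  shows "(\<integral>\<^sup>+y1. \<integral>\<^sup>+y2. ennreal (norm (G y1 y2) * u y1 * h y2) \<partial>M \<partial>M)
    \<le> ennreal (c * (2 * Cl\<^sup>2 / lam x s)) * (\<integral>\<^sup>+y. ennreal (u y) \<partial>M)"
proof -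
  note [measurable] = lam_max_measurable[OF \<open>s > 0\<close>, of x] u(1)
  have [measurable]: "v \<in> borel_measurable M" using tame by (simp add: tame_def)
  have "(\<integral>\<^sup>+y1. \<integral>\<^sup>+y2. ennreal (norm (G y1 y2) * u y1 * h y2) \<partial>M \<partial>M)
      \<le> (\<integral>\<^sup>+y1. ennreal (c * (2 * Cl\<^sup>2 / lam x s)) * ennreal (u y1) \<partial>M)"
  proof (intro nn_integral_mono)
    fix y1
    have "(\<integral>\<^sup>+y2. ennreal (norm (G y1 y2) * u y1 * h y2) \<partial>M)
        \<le> (\<integral>\<^sup>+y2. ennreal (c * u y1) * (ennreal (v y2) * ennreal (1 / (lam x (max s (dist x y2)))\<^sup>2)) \<partial>M)"
    proof (intro nn_integral_mono)
      fix y2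
      have vn: "0 \<le> v y2" using h[of y2] by linarith
      have "norm (G y1 y2) * u y1 * h y2 \<le> c * u y1 * (v y2 * (1 / (lam x (max s (dist x y2)))\<^sup>2))"
      proof (cases "u y1 = 0 \<or> h y2 = 0")
        case True
        then show ?thesis using u(2)[of y1] vn \<open>c \<ge> 0\<close> by auto
      next
        case False
        then have "norm (G y1 y2) * u y1 * h y2 \<le> c / (lam x (max s (dist x y2)))\<^sup>2 * u y1 * v y2"
          using le[of y1 y2] u(2)[of y1] h[of y2] \<open>c \<ge> 0\<close> by (intro mult_mono mult_nonneg_nonneg) auto
        then show ?thesis by (simp add: mult_ac)
      qed
      then show "ennreal (norm (G y1 y2) * u y1 * h y2)
          \<le> ennreal (c * u y1) * (ennreal (v y2) * ennreal (1 / (lam x (max s (dist x y2)))\<^sup>2))"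
        using vn u(2)[of y1] \<open>c \<ge> 0\<close> by (simp add: ennreal_leI flip: ennreal_mult)
    qed
    also have "\<dots> = ennreal (c * u y1) * (\<integral>\<^sup>+y2. ennreal (v y2) * ennreal (1 / (lam x (max s (dist x y2)))\<^sup>2) \<partial>M)"
      by (rule nn_integral_cmult) measurable
    also have "\<dots> \<le> ennreal (c * u y1) * ennreal (2 * Cl\<^sup>2 / lam x s)"
      using tame_integral[OF tame \<open>s > 0\<close>] by (rule mult_left_mono) simp
    also have "\<dots> = ennreal (c * (2 * Cl\<^sup>2 / lam x s)) * ennreal (u y1)"
      using \<open>c \<ge> 0\<close> u(2)[of y1] lam_pos[OF \<open>s > 0\<close>, of x] by (simp add: mult_ac flip: ennreal_mult)
    finally show "(\<integral>\<^sup>+y2. ennreal (norm (G y1 y2) * u y1 * h y2) \<partial>M)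
        \<le> ennreal (c * (2 * Cl\<^sup>2 / lam x s)) * ennreal (u y1)" .
  qed
  also have "\<dots> = ennreal (c * (2 * Cl\<^sup>2 / lam x s)) * (\<integral>\<^sup>+y. ennreal (u y) \<partial>M)"
    by (rule nn_integral_cmult) measurable
  finally show ?thesis .
qed

text \<open>Moving the sum inside leaves only the pointwise sum of the norms of the
  \<open>h i\<close>. This has a common majorant, so the number of terms does not enter the
  estimates.\<close>

lemma sum_nn_integral_pair:
  fixes G :: "'a \<Rightarrow> 'a \<Rightarrow> 'b" and h :: "'i \<Rightarrow> 'a \<Rightarrow> 'b"
  assumes "finite I" and [measurable]: "(\<lambda>z. G (fst z) (snd z)) \<in> borel_measurable (M \<Otimes>\<^sub>M M)"
    and [measurable]: "u \<in> borel_measurable M" and h: "\<And>i. i \<in> I \<Longrightarrow> h i \<in> borel_measurable M"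
  shows "(\<Sum>i\<in>I. \<integral>\<^sup>+y1. \<integral>\<^sup>+y2. ennreal (norm (G y1 y2 * u y1 * h i y2)) \<partial>M \<partial>M)
    = (\<integral>\<^sup>+y1. \<integral>\<^sup>+y2. ennreal (norm (G y1 y2) * norm (u y1) * (\<Sum>i\<in>I. norm (h i y2))) \<partial>M \<partial>M)"
proof -
  have Gm [measurable]: "(\<lambda>y2. G y1 y2) \<in> borel_measurable M" for y1
    using measurable_compose[OF measurable_Pair1' assms(2), of y1] by simp
  have m: "(\<lambda>y1. \<integral>\<^sup>+y2. ennreal (norm (G y1 y2 * u y1 * h i y2)) \<partial>M) \<in> borel_measurable M" if "i \<in> I" for i
  proof -
    note [measurable] = h[OF that]
    have "(\<lambda>z. ennreal (norm (G (fst z) (snd z) * u (fst z) * h i (snd z)))) \<in> borel_measurable (M \<Otimes>\<^sub>M M)"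
      by measurable
    from borel_measurable_nn_integral_fst[OF this] show ?thesis by simp
  qed
  have "(\<Sum>i\<in>I. \<integral>\<^sup>+y1. \<integral>\<^sup>+y2. ennreal (norm (G y1 y2 * u y1 * h i y2)) \<partial>M \<partial>M)
    = (\<integral>\<^sup>+y1. (\<Sum>i\<in>I. \<integral>\<^sup>+y2. ennreal (norm (G y1 y2 * u y1 * h i y2)) \<partial>M) \<partial>M)"
    using m by (rule nn_integral_sum[symmetric])
  also have "\<dots> = (\<integral>\<^sup>+y1. \<integral>\<^sup>+y2. (\<Sum>i\<in>I. ennreal (norm (G y1 y2 * u y1 * h i y2))) \<partial>M \<partial>M)"
  proof (intro nn_integral_cong nn_integral_sum[symmetric])
    fix y1 i assume "i \<in> I"
    note [measurable] = h[OF this]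
    show "(\<lambda>y2. ennreal (norm (G y1 y2 * u y1 * h i y2))) \<in> borel_measurable M" by measurable
  qed
  also have "\<dots> = (\<integral>\<^sup>+y1. \<integral>\<^sup>+y2. ennreal (norm (G y1 y2) * norm (u y1) * (\<Sum>i\<in>I. norm (h i y2))) \<partial>M \<partial>M)"
    by (intro nn_integral_cong) (simp add: norm_mult sum_distrib_left sum_ennreal)
  finally show ?thesis .
qed

text \<open>The null set comes from association for the finitely many pairs \<open>(u, h j)\<close>.
  It is independent of \<open>I\<close> and \<open>s\<close>, which may thus be chosen according to
  \<open>x\<close>, for instance as the indices of the balls that are far from
  \<open>x\<close>.\<close>

lemma T_sum_size:
  assumes u: "u \<in> bcs M" and J: "finite J" "\<And>j. j \<in> J \<Longrightarrow> h j \<in> bcs M"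
    and v: "\<And>y. (\<Sum>j\<in>J. norm (h j y)) \<le> v y"
  shows "AE x in M. tame v x \<longrightarrow> (\<forall>I\<subseteq>J. \<forall>s>0.
    (\<forall>j\<in>I. \<forall>y1 y2. u y1 \<noteq> 0 \<longrightarrow> h j y2 \<noteq> 0 \<longrightarrow> s \<le> max (dist x y1) (dist x y2)) \<longrightarrow>
    (\<Sum>j\<in>I. ennreal (norm (T u (h j) x))) \<le> ennreal (CK * (2 * Cl\<^sup>2 / lam x s)) * (\<integral>\<^sup>+y. ennreal (norm (u y)) \<partial>M))"
proof -
  have "AE x in M. \<forall>j\<in>J. x \<notin> supp u \<inter> supp (h j) \<longrightarrow>
      T u (h j) x = (\<integral>(y1, y2). K x y1 y2 * u y1 * h j y2 \<partial>(M \<Otimes>\<^sub>M M))"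
    using J u by (intro AE_finite_allI assoc) auto
  then show ?thesis
  proof (rule AE_mp, intro AE_I2 impI allI)
    fix x I and s :: real
    assume A: "\<forall>j\<in>J. x \<notin> supp u \<inter> supp (h j) \<longrightarrow>
      T u (h j) x = (\<integral>(y1, y2). K x y1 y2 * u y1 * h j y2 \<partial>(M \<Otimes>\<^sub>M M))"
      and tame: "tame v x" and I: "I \<subseteq> J" and "s > 0"
      and sep: "\<forall>j\<in>I. \<forall>y1 y2. u y1 \<noteq> 0 \<longrightarrow> h j y2 \<noteq> 0 \<longrightarrow> s \<le> max (dist x y1) (dist x y2)"
    note [measurable] = K_section[of x] bcs_measurable[OF u]
    have hm: "h j \<in> borel_measurable M" if "j \<in> I" for j using J(2) I that by (auto intro: bcs_measurable)
    have fI: "finite I" using I J(1) finite_subset by blast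
    have "(\<Sum>j\<in>I. ennreal (norm (T u (h j) x)))
        \<le> (\<Sum>j\<in>I. \<integral>\<^sup>+y1. \<integral>\<^sup>+y2. ennreal (norm (K x y1 y2 * u y1 * h j y2)) \<partial>M \<partial>M)"
    proof (intro sum_mono)
      fix j assume j: "j \<in> I"
      note [measurable] = hm[OF j]
      \<comment> \<open>The separation concerns the sets where the functions are nonzero; being by a
        positive distance, it survives the passage to closures.\<close>
      have "x \<notin> supp u \<inter> supp (h j)"
      proof
        assume "x \<in> supp u \<inter> supp (h j)"
        then have "x \<in> closure {y. u y \<noteq> 0}" "x \<in> closure {y. h j y \<noteq> 0}" by (auto simp: supp_def)
        then obtain y1 y2 where "u y1 \<noteq> 0" "dist y1 x < s" "h j y2 \<noteq> 0" "dist y2 x < s"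
          using \<open>s > 0\<close> unfolding closure_approachable by blast
        then show False using sep j by (force simp: dist_commute)
      qed
      then have "T u (h j) x = (\<integral>(y1, y2). K x y1 y2 * u y1 * h j y2 \<partial>(M \<Otimes>\<^sub>M M))"
        using A I j by blast
      moreover have "(\<lambda>z. K x (fst z) (snd z) * u (fst z) * h j (snd z)) \<in> borel_measurable (M \<Otimes>\<^sub>M M)"
        by measurable
      ultimately show "ennreal (norm (T u (h j) x))
          \<le> (\<integral>\<^sup>+y1. \<integral>\<^sup>+y2. ennreal (norm (K x y1 y2 * u y1 * h j y2)) \<partial>M \<partial>M)"
        using norm_integral_pair_le[of "\<lambda>y1 y2. K x y1 y2 * u y1 * h j y2"] by simp
    qed
    also have "\<dots> = (\<integral>\<^sup>+y1. \<integral>\<^sup>+y2. ennreal (norm (K x y1 y2) * norm (u y1) * (\<Sum>j\<in>I. norm (h j y2))) \<partial>M \<partial>M)"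
      by (rule sum_nn_integral_pair[OF fI K_section bcs_measurable[OF u] hm])
    also have "\<dots> \<le> ennreal (CK * (2 * Cl\<^sup>2 / lam x s)) * (\<integral>\<^sup>+y. ennreal (norm (u y)) \<partial>M)"
    proof (rule kernel_integral_bound[OF tame \<open>s > 0\<close>])
      fix y1 y2
      assume u1: "norm (u y1) \<noteq> 0" and "(\<Sum>j\<in>I. norm (h j y2)) \<noteq> 0"
      then obtain j where "j \<in> I" "norm (h j y2) \<noteq> 0"
        by (elim sum.not_neutral_contains_not_neutral) simp
      then have "j \<in> I" "h j y2 \<noteq> 0" "u y1 \<noteq> 0" using u1 by auto
      then have D: "s \<le> max (dist x y1) (dist x y2)" using sep by blast
      then have "norm (K x y1 y2) \<le> CK / (lam x (max (dist x y1) (dist x y2)))\<^sup>2"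
        using \<open>s > 0\<close> by (intro K_size) linarith
      \<comment> \<open>Here the dependence on \<open>y1\<close> is given up, at no loss since the
        separation provides the lower bound \<open>s\<close>.\<close>
      also have "\<dots> \<le> CK / (lam x (max s (dist x y2)))\<^sup>2"
        using D \<open>s > 0\<close> CK
        by (intro divide_left_mono power_mono lam_mono mult_pos_pos zero_less_power lam_pos less_imp_le[OF lam_pos]) auto
      finally show "norm (K x y1 y2) \<le> CK / (lam x (max s (dist x y2)))\<^sup>2" .
    next
      fix y
      have "(\<Sum>j\<in>I. norm (h j y)) \<le> (\<Sum>j\<in>J. norm (h j y))" using I J(1) by (intro sum_mono2) auto
      then show "(\<Sum>j\<in>I. norm (h j y)) \<le> v y" using v[of y] by linarith
    qed (use CK in \<open>auto intro: sum_nonneg\<close>)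
    finally show "(\<Sum>j\<in>I. ennreal (norm (T u (h j) x)))
        \<le> ennreal (CK * (2 * Cl\<^sup>2 / lam x s)) * (\<integral>\<^sup>+y. ennreal (norm (u y)) \<partial>M)" .
  qed
qed

lemma integrable_kernel_product:
  fixes G :: "'a \<Rightarrow> 'a \<Rightarrow> 'b"
  assumes [measurable]: "(\<lambda>z. G (fst z) (snd z)) \<in> borel_measurable (M \<Otimes>\<^sub>M M)"
    and u: "u \<in> bcs M" and h: "h \<in> bcs M" and le: "\<And>y1 y2. u y1 \<noteq> 0 \<Longrightarrow> norm (G y1 y2) \<le> C"
  shows "integrable (M \<Otimes>\<^sub>M M) (\<lambda>(y1, y2). G y1 y2 * u y1 * h y2)"
proof -
  obtain B S where B: "u \<in> borel_measurable M" "B > 0" "\<And>x. norm (u x) \<le> B" "compact S"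
    "\<And>x. u x \<noteq> 0 \<Longrightarrow> x \<in> S" by (rule bcsE[OF u]) blast
  obtain B' S' where B': "h \<in> borel_measurable M" "B' > 0" "\<And>x. norm (h x) \<le> B'" "compact S'"
    "\<And>x. h x \<noteq> 0 \<Longrightarrow> x \<in> S'" by (rule bcsE[OF h]) blast
  note [measurable] = B(1) B'(1)
  have S: "S \<in> sets M" "S' \<in> sets M" using B(4) B'(4) by (simp_all add: sets_M borel_compact)
  have bd: "norm (G y1 y2 * u y1 * h y2) \<le> \<bar>C\<bar> * B * B'" for y1 y2
  proof (cases "u y1 = 0")
    case False
    then show ?thesis
      unfolding norm_mult using le[OF False, of y2] B(2) B(3)[of y1] B'(3)[of y2]
      by (intro mult_mono) auto
  qed (use B B' in simp)
  show ?thesis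
  proof (rule integrableI_bounded_set[where A = "S \<times> S'" and B = "\<bar>C\<bar> * B * B'"])
    show "S \<times> S' \<in> sets (M \<Otimes>\<^sub>M M)" using S by simp
    show "(\<lambda>(y1, y2). G y1 y2 * u y1 * h y2) \<in> borel_measurable (M \<Otimes>\<^sub>M M)"
    proof -
      have "(\<lambda>z. G (fst z) (snd z) * u (fst z) * h (snd z)) \<in> borel_measurable (M \<Otimes>\<^sub>M M)" by measurable
      then show ?thesis by (simp add: case_prod_unfold)
    qed
    show "emeasure (M \<Otimes>\<^sub>M M) (S \<times> S') < \<infinity>"
      using S emeasure_compact_finite[OF B(4)] emeasure_compact_finite[OF B'(4)]
      by (simp add: emeasure_pair_measure_Times ennreal_mult_less_top)
  qed (use bd B(5) B'(5) in \<open>auto intro!: AE_I2\<close>)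
qed

text \<open>The vanishing integral of \<open>u\<close> permits subtracting the kernel at the centre
  \<open>z\<close>, so smoothness in the first variable is enough. Since \<open>x\<close> is away
  from the support of \<open>u\<close>, the functions \<open>h j\<close> may live anywhere, also
  near \<open>x\<close>.\<close>

lemma T_sum_smooth:
  assumes u: "u \<in> bcs M" and mean: "(\<integral>y. u y \<partial>M) = 0" and "\<rho> > 0"
    and su: "\<And>y. u y \<noteq> 0 \<Longrightarrow> dist z y < \<rho>"
    and J: "finite J" "\<And>j. j \<in> J \<Longrightarrow> h j \<in> bcs M"
    and v: "\<And>y. (\<Sum>j\<in>J. norm (h j y)) \<le> v y"
  shows "AE x in M. tame v x \<longrightarrow> 2 * \<rho> \<le> dist x z \<longrightarrow>
    (\<Sum>j\<in>J. ennreal (norm (T u (h j) x)))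
    \<le> ennreal (CK * \<omega> (\<rho> / dist x z) * (2 * Cl\<^sup>2 / lam x (dist x z))) * (\<integral>\<^sup>+y. ennreal (norm (u y)) \<partial>M)"
proof -
  have "AE x in M. \<forall>j\<in>J. x \<notin> supp u \<inter> supp (h j) \<longrightarrow>
      T u (h j) x = (\<integral>(y1, y2). K x y1 y2 * u y1 * h j y2 \<partial>(M \<Otimes>\<^sub>M M))"
    using J u by (intro AE_finite_allI assoc) auto
  then show ?thesis
  proof (rule AE_mp, intro AE_I2 impI)
    fix x
    assume A: "\<forall>j\<in>J. x \<notin> supp u \<inter> supp (h j) \<longrightarrow>
      T u (h j) x = (\<integral>(y1, y2). K x y1 y2 * u y1 * h j y2 \<partial>(M \<Otimes>\<^sub>M M))"
      and tame: "tame v x" and xz: "2 * \<rho> \<le> dist x z"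
    define d where "d = dist x z"
    have d: "2 * \<rho> \<le> d" "d > 0" using xz \<open>\<rho> > 0\<close> by (auto simp: d_def)
    note [measurable] = K_section[of x] bcs_measurable[OF u] K_section1
    \<comment> \<open>The two kernel terms are integrable separately, because \<open>x\<close> has
      distance at least \<open>\<rho>\<close> from the points where \<open>u\<close> is nonzero and
      positive distance from \<open>z\<close>. Integrated in \<open>y1\<close>, the term frozen at
      \<open>z\<close> vanishes.\<close>
    define G where "G = (\<lambda>y1 y2. K x y1 y2 - K x z y2)"
    have Gm [measurable]: "(\<lambda>y. G (fst y) (snd y)) \<in> borel_measurable (M \<Otimes>\<^sub>M M)"
      unfolding G_def by measurable
    have far: "\<rho> \<le> dist x y" if "u y \<noteq> 0" for y
      using su[OF that] xz dist_triangle[of x z y] by (simp add: dist_commute)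
    have "x \<notin> supp u"
    proof
      assume "x \<in> supp u"
      then obtain y where "u y \<noteq> 0" "dist y x < \<rho>"
        using \<open>\<rho> > 0\<close> unfolding supp_def closure_approachable by blast
      then show False using far[of y] by (simp add: dist_commute)
    qed
    have eq: "T u (h j) x = (\<integral>(y1, y2). G y1 y2 * u y1 * h j y2 \<partial>(M \<Otimes>\<^sub>M M))" if j: "j \<in> J" for j
    proof -
      have hj: "h j \<in> bcs M" by (rule J(2)[OF j])
      note [measurable] = bcs_measurable[OF hj]
      have i1: "integrable (M \<Otimes>\<^sub>M M) (\<lambda>(y1, y2). K x y1 y2 * u y1 * h j y2)"
      proof (rule integrable_kernel_product[OF K_section u hj])
        fix y1 y2 assume "u y1 \<noteq> 0"
        then have D: "\<rho> \<le> max (dist x y1) (dist x y2)" using far[of y1] by simp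
        then have "norm (K x y1 y2) \<le> CK / (lam x (max (dist x y1) (dist x y2)))\<^sup>2"
          using \<open>\<rho> > 0\<close> by (intro K_size) linarith
        also have "\<dots> \<le> CK / (lam x \<rho>)\<^sup>2"
          using D \<open>\<rho> > 0\<close> CK
          by (intro divide_left_mono power_mono lam_mono mult_pos_pos zero_less_power lam_pos less_imp_le[OF lam_pos]) auto
        finally show "norm (K x y1 y2) \<le> CK / (lam x \<rho>)\<^sup>2" .
      qed
      have i2: "integrable (M \<Otimes>\<^sub>M M) (\<lambda>(y1, y2). K x z y2 * u y1 * h j y2)"
      proof (rule integrable_kernel_product[OF _ u hj])
        show "(\<lambda>y. K x z (snd y)) \<in> borel_measurable (M \<Otimes>\<^sub>M M)" by measurable
        fix y1 y2
        have D: "d \<le> max (dist x z) (dist x y2)" by (simp add: d_def)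
        then have "norm (K x z y2) \<le> CK / (lam x (max (dist x z) (dist x y2)))\<^sup>2"
          using d by (intro K_size) linarith
        also have "\<dots> \<le> CK / (lam x d)\<^sup>2"
          using D d CK
          by (intro divide_left_mono power_mono lam_mono mult_pos_pos zero_less_power lam_pos less_imp_le[OF lam_pos]) auto
        finally show "norm (K x z y2) \<le> CK / (lam x d)\<^sup>2" .
      qed
      have "(\<integral>(y1, y2). K x z y2 * u y1 * h j y2 \<partial>(M \<Otimes>\<^sub>M M)) = (\<integral>y2. \<integral>y1. K x z y2 * u y1 * h j y2 \<partial>M \<partial>M)"
        using i2 by (intro pair.integral_snd[symmetric])
      also have "\<dots> = (\<integral>y2. 0 \<partial>M)"
      proof (intro Bochner_Integration.integral_cong refl)
        fix y2
        have "(\<integral>y1. K x z y2 * u y1 * h j y2 \<partial>M) = K x z y2 * (\<integral>y1. u y1 \<partial>M) * h j y2"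
          using bcs_integrable[OF u] by simp
        then show "(\<integral>y1. K x z y2 * u y1 * h j y2 \<partial>M) = 0" using mean by simp
      qed
      finally have z: "(\<integral>(y1, y2). K x z y2 * u y1 * h j y2 \<partial>(M \<Otimes>\<^sub>M M)) = 0" by simp
      have "(\<integral>(y1, y2). G y1 y2 * u y1 * h j y2 \<partial>(M \<Otimes>\<^sub>M M))
          = (\<integral>y. (case y of (y1, y2) \<Rightarrow> K x y1 y2 * u y1 * h j y2) - (case y of (y1, y2) \<Rightarrow> K x z y2 * u y1 * h j y2) \<partial>(M \<Otimes>\<^sub>M M))"
        by (intro Bochner_Integration.integral_cong) (auto simp: G_def algebra_simps)
      also have "\<dots> = (\<integral>(y1, y2). K x y1 y2 * u y1 * h j y2 \<partial>(M \<Otimes>\<^sub>M M))"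
        using z by (subst Bochner_Integration.integral_diff[OF i1 i2]) simp
      also have "\<dots> = T u (h j) x" using A j \<open>x \<notin> supp u\<close> by simp
      finally show ?thesis by simp
    qed
    have "(\<Sum>j\<in>J. ennreal (norm (T u (h j) x)))
        \<le> (\<Sum>j\<in>J. \<integral>\<^sup>+y1. \<integral>\<^sup>+y2. ennreal (norm (G y1 y2 * u y1 * h j y2)) \<partial>M \<partial>M)"
    proof (intro sum_mono)
      fix j assume j: "j \<in> J"
      note [measurable] = bcs_measurable[OF J(2)[OF j]]
      show "ennreal (norm (T u (h j) x)) \<le> (\<integral>\<^sup>+y1. \<integral>\<^sup>+y2. ennreal (norm (G y1 y2 * u y1 * h j y2)) \<partial>M \<partial>M)"
        unfolding eq[OF j] by (rule norm_integral_pair_le) measurable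
    qed
    also have "\<dots> = (\<integral>\<^sup>+y1. \<integral>\<^sup>+y2. ennreal (norm (G y1 y2) * norm (u y1) * (\<Sum>j\<in>J. norm (h j y2))) \<partial>M \<partial>M)"
      using J by (intro sum_nn_integral_pair Gm) (auto intro: bcs_measurable u)
    also have "\<dots> \<le> ennreal (CK * \<omega> (\<rho> / d) * (2 * Cl\<^sup>2 / lam x d)) * (\<integral>\<^sup>+y. ennreal (norm (u y)) \<partial>M)"
    proof (rule kernel_integral_bound[OF tame \<open>d > 0\<close>])
      show "0 \<le> CK * \<omega> (\<rho> / d)" using CK \<open>\<rho> > 0\<close> d by (intro mult_nonneg_nonneg dini_nonneg[OF om]) auto
      fix y1 y2 assume "norm (u y1) \<noteq> 0"
      then have y1: "dist z y1 < \<rho>" using su by simp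
      define D where "D = max d (dist x y2)"
      have D: "d \<le> D" by (simp add: D_def)
      have "norm (K x z y2 - K x y1 y2) \<le> CK / (lam x D)\<^sup>2 * \<omega> (dist z y1 / D)"
        unfolding D_def d_def
        by (rule K_smooth1) (use d y1 in \<open>auto simp: d_def max_def\<close>)
      also have "\<dots> \<le> CK / (lam x D)\<^sup>2 * \<omega> (\<rho> / d)"
        using y1 D d CK \<open>\<rho> > 0\<close> by (intro mult_left_mono dini_mono[OF om] frac_le) auto
      finally show "norm (G y1 y2) \<le> CK * \<omega> (\<rho> / d) / (lam x (max d (dist x y2)))\<^sup>2"
        by (simp add: G_def D_def norm_minus_commute)
    qed (use v in \<open>auto intro: sum_nonneg bcs_measurable[OF u]\<close>)
    finally show "(\<Sum>j\<in>J. ennreal (norm (T u (h j) x)))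
      \<le> ennreal (CK * \<omega> (\<rho> / dist x z) * (2 * Cl\<^sup>2 / lam x (dist x z))) * (\<integral>\<^sup>+y. ennreal (norm (u y)) \<partial>M)"
      unfolding d_def .
  qed
qed

text \<open>Through this symmetry, estimates in which the first argument is localised or has
  integral zero yield those for the second argument. In the association the two integration
  variables are interchanged.\<close>

lemma cz_setting_flip: "cz_setting M lam Cl N (\<lambda>f g. T g f) (\<lambda>x y1 y2. K x y2 y1) p2 p1 p CT CK \<omega>"
proof
  show "1 < p" "1 < p2" "1 < p1" "1 / p = 1 / p2 + 1 / p1" "CT > 0" "CK > 0" "dini_modulus \<omega>"
    using p CT CK om by auto
  show "bilinear_ae M (Lp_space p2 M) (Lp_space p1 M) (\<lambda>f g. T g f)"
    using T_bilinear unfolding bilinear_ae_def by blast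
  show "T g f \<in> Lp_space p M" if "f \<in> Lp_space p2 M" "g \<in> Lp_space p1 M" for f g
    using T_Lp that by blast
  show "Lp_norm p M (T g f) \<le> CT * Lp_norm p2 M f * Lp_norm p1 M g"
    if "f \<in> Lp_space p2 M" "g \<in> Lp_space p1 M" for f g
    using T_bound[OF that(2,1)] by (simp add: mult_ac)
  show "(\<lambda>(x, y1, y2). K x y2 y1) \<in> borel_measurable (M \<Otimes>\<^sub>M M \<Otimes>\<^sub>M M)"
  proof -
    have "(\<lambda>z. (\<lambda>(x, y1, y2). K x y1 y2) (fst z, snd (snd z), fst (snd z))) \<in> borel_measurable (M \<Otimes>\<^sub>M M \<Otimes>\<^sub>M M)"
      by (rule measurable_compose[OF _ K_measurable]) measurable
    then show ?thesis by (simp add: case_prod_unfold)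
  qed
  show "norm (K x y2 y1) \<le> CK / (lam x (max (dist x y1) (dist x y2)))\<^sup>2"
    if "max (dist x y1) (dist x y2) > 0" for x y1 y2
    using K_size[of x y2 y1] that by (simp add: max.commute)
  show "norm (K x y2 y1 - K x y2 y1') \<le> CK / (lam x (max (dist x y1) (dist x y2)))\<^sup>2
        * \<omega> (dist y1 y1' / max (dist x y1) (dist x y2))"
    if "max (dist x y1) (dist x y2) > 0" "dist y1 y1' \<le> max (dist x y1) (dist x y2) / 2" for x y1 y1' y2
    using K_smooth2[of x y2 y1 y1'] that by (simp add: max.commute)
  show "norm (K x y2 y1 - K x y2' y1) \<le> CK / (lam x (max (dist x y1) (dist x y2)))\<^sup>2
        * \<omega> (dist y2 y2' / max (dist x y1) (dist x y2))"
    if "max (dist x y1) (dist x y2) > 0" "dist y2 y2' \<le> max (dist x y1) (dist x y2) / 2" for x y1 y2 y2'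
    using K_smooth1[of x y2 y1 y2'] that by (simp add: max.commute)
  show "AE x in M. x \<notin> supp f1 \<inter> supp f2 \<longrightarrow>
        T f2 f1 x = (\<integral>(y1, y2). K x y2 y1 * f1 y1 * f2 y2 \<partial>(M \<Otimes>\<^sub>M M))"
    if "f1 \<in> bcs M" "f2 \<in> bcs M" for f1 f2
    using assoc[OF that(2,1)]
  proof (rule AE_mp, intro AE_I2 impI)
    fix x assume 1: "x \<notin> supp f2 \<inter> supp f1 \<longrightarrow>
        T f2 f1 x = (\<integral>(y1, y2). K x y1 y2 * f2 y1 * f1 y2 \<partial>(M \<Otimes>\<^sub>M M))"
      and x: "x \<notin> supp f1 \<inter> supp f2"
    note [measurable] = K_section[of x] bcs_measurable[OF that(1)] bcs_measurable[OF that(2)]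
    have "T f2 f1 x = (\<integral>y. K x (fst y) (snd y) * f2 (fst y) * f1 (snd y) \<partial>(M \<Otimes>\<^sub>M M))"
      using 1 x by (auto simp: case_prod_unfold)
    also have "\<dots> = (\<integral>(y1, y2). (\<lambda>y. K x (fst y) (snd y) * f2 (fst y) * f1 (snd y)) (y2, y1) \<partial>(M \<Otimes>\<^sub>M M))"
      by (rule pair.integral_product_swap[symmetric]) measurable
    finally show "T f2 f1 x = (\<integral>(y1, y2). K x y2 y1 * f1 y1 * f2 y2 \<partial>(M \<Otimes>\<^sub>M M))"
      by (simp add: mult_ac)
  qed
qed

end

section \<open>The bad part of the operator\<close>

text \<open>The square is grouped by the larger of the two indices. The diagonal entry goes with the
  row, so the column part stops before \<open>k\<close>.\<close>

lemma sum_square_max: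
  fixes g :: "nat \<Rightarrow> nat \<Rightarrow> 'c::comm_monoid_add"
  shows "(\<Sum>i\<le>n. \<Sum>j\<le>n. g i j) = (\<Sum>k\<le>n. (\<Sum>j\<le>k. g k j) + (\<Sum>i<k. g i k))"
proof (induction n)
  case (Suc n)
  have "(\<Sum>i\<le>Suc n. \<Sum>j\<le>Suc n. g i j)
      = (\<Sum>i\<le>n. \<Sum>j\<le>n. g i j) + (\<Sum>i\<le>n. g i (Suc n)) + (\<Sum>j\<le>Suc n. g (Suc n) j)"
    by (simp add: sum.distrib add_ac)
  also have "\<dots> = (\<Sum>k\<le>Suc n. (\<Sum>j\<le>k. g k j) + (\<Sum>i<k. g i k))"
    unfolding Suc.IH by (simp add: add_ac lessThan_Suc_atMost)
  finally show ?case .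
qed simp

text \<open>The error charged to ball \<open>k\<close> at a fixed point. In the application
  \<open>t\<close> stands for the values of \<open>T\<close> on two original pieces,
  \<open>q\<close> for the first one flattened, \<open>s\<close> for both flattened. If the ball is
  far, each replacement costs a difference; if it is near, original and flattened terms are
  estimated separately, and the flattened terms with smaller indices are kept inside the norm as one
  sum.\<close>

definition pair_error ::
    "(nat \<Rightarrow> bool) \<Rightarrow> (nat \<Rightarrow> nat \<Rightarrow> 'c) \<Rightarrow> (nat \<Rightarrow> nat \<Rightarrow> 'c) \<Rightarrow> (nat \<Rightarrow> nat \<Rightarrow> 'c::real_normed_vector) \<Rightarrow> nat \<Rightarrow> nat \<Rightarrow> real" where
  "pair_error near t q s n k = (if near k
      then (\<Sum>j\<le>n. norm (t k j)) + (\<Sum>i\<le>n. norm (t i k)) +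
        (\<Sum>j\<in>{j. j \<le> n \<and> k < j \<and> \<not> near j}. norm (s k j)) +
        (\<Sum>i\<in>{i. i \<le> n \<and> k < i \<and> \<not> near i}. norm (s i k)) +
        norm (\<Sum>j\<le>k. s k j) + norm (\<Sum>i<k. s i k)
      else (\<Sum>j\<le>n. norm (t k j - q k j)) + (\<Sum>i\<le>n. norm (q i k - s i k)))"

text \<open>Each pair is assigned to the ball with the larger index, which has the larger radius. This
  makes the sums of the \<open>s k j\<close> and \<open>s i k\<close> over near balls independent of the point at which
  the operator is evaluated.\<close>

lemma pair_splitting:
  fixes t q s :: "nat \<Rightarrow> nat \<Rightarrow> 'c::real_normed_vector"
  assumes near0: "\<not> near 0" and t0: "\<And>j. t 0 j = q 0 j" and q0: "\<And>i. q i 0 = s i 0"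
  shows "norm (\<Sum>i\<le>n. \<Sum>j\<le>n. t i j) \<le> norm (\<Sum>i\<le>n. \<Sum>j\<le>n. s i j) +
    (\<Sum>k\<in>{1..n}. pair_error near t q s n k)"
proof -
  \<comment> \<open>Entrywise \<open>t = s + e - m\<close>. If the larger index is near,
    \<open>s\<close> has to be taken out again, and \<open>m\<close> collects these entries into
    whole rows and columns up to the diagonal. \<open>a\<close> and \<open>a'\<close> charge the
    first and second argument; \<open>b\<close> and \<open>b'\<close> take the entry
    \<open>s\<close> of the mixed pairs whose smaller index is near and whose larger index is
    not.\<close>
  define e where "e = (\<lambda>i j. if near (max i j) then t i j else t i j - s i j)"
  define m where "m = (\<lambda>i j. if near (max i j) then s i j else 0)"
  define a where "a = (\<lambda>i j. if near i then norm (t i j) else norm (t i j - q i j))"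
  define a' where "a' = (\<lambda>i j. if near j then norm (t i j) else norm (q i j - s i j))"
  define b where "b = (\<lambda>i j. if near i \<and> i < j \<and> \<not> near j then norm (s i j) else 0)"
  define b' where "b' = (\<lambda>i j. if near j \<and> j < i \<and> \<not> near i then norm (s i j) else 0)"
  have split: "(\<Sum>k\<le>n. F k) = (\<Sum>k\<in>{1..n}. F k)" if "F 0 = 0" for F :: "nat \<Rightarrow> real"
  proof -
    have "{..n} = insert 0 {1..n}" by auto
    then show ?thesis using that by simp
  qed
  have "(\<Sum>i\<le>n. \<Sum>j\<le>n. t i j) = (\<Sum>i\<le>n. \<Sum>j\<le>n. s i j + e i j - m i j)"
    by (intro sum.cong) (auto simp: e_def m_def)
  also have "\<dots> = (\<Sum>i\<le>n. \<Sum>j\<le>n. s i j) + (\<Sum>i\<le>n. \<Sum>j\<le>n. e i j) - (\<Sum>i\<le>n. \<Sum>j\<le>n. m i j)"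
    by (simp add: sum.distrib sum_subtractf)
  finally have sm: "(\<Sum>i\<le>n. \<Sum>j\<le>n. t i j)
      = (\<Sum>i\<le>n. \<Sum>j\<le>n. s i j) + (\<Sum>i\<le>n. \<Sum>j\<le>n. e i j) - (\<Sum>i\<le>n. \<Sum>j\<le>n. m i j)" .
  have "norm (\<Sum>i\<le>n. \<Sum>j\<le>n. t i j) \<le> norm (\<Sum>i\<le>n. \<Sum>j\<le>n. s i j)
      + norm (\<Sum>i\<le>n. \<Sum>j\<le>n. e i j) + norm (\<Sum>i\<le>n. \<Sum>j\<le>n. m i j)"
  proof -
    have "norm (X + Y - Z) \<le> norm X + norm Y + norm Z" for X Y Z :: 'c
      using norm_triangle_ineq[of X Y] norm_triangle_ineq4[of "X + Y" Z] by linarith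
    then show ?thesis unfolding sm .
  qed
  moreover have "norm (\<Sum>i\<le>n. \<Sum>j\<le>n. e i j) \<le> (\<Sum>i\<le>n. \<Sum>j\<le>n. a i j + a' i j + b i j + b' i j)"
  proof (intro sum_norm_le)
    fix i j
    have tri: "norm (t i j - s i j) \<le> norm (t i j - q i j) + norm (q i j - s i j)"
      using norm_triangle_ineq[of "t i j - q i j" "q i j - s i j"] by simp
    have tri2: "norm (t i j - s i j) \<le> norm (t i j) + norm (s i j)" by (rule norm_triangle_ineq4)
    show "norm (e i j) \<le> a i j + a' i j + b i j + b' i j"
    proof (cases "near (max i j)")
      case True
      then have "near i \<or> near j" by (auto simp: max_def split: if_splits)
      moreover have "norm (e i j) = norm (t i j)" using True by (simp add: e_def)
      ultimately show ?thesis by (auto simp: a_def a'_def b_def b'_def)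
    next
      case False
      then have eq: "norm (e i j) = norm (t i j - s i j)" by (simp add: e_def)
      consider "\<not> near i" "\<not> near j" | "near i" "\<not> near j" | "near j" "\<not> near i"
        using False by (auto simp: max_def split: if_splits)
      then show ?thesis
      proof cases
        case 1
        then show ?thesis unfolding eq using tri by (simp add: a_def a'_def b_def b'_def)
      next
        case 2
        then have "i \<noteq> j" by auto
        then have "i < j" using 2 False by (auto simp: max_def split: if_splits)
        then have "b i j = norm (s i j)" "a i j = norm (t i j)" "a' i j \<ge> 0" "b' i j \<ge> 0"
          using 2 by (auto simp: a_def a'_def b_def b'_def)
        then show ?thesis unfolding eq using tri2 by linarith
      next
        case 3
        then have "i \<noteq> j" by auto
        then have "j < i" using 3 False by (auto simp: max_def split: if_splits)
        then have "b' i j = norm (s i j)" "a' i j = norm (t i j)" "a i j \<ge> 0" "b i j \<ge> 0"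
          using 3 by (auto simp: a_def a'_def b_def b'_def)
        then show ?thesis unfolding eq using tri2 by linarith
      qed
    qed
  qed
  moreover have "(\<Sum>i\<le>n. \<Sum>j\<le>n. a i j + a' i j + b i j + b' i j) =
      (\<Sum>k\<in>{1..n}. \<Sum>j\<le>n. a k j) + (\<Sum>k\<in>{1..n}. \<Sum>i\<le>n. a' i k)
      + (\<Sum>k\<in>{1..n}. \<Sum>j\<le>n. b k j) + (\<Sum>k\<in>{1..n}. \<Sum>i\<le>n. b' i k)"
  proof -
    \<comment> \<open>Row 0 contributes nothing, since the part with index 0 is not modified and is
      never near.\<close>
    have "(\<Sum>i\<le>n. \<Sum>j\<le>n. a i j) = (\<Sum>k\<in>{1..n}. \<Sum>j\<le>n. a k j)"
      by (rule split) (simp add: a_def near0 t0)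
    moreover have "(\<Sum>i\<le>n. \<Sum>j\<le>n. a' i j) = (\<Sum>k\<in>{1..n}. \<Sum>i\<le>n. a' i k)"
      by (subst sum.swap, rule split) (simp add: a'_def near0 q0)
    moreover have "(\<Sum>i\<le>n. \<Sum>j\<le>n. b i j) = (\<Sum>k\<in>{1..n}. \<Sum>j\<le>n. b k j)"
      by (rule split) (simp add: b_def near0)
    moreover have "(\<Sum>i\<le>n. \<Sum>j\<le>n. b' i j) = (\<Sum>k\<in>{1..n}. \<Sum>i\<le>n. b' i k)"
      by (subst sum.swap, rule split) (simp add: b'_def near0)
    ultimately show ?thesis by (simp add: sum.distrib)
  qed
  moreover have "norm (\<Sum>i\<le>n. \<Sum>j\<le>n. m i j)
      \<le> (\<Sum>k\<in>{1..n}. if near k then norm (\<Sum>j\<le>k. s k j) + norm (\<Sum>i<k. s i k) else 0)"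
  proof -
    have "(\<Sum>i\<le>n. \<Sum>j\<le>n. m i j) = (\<Sum>k\<le>n. (\<Sum>j\<le>k. m k j) + (\<Sum>i<k. m i k))"
      by (rule sum_square_max)
    also have "\<dots> = (\<Sum>k\<le>n. if near k then (\<Sum>j\<le>k. s k j) + (\<Sum>i<k. s i k) else 0)"
      by (intro sum.cong) (auto simp: m_def max_def intro!: arg_cong2[where f = plus] sum.cong)
    finally have "norm (\<Sum>i\<le>n. \<Sum>j\<le>n. m i j)
        \<le> (\<Sum>k\<le>n. if near k then norm (\<Sum>j\<le>k. s k j) + norm (\<Sum>i<k. s i k) else 0)"
      by (auto intro!: sum_norm_le norm_triangle_ineq)
    then show ?thesis by (subst (asm) split) (auto simp: near0)
  qed
  moreover have "(\<Sum>k\<in>{1..n}. pair_error near t q s n k)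
    = (\<Sum>k\<in>{1..n}. (\<Sum>j\<le>n. a k j) + (\<Sum>i\<le>n. a' i k) + (\<Sum>j\<le>n. b k j) + (\<Sum>i\<le>n. b' i k)
      + (if near k then norm (\<Sum>j\<le>k. s k j) + norm (\<Sum>i<k. s i k) else 0))"
  proof (intro sum.cong refl)
    fix k
    have "(\<Sum>j\<le>n. b k j) = (if near k then (\<Sum>j\<in>{j. j \<le> n \<and> k < j \<and> \<not> near j}. norm (s k j)) else 0)"
    proof -
      have "(\<Sum>j\<in>{j. j \<le> n \<and> k < j \<and> \<not> near j}. norm (s k j))
          = (\<Sum>j\<in>{j\<in>{..n}. k < j \<and> \<not> near j}. norm (s k j))" by (rule sum.cong) auto
      also have "\<dots> = (\<Sum>j\<le>n. if k < j \<and> \<not> near j then norm (s k j) else 0)" by (rule sum.inter_filter) simp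
      finally show ?thesis by (auto simp: b_def)
    qed
    moreover have "(\<Sum>i\<le>n. b' i k) = (if near k then (\<Sum>i\<in>{i. i \<le> n \<and> k < i \<and> \<not> near i}. norm (s i k)) else 0)"
    proof -
      have "(\<Sum>i\<in>{i. i \<le> n \<and> k < i \<and> \<not> near i}. norm (s i k))
          = (\<Sum>i\<in>{i\<in>{..n}. k < i \<and> \<not> near i}. norm (s i k))" by (rule sum.cong) auto
      also have "\<dots> = (\<Sum>i\<le>n. if k < i \<and> \<not> near i then norm (s i k) else 0)" by (rule sum.inter_filter) simp
      finally show ?thesis by (auto simp: b'_def)
    qed
    ultimately show "pair_error near t q s n k =
      (\<Sum>j\<le>n. a k j) + (\<Sum>i\<le>n. a' i k) + (\<Sum>j\<le>n. b k j) + (\<Sum>i\<le>n. b' i k)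
      + (if near k then norm (\<Sum>j\<le>k. s k j) + norm (\<Sum>i<k. s i k) else 0)"
      by (simp add: a_def a'_def pair_error_def)
  qed
  moreover have "(\<Sum>k\<in>{1..n}. (\<Sum>j\<le>n. a k j) + (\<Sum>i\<le>n. a' i k) + (\<Sum>j\<le>n. b k j) + (\<Sum>i\<le>n. b' i k)
      + (if near k then norm (\<Sum>j\<le>k. s k j) + norm (\<Sum>i<k. s i k) else 0))
    = (\<Sum>k\<in>{1..n}. \<Sum>j\<le>n. a k j) + (\<Sum>k\<in>{1..n}. \<Sum>i\<le>n. a' i k)
      + (\<Sum>k\<in>{1..n}. \<Sum>j\<le>n. b k j) + (\<Sum>k\<in>{1..n}. \<Sum>i\<le>n. b' i k)
      + (\<Sum>k\<in>{1..n}. if near k then norm (\<Sum>j\<le>k. s k j) + norm (\<Sum>i<k. s i k) else 0)"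
    by (simp only: sum.distrib)
  ultimately show ?thesis by linarith
qed

text \<open>\<open>w\<close> measures both functions at once and all sizes refer to the one number
  \<open>W\<close>, so nothing distinguishes the two arguments. \<open>w_le\<close> holds at every
  point outside the cells: the leftover of the cover is to be cut off from the functions
  beforehand.\<close>

locale cz_decomposition = cz_setting M lam Cl N T K p1 p2 p CT CK \<omega>
  for M :: "'a::metric_space measure" and lam :: "'a \<Rightarrow> real \<Rightarrow> real" and Cl :: real and N :: nat
    and T :: "('a, 'b::{real_normed_field,banach,second_countable_topology}) bilinear_op"
    and K :: "'a \<Rightarrow> 'a \<Rightarrow> 'a \<Rightarrow> 'b" and p1 p2 p CT CK :: real and \<omega> :: "real \<Rightarrow> real" +
  fixes f1 f2 :: "'a \<Rightarrow> 'b" and w :: "'a \<Rightarrow> real" and n :: nat and c :: "nat \<Rightarrow> 'a"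
    and r \<rho> :: "nat \<Rightarrow> real" and V A :: "nat \<Rightarrow> 'a set" and J :: "nat \<Rightarrow> 'a \<Rightarrow> ennreal"
    and m :: "nat \<Rightarrow> real" and W S :: real
  assumes f: "f1 \<in> bcs M" "f2 \<in> bcs M" and w: "\<And>y. w y = norm (f1 y) + norm (f2 y)"
    and S: "S \<ge> 0" "(\<Sum>k. ennreal (\<omega> (1 / 2 ^ Suc k))) \<le> ennreal S"
    and balls: "\<And>i. i \<in> {1..n} \<Longrightarrow> cz_ball (c i) (r i) (\<rho> i) (V i) (A i) (J i)"
    and rho_mono: "\<And>i j. i \<in> {1..n} \<Longrightarrow> j \<in> {1..n} \<Longrightarrow> i \<le> j \<Longrightarrow> \<rho> i \<le> \<rho> j"
    and V_disjoint: "disjoint_family_on V {1..n}"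
    and alloc: "\<And>y. (\<Sum>i\<in>{1..n}. m i / measure M (A i) * indicator (A i) y) \<le> 6 * beta"
    and exceptional: "emeasure M (\<Union>i\<in>{1..n}. ball (c i) (2 * r i)) \<le> ennreal W"
    and m_ge: "\<And>i. i \<in> {1..n} \<Longrightarrow> (\<integral>y. indicator (V i) y * w y \<partial>M) \<le> m i"
    and m_sum: "(\<Sum>i\<in>{1..n}. m i) \<le> W" and W_ge: "(\<integral>y. w y \<partial>M) \<le> W"
    and w_le: "\<And>y. y \<notin> (\<Union>i\<in>{1..n}. V i) \<Longrightarrow> w y \<le> 2 * beta"
begin

text \<open>Balls, cells and masses are common to both functions, so exchanging \<open>f1\<close>
  and \<open>f2\<close> changes none of them. Interpreting the locale once more gives the second
  half of all estimates.\<close>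

lemma cz_decomposition_flip:
  "cz_decomposition M lam Cl N (\<lambda>f g. T g f) (\<lambda>x y1 y2. K x y2 y1) p2 p1 p CT CK \<omega>
    f2 f1 w n c r \<rho> V A J m W S"
  by (intro cz_decomposition.intro cz_setting_flip cz_decomposition_axioms.intro;
      (fact f S balls rho_mono V_disjoint alloc exceptional m_ge m_sum W_ge w_le)?)
    (simp add: w)

section \<open>Cells, pieces and flattened pieces\<close>

lemma
  assumes "i \<in> {1..n}"
  shows r_pos: "0 < r i" and rho_ge: "16 * r i \<le> \<rho> i"
    and V_sets: "V i \<in> sets borel" and V_sub: "V i \<subseteq> ball (c i) (r i)"
    and A_compact: "compact (A i)" and A_sub: "A i \<subseteq> ball (c i) (\<rho> i)"
    and R_pos: "0 < measure M (ball (c i) (\<rho> i))"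
    and R_le: "measure M (ball (c i) (\<rho> i)) \<le> 4 * measure M (A i)"
    and R_doubling: "doubling_ball (c i) (\<rho> i)"
    and J_measurable: "J i \<in> borel_measurable M"
    and J_integral: "(\<integral>\<^sup>+y. J i y \<partial>M) \<le> ennreal (3 * Cl ^ 5)"
    and J_ge: "\<And>y. 2 * r i \<le> dist y (c i) \<Longrightarrow> dist y (c i) < 2 * \<rho> i \<Longrightarrow>
      ennreal (1 / lam y (dist y (c i))) \<le> J i y"
  using balls[OF assms] by (simp_all add: cz_ball_def)

text \<open>Index \<open>0\<close> stands for the part outside all \<open>V i\<close>, which is not modified: \<open>flat f 0 = piece f 0\<close>.
  It behaves like a piece on an empty ball, smaller than all others. For the other indices, \<open>flat f k\<close>
  spreads the integral of \<open>f\<close> over \<open>V k\<close> evenly over \<open>A k\<close>.\<close>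

definition cell :: "nat \<Rightarrow> 'a set" where
  "cell k = (if k = 0 then - (\<Union>i\<in>{1..n}. V i) else V k)"

definition piece :: "('a \<Rightarrow> 'b) \<Rightarrow> nat \<Rightarrow> 'a \<Rightarrow> 'b" where
  "piece f k = (\<lambda>y. indicator (cell k) y *\<^sub>R f y)"

definition avg :: "('a \<Rightarrow> 'b) \<Rightarrow> nat \<Rightarrow> 'b" where
  "avg f k = (1 / measure M (A k)) *\<^sub>R (\<integral>y. piece f k y \<partial>M)"

definition flat :: "('a \<Rightarrow> 'b) \<Rightarrow> nat \<Rightarrow> 'a \<Rightarrow> 'b" where
  "flat f k = (if k = 0 then piece f 0 else (\<lambda>y. indicator (A k) y *\<^sub>R avg f k))"

text \<open>A single weight of mass at most \<open>2 * W\<close> that dominates the sums of norms of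
  all pieces and of all flattened pieces. One exceptional set therefore makes all occurring families
  \<open>tame\<close>.\<close>

definition v :: "'a \<Rightarrow> real" where
  "v y = w y + (\<Sum>i\<in>{1..n}. m i / measure M (A i) * indicator (A i) y)"

lemma A_sets: "i \<in> {1..n} \<Longrightarrow> A i \<in> sets M"
  using A_compact by (simp add: sets_M borel_compact)

lemma A_pos: "i \<in> {1..n} \<Longrightarrow> measure M (A i) > 0"
  using R_pos[of i] R_le[of i] by linarith

lemma emeasure_A: "i \<in> {1..n} \<Longrightarrow> emeasure M (A i) = ennreal (measure M (A i))"
  using emeasure_compact_finite[OF A_compact[of i]] by (simp add: emeasure_eq_ennreal_measure less_top)

lemma rho_pos: "i \<in> {1..n} \<Longrightarrow> \<rho> i > 0"
  using r_pos[of i] rho_ge[of i] by linarith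

lemma cell_sets: "k \<le> n \<Longrightarrow> cell k \<in> sets M"
proof -
  assume "k \<le> n"
  have "- (\<Union>i\<in>{1..n}. V i) \<in> sets borel"
    by (intro borel_comp sets.finite_UN V_sets) auto
  then show ?thesis using V_sets[of k] \<open>k \<le> n\<close> by (simp add: cell_def sets_M)
qed

lemma sum_cell: "(\<Sum>k\<le>n. indicator (cell k) y) = (1::real)"
proof -
  have "(\<Sum>k\<le>n. indicator (cell k) y :: real) = indicator (cell 0) y + (\<Sum>k\<in>{1..n}. indicator (cell k) y)"
  proof -
    have "{..n} = insert 0 {1..n}" by auto
    then show ?thesis by simp
  qed
  also have "(\<Sum>k\<in>{1..n}. indicator (cell k) y :: real) = (\<Sum>k\<in>{1..n}. indicator (V k) y)"
    by (intro sum.cong) (auto simp: cell_def)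
  also have "\<dots> = indicator (\<Union>k\<in>{1..n}. V k) y"
    using V_disjoint by (intro indicator_UN_disjoint[symmetric]) auto
  finally show ?thesis by (simp add: cell_def indicator_def)
qed

lemma w_measurable [measurable]: "w \<in> borel_measurable M"
proof -
  note [measurable] = bcs_measurable[OF f(1)] bcs_measurable[OF f(2)]
  have "(\<lambda>y. norm (f1 y) + norm (f2 y)) \<in> borel_measurable M" by measurable
  then show ?thesis by (simp add: w[abs_def])
qed

lemma w_nonneg: "w y \<ge> 0"
  by (simp add: w)

lemma w_integrable: "integrable M w"
  unfolding w[abs_def] using bcs_integrable[OF f(1)] bcs_integrable[OF f(2)]
  by (intro Bochner_Integration.integrable_add integrable_norm)

lemma m_nonneg: "i \<in> {1..n} \<Longrightarrow> m i \<ge> 0"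
proof -
  assume i: "i \<in> {1..n}"
  have "0 \<le> (\<integral>y. indicator (V i) y * w y \<partial>M)" using w_nonneg by (intro integral_nonneg_AE) auto
  then show ?thesis using m_ge[OF i] by linarith
qed

lemma W_nonneg: "W \<ge> 0"
  using m_nonneg m_sum sum_nonneg[of "{1..n}" m] by simp

lemma v_nonneg: "v y \<ge> 0"
  unfolding v_def using w_nonneg m_nonneg by (intro add_nonneg_nonneg sum_nonneg mult_nonneg_nonneg) auto

lemma v_measurable [measurable]: "v \<in> borel_measurable M"
  unfolding v_def[abs_def] using A_sets by measurable

lemma v_nn_integral: "(\<integral>\<^sup>+y. ennreal (v y) \<partial>M) \<le> ennreal (2 * W)"
proof -
  have tm: "(\<lambda>y. ennreal (m i / measure M (A i)) * indicator (A i) y) \<in> borel_measurable M" if "i \<in> {1..n}" for i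
  proof -
    note [measurable] = A_sets[OF that]
    show ?thesis by measurable
  qed
  have "(\<integral>\<^sup>+y. ennreal (v y) \<partial>M)
      = (\<integral>\<^sup>+y. ennreal (w y) + (\<Sum>i\<in>{1..n}. ennreal (m i / measure M (A i)) * indicator (A i) y) \<partial>M)"
  proof (intro nn_integral_cong)
    fix y
    have "ennreal (v y) = ennreal (w y) + ennreal (\<Sum>i\<in>{1..n}. m i / measure M (A i) * indicator (A i) y)"
      unfolding v_def using w_nonneg m_nonneg
      by (intro ennreal_plus sum_nonneg mult_nonneg_nonneg) auto
    also have "ennreal (\<Sum>i\<in>{1..n}. m i / measure M (A i) * indicator (A i) y)
        = (\<Sum>i\<in>{1..n}. ennreal (m i / measure M (A i) * indicator (A i) y))"
      using m_nonneg by (intro sum_ennreal[symmetric] mult_nonneg_nonneg) auto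
    also have "\<dots> = (\<Sum>i\<in>{1..n}. ennreal (m i / measure M (A i)) * indicator (A i) y)"
      by (intro sum.cong) (auto simp: indicator_def)
    finally show "ennreal (v y) = ennreal (w y) + (\<Sum>i\<in>{1..n}. ennreal (m i / measure M (A i)) * indicator (A i) y)" .
  qed
  also have "\<dots> = (\<integral>\<^sup>+y. ennreal (w y) \<partial>M)
      + (\<integral>\<^sup>+y. (\<Sum>i\<in>{1..n}. ennreal (m i / measure M (A i)) * indicator (A i) y) \<partial>M)"
    by (intro nn_integral_add borel_measurable_sum tm) measurable
  also have "(\<integral>\<^sup>+y. (\<Sum>i\<in>{1..n}. ennreal (m i / measure M (A i)) * indicator (A i) y) \<partial>M)
      = (\<Sum>i\<in>{1..n}. \<integral>\<^sup>+y. ennreal (m i / measure M (A i)) * indicator (A i) y \<partial>M)"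
    by (intro nn_integral_sum tm)
  also have "\<dots> = (\<Sum>i\<in>{1..n}. ennreal (m i))"
  proof (intro sum.cong refl)
    fix i assume i: "i \<in> {1..n}"
    show "(\<integral>\<^sup>+y. ennreal (m i / measure M (A i)) * indicator (A i) y \<partial>M) = ennreal (m i)"
      using A_sets[OF i] A_pos[OF i] m_nonneg[OF i]
      by (simp add: nn_integral_cmult_indicator emeasure_A[OF i] flip: ennreal_mult)
  qed
  also have "\<dots> = ennreal (\<Sum>i\<in>{1..n}. m i)" using m_nonneg by (intro sum_ennreal)
  also have "(\<integral>\<^sup>+y. ennreal (w y) \<partial>M) = ennreal (\<integral>y. w y \<partial>M)"
    using w_integrable w_nonneg by (intro nn_integral_eq_integral) auto
  also have "ennreal (\<integral>y. w y \<partial>M) + ennreal (\<Sum>i\<in>{1..n}. m i) \<le> ennreal W + ennreal W"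
    using m_sum W_ge by (intro add_mono ennreal_leI)
  also have "\<dots> = ennreal (2 * W)" using W_nonneg by (simp flip: ennreal_plus)
  finally show ?thesis .
qed

lemma v_finite_measure: "finite_measure (density M (\<lambda>y. ennreal (v y)))"
proof (rule finite_measureI)
  have "emeasure (density M (\<lambda>y. ennreal (v y))) UNIV \<le> ennreal (2 * W)"
    using v_nn_integral by (subst emeasure_density) (auto simp: sets_M)
  then show "emeasure (density M (\<lambda>y. ennreal (v y))) (space (density M (\<lambda>y. ennreal (v y)))) \<noteq> \<infinity>"
    by (auto simp: top_unique)
qed

lemma dominated: "norm (f1 y) \<le> w y" "norm (f2 y) \<le> w y"
  by (simp_all add: w)

lemma piece_bcs: "f \<in> bcs M \<Longrightarrow> k \<le> n \<Longrightarrow> piece f k \<in> bcs M"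
  unfolding piece_def by (intro bcs_indicator cell_sets)

lemma sum_piece: "(\<Sum>k\<le>n. piece f k y) = f y"
  unfolding piece_def by (simp only: scaleR_sum_left[symmetric] sum_cell scaleR_one)

lemma sum_norm_piece: "(\<Sum>k\<le>n. norm (piece f k y)) = norm (f y)"
proof -
  have "(\<Sum>k\<le>n. norm (piece f k y)) = (\<Sum>k\<le>n. indicator (cell k) y) * norm (f y)"
    unfolding piece_def by (simp add: sum_distrib_right)
  then show ?thesis by (simp add: sum_cell)
qed

lemma flat_bcs: "f \<in> bcs M \<Longrightarrow> k \<le> n \<Longrightarrow> flat f k \<in> bcs M"
  by (cases "k = 0") (auto simp: flat_def intro!: piece_bcs bcs_const A_compact)

lemma piece_nn_integral:
  assumes "f \<in> bcs M" "\<And>y. norm (f y) \<le> w y" "k \<in> {1..n}"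
  shows "(\<integral>\<^sup>+y. ennreal (norm (piece f k y)) \<partial>M) \<le> ennreal (m k)"
proof -
  have [measurable]: "V k \<in> sets M" using V_sets[OF assms(3)] by (simp add: sets_M)
  have i: "integrable M (\<lambda>y. indicator (V k) y * w y)"
    using integrable_mult_indicator[OF _ w_integrable, of "V k"] by simp
  have "(\<integral>\<^sup>+y. ennreal (norm (piece f k y)) \<partial>M) \<le> (\<integral>\<^sup>+y. ennreal (indicator (V k) y * w y) \<partial>M)"
    using assms by (intro nn_integral_mono ennreal_leI) (auto simp: piece_def cell_def indicator_def)
  also have "\<dots> = ennreal (\<integral>y. indicator (V k) y * w y \<partial>M)"
    using i w_nonneg by (intro nn_integral_eq_integral) auto
  also have "\<dots> \<le> ennreal (m k)" using m_ge[OF assms(3)] by (rule ennreal_leI)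
  finally show ?thesis .
qed

lemma norm_avg:
  assumes "f \<in> bcs M" "\<And>y. norm (f y) \<le> w y" "k \<in> {1..n}"
  shows "norm (avg f k) \<le> m k / measure M (A k)"
proof -
  have k: "k \<le> n" using assms(3) by simp
  have "ennreal (norm (\<integral>y. piece f k y \<partial>M)) \<le> ennreal (m k)"
    using integral_norm_bound_ennreal[OF bcs_integrable[OF piece_bcs[OF assms(1) k]]]
      piece_nn_integral[OF assms] order_trans by blast
  then have "norm (\<integral>y. piece f k y \<partial>M) \<le> m k" using m_nonneg[OF assms(3)] by simp
  then show ?thesis using A_pos[OF assms(3)] by (simp add: avg_def divide_right_mono)
qed

lemma norm_flat:
  assumes "f \<in> bcs M" "\<And>y. norm (f y) \<le> w y" "k \<in> {1..n}"
  shows "norm (flat f k y) \<le> m k / measure M (A k) * indicator (A k) y"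
  using norm_avg[OF assms] assms(3) by (simp add: flat_def indicator_def)

lemma flat_nn_integral:
  assumes "f \<in> bcs M" "\<And>y. norm (f y) \<le> w y" "k \<in> {1..n}"
  shows "(\<integral>\<^sup>+y. ennreal (norm (flat f k y)) \<partial>M) \<le> ennreal (m k)"
proof -
  have "(\<integral>\<^sup>+y. ennreal (norm (flat f k y)) \<partial>M)
      \<le> (\<integral>\<^sup>+y. ennreal (m k / measure M (A k)) * indicator (A k) y \<partial>M)"
  proof (intro nn_integral_mono)
    fix y
    have "ennreal (norm (flat f k y)) \<le> ennreal (m k / measure M (A k) * indicator (A k) y)"
      by (intro ennreal_leI norm_flat assms)
    then show "ennreal (norm (flat f k y)) \<le> ennreal (m k / measure M (A k)) * indicator (A k) y"
      by (cases "y \<in> A k") auto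
  qed
  also have "\<dots> = ennreal (m k)"
    using A_sets[OF assms(3)] A_pos[OF assms(3)] m_nonneg[OF assms(3)]
    by (simp add: nn_integral_cmult_indicator emeasure_A[OF assms(3)] flip: ennreal_mult)
  finally show ?thesis .
qed

lemma integral_flat:
  assumes "k \<in> {1..n}"
  shows "(\<integral>y. flat f k y \<partial>M) = (\<integral>y. piece f k y \<partial>M)"
proof -
  have "(\<integral>y. flat f k y \<partial>M) = (\<integral>y. indicator (A k) y *\<^sub>R avg f k \<partial>M)"
    using assms by (simp add: flat_def)
  also have "\<dots> = measure M (A k) *\<^sub>R avg f k"
    using A_sets[OF assms] emeasure_compact_finite[OF A_compact[OF assms]] by simp
  also have "\<dots> = (\<integral>y. piece f k y \<partial>M)" using A_pos[OF assms] by (simp add: avg_def)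
  finally show ?thesis .
qed

lemma sum_norm_flat:
  assumes "f \<in> bcs M" "\<And>y. norm (f y) \<le> w y"
  shows "(\<Sum>k\<le>n. norm (flat f k y)) \<le> norm (piece f 0 y) + (\<Sum>i\<in>{1..n}. m i / measure M (A i) * indicator (A i) y)"
proof -
  have "{..n} = insert 0 {1..n}" by auto
  then have "(\<Sum>k\<le>n. norm (flat f k y)) = norm (flat f 0 y) + (\<Sum>k\<in>{1..n}. norm (flat f k y))" by simp
  also have "\<dots> \<le> norm (piece f 0 y) + (\<Sum>i\<in>{1..n}. m i / measure M (A i) * indicator (A i) y)"
    using assms by (intro add_mono sum_mono norm_flat) (auto simp: flat_def)
  finally show ?thesis .
qed

lemma sum_norm_flat_le_v:
  assumes "f \<in> bcs M" "\<And>y. norm (f y) \<le> w y"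
  shows "(\<Sum>k\<le>n. norm (flat f k y)) \<le> v y"
proof -
  have "norm (piece f 0 y) \<le> w y"
    using assms(2)[of y] w_nonneg[of y] by (simp add: piece_def indicator_def)
  then show ?thesis using sum_norm_flat[OF assms, of y] by (simp add: v_def)
qed

text \<open>The part outside the cells contributes \<open>2 * beta\<close> and the allocation on the
  sets \<open>A i\<close> contributes \<open>6 * beta\<close>.\<close>

lemma sum_norm_flat_le:
  assumes "f \<in> bcs M" "\<And>y. norm (f y) \<le> w y"
  shows "(\<Sum>k\<le>n. norm (flat f k y)) \<le> 8 * beta"
proof -
  have "norm (piece f 0 y) \<le> 2 * beta"
    using assms(2)[of y] w_le[of y] beta_ge(3) by (auto simp: piece_def cell_def indicator_def)
  then show ?thesis using sum_norm_flat[OF assms, of y] alloc[of y] by simp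
qed

lemma sum_norm_piece_le_v:
  assumes "\<And>y. norm (f y) \<le> w y"
  shows "(\<Sum>k\<le>n. norm (piece f k y)) \<le> v y"
proof -
  have "0 \<le> (\<Sum>i\<in>{1..n}. m i / measure M (A i) * indicator (A i) y)"
    using m_nonneg by (intro sum_nonneg mult_nonneg_nonneg) auto
  then have "w y \<le> v y" by (simp add: v_def)
  then show ?thesis using assms[of y] by (simp add: sum_norm_piece)
qed

section \<open>Estimates for a single ball\<close>

lemma inverse_lam_rho:
  assumes "k \<in> {1..n}" "dist x (c k) < 2 * \<rho> k"
  shows "1 / lam x (\<rho> k) \<le> Cl\<^sup>2 / measure M (ball (c k) (2 * \<rho> k))"
proof (rule inverse_lam_le)
  have "measure M (ball (c k) (\<rho> k)) \<le> measure M (ball (c k) (2 * \<rho> k))"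
    using rho_pos[OF assms(1)] by (intro measure_ball_mono subset_ball) simp
  then show "0 < measure M (ball (c k) (2 * \<rho> k))" using R_pos[OF assms(1)] by simp
qed (use rho_pos[OF assms(1)] assms(2) in auto)

text \<open>These are the contributions of a near ball that the size of the kernel can handle. For
  the original pieces the separation is half the distance to the centre, which leads to
  \<open>J k\<close>; for the flattened ones it is \<open>\<rho> k\<close>, coming from the second
  argument. The function \<open>h\<close> stands for a partial sum of flattened pieces; its part
  inside the ball of radius \<open>4 * \<rho> k\<close> is left to
  \<open>local_bound\<close>.\<close>

lemma near_bound:
  assumes k: "k \<in> {1..n}" and h: "h \<in> bcs M" "\<And>y. norm (h y) \<le> v y"
  shows "AE x in M. tame v x \<longrightarrow> 2 * r k \<le> dist x (c k) \<longrightarrow> dist x (c k) < 2 * \<rho> k \<longrightarrow>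
    (\<Sum>j\<le>n. ennreal (norm (T (piece f1 k) (piece f2 j) x))) +
    (\<Sum>j\<in>{j. j \<le> n \<and> k < j \<and> 2 * \<rho> j \<le> dist x (c j)}. ennreal (norm (T (flat f1 k) (flat f2 j) x))) +
    ennreal (norm (T (flat f1 k) (\<lambda>y. indicator (- ball (c k) (4 * \<rho> k)) y *\<^sub>R h y) x))
    \<le> ennreal (8 * CK * Cl ^ 3 * m k) * (J k x + ennreal (Cl\<^sup>2 / measure M (ball (c k) (2 * \<rho> k))))"
proof -
  have kn: "k \<le> n" "k \<noteq> 0" using k by auto
  have mk: "m k \<ge> 0" by (rule m_nonneg[OF k])
  define g where "g = (\<lambda>y. indicator (- ball (c k) (4 * \<rho> k)) y *\<^sub>R h y)"
  have gb: "g \<in> bcs M" unfolding g_def by (intro bcs_indicator h) (simp add: sets_M)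
  have gv: "norm (g y) \<le> v y" for y using h(2)[of y] v_nonneg[of y] by (simp add: g_def indicator_def)
  note fb = f flat_bcs[OF f(1) kn(1)] piece_bcs[OF f(1) kn(1)]
  have 1: "AE x in M. tame v x \<longrightarrow> (\<forall>I\<subseteq>{..n}. \<forall>s>0.
    (\<forall>j\<in>I. \<forall>y1 y2. piece f1 k y1 \<noteq> 0 \<longrightarrow> piece f2 j y2 \<noteq> 0 \<longrightarrow> s \<le> max (dist x y1) (dist x y2)) \<longrightarrow>
    (\<Sum>j\<in>I. ennreal (norm (T (piece f1 k) (piece f2 j) x)))
      \<le> ennreal (CK * (2 * Cl\<^sup>2 / lam x s)) * (\<integral>\<^sup>+y. ennreal (norm (piece f1 k y)) \<partial>M))"
    by (intro T_sum_size fb sum_norm_piece_le_v dominated piece_bcs) auto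
  have 2: "AE x in M. tame v x \<longrightarrow> (\<forall>I\<subseteq>{..n}. \<forall>s>0.
    (\<forall>j\<in>I. \<forall>y1 y2. flat f1 k y1 \<noteq> 0 \<longrightarrow> flat f2 j y2 \<noteq> 0 \<longrightarrow> s \<le> max (dist x y1) (dist x y2)) \<longrightarrow>
    (\<Sum>j\<in>I. ennreal (norm (T (flat f1 k) (flat f2 j) x)))
      \<le> ennreal (CK * (2 * Cl\<^sup>2 / lam x s)) * (\<integral>\<^sup>+y. ennreal (norm (flat f1 k y)) \<partial>M))"
    by (intro T_sum_size fb sum_norm_flat_le_v dominated flat_bcs) auto
  \<comment> \<open>A family with a single member, so that the statement for sums also covers the
    function cut off outside the ball.\<close>
  have 3: "AE x in M. tame v x \<longrightarrow> (\<forall>I\<subseteq>{()}. \<forall>s>0.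
    (\<forall>j\<in>I. \<forall>y1 y2. flat f1 k y1 \<noteq> 0 \<longrightarrow> (\<lambda>_. g) j y2 \<noteq> 0 \<longrightarrow> s \<le> max (dist x y1) (dist x y2)) \<longrightarrow>
    (\<Sum>j\<in>I. ennreal (norm (T (flat f1 k) ((\<lambda>_. g) j) x)))
      \<le> ennreal (CK * (2 * Cl\<^sup>2 / lam x s)) * (\<integral>\<^sup>+y. ennreal (norm (flat f1 k y)) \<partial>M))"
    using gv gb by (intro T_sum_size fb) auto
  from 1 2 3 show ?thesis
  proof eventually_elim
    case (elim x)
    show ?case
    proof (intro impI)
      assume tame: "tame v x" and lo: "2 * r k \<le> dist x (c k)" and hi: "dist x (c k) < 2 * \<rho> k"
      define d where "d = dist x (c k)"
      have d: "d > 0" "r k > 0" "\<rho> k > 0" using lo r_pos[OF k] rho_pos[OF k] by (auto simp: d_def)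
      have Cl0: "Cl \<ge> 0" "Cl \<ge> 1" using Cl_ge_1 by auto
      have A: "(\<Sum>j\<le>n. ennreal (norm (T (piece f1 k) (piece f2 j) x))) \<le> ennreal (8 * CK * Cl ^ 3 * m k) * J k x"
      proof -
        have sep: "d / 2 \<le> max (dist x y1) (dist x y2)" if "piece f1 k y1 \<noteq> 0" for y1 y2
        proof -
          have "y1 \<in> V k" using that kn by (auto simp: piece_def cell_def indicator_def split: if_splits)
          then have "dist (c k) y1 < r k" using V_sub[OF k] by auto
          then show ?thesis
            using dist_triangle[of x "c k" y1] lo by (simp add: d_def dist_commute)
        qed
        have "d / 2 > 0" using d by simp
        then have "(\<Sum>j\<le>n. ennreal (norm (T (piece f1 k) (piece f2 j) x)))
            \<le> ennreal (CK * (2 * Cl\<^sup>2 / lam x (d / 2))) * (\<integral>\<^sup>+y. ennreal (norm (piece f1 k y)) \<partial>M)"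
          using elim(1) tame sep by blast
        also have "\<dots> \<le> ennreal (CK * (2 * Cl\<^sup>2 / lam x (d / 2))) * ennreal (m k)"
          by (intro mult_left_mono piece_nn_integral[OF f(1) dominated(1) k]) simp
        also have "\<dots> = ennreal (CK * (2 * Cl\<^sup>2 / lam x (d / 2)) * m k)"
          using mk by (rule ennreal_mult''[symmetric])
        also have "\<dots> \<le> ennreal (8 * CK * Cl ^ 3 * m k * (1 / lam x d))"
        proof (rule ennreal_leI)
          have "1 / lam x (d / 2) \<le> Cl / lam x d"
            using lam_half[OF d(1), of x] lam_pos[of "d / 2" x] lam_pos[of d x] d by (simp add: field_simps)
          then have "CK * (2 * Cl\<^sup>2) * m k * (1 / lam x (d / 2)) \<le> CK * (2 * Cl\<^sup>2) * m k * (Cl / lam x d)"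
            using CK mk by (intro mult_left_mono) auto
          also have "\<dots> = 2 * CK * Cl ^ 3 * m k * (1 / lam x d)" by (simp add: power_numeral_reduce)
          also have "\<dots> \<le> 8 * CK * Cl ^ 3 * m k * (1 / lam x d)"
            using CK mk Cl0 lam_pos[OF d(1), of x] by (intro mult_right_mono) auto
          finally show "CK * (2 * Cl\<^sup>2 / lam x (d / 2)) * m k \<le> 8 * CK * Cl ^ 3 * m k * (1 / lam x d)"
            by (simp add: mult_ac)
        qed
        also have "\<dots> = ennreal (8 * CK * Cl ^ 3 * m k) * ennreal (1 / lam x d)"
          using CK mk Cl0 by (intro ennreal_mult') auto
        also have "\<dots> \<le> ennreal (8 * CK * Cl ^ 3 * m k) * J k x"
          using J_ge[OF k lo hi] by (intro mult_left_mono) (auto simp: d_def)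
        finally show ?thesis .
      qed
      define e where "e = Cl\<^sup>2 / measure M (ball (c k) (2 * \<rho> k))"
      have e: "1 / lam x (\<rho> k) \<le> e" unfolding e_def by (rule inverse_lam_rho[OF k hi])
      have e0: "e \<ge> 0" by (simp add: e_def)
      have size: "ennreal (CK * (2 * Cl\<^sup>2 / lam x (\<rho> k))) * (\<integral>\<^sup>+y. ennreal (norm (flat f1 k y)) \<partial>M)
          \<le> ennreal (4 * CK * Cl ^ 3 * m k * e)"
      proof -
        have "ennreal (CK * (2 * Cl\<^sup>2 / lam x (\<rho> k))) * (\<integral>\<^sup>+y. ennreal (norm (flat f1 k y)) \<partial>M)
            \<le> ennreal (CK * (2 * Cl\<^sup>2 / lam x (\<rho> k))) * ennreal (m k)"
          by (intro mult_left_mono flat_nn_integral[OF f(1) dominated(1) k]) simp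
        also have "\<dots> = ennreal (CK * (2 * Cl\<^sup>2 / lam x (\<rho> k)) * m k)"
          using mk by (rule ennreal_mult''[symmetric])
        also have "\<dots> \<le> ennreal (4 * CK * Cl ^ 3 * m k * e)"
        proof (rule ennreal_leI)
          have "CK * (2 * Cl\<^sup>2) * m k * (1 / lam x (\<rho> k)) \<le> CK * (2 * Cl\<^sup>2) * m k * e"
            using CK mk e by (intro mult_left_mono) auto
          also have "\<dots> \<le> CK * (4 * Cl ^ 3) * m k * e"
          proof -
            have "Cl\<^sup>2 \<le> Cl ^ 3" using Cl0 by (intro power_increasing) auto
            then have "2 * Cl\<^sup>2 \<le> 4 * Cl ^ 3" using Cl0 by (smt (verit) zero_le_power)
            then show ?thesis using CK mk e0 by (intro mult_right_mono mult_left_mono) auto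
          qed
          finally show "CK * (2 * Cl\<^sup>2 / lam x (\<rho> k)) * m k \<le> 4 * CK * Cl ^ 3 * m k * e"
            by (simp add: mult_ac)
        qed
        finally show ?thesis .
      qed
      have B: "(\<Sum>j\<in>{j. j \<le> n \<and> k < j \<and> 2 * \<rho> j \<le> dist x (c j)}. ennreal (norm (T (flat f1 k) (flat f2 j) x)))
          \<le> ennreal (4 * CK * Cl ^ 3 * m k * e)"
      proof -
        \<comment> \<open>The ball \<open>j\<close> is far from \<open>x\<close> in terms of its own
          radius, and \<open>\<rho> j\<close> is at least \<open>\<rho> k\<close> because
          \<open>k < j\<close>. Nothing is used about the first argument, which may be close to
          \<open>x\<close>.\<close>
        have sep: "\<rho> k \<le> max (dist x y1) (dist x y2)"
          if j: "j \<le> n" "k < j" "2 * \<rho> j \<le> dist x (c j)" and nz: "flat f2 j y2 \<noteq> 0" for j y1 y2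
        proof -
          have j1: "j \<in> {1..n}" using j k by auto
          have "y2 \<in> A j" using nz j(2) by (auto simp: flat_def indicator_def split: if_splits)
          then have "dist (c j) y2 < \<rho> j" using A_sub[OF j1] by auto
          then have "\<rho> j \<le> dist x y2"
            using dist_triangle[of x "c j" y2] j(3) by (simp add: dist_commute)
          then show ?thesis using rho_mono[OF k j1] j(2) by simp
        qed
        have "{j. j \<le> n \<and> k < j \<and> 2 * \<rho> j \<le> dist x (c j)} \<subseteq> {..n}" by auto
        then have "(\<Sum>j\<in>{j. j \<le> n \<and> k < j \<and> 2 * \<rho> j \<le> dist x (c j)}. ennreal (norm (T (flat f1 k) (flat f2 j) x)))
          \<le> ennreal (CK * (2 * Cl\<^sup>2 / lam x (\<rho> k))) * (\<integral>\<^sup>+y. ennreal (norm (flat f1 k y)) \<partial>M)"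
          using elim(2) tame sep d(3) by (metis (mono_tags, lifting) mem_Collect_eq)
        then show ?thesis using size by (rule order_trans)
      qed
      have C: "ennreal (norm (T (flat f1 k) g x)) \<le> ennreal (4 * CK * Cl ^ 3 * m k * e)"
      proof -
        have sep: "\<rho> k \<le> max (dist x y1) (dist x y2)" if "g y2 \<noteq> 0" for y1 y2
        proof -
          have "4 * \<rho> k \<le> dist (c k) y2"
            using that by (auto simp: g_def indicator_def split: if_splits)
          then show ?thesis
            using dist_triangle[of "c k" y2 x] hi d(3) by (simp add: dist_commute)
        qed
        have "(\<Sum>j\<in>{()}. ennreal (norm (T (flat f1 k) ((\<lambda>_. g) j) x)))
          \<le> ennreal (CK * (2 * Cl\<^sup>2 / lam x (\<rho> k))) * (\<integral>\<^sup>+y. ennreal (norm (flat f1 k y)) \<partial>M)"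
          using elim(3) tame sep d(3) by blast
        then show ?thesis using size by simp
      qed
      have "(\<Sum>j\<le>n. ennreal (norm (T (piece f1 k) (piece f2 j) x))) +
          (\<Sum>j\<in>{j. j \<le> n \<and> k < j \<and> 2 * \<rho> j \<le> dist x (c j)}. ennreal (norm (T (flat f1 k) (flat f2 j) x))) +
          ennreal (norm (T (flat f1 k) g x))
        \<le> ennreal (8 * CK * Cl ^ 3 * m k) * J k x + ennreal (4 * CK * Cl ^ 3 * m k * e) + ennreal (4 * CK * Cl ^ 3 * m k * e)"
        by (intro add_mono A B C)
      also have "\<dots> = ennreal (8 * CK * Cl ^ 3 * m k) * J k x + ennreal (8 * CK * Cl ^ 3 * m k * e)"
        using CK mk e0 Cl0 by (simp add: add.assoc flip: ennreal_plus)
      also have "ennreal (8 * CK * Cl ^ 3 * m k * e) = ennreal (8 * CK * Cl ^ 3 * m k) * ennreal e"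
        using e0 by (rule ennreal_mult'')
      finally show "(\<Sum>j\<le>n. ennreal (norm (T (piece f1 k) (piece f2 j) x))) +
          (\<Sum>j\<in>{j. j \<le> n \<and> k < j \<and> 2 * \<rho> j \<le> dist x (c j)}. ennreal (norm (T (flat f1 k) (flat f2 j) x))) +
          ennreal (norm (T (flat f1 k) (\<lambda>y. indicator (- ball (c k) (4 * \<rho> k)) y *\<^sub>R h y) x))
        \<le> ennreal (8 * CK * Cl ^ 3 * m k) * (J k x + ennreal (Cl\<^sup>2 / measure M (ball (c k) (2 * \<rho> k))))"
        by (simp add: distrib_left e_def g_def)
    qed
  qed
qed

text \<open>A piece minus its flattened version has integral zero and lives in the ball of radius
  \<open>\<rho> k\<close>. The first sum serves the replacement in the first argument; the second
  one, read with the arguments exchanged, serves the replacement in the second argument, after the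
  first has been replaced.\<close>

lemma far_bound:
  assumes k: "k \<in> {1..n}"
  shows "AE x in M. tame v x \<longrightarrow> 2 * \<rho> k \<le> dist x (c k) \<longrightarrow>
    (\<Sum>j\<le>n. ennreal (norm (T (\<lambda>y. piece f1 k y - flat f1 k y) (piece f2 j) x)))
      \<le> ennreal (8 * CK * Cl ^ 3 * m k) * ennreal (\<omega> (\<rho> k / dist x (c k)) / lam x (dist x (c k))) \<and>
    (\<Sum>j\<le>n. ennreal (norm (T (\<lambda>y. piece f1 k y - flat f1 k y) (flat f2 j) x)))
      \<le> ennreal (8 * CK * Cl ^ 3 * m k) * ennreal (\<omega> (\<rho> k / dist x (c k)) / lam x (dist x (c k)))"
proof -
  have kn: "k \<le> n" "k \<noteq> 0" using k by auto
  have mk: "m k \<ge> 0" by (rule m_nonneg[OF k])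
  define u where "u = (\<lambda>y. piece f1 k y - flat f1 k y)"
  have pb: "piece f1 k \<in> bcs M" "flat f1 k \<in> bcs M" using piece_bcs flat_bcs f kn by auto
  have ub: "u \<in> bcs M" unfolding u_def by (intro bcs_diff pb)
  have mean: "(\<integral>y. u y \<partial>M) = 0"
    unfolding u_def using bcs_integrable[OF pb(1)] bcs_integrable[OF pb(2)] integral_flat[OF k] by simp
  have su: "dist (c k) y < \<rho> k" if "u y \<noteq> 0" for y
  proof -
    have "y \<in> V k \<or> y \<in> A k"
      using that kn by (auto simp: u_def piece_def cell_def flat_def indicator_def split: if_splits)
    then show ?thesis using V_sub[OF k] A_sub[OF k] rho_ge[OF k] r_pos[OF k] by fastforce
  qed
  have ui: "(\<integral>\<^sup>+y. ennreal (norm (u y)) \<partial>M) \<le> ennreal (2 * m k)"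
  proof -
    have "(\<integral>\<^sup>+y. ennreal (norm (u y)) \<partial>M)
        \<le> (\<integral>\<^sup>+y. ennreal (norm (piece f1 k y)) + ennreal (norm (flat f1 k y)) \<partial>M)"
      unfolding u_def
      by (intro nn_integral_mono) (auto simp: norm_triangle_ineq4 intro: ennreal_leI simp flip: ennreal_plus)
    also have "\<dots> = (\<integral>\<^sup>+y. ennreal (norm (piece f1 k y)) \<partial>M) + (\<integral>\<^sup>+y. ennreal (norm (flat f1 k y)) \<partial>M)"
    proof -
      note [measurable] = bcs_measurable[OF pb(1)] bcs_measurable[OF pb(2)]
      show ?thesis by (rule nn_integral_add) measurable
    qed
    also have "\<dots> \<le> ennreal (m k) + ennreal (m k)"
      by (intro add_mono piece_nn_integral flat_nn_integral f dominated k)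
    finally show ?thesis using mk by (simp flip: ennreal_plus)
  qed
  have 1: "AE x in M. tame v x \<longrightarrow> 2 * \<rho> k \<le> dist x (c k) \<longrightarrow>
    (\<Sum>j\<le>n. ennreal (norm (T u (piece f2 j) x)))
    \<le> ennreal (CK * \<omega> (\<rho> k / dist x (c k)) * (2 * Cl\<^sup>2 / lam x (dist x (c k)))) * (\<integral>\<^sup>+y. ennreal (norm (u y)) \<partial>M)"
    by (intro T_sum_smooth ub mean rho_pos k su sum_norm_piece_le_v dominated piece_bcs f) auto
  have 2: "AE x in M. tame v x \<longrightarrow> 2 * \<rho> k \<le> dist x (c k) \<longrightarrow>
    (\<Sum>j\<le>n. ennreal (norm (T u (flat f2 j) x)))
    \<le> ennreal (CK * \<omega> (\<rho> k / dist x (c k)) * (2 * Cl\<^sup>2 / lam x (dist x (c k)))) * (\<integral>\<^sup>+y. ennreal (norm (u y)) \<partial>M)"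
    by (intro T_sum_smooth ub mean rho_pos k su sum_norm_flat_le_v dominated flat_bcs f) auto
  have le: "ennreal (CK * \<omega> (\<rho> k / dist x (c k)) * (2 * Cl\<^sup>2 / lam x (dist x (c k)))) * (\<integral>\<^sup>+y. ennreal (norm (u y)) \<partial>M)
     \<le> ennreal (8 * CK * Cl ^ 3 * m k) * ennreal (\<omega> (\<rho> k / dist x (c k)) / lam x (dist x (c k)))"
    if "2 * \<rho> k \<le> dist x (c k)" for x
  proof -
    define z where "z = \<omega> (\<rho> k / dist x (c k)) / lam x (dist x (c k))"
    have "dist x (c k) > 0" using that rho_pos[OF k] by linarith
    then have z: "z \<ge> 0"
      unfolding z_def using rho_pos[OF k] by (intro divide_nonneg_nonneg dini_nonneg[OF om] less_imp_le[OF lam_pos]) auto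
    have "ennreal (CK * \<omega> (\<rho> k / dist x (c k)) * (2 * Cl\<^sup>2 / lam x (dist x (c k)))) * (\<integral>\<^sup>+y. ennreal (norm (u y)) \<partial>M)
        \<le> ennreal (CK * \<omega> (\<rho> k / dist x (c k)) * (2 * Cl\<^sup>2 / lam x (dist x (c k)))) * ennreal (2 * m k)"
      by (intro mult_left_mono ui) simp
    also have "\<dots> = ennreal (CK * \<omega> (\<rho> k / dist x (c k)) * (2 * Cl\<^sup>2 / lam x (dist x (c k))) * (2 * m k))"
      using mk by (intro ennreal_mult''[symmetric]) simp
    also have "CK * \<omega> (\<rho> k / dist x (c k)) * (2 * Cl\<^sup>2 / lam x (dist x (c k))) * (2 * m k) = 4 * CK * Cl\<^sup>2 * m k * z"
      by (simp add: z_def)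
    also have "ennreal (4 * CK * Cl\<^sup>2 * m k * z) \<le> ennreal (8 * CK * Cl ^ 3 * m k * z)"
    proof -
      have "Cl\<^sup>2 \<le> Cl ^ 3" using Cl_ge_1 by (intro power_increasing) auto
      moreover have "0 \<le> Cl ^ 3" using Cl_ge_1 by simp
      ultimately have "4 * CK * Cl\<^sup>2 \<le> 8 * CK * Cl ^ 3" using CK by (intro mult_mono) auto
      then show ?thesis using mk z by (intro ennreal_leI mult_right_mono) auto
    qed
    also have "ennreal (8 * CK * Cl ^ 3 * m k * z) = ennreal (8 * CK * Cl ^ 3 * m k) * ennreal z"
      using z by (rule ennreal_mult'')
    finally show ?thesis by (simp add: z_def)
  qed
  from 1 2 show ?thesis
    unfolding u_def[symmetric] by eventually_elim (blast intro: order_trans le)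
qed

text \<open>This is where doubling of the ball of radius \<open>\<rho> k\<close> pays off: the balls
  of radius \<open>2 * \<rho> k\<close> and \<open>4 * \<rho> k\<close> have measure comparable to
  \<open>A k\<close>. The bound on Lebesgue spaces gives the product of the two heights and these
  measures, and the height of \<open>flat f1 k\<close> times the measure of \<open>A k\<close> is at
  most \<open>m k\<close>.\<close>

lemma local_bound:
  assumes k: "k \<in> {1..n}" and h: "h \<in> bcs M" "\<And>y. norm (h y) \<le> 8 * beta"
  shows "(\<integral>\<^sup>+x. ennreal (norm (T (flat f1 k) (\<lambda>y. indicator (ball (c k) (4 * \<rho> k)) y *\<^sub>R h y) x)) *
    indicator (ball (c k) (2 * \<rho> k)) x \<partial>M) \<le> ennreal (64 * beta\<^sup>2 * CT * m k)"
proof -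
  have kn: "k \<le> n" "k \<noteq> 0" using k by auto
  define g where "g = (\<lambda>y. indicator (ball (c k) (4 * \<rho> k)) y *\<^sub>R h y)"
  have gb: "g \<in> bcs M" unfolding g_def by (intro bcs_indicator h) (simp add: sets_M)
  have fb: "flat f1 k \<in> bcs M" by (intro flat_bcs f kn)
  define \<mu> where "\<mu> = measure M (ball (c k) (4 * \<rho> k))"
  define a where "a = norm (avg f1 k)"
  have b0: "beta \<ge> 0" using beta_ge(3) by simp
  have bm: "ball (c k) (4 * \<rho> k) \<in> sets M" by (simp add: sets_M)
  have A\<mu>: "measure M (A k) \<le> \<mu>"
  proof -
    have "ball (c k) (\<rho> k) \<subseteq> ball (c k) (4 * \<rho> k)" using rho_pos[OF k] by (intro subset_ball) simp
    then show ?thesis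
      unfolding \<mu>_def using A_sub[OF k] A_sets[OF k] by (intro measure_mono_fmeasurable) auto
  qed
  have \<mu>le: "measure M (ball (c k) (2 * \<rho> k)) \<le> 4 * beta * measure M (A k)" "\<mu> \<le> 4 * beta * measure M (A k)"
  proof -
    have "measure M (ball (c k) (16 * \<rho> k)) \<le> beta * measure M (ball (c k) (\<rho> k))"
      using R_doubling[OF k] by (simp add: doubling_ball_def)
    also have "\<dots> \<le> beta * (4 * measure M (A k))" using R_le[OF k] b0 by (intro mult_left_mono)
    finally have "measure M (ball (c k) (16 * \<rho> k)) \<le> 4 * beta * measure M (A k)" by simp
    moreover have "measure M (ball (c k) (2 * \<rho> k)) \<le> measure M (ball (c k) (16 * \<rho> k))"
      "\<mu> \<le> measure M (ball (c k) (16 * \<rho> k))"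
      unfolding \<mu>_def using rho_pos[OF k] by (auto intro!: measure_ball_mono subset_ball)
    ultimately show "measure M (ball (c k) (2 * \<rho> k)) \<le> 4 * beta * measure M (A k)" "\<mu> \<le> 4 * beta * measure M (A k)"
      by linarith+
  qed
  have "(\<integral>\<^sup>+x. ennreal (norm (T (flat f1 k) g x)) * indicator (ball (c k) (2 * \<rho> k)) x \<partial>M)
      \<le> ennreal (CT * a * (8 * beta) * (measure M (ball (c k) (2 * \<rho> k)) + \<mu>))"
  proof (rule T_local_bound)
    show "flat f1 k \<in> Lp_space p1 M" "g \<in> Lp_space p2 M" by (intro bcs_Lp1 bcs_Lp2 fb gb)+
    have "(\<integral>x. norm (flat f1 k x) powr p1 \<partial>M) = (\<integral>x. indicator (A k) x * a powr p1 \<partial>M)"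
      using kn p(2) by (intro Bochner_Integration.integral_cong) (auto simp: flat_def a_def indicator_def)
    also have "\<dots> = measure M (A k) * a powr p1"
      using A_sets[OF k] by simp
    also have "\<dots> \<le> a powr p1 * \<mu>" using mult_left_mono[OF A\<mu>, of "a powr p1"] by (simp add: mult.commute)
    finally show "(\<integral>x. norm (flat f1 k x) powr p1 \<partial>M) \<le> a powr p1 * \<mu>" .
    have "(\<integral>x. norm (g x) powr p2 \<partial>M) \<le> (\<integral>x. indicator (ball (c k) (4 * \<rho> k)) x * (8 * beta) powr p2 \<partial>M)"
    proof (rule integral_mono)
      show "integrable M (\<lambda>x. norm (g x) powr p2)" using p by (intro bcs_powr_integrable gb) auto
      show "integrable M (\<lambda>x. indicator (ball (c k) (4 * \<rho> k)) x * (8 * beta) powr p2)"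
        using bm emeasure_ball_finite by (intro integrable_mult_left) auto
      show "norm (g x) powr p2 \<le> indicator (ball (c k) (4 * \<rho> k)) x * (8 * beta) powr p2" for x
        using h(2)[of x] p(3) by (auto simp: g_def indicator_def intro!: powr_mono2)
    qed
    also have "\<dots> = (8 * beta) powr p2 * \<mu>" using bm by (simp add: \<mu>_def mult.commute)
    finally show "(\<integral>x. norm (g x) powr p2 \<partial>M) \<le> (8 * beta) powr p2 * \<mu>" .
  qed (use b0 in \<open>auto simp: a_def \<mu>_def\<close>)
  also have "\<dots> \<le> ennreal (64 * beta\<^sup>2 * CT * m k)"
  proof (rule ennreal_leI)
    have am: "a * measure M (A k) \<le> m k"
      using norm_avg[OF f(1) dominated(1) k] A_pos[OF k] by (simp add: a_def field_simps)
    have "CT * a * (8 * beta) * (measure M (ball (c k) (2 * \<rho> k)) + \<mu>)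
        \<le> CT * a * (8 * beta) * (8 * beta * measure M (A k))"
      using \<mu>le CT b0 by (intro mult_left_mono) (auto simp: a_def)
    also have "\<dots> = 64 * beta\<^sup>2 * CT * (a * measure M (A k))" by (simp add: power2_eq_square)
    also have "\<dots> \<le> 64 * beta\<^sup>2 * CT * m k" using am CT by (intro mult_left_mono) auto
    finally show "CT * a * (8 * beta) * (measure M (ball (c k) (2 * \<rho> k)) + \<mu>) \<le> 64 * beta\<^sup>2 * CT * m k" .
  qed
  finally show ?thesis by (simp add: g_def)
qed

text \<open>Since \<open>8 * beta \<ge> 1\<close> bounds the sum, its power \<open>q\<close> is at
  most a constant times the sum itself, whose integral is controlled by \<open>v\<close>.\<close>

lemma sum_flat_powr:
  assumes fb: "f \<in> bcs M" and fw: "\<And>y. norm (f y) \<le> w y" and "q \<ge> 1"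
  shows "(\<integral>x. norm (\<Sum>k\<le>n. flat f k x) powr q \<partial>M) \<le> (8 * beta) powr q * (2 * W)"
proof -
  define \<phi> where "\<phi> = (\<lambda>x. \<Sum>k\<le>n. flat f k x)"
  have \<phi>b: "\<phi> \<in> bcs M" unfolding \<phi>_def by (intro bcs_sum flat_bcs fb) auto
  have n1: "norm (\<phi> x) \<le> 8 * beta" "norm (\<phi> x) \<le> v x" for x
  proof -
    have "norm (\<phi> x) \<le> (\<Sum>k\<le>n. norm (flat f k x))" unfolding \<phi>_def by (rule norm_sum)
    then show "norm (\<phi> x) \<le> 8 * beta" "norm (\<phi> x) \<le> v x"
      using sum_norm_flat_le[OF fb fw, of x] sum_norm_flat_le_v[OF fb fw, of x] by linarith+
  qed
  have b1: "8 * beta \<ge> 1" using beta_ge(3) by simp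
  have pw: "norm (\<phi> x) powr q \<le> (8 * beta) powr q * norm (\<phi> x)" for x
  proof -
    have "(norm (\<phi> x) / (8 * beta)) powr q \<le> (norm (\<phi> x) / (8 * beta)) powr 1"
      using n1[of x] b1 \<open>q \<ge> 1\<close> by (intro powr_mono') auto
    then have "norm (\<phi> x) powr q \<le> (8 * beta) powr q * (norm (\<phi> x) / (8 * beta))"
      using b1 by (simp add: powr_divide field_simps)
    also have "\<dots> \<le> (8 * beta) powr q * (norm (\<phi> x) / 1)"
      using b1 by (intro mult_left_mono divide_left_mono) auto
    finally show ?thesis by simp
  qed
  have "(\<integral>x. norm (\<phi> x) powr q \<partial>M) \<le> (\<integral>x. (8 * beta) powr q * norm (\<phi> x) \<partial>M)"
    using bcs_powr_integrable[OF \<phi>b, of q] bcs_integrable[OF \<phi>b] \<open>q \<ge> 1\<close> pw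
    by (intro integral_mono) auto
  also have "\<dots> = (8 * beta) powr q * (\<integral>x. norm (\<phi> x) \<partial>M)" by simp
  also have "\<dots> \<le> (8 * beta) powr q * (2 * W)"
  proof (rule mult_left_mono)
    have "ennreal (\<integral>x. norm (\<phi> x) \<partial>M) = (\<integral>\<^sup>+x. ennreal (norm (\<phi> x)) \<partial>M)"
      using bcs_integrable[OF \<phi>b] by (intro nn_integral_eq_integral[symmetric]) auto
    also have "\<dots> \<le> (\<integral>\<^sup>+x. ennreal (v x) \<partial>M)" using n1(2) by (intro nn_integral_mono ennreal_leI)
    also have "\<dots> \<le> ennreal (2 * W)" by (rule v_nn_integral)
    finally show "(\<integral>x. norm (\<phi> x) \<partial>M) \<le> 2 * W" using W_nonneg by simp
  qed simp
  finally show ?thesis by (simp add: \<phi>_def)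
qed

lemma flat_weak_bound:
  "emeasure M {x. norm (T (\<lambda>y. \<Sum>i\<le>n. flat f1 i y) (\<lambda>y. \<Sum>j\<le>n. flat f2 j y) x) \<ge> 1 / 2}
    \<le> ennreal ((CT * (8 * beta) * (8 * beta) / (1 / 2)) powr p * (2 * W))"
proof (rule T_weak_bound)
  show "(\<lambda>y. \<Sum>i\<le>n. flat f1 i y) \<in> Lp_space p1 M" "(\<lambda>y. \<Sum>i\<le>n. flat f2 i y) \<in> Lp_space p2 M"
    by (intro bcs_Lp1 bcs_Lp2 bcs_sum flat_bcs f; simp)+
  show "(\<integral>x. norm (\<Sum>i\<le>n. flat f1 i x) powr p1 \<partial>M) \<le> (8 * beta) powr p1 * (2 * W)"
    using p by (intro sum_flat_powr f dominated) auto
  show "(\<integral>x. norm (\<Sum>i\<le>n. flat f2 i x) powr p2 \<partial>M) \<le> (8 * beta) powr p2 * (2 * W)"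
    using p by (intro sum_flat_powr f dominated) auto
qed (use beta_ge(3) W_nonneg in auto)

section \<open>Summation over all balls\<close>

definition cG :: real where "cG = 3 * Cl ^ 5 + Cl\<^sup>2 * S + Cl\<^sup>2"

text \<open>In this order the terms come from the exceptional set of the maximal function (with mass
  \<open>2 * W\<close>), the doubled balls, the flattened functions at level 1/2, and the sum of all
  errors at level 1/2. The three terms of \<open>cG\<close> are the integrals of the majorants
  between the balls, far away, and on the ball of radius \<open>2 * \<rho> k\<close>.\<close>

definition C0 :: real where
  "C0 = 2 * Cl\<^sup>2 + 1 + 2 * (CT * (8 * beta) * (8 * beta) / (1 / 2)) powr p +
    2 * (16 * CK * Cl ^ 3 * cG + 128 * beta\<^sup>2 * CT)"

text \<open>Off two exceptional sets, \<open>T f1 f2\<close> is bounded by the operator on the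
  flattened sums plus \<open>\<Sum>k. H k\<close>. The flattened sums are bounded functions and
  admit the bound on Lebesgue spaces; the errors have total integral at most a multiple of
  \<open>\<Sum>k. m k\<close>.\<close>

lemma level_set_bound: "emeasure M {x. norm (T f1 f2 x) > 1} \<le> ennreal (C0 * W)"
proof -
  interpret fl: cz_decomposition M lam Cl N "\<lambda>f g. T g f" "\<lambda>x y1 y2. K x y2 y1" p2 p1 p CT CK \<omega>
    f2 f1 w n c r \<rho> V A J m W S
    by (rule cz_decomposition_flip)
  have Cl0: "Cl \<ge> 0" "Cl \<ge> 1" using Cl_ge_1 by auto
  have b0: "beta \<ge> 0" using beta_ge(3) by simp
  obtain \<Omega> where \<Omega>: "open \<Omega>" "emeasure M \<Omega> \<le> ennreal (Cl\<^sup>2) * emeasure (density M (\<lambda>y. ennreal (v y))) UNIV"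
    "\<And>x r. x \<notin> \<Omega> \<Longrightarrow> r > 0 \<Longrightarrow> measure (density M (\<lambda>y. ennreal (v y))) (ball x r) \<le> lam x r"
    by (rule maximal_exceptional_set[OF _ v_finite_measure]) (simp add: sets_M, blast)
  have \<Omega>m [measurable]: "\<Omega> \<in> sets M" using \<Omega>(1) by (simp add: sets_M)
  have tame: "tame v x" if "x \<notin> \<Omega>" for x
    using \<Omega>(3)[OF that] v_finite_measure by (simp add: tame_def)
  define PD where "PD = (\<lambda>k D. D \<in> borel_measurable M \<and> (\<integral>\<^sup>+x. D x \<partial>M) \<le> ennreal (Cl\<^sup>2) * ennreal S \<and>
    (\<forall>x. 2 * \<rho> k \<le> dist x (c k) \<longrightarrow> ennreal (\<omega> (\<rho> k / dist x (c k)) / lam x (dist x (c k))) \<le> D x))"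
  have "\<exists>D. PD k D" if "k \<in> {1..n}" for k
    unfolding PD_def by (rule dini_kernel_bound[OF om S(2) rho_pos[OF that] R_pos[OF that]]) blast
  then obtain D where D: "\<And>k. k \<in> {1..n} \<Longrightarrow> PD k (D k)" by metis
  define e where "e = (\<lambda>k. ennreal (Cl\<^sup>2 / measure M (ball (c k) (2 * \<rho> k))))"
  define B where "B = (\<lambda>k. ball (c k) (2 * \<rho> k))"
  define B4 where "B4 = (\<lambda>k. ball (c k) (4 * \<rho> k))"
  have Bm [measurable]: "B k \<in> sets M" "B4 k \<in> sets M" "- B4 k \<in> sets M" for k
    by (simp_all add: B_def B4_def sets_M)
  \<comment> \<open>Partial sums over the smaller indices; the diagonal term belongs to
    \<open>h\<close> and not to \<open>h'\<close>, as in \<open>sum_square_max\<close>. Domination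
    by \<open>v\<close> is used for their parts outside \<open>B4 k\<close>, the bound
    \<open>8 * beta\<close> for the parts inside.\<close>
  define h where "h = (\<lambda>k y. \<Sum>j\<le>k. flat f2 j y)"
  define h' where "h' = (\<lambda>k y. \<Sum>i<k. flat f1 i y)"
  have hb: "h k \<in> bcs M" "h' k \<in> bcs M" if "k \<in> {1..n}" for k
    using that unfolding h_def h'_def by (intro bcs_sum flat_bcs f; simp)+
  have hs: "norm (h k y) \<le> (\<Sum>j\<le>n. norm (flat f2 j y))" "norm (h' k y) \<le> (\<Sum>j\<le>n. norm (flat f1 j y))"
    if "k \<in> {1..n}" for k y
  proof -
    have "norm (h k y) \<le> (\<Sum>j\<le>k. norm (flat f2 j y))" unfolding h_def by (rule norm_sum)
    also have "\<dots> \<le> (\<Sum>j\<le>n. norm (flat f2 j y))" using that by (intro sum_mono2) auto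
    finally show "norm (h k y) \<le> (\<Sum>j\<le>n. norm (flat f2 j y))" .
    have "norm (h' k y) \<le> (\<Sum>j<k. norm (flat f1 j y))" unfolding h'_def by (rule norm_sum)
    also have "\<dots> \<le> (\<Sum>j\<le>n. norm (flat f1 j y))" using that by (intro sum_mono2) auto
    finally show "norm (h' k y) \<le> (\<Sum>j\<le>n. norm (flat f1 j y))" .
  qed
  have hv: "norm (h k y) \<le> v y" "norm (h' k y) \<le> v y" if "k \<in> {1..n}" for k y
    using hs[OF that, of y] sum_norm_flat_le_v[OF f(1) dominated(1), of y]
      sum_norm_flat_le_v[OF f(2) dominated(2), of y] by linarith+
  have h8: "norm (h k y) \<le> 8 * beta" "norm (h' k y) \<le> 8 * beta" if "k \<in> {1..n}" for k y
    using hs[OF that, of y] sum_norm_flat_le[OF f(1) dominated(1), of y]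
      sum_norm_flat_le[OF f(2) dominated(2), of y] by linarith+
  define loc where "loc = (\<lambda>k x. norm (T (flat f1 k) (\<lambda>y. indicator (B4 k) y *\<^sub>R h k y) x))"
  define loc' where "loc' = (\<lambda>k x. norm (T (\<lambda>y. indicator (B4 k) y *\<^sub>R h' k y) (flat f2 k) x))"
  define q where "q = (\<lambda>k. ennreal (8 * CK * Cl ^ 3 * m k))"
  \<comment> \<open>All that is charged to ball \<open>k\<close>: \<open>J\<close>, \<open>e\<close>
    and the local terms if the ball is near, \<open>D\<close> if it is far. The factor 2 accounts
    for the two arguments. Near and far majorants are simply added, because each is integrable over
    the whole space.\<close>
  define H where "H = (\<lambda>k x. 2 * q k * (J k x + D k x + e k * indicator (B k) x)
    + (ennreal (loc k x) * indicator (B k) x + ennreal (loc' k x) * indicator (B k) x))"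
  have locm: "loc k \<in> borel_measurable M" "loc' k \<in> borel_measurable M" if "k \<in> {1..n}" for k
  proof -
    have kn: "k \<le> n" using that by simp
    have [measurable]: "T (flat f1 k) (\<lambda>y. indicator (B4 k) y *\<^sub>R h k y) \<in> borel_measurable M"
      "T (\<lambda>y. indicator (B4 k) y *\<^sub>R h' k y) (flat f2 k) \<in> borel_measurable M"
      by (intro T_bcs_measurable flat_bcs bcs_indicator hb f Bm kn that)+
    show "loc k \<in> borel_measurable M" unfolding loc_def by measurable
    show "loc' k \<in> borel_measurable M" unfolding loc'_def by measurable
  qed
  have Hm: "H k \<in> borel_measurable M" if "k \<in> {1..n}" for k
  proof -
    note [measurable] = locm[OF that] J_measurable[OF that]
    have [measurable]: "D k \<in> borel_measurable M" using D[OF that] by (simp add: PD_def)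
    show ?thesis unfolding H_def by measurable
  qed
  have Hint: "(\<integral>\<^sup>+x. H k x \<partial>M) \<le> ennreal ((16 * CK * Cl ^ 3 * cG + 128 * beta\<^sup>2 * CT) * m k)"
    if k: "k \<in> {1..n}" for k
  proof -
    have mk: "m k \<ge> 0" by (rule m_nonneg[OF k])
    note [measurable] = locm[OF k] J_measurable[OF k]
    have Dm [measurable]: "D k \<in> borel_measurable M" using D[OF k] by (simp add: PD_def)
    have "(\<integral>\<^sup>+x. H k x \<partial>M) = 2 * q k * ((\<integral>\<^sup>+x. J k x \<partial>M) + (\<integral>\<^sup>+x. D k x \<partial>M) + e k * emeasure M (B k))
      + ((\<integral>\<^sup>+x. ennreal (loc k x) * indicator (B k) x \<partial>M) + (\<integral>\<^sup>+x. ennreal (loc' k x) * indicator (B k) x \<partial>M))"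
      unfolding H_def by (simp add: nn_integral_add nn_integral_cmult nn_integral_cmult_indicator)
    also have "\<dots> \<le> 2 * q k * (ennreal (3 * Cl ^ 5) + ennreal (Cl\<^sup>2) * ennreal S + ennreal (Cl\<^sup>2))
      + (ennreal (64 * beta\<^sup>2 * CT * m k) + ennreal (64 * beta\<^sup>2 * CT * m k))"
    proof (intro add_mono mult_left_mono)
      show "(\<integral>\<^sup>+x. J k x \<partial>M) \<le> ennreal (3 * Cl ^ 5)" by (rule J_integral[OF k])
      show "(\<integral>\<^sup>+x. D k x \<partial>M) \<le> ennreal (Cl\<^sup>2) * ennreal S" using D[OF k] by (simp add: PD_def)
      have "e k * emeasure M (B k)
          = ennreal (Cl\<^sup>2 / measure M (ball (c k) (2 * \<rho> k)) * measure M (ball (c k) (2 * \<rho> k)))"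
        unfolding e_def B_def emeasure_ball by (rule ennreal_mult''[symmetric]) simp
      also have "\<dots> \<le> ennreal (Cl\<^sup>2)" by (intro ennreal_leI) simp
      finally show "e k * emeasure M (B k) \<le> ennreal (Cl\<^sup>2)" .
      show "(\<integral>\<^sup>+x. ennreal (loc k x) * indicator (B k) x \<partial>M) \<le> ennreal (64 * beta\<^sup>2 * CT * m k)"
        unfolding loc_def B_def B4_def by (rule local_bound[OF k hb(1)[OF k] h8(1)[OF k]])
      show "(\<integral>\<^sup>+x. ennreal (loc' k x) * indicator (B k) x \<partial>M) \<le> ennreal (64 * beta\<^sup>2 * CT * m k)"
        unfolding loc'_def B_def B4_def by (rule fl.local_bound[OF k hb(2)[OF k] h8(2)[OF k]])
    qed auto
    also have "\<dots> = ennreal ((16 * CK * Cl ^ 3 * cG + 128 * beta\<^sup>2 * CT) * m k)"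
    proof -
      have a1: "ennreal (3 * Cl ^ 5) + ennreal (Cl\<^sup>2) * ennreal S + ennreal (Cl\<^sup>2) = ennreal cG"
        using Cl0 S(1) by (simp add: cG_def flip: ennreal_mult ennreal_plus)
      have a2: "2 * q k = ennreal (16 * CK * Cl ^ 3 * m k)"
      proof -
        have "2 * q k = ennreal 2 * q k" by simp
        also have "\<dots> = ennreal (2 * (8 * CK * Cl ^ 3 * m k))"
          unfolding q_def by (rule ennreal_mult'[symmetric]) simp
        also have "2 * (8 * CK * Cl ^ 3 * m k) = 16 * CK * Cl ^ 3 * m k" by simp
        finally show ?thesis .
      qed
      have a3: "cG \<ge> 0" using Cl0 S(1) by (simp add: cG_def)
      have a4: "0 \<le> 16 * CK * Cl ^ 3 * m k" using CK Cl0 mk by simp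
      have a5: "0 \<le> 64 * beta\<^sup>2 * CT * m k" using CT mk by simp
      have "ennreal (16 * CK * Cl ^ 3 * m k) * ennreal cG + (ennreal (64 * beta\<^sup>2 * CT * m k) + ennreal (64 * beta\<^sup>2 * CT * m k))
          = ennreal (16 * CK * Cl ^ 3 * m k * cG + (64 * beta\<^sup>2 * CT * m k + 64 * beta\<^sup>2 * CT * m k))"
        using a3 a4 a5 by (simp only: ennreal_mult ennreal_plus add_nonneg_nonneg mult_nonneg_nonneg)
      also have "16 * CK * Cl ^ 3 * m k * cG + (64 * beta\<^sup>2 * CT * m k + 64 * beta\<^sup>2 * CT * m k)
          = (16 * CK * Cl ^ 3 * cG + 128 * beta\<^sup>2 * CT) * m k" by (simp add: algebra_simps)
      finally show ?thesis unfolding a1 a2 .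
    qed
    finally show ?thesis .
  qed
  define \<Phi> where "\<Phi> = (\<lambda>x. T (\<lambda>y. \<Sum>i\<le>n. flat f1 i y) (\<lambda>y. \<Sum>j\<le>n. flat f2 j y) x)"
  have "T (\<lambda>y. \<Sum>i\<le>n. flat f1 i y) (\<lambda>y. \<Sum>j\<le>n. flat f2 j y) \<in> borel_measurable M"
    by (intro T_bcs_measurable bcs_sum flat_bcs f) auto
  then have \<Phi>m [measurable]: "\<Phi> \<in> borel_measurable M" unfolding \<Phi>_def .
  define E where "E = (\<Union>k\<in>{1..n}. ball (c k) (2 * r k))"
  have Em [measurable]: "E \<in> sets M" unfolding E_def sets_M by (intro borel_open open_UN) auto
  have e1: "AE x in M. T f1 f2 x = (\<Sum>i\<le>n. \<Sum>j\<le>n. T (piece f1 i) (piece f2 j) x)"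
    using T_sum[of "{..n}" "piece f1" "{..n}" "piece f2"] piece_bcs f by (simp add: sum_piece)
  have e2: "AE x in M. \<Phi> x = (\<Sum>i\<le>n. \<Sum>j\<le>n. T (flat f1 i) (flat f2 j) x)"
    unfolding \<Phi>_def using flat_bcs f by (intro T_sum) auto
  have e3: "AE x in M. \<forall>k\<in>{1..n}. (\<Sum>j\<le>k. T (flat f1 k) (flat f2 j) x)
      = T (flat f1 k) (\<lambda>y. indicator (B4 k) y *\<^sub>R h k y) x + T (flat f1 k) (\<lambda>y. indicator (- B4 k) y *\<^sub>R h k y) x"
  proof (intro AE_finite_allI)
    fix k assume k: "k \<in> {1..n}"
    have "AE x in M. T (flat f1 k) (\<lambda>y. \<Sum>j\<le>k. flat f2 j y) x = (\<Sum>j\<le>k. T (flat f1 k) (flat f2 j) x)"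
      using k by (intro T_sum2 flat_bcs f) auto
    moreover have "AE x in M. T (flat f1 k) (\<lambda>y. indicator (B4 k) y *\<^sub>R h k y + indicator (- B4 k) y *\<^sub>R h k y) x
      = T (flat f1 k) (\<lambda>y. indicator (B4 k) y *\<^sub>R h k y) x + T (flat f1 k) (\<lambda>y. indicator (- B4 k) y *\<^sub>R h k y) x"
      using k by (intro T_add2 flat_bcs bcs_indicator hb f Bm) auto
    moreover have "(\<lambda>y. indicator (B4 k) y *\<^sub>R h k y + indicator (- B4 k) y *\<^sub>R h k y) = (\<lambda>y. \<Sum>j\<le>k. flat f2 j y)"
      by (auto simp: h_def indicator_def)
    ultimately show "AE x in M. (\<Sum>j\<le>k. T (flat f1 k) (flat f2 j) x)
      = T (flat f1 k) (\<lambda>y. indicator (B4 k) y *\<^sub>R h k y) x + T (flat f1 k) (\<lambda>y. indicator (- B4 k) y *\<^sub>R h k y) x"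
      by (auto elim: eventually_elim2)
  qed simp
  have e4: "AE x in M. \<forall>k\<in>{1..n}. (\<Sum>i<k. T (flat f1 i) (flat f2 k) x)
      = T (\<lambda>y. indicator (B4 k) y *\<^sub>R h' k y) (flat f2 k) x + T (\<lambda>y. indicator (- B4 k) y *\<^sub>R h' k y) (flat f2 k) x"
  proof (intro AE_finite_allI)
    fix k assume k: "k \<in> {1..n}"
    have "AE x in M. T (\<lambda>y. \<Sum>i<k. flat f1 i y) (flat f2 k) x = (\<Sum>i<k. T (flat f1 i) (flat f2 k) x)"
      using k by (intro T_sum1 flat_bcs f) auto
    moreover have "AE x in M. T (\<lambda>y. indicator (B4 k) y *\<^sub>R h' k y + indicator (- B4 k) y *\<^sub>R h' k y) (flat f2 k) x
      = T (\<lambda>y. indicator (B4 k) y *\<^sub>R h' k y) (flat f2 k) x + T (\<lambda>y. indicator (- B4 k) y *\<^sub>R h' k y) (flat f2 k) x"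
      using k by (intro T_add1 flat_bcs bcs_indicator hb f Bm) auto
    moreover have "(\<lambda>y. indicator (B4 k) y *\<^sub>R h' k y + indicator (- B4 k) y *\<^sub>R h' k y) = (\<lambda>y. \<Sum>i<k. flat f1 i y)"
      by (auto simp: h'_def indicator_def)
    ultimately show "AE x in M. (\<Sum>i<k. T (flat f1 i) (flat f2 k) x)
      = T (\<lambda>y. indicator (B4 k) y *\<^sub>R h' k y) (flat f2 k) x + T (\<lambda>y. indicator (- B4 k) y *\<^sub>R h' k y) (flat f2 k) x"
      by (auto elim: eventually_elim2)
  qed simp
  have e5: "AE x in M. \<forall>k\<in>{1..n}. \<forall>j\<in>{..n}. T (\<lambda>y. piece f1 k y - flat f1 k y) (piece f2 j) x
      = T (piece f1 k) (piece f2 j) x - T (flat f1 k) (piece f2 j) x"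
    by (intro AE_finite_allI T_diff1 piece_bcs flat_bcs f) auto
  have e6: "AE x in M. \<forall>k\<in>{1..n}. \<forall>i\<in>{..n}. T (flat f1 i) (\<lambda>y. piece f2 k y - flat f2 k y) x
      = T (flat f1 i) (piece f2 k) x - T (flat f1 i) (flat f2 k) x"
    by (intro AE_finite_allI T_diff2 piece_bcs flat_bcs f) auto
  have n1: "AE x in M. \<forall>k\<in>{1..n}. tame v x \<longrightarrow> 2 * r k \<le> dist x (c k) \<longrightarrow> dist x (c k) < 2 * \<rho> k \<longrightarrow>
    (\<Sum>j\<le>n. ennreal (norm (T (piece f1 k) (piece f2 j) x))) +
    (\<Sum>j\<in>{j. j \<le> n \<and> k < j \<and> 2 * \<rho> j \<le> dist x (c j)}. ennreal (norm (T (flat f1 k) (flat f2 j) x))) +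
    ennreal (norm (T (flat f1 k) (\<lambda>y. indicator (- B4 k) y *\<^sub>R h k y) x)) \<le> q k * (J k x + e k)"
    unfolding B4_def q_def e_def by (intro AE_finite_allI near_bound hb hv) auto
  have n2: "AE x in M. \<forall>k\<in>{1..n}. tame v x \<longrightarrow> 2 * r k \<le> dist x (c k) \<longrightarrow> dist x (c k) < 2 * \<rho> k \<longrightarrow>
    (\<Sum>i\<le>n. ennreal (norm (T (piece f1 i) (piece f2 k) x))) +
    (\<Sum>i\<in>{i. i \<le> n \<and> k < i \<and> 2 * \<rho> i \<le> dist x (c i)}. ennreal (norm (T (flat f1 i) (flat f2 k) x))) +
    ennreal (norm (T (\<lambda>y. indicator (- B4 k) y *\<^sub>R h' k y) (flat f2 k) x)) \<le> q k * (J k x + e k)"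
    unfolding B4_def q_def e_def by (intro AE_finite_allI fl.near_bound hb hv) auto
  have n3: "AE x in M. \<forall>k\<in>{1..n}. tame v x \<longrightarrow> 2 * \<rho> k \<le> dist x (c k) \<longrightarrow>
    (\<Sum>j\<le>n. ennreal (norm (T (\<lambda>y. piece f1 k y - flat f1 k y) (piece f2 j) x)))
      \<le> q k * ennreal (\<omega> (\<rho> k / dist x (c k)) / lam x (dist x (c k)))"
  proof (intro AE_finite_allI)
    fix k assume "k \<in> {1..n}"
    from far_bound[OF this] show "AE x in M. tame v x \<longrightarrow> 2 * \<rho> k \<le> dist x (c k) \<longrightarrow>
    (\<Sum>j\<le>n. ennreal (norm (T (\<lambda>y. piece f1 k y - flat f1 k y) (piece f2 j) x)))
      \<le> q k * ennreal (\<omega> (\<rho> k / dist x (c k)) / lam x (dist x (c k)))"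
      unfolding q_def by eventually_elim blast
  qed simp
  have n4: "AE x in M. \<forall>k\<in>{1..n}. tame v x \<longrightarrow> 2 * \<rho> k \<le> dist x (c k) \<longrightarrow>
    (\<Sum>i\<le>n. ennreal (norm (T (flat f1 i) (\<lambda>y. piece f2 k y - flat f2 k y) x)))
      \<le> q k * ennreal (\<omega> (\<rho> k / dist x (c k)) / lam x (dist x (c k)))"
  proof (intro AE_finite_allI)
    fix k assume "k \<in> {1..n}"
    from fl.far_bound[OF this] show "AE x in M. tame v x \<longrightarrow> 2 * \<rho> k \<le> dist x (c k) \<longrightarrow>
    (\<Sum>i\<le>n. ennreal (norm (T (flat f1 i) (\<lambda>y. piece f2 k y - flat f2 k y) x)))
      \<le> q k * ennreal (\<omega> (\<rho> k / dist x (c k)) / lam x (dist x (c k)))"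
      unfolding q_def by eventually_elim blast
  qed simp
  have pointwise: "AE x in M. x \<notin> \<Omega> \<union> E \<longrightarrow>
    ennreal (norm (T f1 f2 x)) \<le> ennreal (norm (\<Phi> x)) + (\<Sum>k\<in>{1..n}. H k x)"
    using e1 e2 e3 e4 e5 e6 n1 n2 n3 n4
  proof eventually_elim
    case (elim x)
    show ?case
    proof
      assume x: "x \<notin> \<Omega> \<union> E"
      then have tx: "tame v x" by (intro tame) simp
      have xr: "2 * r k \<le> dist x (c k)" if "k \<in> {1..n}" for k
        using x that by (auto simp: E_def dist_commute not_less)
      \<comment> \<open>The notion of near depends on \<open>x\<close>, but the arguments to which
        \<open>T\<close> is applied do not; only the index sets of sums of norms vary. Hence the
        finitely many null sets collected before suffice for all \<open>x\<close>.\<close>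
      define near where "near = (\<lambda>k. k \<in> {1..n} \<and> dist x (c k) < 2 * \<rho> k)"
      define t where "t = (\<lambda>i j. T (piece f1 i) (piece f2 j) x)"
      define u where "u = (\<lambda>i j. T (flat f1 i) (piece f2 j) x)"
      define s where "s = (\<lambda>i j. T (flat f1 i) (flat f2 j) x)"
      define Q where "Q = pair_error near t u s n"
      have Q0: "Q k \<ge> 0" for k unfolding Q_def pair_error_def by (auto intro!: add_nonneg_nonneg sum_nonneg)
      have "norm (T f1 f2 x) \<le> norm (\<Phi> x) + (\<Sum>k\<in>{1..n}. Q k)"
        unfolding elim(1,2) Q_def using pair_splitting[of near t u s n]
        by (simp add: near_def t_def u_def s_def flat_def)
      then have "ennreal (norm (T f1 f2 x)) \<le> ennreal (norm (\<Phi> x) + (\<Sum>k\<in>{1..n}. Q k))"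
        by (rule ennreal_leI)
      also have "\<dots> = ennreal (norm (\<Phi> x)) + (\<Sum>k\<in>{1..n}. ennreal (Q k))"
        using Q0 by (simp add: sum_nonneg sum_ennreal)
      also have "\<dots> \<le> ennreal (norm (\<Phi> x)) + (\<Sum>k\<in>{1..n}. H k x)"
      proof (intro add_left_mono sum_mono)
        fix k assume k: "k \<in> {1..n}"
        show "ennreal (Q k) \<le> H k x"
        proof (cases "near k")
          case True
          then have dk: "dist x (c k) < 2 * \<rho> k" "x \<in> B k" by (auto simp: near_def B_def dist_commute)
          have set: "{j. j \<le> n \<and> k < j \<and> \<not> near j} = {j. j \<le> n \<and> k < j \<and> 2 * \<rho> j \<le> dist x (c j)}"
            using k by (auto simp: near_def)
          define S1 where "S1 = (\<Sum>j\<le>n. norm (t k j))"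
          define S2 where "S2 = (\<Sum>i\<le>n. norm (t i k))"
          define S3 where "S3 = (\<Sum>j\<in>{j. j \<le> n \<and> k < j \<and> \<not> near j}. norm (s k j))"
          define S4 where "S4 = (\<Sum>i\<in>{i. i \<le> n \<and> k < i \<and> \<not> near i}. norm (s i k))"
          define l1 where "l1 = norm (T (flat f1 k) (\<lambda>y. indicator (- B4 k) y *\<^sub>R h k y) x)"
          define l2 where "l2 = norm (T (\<lambda>y. indicator (- B4 k) y *\<^sub>R h' k y) (flat f2 k) x)"
          have pos: "S1 \<ge> 0" "S2 \<ge> 0" "S3 \<ge> 0" "S4 \<ge> 0" "l1 \<ge> 0" "l2 \<ge> 0" "loc k x \<ge> 0" "loc' k x \<ge> 0"
            by (auto simp: S1_def S2_def S3_def S4_def l1_def l2_def loc_def loc'_def intro!: sum_nonneg)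
          have "norm (\<Sum>j\<le>k. s k j) \<le> loc k x + l1"
            using elim(3) k unfolding s_def loc_def l1_def by (simp add: norm_triangle_ineq)
          moreover have "norm (\<Sum>i<k. s i k) \<le> loc' k x + l2"
            using elim(4) k unfolding s_def loc'_def l2_def by (simp add: norm_triangle_ineq)
          ultimately have "Q k \<le> (S1 + S3 + l1) + (S2 + S4 + l2) + (loc k x + loc' k x)"
            using True by (simp add: Q_def pair_error_def S1_def S2_def S3_def S4_def)
          then have "ennreal (Q k) \<le> ennreal ((S1 + S3 + l1) + (S2 + S4 + l2) + (loc k x + loc' k x))"
            by (rule ennreal_leI)
          also have "\<dots> = (ennreal S1 + ennreal S3 + ennreal l1) + (ennreal S2 + ennreal S4 + ennreal l2)
              + (ennreal (loc k x) + ennreal (loc' k x))"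
            using pos by simp
          also have "\<dots> \<le> q k * (J k x + e k) + q k * (J k x + e k) + (ennreal (loc k x) + ennreal (loc' k x))"
          proof (intro add_mono order_refl)
            have "ennreal S1 = (\<Sum>j\<le>n. ennreal (norm (T (piece f1 k) (piece f2 j) x)))"
              "ennreal S3 = (\<Sum>j\<in>{j. j \<le> n \<and> k < j \<and> 2 * \<rho> j \<le> dist x (c j)}. ennreal (norm (T (flat f1 k) (flat f2 j) x)))"
              unfolding S1_def S3_def t_def s_def set by (simp_all add: sum_ennreal)
            then show "ennreal S1 + ennreal S3 + ennreal l1 \<le> q k * (J k x + e k)"
              using elim(7) k tx xr[OF k] dk(1) by (simp add: l1_def)
            have "ennreal S2 = (\<Sum>j\<le>n. ennreal (norm (T (piece f1 j) (piece f2 k) x)))"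
              "ennreal S4 = (\<Sum>j\<in>{j. j \<le> n \<and> k < j \<and> 2 * \<rho> j \<le> dist x (c j)}. ennreal (norm (T (flat f1 j) (flat f2 k) x)))"
              unfolding S2_def S4_def t_def s_def set by (simp_all add: sum_ennreal)
            then show "ennreal S2 + ennreal S4 + ennreal l2 \<le> q k * (J k x + e k)"
              using elim(8) k tx xr[OF k] dk(1) by (simp add: l2_def)
          qed
          also have "q k * (J k x + e k) + q k * (J k x + e k) = 2 * q k * (J k x + e k)"
            by (simp add: mult_2 distrib_right)
          also have "2 * q k * (J k x + e k) \<le> 2 * q k * (J k x + D k x + e k)"
            by (intro mult_left_mono add_right_mono) (auto simp: add_increasing2)
          finally show ?thesis using dk(2) by (simp add: H_def add_right_mono)
        next
          case False
          then have dk: "2 * \<rho> k \<le> dist x (c k)" using k by (simp add: near_def)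
          define z where "z = ennreal (\<omega> (\<rho> k / dist x (c k)) / lam x (dist x (c k)))"
          have "z \<le> D k x" using D[OF k] dk by (simp add: PD_def z_def)
          have "ennreal (Q k) = (\<Sum>j\<le>n. ennreal (norm (t k j - u k j))) + (\<Sum>i\<le>n. ennreal (norm (u i k - s i k)))"
            using False by (simp add: Q_def pair_error_def sum_nonneg sum_ennreal)
          also have "\<dots> \<le> q k * z + q k * z"
          proof (intro add_mono)
            have "(\<Sum>j\<le>n. ennreal (norm (t k j - u k j)))
                = (\<Sum>j\<le>n. ennreal (norm (T (\<lambda>y. piece f1 k y - flat f1 k y) (piece f2 j) x)))"
              using elim(5) k by (intro sum.cong) (auto simp: t_def u_def)
            then show "(\<Sum>j\<le>n. ennreal (norm (t k j - u k j))) \<le> q k * z"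
              using elim(9) k tx dk by (simp add: z_def)
            have "(\<Sum>i\<le>n. ennreal (norm (u i k - s i k)))
                = (\<Sum>i\<le>n. ennreal (norm (T (flat f1 i) (\<lambda>y. piece f2 k y - flat f2 k y) x)))"
              using elim(6) k by (intro sum.cong) (auto simp: u_def s_def)
            then show "(\<Sum>i\<le>n. ennreal (norm (u i k - s i k))) \<le> q k * z"
              using elim(10) k tx dk by (simp add: z_def)
          qed
          also have "\<dots> = 2 * q k * z" by (simp add: mult_2 distrib_right)
          also have "\<dots> \<le> 2 * q k * (J k x + D k x + e k * indicator (B k) x)"
          proof (intro mult_left_mono)
            have "0 + z + 0 \<le> J k x + D k x + e k * indicator (B k) x"
              using \<open>z \<le> D k x\<close> by (intro add_mono) auto
            then show "z \<le> J k x + D k x + e k * indicator (B k) x" by simp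
          qed simp
          also have "\<dots> \<le> H k x" unfolding H_def by simp
          finally show ?thesis .
        qed
      qed
      finally show "ennreal (norm (T f1 f2 x)) \<le> ennreal (norm (\<Phi> x)) + (\<Sum>k\<in>{1..n}. H k x)" .
    qed
  qed
  define Hs where "Hs = (\<lambda>x. \<Sum>k\<in>{1..n}. H k x)"
  have Hsm [measurable]: "Hs \<in> borel_measurable M" unfolding Hs_def using Hm by (intro borel_measurable_sum)
  \<comment> \<open>If a sum of two nonnegative terms exceeds 1, one of them is at least
    1/2.\<close>
  define G1 where "G1 = {x. norm (\<Phi> x) \<ge> 1 / 2}"
  define G2 where "G2 = {x\<in>UNIV. 1 \<le> 2 * Hs x}"
  have "{x\<in>space M. norm (\<Phi> x) \<ge> 1 / 2} \<in> sets M" "{x\<in>space M. 1 \<le> 2 * Hs x} \<in> sets M" by measurable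
  then have Gm [measurable]: "G1 \<in> sets M" "G2 \<in> sets M" by (simp_all add: G1_def G2_def)
  have "AE x in M. x \<in> {x. norm (T f1 f2 x) > 1} \<longrightarrow> x \<in> \<Omega> \<union> E \<union> G1 \<union> G2"
    using pointwise
  proof (rule AE_mp, intro AE_I2 impI)
    fix x assume le: "x \<notin> \<Omega> \<union> E \<longrightarrow> ennreal (norm (T f1 f2 x)) \<le> ennreal (norm (\<Phi> x)) + (\<Sum>k\<in>{1..n}. H k x)"
      and x: "x \<in> {x. norm (T f1 f2 x) > 1}"
    show "x \<in> \<Omega> \<union> E \<union> G1 \<union> G2"
    proof (rule ccontr)
      assume n: "x \<notin> \<Omega> \<union> E \<union> G1 \<union> G2"
      then have H1: "\<not> 1 \<le> 2 * Hs x" by (simp add: G2_def)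
      then have "Hs x \<noteq> top" by (auto simp: ennreal_mult_top)
      then obtain a where a: "a \<ge> 0" "Hs x = ennreal a" by (cases "Hs x") auto
      have "\<not> ennreal 1 \<le> ennreal (2 * a)" using H1 a by (simp add: ennreal_mult)
      then have "2 * a < 1" using a(1) by (simp add: ennreal_le_iff del: ennreal_1)
      moreover have "norm (T f1 f2 x) \<le> norm (\<Phi> x) + a"
      proof -
        have "ennreal (norm (T f1 f2 x)) \<le> ennreal (norm (\<Phi> x)) + ennreal a"
          using le n a by (simp add: Hs_def)
        also have "\<dots> = ennreal (norm (\<Phi> x) + a)" using a(1) by (intro ennreal_plus[symmetric]) auto
        finally show ?thesis using a(1) by (subst (asm) ennreal_le_iff) auto
      qed
      moreover have "norm (\<Phi> x) < 1 / 2" using n by (simp add: G1_def)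
      ultimately show False using x by simp
    qed
  qed
  then have "emeasure M {x. norm (T f1 f2 x) > 1} \<le> emeasure M (\<Omega> \<union> E \<union> G1 \<union> G2)"
    by (rule emeasure_mono_AE) measurable
  also have "\<dots> \<le> emeasure M (\<Omega> \<union> E \<union> G1) + emeasure M G2"
    by (intro emeasure_subadditive) measurable
  also have "\<dots> \<le> (emeasure M (\<Omega> \<union> E) + emeasure M G1) + emeasure M G2"
    by (intro add_right_mono emeasure_subadditive) measurable
  also have "\<dots> \<le> ((emeasure M \<Omega> + emeasure M E) + emeasure M G1) + emeasure M G2"
    by (intro add_right_mono emeasure_subadditive) measurable
  also have "\<dots> \<le> ((ennreal (2 * Cl\<^sup>2 * W) + ennreal W) +
      ennreal ((CT * (8 * beta) * (8 * beta) / (1 / 2)) powr p * (2 * W))) +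
      ennreal (2 * ((16 * CK * Cl ^ 3 * cG + 128 * beta\<^sup>2 * CT) * W))"
  proof (intro add_mono)
    have "emeasure M \<Omega> \<le> ennreal (Cl\<^sup>2) * emeasure (density M (\<lambda>y. ennreal (v y))) UNIV" by (rule \<Omega>)
    also have "emeasure (density M (\<lambda>y. ennreal (v y))) UNIV = (\<integral>\<^sup>+y. ennreal (v y) \<partial>M)"
      by (subst emeasure_density) (auto simp: sets_M)
    also have "ennreal (Cl\<^sup>2) * \<dots> \<le> ennreal (Cl\<^sup>2) * ennreal (2 * W)"
      by (intro mult_left_mono v_nn_integral) simp
    also have "\<dots> = ennreal (2 * Cl\<^sup>2 * W)" using W_nonneg by (simp add: mult_ac flip: ennreal_mult)
    finally show "emeasure M \<Omega> \<le> ennreal (2 * Cl\<^sup>2 * W)" .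
    show "emeasure M E \<le> ennreal W" unfolding E_def by (rule exceptional)
    show "emeasure M G1 \<le> ennreal ((CT * (8 * beta) * (8 * beta) / (1 / 2)) powr p * (2 * W))"
      unfolding G1_def \<Phi>_def by (rule flat_weak_bound)
    have c0: "0 \<le> 16 * CK * Cl ^ 3 * cG + 128 * beta\<^sup>2 * CT"
      using CK CT Cl0 S(1) by (simp add: cG_def)
    have "emeasure M G2 \<le> 2 * (\<integral>\<^sup>+x. Hs x * indicator UNIV x \<partial>M)"
      unfolding G2_def using sets.top[of M] by (intro nn_integral_Markov_inequality) auto
    also have "(\<integral>\<^sup>+x. Hs x * indicator UNIV x \<partial>M) = (\<Sum>k\<in>{1..n}. \<integral>\<^sup>+x. H k x \<partial>M)"
      unfolding Hs_def indicator_UNIV mult_1_right by (rule nn_integral_sum[OF Hm])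
    also have "2 * \<dots> \<le> 2 * (\<Sum>k\<in>{1..n}. ennreal ((16 * CK * Cl ^ 3 * cG + 128 * beta\<^sup>2 * CT) * m k))"
      by (intro mult_left_mono sum_mono Hint) auto
    also have "(\<Sum>k\<in>{1..n}. ennreal ((16 * CK * Cl ^ 3 * cG + 128 * beta\<^sup>2 * CT) * m k))
        = ennreal ((16 * CK * Cl ^ 3 * cG + 128 * beta\<^sup>2 * CT) * (\<Sum>k\<in>{1..n}. m k))"
      unfolding sum_distrib_left using c0 m_nonneg by (intro sum_ennreal mult_nonneg_nonneg) auto
    also have "\<dots> \<le> ennreal ((16 * CK * Cl ^ 3 * cG + 128 * beta\<^sup>2 * CT) * W)"
      using m_sum c0 by (intro ennreal_leI mult_left_mono)
    also have "2 * ennreal ((16 * CK * Cl ^ 3 * cG + 128 * beta\<^sup>2 * CT) * W)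
        = ennreal (2 * ((16 * CK * Cl ^ 3 * cG + 128 * beta\<^sup>2 * CT) * W))"
      by (subst ennreal_mult'[of 2]) auto
    finally show "emeasure M G2 \<le> ennreal (2 * ((16 * CK * Cl ^ 3 * cG + 128 * beta\<^sup>2 * CT) * W))"
      by (simp add: mult_left_mono)
  qed
  also have "\<dots> = ennreal (C0 * W)"
  proof -
    have "0 \<le> 16 * CK * Cl ^ 3 * cG + 128 * beta\<^sup>2 * CT"
      using CK CT Cl0 S(1) by (simp add: cG_def)
    then have "0 \<le> 2 * ((16 * CK * Cl ^ 3 * cG + 128 * beta\<^sup>2 * CT) * W)" using W_nonneg by simp
    moreover have "0 \<le> 2 * Cl\<^sup>2 * W" "0 \<le> (CT * (8 * beta) * (8 * beta) / (1 / 2)) powr p * (2 * W)"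
      using W_nonneg by auto
    ultimately show ?thesis
      using W_nonneg by (simp only: C0_def ennreal_plus[symmetric] add_nonneg_nonneg) (simp add: algebra_simps)
  qed
  finally show ?thesis .
qed

end

section \<open>The weak-type bound\<close>

context cz_setting
begin

text \<open>The cover misses a set \<open>Z\<close>, and the functions on \<open>Z\<close> are
  treated as perturbations. To make room for them \<open>f1\<close> is doubled: if
  \<open>T f1 f2\<close> has norm above 1, the sum of three terms has norm above 2, so the main term
  exceeds 1 or one of the two error terms is at least 1/2.\<close>

lemma level_one_bound:
  obtains C where "C > 0" "\<And>f1 f2 W. f1 \<in> bcs M \<Longrightarrow> f2 \<in> bcs M \<Longrightarrow> W > 0 \<Longrightarrow>
    (\<integral>x. norm (f1 x) \<partial>M) + (\<integral>x. norm (f2 x) \<partial>M) \<le> W \<Longrightarrow>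
    emeasure M {x. norm (T f1 f2 x) > 1} \<le> ennreal (C * W)"
proof -
  obtain S where S: "S \<ge> 0" "(\<Sum>k. ennreal (\<omega> (1 / 2 ^ Suc k))) \<le> ennreal S"
    using dini_sum[OF om] .
  \<comment> \<open>This is \<open>C0\<close> with \<open>cG\<close> unfolded. The constant must be
    fixed before the functions, hence outside the locale of a particular decomposition.\<close>
  define C1 where "C1 = 2 * Cl\<^sup>2 + 1 + 2 * (CT * (8 * beta) * (8 * beta) / (1 / 2)) powr p +
    2 * (16 * CK * Cl ^ 3 * (3 * Cl ^ 5 + Cl\<^sup>2 * S + Cl\<^sup>2) + 128 * beta\<^sup>2 * CT)"
  have C1: "C1 \<ge> 1"
  proof -
    have "0 \<le> 16 * CK * Cl ^ 3 * (3 * Cl ^ 5 + Cl\<^sup>2 * S + Cl\<^sup>2) + 128 * beta\<^sup>2 * CT"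
      using CK CT Cl_ge_1 S(1) by simp
    moreover have "1 \<le> 2 * a + 1 + 2 * b + 2 * d" if "0 \<le> a" "0 \<le> b" "0 \<le> d" for a b d :: real
      using that by linarith
    ultimately show ?thesis unfolding C1_def by simp
  qed
  have bd: "emeasure M {x. norm (T f1 f2 x) > 1} \<le> ennreal ((C1 + 1) * (2 * W))"
    if f: "f1 \<in> bcs M" "f2 \<in> bcs M" and "W > 0"
      and WW: "(\<integral>x. norm (f1 x) \<partial>M) + (\<integral>x. norm (f2 x) \<partial>M) \<le> W" for f1 f2 W
  proof -
    define g1 where "g1 = (\<lambda>x. 2 * f1 x)"
    have g: "g1 \<in> bcs M" unfolding g1_def by (intro bcs_cmult f)
    obtain B1 where B1: "B1 > 0" "\<And>x. norm (g1 x) \<le> B1" using g by (elim bcsE) blast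
    obtain B2 where B2: "B2 > 0" "\<And>x. norm (f2 x) \<le> B2" using f(2) by (elim bcsE) blast
    note [measurable] = bcs_measurable[OF g] bcs_measurable[OF f(2)]
    define w where "w = (\<lambda>x. norm (g1 x) + norm (f2 x))"
    have wm [measurable]: "w \<in> borel_measurable M" unfolding w_def by measurable
    then have wb: "w \<in> borel_measurable borel" by measurable
    have w0: "w x \<ge> 0" for x by (simp add: w_def)
    have wi: "integrable M w" unfolding w_def
      by (intro Bochner_Integration.integrable_add integrable_norm bcs_integrable g f)
    have wint: "(\<integral>x. w x \<partial>M) \<le> 2 * W"
    proof -
      have "(\<integral>x. w x \<partial>M) = (\<integral>x. norm (g1 x) \<partial>M) + (\<integral>x. norm (f2 x) \<partial>M)"
        unfolding w_def by (intro Bochner_Integration.integral_add integrable_norm bcs_integrable g f)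
      also have "(\<integral>x. norm (g1 x) \<partial>M) = 2 * (\<integral>x. norm (f1 x) \<partial>M)"
        by (simp add: g1_def norm_mult)
      also have "\<dots> + (\<integral>x. norm (f2 x) \<partial>M) \<le> 2 * ((\<integral>x. norm (f1 x) \<partial>M) + (\<integral>x. norm (f2 x) \<partial>M))"
        by (simp add: integral_nonneg_AE)
      also have "\<dots> \<le> 2 * W" using WW by (intro mult_left_mono) simp_all
      finally show ?thesis .
    qed
    define \<nu> where "\<nu> = density M (\<lambda>x. ennreal (w x))"
    have \<nu>_eq: "emeasure \<nu> A = ennreal (\<integral>x. indicator A x * w x \<partial>M)" if "A \<in> sets M" for A
    proof -
      have "emeasure \<nu> A = (\<integral>\<^sup>+x. ennreal (w x) * indicator A x \<partial>M)"
        unfolding \<nu>_def using that by (subst emeasure_density) auto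
      also have "\<dots> = (\<integral>\<^sup>+x. ennreal (indicator A x * w x) \<partial>M)"
        by (intro nn_integral_cong) (simp add: indicator_def)
      also have "\<dots> = ennreal (\<integral>x. indicator A x * w x \<partial>M)"
        using integrable_mult_indicator[OF that wi] w0 by (intro nn_integral_eq_integral) auto
      finally show ?thesis .
    qed
    have \<nu>U: "emeasure \<nu> UNIV \<le> ennreal (2 * W)"
      using \<nu>_eq[of UNIV] sets.top[of M] wint by (auto intro: ennreal_leI)
    have fin: "finite_measure \<nu>"
    proof (rule finite_measureI)
      show "emeasure \<nu> (space \<nu>) \<noteq> \<infinity>" using \<nu>U by (auto simp: \<nu>_def top_unique)
    qed
    have Tm [measurable]: "T f1 f2 \<in> borel_measurable M" by (intro T_bcs_measurable f)
    show ?thesis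
    proof (cases "emeasure \<nu> UNIV < emeasure M UNIV")
      case False
      \<comment> \<open>Stopping radii may fail to exist here, but the whole space has measure at
        most \<open>2 * W\<close>.\<close>
      have "emeasure M {x. norm (T f1 f2 x) > 1} \<le> emeasure M UNIV"
        using sets.top[of M] by (intro emeasure_mono) auto
      also have "\<dots> \<le> ennreal (2 * W)" using False \<nu>U by simp
      also have "\<dots> \<le> ennreal ((C1 + 1) * (2 * W))"
        using C1 \<open>W > 0\<close> by (intro ennreal_leI) simp
      finally show ?thesis .
    next
      case True
      define I1 where "I1 = (\<integral>x. norm (g1 x) powr p1 \<partial>M)"
      define I2 where "I2 = (\<integral>x. norm (f2 x) powr p2 \<partial>M)"
      have I0: "I1 \<ge> 0" "I2 \<ge> 0" by (auto simp: I1_def I2_def intro!: integral_nonneg_AE)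
      \<comment> \<open>\<open>E1\<close> and \<open>E2\<close> are the norms of \<open>g1\<close>
        and \<open>f2\<close> as heights on measure \<open>W\<close>. The numbers \<open>a1\<close>
        and \<open>a2\<close> are heights of the perturbations for which \<open>T_weak_bound\<close>
        at level 1/2 gives at most \<open>W\<close>, and \<open>\<epsilon>\<close> is so small that
        the restrictions to \<open>Z\<close> obey them.\<close>
      define E1 where "E1 = (I1 / W) powr (1 / p1)"
      define E2 where "E2 = (I2 / W) powr (1 / p2)"
      have E: "E1 \<ge> 0" "E2 \<ge> 0" by (simp_all add: E1_def E2_def)
      have E1p: "E1 powr p1 * W = I1" using p \<open>W > 0\<close> I0 by (simp add: E1_def powr_powr)
      have E2p: "E2 powr p2 * W = I2" using p \<open>W > 0\<close> I0 by (simp add: E2_def powr_powr)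
      define a1 where "a1 = 1 / (2 * CT * (E2 + 1))"
      define a2 where "a2 = 1 / (2 * CT * (E1 + 1))"
      have a: "a1 > 0" "a2 > 0" using CT E by (auto simp: a1_def a2_def)
      have aE: "CT * a1 * E2 / (1 / 2) \<le> 1" "CT * E1 * a2 / (1 / 2) \<le> 1"
      proof -
        have "CT * (1 / (2 * CT * (e + 1))) * e / (1 / 2) \<le> 1" if "e \<ge> 0" for e
        proof -
          have "CT * (1 / (2 * CT * (e + 1))) * e / (1 / 2) = e / (e + 1)"
            using CT that by (simp add: frac_eq_eq)
          then show ?thesis using that by simp
        qed
        from this[OF E(2)] this[OF E(1)]
        show "CT * a1 * E2 / (1 / 2) \<le> 1" "CT * E1 * a2 / (1 / 2) \<le> 1"
          unfolding a1_def a2_def by (simp_all only: mult_ac)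
      qed
      define \<epsilon> where "\<epsilon> = min (a1 powr p1 * W / B1 powr p1) (a2 powr p2 * W / B2 powr p2)"
      have \<epsilon>: "\<epsilon> > 0" "B1 powr p1 * \<epsilon> \<le> a1 powr p1 * W" "B2 powr p2 * \<epsilon> \<le> a2 powr p2 * W"
      proof -
        show "\<epsilon> > 0" using a B1(1) B2(1) \<open>W > 0\<close> by (simp add: \<epsilon>_def)
        have "\<epsilon> \<le> a1 powr p1 * W / B1 powr p1" "\<epsilon> \<le> a2 powr p2 * W / B2 powr p2"
          by (simp_all add: \<epsilon>_def)
        then show "B1 powr p1 * \<epsilon> \<le> a1 powr p1 * W" "B2 powr p2 * \<epsilon> \<le> a2 powr p2 * W"
          using B1(1) B2(1) by (simp_all add: field_simps)
      qed
      from cz_cover[OF wb fin[unfolded \<nu>_def] True[unfolded \<nu>_def] \<epsilon>(1)]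
      obtain n and c :: "nat \<Rightarrow> 'a" and r \<rho> V A J where
        cov: "\<forall>i\<in>{1..n}. cz_ball (c i) (r i) (\<rho> i) (V i) (A i) (J i)"
        and mono: "\<forall>i\<in>{1..n}. \<forall>j\<in>{1..n}. i \<le> j \<longrightarrow> \<rho> i \<le> \<rho> j" and dj: "disjoint_family_on V {1..n}"
        and alloc: "\<forall>y. (\<Sum>i\<in>{1..n}. measure \<nu> (V i) / measure M (A i) * indicator (A i) y) \<le> 6 * beta"
        and exc: "emeasure M (\<Union>i\<in>{1..n}. ball (c i) (2 * r i)) \<le> emeasure \<nu> UNIV"
        and small: "emeasure M {y. 2 * beta \<le> w y \<and> y \<notin> (\<Union>i\<in>{1..n}. V i)} \<le> ennreal \<epsilon>"
        unfolding \<nu>_def[symmetric] by (elim exE conjE) (rule that)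
      have Vm: "V i \<in> sets M" if "i \<in> {1..n}" for i using cov that by (simp add: sets_M cz_ball_def)
      define Z where "Z = {y. 2 * beta \<le> w y \<and> y \<notin> (\<Union>i\<in>{1..n}. V i)}"
      have Zm [measurable]: "Z \<in> sets M"
      proof -
        have "{y\<in>space M. 2 * beta \<le> w y} \<in> sets M" by measurable
        then have "{y\<in>space M. 2 * beta \<le> w y} - (\<Union>i\<in>{1..n}. V i) \<in> sets M"
          using Vm by (intro sets.Diff sets.finite_UN) auto
        moreover have "{y\<in>space M. 2 * beta \<le> w y} - (\<Union>i\<in>{1..n}. V i) = Z" by (auto simp: Z_def)
        ultimately show ?thesis by simp
      qed
      have Zc: "- Z \<in> sets M" using sets.compl_sets[OF Zm] by (simp add: Compl_eq_Diff_UNIV)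
      have Zf: "emeasure M Z \<le> ennreal \<epsilon>" using small by (simp add: Z_def)
      then have Zmeas: "measure M Z \<le> \<epsilon>" "emeasure M Z < \<infinity>"
        using \<epsilon>(1) le_less_trans[OF Zf] by (auto simp: measure_def intro!: enn2real_leI)
      \<comment> \<open>After the cut the weight is at most \<open>2 * beta\<close> at every point
        outside the cells. As \<open>Z\<close> does not meet the cells, the masses there are
        unchanged.\<close>
      define u1 where "u1 = (\<lambda>x. indicator (- Z) x *\<^sub>R g1 x)"
      define u2 where "u2 = (\<lambda>x. indicator (- Z) x *\<^sub>R f2 x)"
      define z1 where "z1 = (\<lambda>x. indicator Z x *\<^sub>R g1 x)"
      define z2 where "z2 = (\<lambda>x. indicator Z x *\<^sub>R f2 x)"
      have bc: "u1 \<in> bcs M" "u2 \<in> bcs M" "z1 \<in> bcs M" "z2 \<in> bcs M"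
        unfolding u1_def u2_def z1_def z2_def by (intro bcs_indicator g f Zm Zc)+
      define w' where "w' = (\<lambda>x. norm (u1 x) + norm (u2 x))"
      have w'_eq: "w' x = indicator (- Z) x * w x" for x
        by (simp add: w'_def u1_def u2_def w_def indicator_def)
      have "cz_decomposition M lam Cl N T K p1 p2 p CT CK \<omega> u1 u2 w' n c r \<rho> V A J
          (\<lambda>i. measure \<nu> (V i)) (2 * W) S"
      proof (intro cz_decomposition.intro cz_decomposition_axioms.intro)
        show "cz_setting M lam Cl N T K p1 p2 p CT CK \<omega>" by (rule cz_setting_axioms)
        show "w' y = norm (u1 y) + norm (u2 y)" for y by (simp add: w'_def)
        show "emeasure M (\<Union>i\<in>{1..n}. ball (c i) (2 * r i)) \<le> ennreal (2 * W)" using exc \<nu>U by (rule order_trans)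
        show "(\<integral>y. indicator (V i) y * w' y \<partial>M) \<le> measure \<nu> (V i)" if "i \<in> {1..n}" for i
        proof -
          have "(\<integral>y. indicator (V i) y * w' y \<partial>M) = (\<integral>y. indicator (V i) y * w y \<partial>M)"
            using that by (intro Bochner_Integration.integral_cong) (auto simp: w'_eq indicator_def Z_def)
          also have "\<dots> = measure \<nu> (V i)"
            using \<nu>_eq[OF Vm[OF that]] w0 by (simp add: measure_def integral_nonneg_AE)
          finally show ?thesis by simp
        qed
        show "(\<Sum>i\<in>{1..n}. measure \<nu> (V i)) \<le> 2 * W"
        proof -
          interpret \<nu>: finite_measure \<nu> by (rule fin)
          have "(\<Sum>i\<in>{1..n}. measure \<nu> (V i)) = measure \<nu> (\<Union>i\<in>{1..n}. V i)"
            using dj Vm by (intro \<nu>.finite_measure_finite_Union[symmetric]) (auto simp: \<nu>_def)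
          also have "\<dots> \<le> measure \<nu> UNIV" using sets.top[of M] by (intro \<nu>.finite_measure_mono) (auto simp: \<nu>_def)
          also have "\<dots> \<le> 2 * W" using \<nu>U \<open>W > 0\<close> by (simp add: \<nu>.emeasure_eq_measure)
          finally show ?thesis .
        qed
        show "(\<integral>y. w' y \<partial>M) \<le> 2 * W"
        proof -
          have "(\<integral>y. w' y \<partial>M) \<le> (\<integral>y. w y \<partial>M)"
            unfolding w'_eq using integrable_mult_indicator[OF Zc wi] wi w0
            by (intro integral_mono) (auto simp: indicator_def)
          then show ?thesis using wint by simp
        qed
        show "w' y \<le> 2 * beta" if "y \<notin> (\<Union>i\<in>{1..n}. V i)" for y
          using that beta_ge(3) by (auto simp: w'_eq indicator_def Z_def)
      qed (use bc S cov mono dj alloc in auto)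
      then interpret cz: cz_decomposition M lam Cl N T K p1 p2 p CT CK \<omega> u1 u2 w' n c r \<rho> V A J
          "\<lambda>i. measure \<nu> (V i)" "2 * W" S .
      have main: "emeasure M {x. norm (T u1 u2 x) > 1} \<le> ennreal (C1 * (2 * W))"
        using cz.level_set_bound unfolding cz.C0_def cz.cG_def C1_def .
      have zp: "(\<integral>x. norm (indicator Z x *\<^sub>R k x) powr q \<partial>M) \<le> B powr q * \<epsilon>"
        if "q > 0" "\<And>x. norm (k x) \<le> B" "k \<in> bcs M" for k :: "'a \<Rightarrow> 'b" and q B
      proof -
        have "(\<integral>x. norm (indicator Z x *\<^sub>R k x) powr q \<partial>M) \<le> (\<integral>x. indicator Z x * B powr q \<partial>M)"
        proof (rule integral_mono)
          show "integrable M (\<lambda>x. norm (indicator Z x *\<^sub>R k x) powr q)"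
            by (rule bcs_powr_integrable[OF bcs_indicator[OF that(3) Zm] that(1)])
          show "integrable M (\<lambda>x. indicator Z x * B powr q)"
            using Zmeas(2) by (intro integrable_mult_left) auto
          show "norm (indicator Z x *\<^sub>R k x) powr q \<le> indicator Z x * B powr q" for x
            using that(1,2) by (auto simp: indicator_def intro!: powr_mono2)
        qed
        also have "\<dots> = B powr q * measure M Z" by simp
        also have "\<dots> \<le> B powr q * \<epsilon>" using Zmeas(1) by (intro mult_left_mono) auto
        finally show ?thesis .
      qed
      have small1: "emeasure M {x. norm (T z1 f2 x) \<ge> 1 / 2} \<le> ennreal W"
      proof -
        have "emeasure M {x. norm (T z1 f2 x) \<ge> 1 / 2} \<le> ennreal ((CT * a1 * E2 / (1 / 2)) powr p * W)"
        proof (rule T_weak_bound[OF bcs_Lp1[OF bc(3)] bcs_Lp2[OF f(2)]])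
          show "(\<integral>x. norm (z1 x) powr p1 \<partial>M) \<le> a1 powr p1 * W"
            unfolding z1_def using zp[of p1 g1 B1] p B1 g \<epsilon>(2) by simp
          show "(\<integral>x. norm (f2 x) powr p2 \<partial>M) \<le> E2 powr p2 * W" using E2p by (simp add: I2_def)
        qed (use a E \<open>W > 0\<close> in auto)
        also have "\<dots> \<le> ennreal (1 powr p * W)"
          using aE a E CT \<open>W > 0\<close> p by (intro ennreal_leI mult_right_mono powr_mono2) auto
        finally show ?thesis by simp
      qed
      have small2: "emeasure M {x. norm (T u1 z2 x) \<ge> 1 / 2} \<le> ennreal W"
      proof -
        have "emeasure M {x. norm (T u1 z2 x) \<ge> 1 / 2} \<le> ennreal ((CT * E1 * a2 / (1 / 2)) powr p * W)"
        proof (rule T_weak_bound[OF bcs_Lp1[OF bc(1)] bcs_Lp2[OF bc(4)]])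
          have "(\<integral>x. norm (u1 x) powr p1 \<partial>M) \<le> I1"
            unfolding I1_def using p bcs_powr_integrable[OF bc(1), of p1] bcs_powr_integrable[OF g, of p1]
            by (intro integral_mono) (auto simp: u1_def indicator_def)
          then show "(\<integral>x. norm (u1 x) powr p1 \<partial>M) \<le> E1 powr p1 * W" using E1p by simp
          show "(\<integral>x. norm (z2 x) powr p2 \<partial>M) \<le> a2 powr p2 * W"
            unfolding z2_def using zp[of p2 f2 B2] p B2 f(2) \<epsilon>(3) by simp
        qed (use a E \<open>W > 0\<close> in auto)
        also have "\<dots> \<le> ennreal (1 powr p * W)"
          using aE a E CT \<open>W > 0\<close> p by (intro ennreal_leI mult_right_mono powr_mono2) auto
        finally show ?thesis by simp
      qed
      have e1: "AE x in M. T (\<lambda>x. 2 * f1 x) f2 x = 2 * T f1 f2 x" by (intro T_cmult1 f)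
      have e2: "AE x in M. T (\<lambda>x. u1 x + z1 x) f2 x = T u1 f2 x + T z1 f2 x" by (intro T_add1 bc f)
      have e3: "AE x in M. T u1 (\<lambda>x. u2 x + z2 x) x = T u1 u2 x + T u1 z2 x" by (intro T_add2 bc f)
      have g1_eq: "(\<lambda>x. u1 x + z1 x) = (\<lambda>x. 2 * f1 x)" by (auto simp: u1_def z1_def g1_def indicator_def)
      have f2_eq: "(\<lambda>x. u2 x + z2 x) = f2" by (auto simp: u2_def z2_def indicator_def)
      define G0 where "G0 = {x. norm (T u1 u2 x) > 1}"
      define G1 where "G1 = {x. norm (T z1 f2 x) \<ge> 1 / 2}"
      define G2 where "G2 = {x. norm (T u1 z2 x) \<ge> 1 / 2}"
      have [measurable]: "T u1 u2 \<in> borel_measurable M" "T z1 f2 \<in> borel_measurable M" "T u1 z2 \<in> borel_measurable M"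
        by (intro T_bcs_measurable bc f)+
      have "{x\<in>space M. norm (T u1 u2 x) > 1} \<in> sets M" "{x\<in>space M. norm (T z1 f2 x) \<ge> 1 / 2} \<in> sets M"
        "{x\<in>space M. norm (T u1 z2 x) \<ge> 1 / 2} \<in> sets M" by measurable
      then have [measurable]: "G0 \<in> sets M" "G1 \<in> sets M" "G2 \<in> sets M"
        by (simp_all add: G0_def G1_def G2_def)
      have "AE x in M. x \<in> {x. norm (T f1 f2 x) > 1} \<longrightarrow> x \<in> G0 \<union> G1 \<union> G2"
        using e1 e2 e3 unfolding g1_eq f2_eq
      proof eventually_elim
        case (elim x)
        have "2 * T f1 f2 x = T u1 u2 x + T u1 z2 x + T z1 f2 x" using elim by simp
        then have "2 * norm (T f1 f2 x) = norm (T u1 u2 x + T u1 z2 x + T z1 f2 x)"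
          by (metis norm_mult norm_numeral)
        also have "\<dots> \<le> norm (T u1 u2 x) + norm (T u1 z2 x) + norm (T z1 f2 x)"
          by (meson add_right_mono norm_triangle_ineq order_trans)
        finally show ?case by (auto simp: G0_def G1_def G2_def)
      qed
      then have "emeasure M {x. norm (T f1 f2 x) > 1} \<le> emeasure M (G0 \<union> G1 \<union> G2)"
        by (rule emeasure_mono_AE) measurable
      also have "\<dots> \<le> emeasure M (G0 \<union> G1) + emeasure M G2" by (intro emeasure_subadditive) measurable
      also have "\<dots> \<le> (emeasure M G0 + emeasure M G1) + emeasure M G2"
        by (intro add_right_mono emeasure_subadditive) measurable
      also have "\<dots> \<le> (ennreal (C1 * (2 * W)) + ennreal W) + ennreal W"
        unfolding G0_def G1_def G2_def by (intro add_mono main small1 small2)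
      also have "\<dots> = ennreal ((C1 + 1) * (2 * W))"
        using C1 \<open>W > 0\<close> by (simp add: distrib_right flip: ennreal_plus)
      finally show ?thesis .
    qed
  qed
  have "emeasure M {x. norm (T f1 f2 x) > 1} \<le> ennreal ((C1 + 1) * 2 * W)"
    if "f1 \<in> bcs M" "f2 \<in> bcs M" "W > 0"
      "(\<integral>x. norm (f1 x) \<partial>M) + (\<integral>x. norm (f2 x) \<partial>M) \<le> W" for f1 f2 W
    using bd[OF that] by (simp only: mult.assoc)
  then show thesis using that[of "(C1 + 1) * 2"] C1 by simp
qed

text \<open>Apply the bound at level one to \<open>f1 / a\<close> and \<open>a * f2 / t\<close> and optimise \<open>a\<close>.\<close>

lemma weak_bound:
  obtains C where "C > 0" "\<And>f1 f2 s t. f1 \<in> bcs M \<Longrightarrow> f2 \<in> bcs M \<Longrightarrow> s > 0 \<Longrightarrow> t > 0 \<Longrightarrow>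
    (\<integral>x. norm (f1 x) \<partial>M) * (\<integral>x. norm (f2 x) \<partial>M) \<le> s\<^sup>2 * t \<Longrightarrow>
    emeasure M {x. norm (T f1 f2 x) > t} \<le> ennreal (C * s)"
proof -
  obtain C where C: "C > 0" "\<And>f1 f2 W. f1 \<in> bcs M \<Longrightarrow> f2 \<in> bcs M \<Longrightarrow> W > 0 \<Longrightarrow>
    (\<integral>x. norm (f1 x) \<partial>M) + (\<integral>x. norm (f2 x) \<partial>M) \<le> W \<Longrightarrow>
    emeasure M {x. norm (T f1 f2 x) > 1} \<le> ennreal (C * W)"
    by (rule level_one_bound) blast
  have "emeasure M {x. norm (T f1 f2 x) > t} \<le> ennreal (C * 2 * s)"
    if f: "f1 \<in> bcs M" "f2 \<in> bcs M" and "s > 0" "t > 0"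
      and le: "(\<integral>x. norm (f1 x) \<partial>M) * (\<integral>x. norm (f2 x) \<partial>M) \<le> s\<^sup>2 * t" for f1 f2 s t
  proof -
    define N1 where "N1 = (\<integral>x. norm (f1 x) \<partial>M)"
    define N2 where "N2 = (\<integral>x. norm (f2 x) \<partial>M)"
    have N0: "N1 \<ge> 0" "N2 \<ge> 0" by (auto simp: N1_def N2_def integral_nonneg_AE)
    \<comment> \<open>For \<open>N1 > 0\<close> the choice \<open>N1 / s\<close> makes the first
      bound an equality, and the second one is the hypothesis. For \<open>N1 = 0\<close> only the
      second bound restricts \<open>a\<close>; the denominator \<open>N2 + 1\<close> also covers
      \<open>N2 = 0\<close>.\<close>
    obtain a where a: "a > 0" "N1 / a \<le> s" "N2 * a / t \<le> s"
    proof (cases "N1 = 0")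
      case True
      have "N2 * (s * t / (N2 + 1)) / t \<le> s"
      proof -
        have "N2 * (s * t / (N2 + 1)) / t = s * (N2 / (N2 + 1))" using \<open>t > 0\<close> by simp
        also have "\<dots> \<le> s * 1" using N0 \<open>s > 0\<close> by (intro mult_left_mono) auto
        finally show ?thesis by simp
      qed
      then show thesis using that[of "s * t / (N2 + 1)"] N0 True \<open>s > 0\<close> \<open>t > 0\<close> by simp
    next
      case False
      have "N2 * (N1 / s) / t \<le> s"
        using le N0 \<open>s > 0\<close> \<open>t > 0\<close> by (simp add: N1_def N2_def field_simps power2_eq_square)
      then show thesis using that[of "N1 / s"] N0 False \<open>s > 0\<close> by simp
    qed
    define g1 where "g1 = (\<lambda>x. of_real (1 / a) * f1 x)"
    define g2 where "g2 = (\<lambda>x. of_real (a / t) * f2 x)"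
    have g: "g1 \<in> bcs M" "g2 \<in> bcs M" unfolding g1_def g2_def by (intro bcs_cmult f)+
    have "(\<integral>x. norm (g1 x) \<partial>M) + (\<integral>x. norm (g2 x) \<partial>M) = N1 / a + N2 * a / t"
      using a(1) \<open>t > 0\<close> by (simp add: g1_def g2_def norm_mult N1_def N2_def norm_divide)
    then have le1: "emeasure M {x. norm (T g1 g2 x) > 1} \<le> ennreal (C * (2 * s))"
      using a \<open>s > 0\<close> by (intro C(2) g) auto
    have "AE x in M. T g1 g2 x = of_real (1 / a) * T f1 g2 x" unfolding g1_def by (intro T_cmult1 f g)
    moreover have "AE x in M. T f1 g2 x = of_real (a / t) * T f1 f2 x" unfolding g2_def by (intro T_cmult2 f g)
    ultimately have "AE x in M. x \<in> {x. norm (T f1 f2 x) > t} \<longrightarrow> x \<in> {x. norm (T g1 g2 x) > 1}"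
    proof eventually_elim
      case (elim x)
      then have "norm (T g1 g2 x) = norm (T f1 f2 x) / t"
        using a(1) \<open>t > 0\<close> by (simp add: norm_mult norm_divide)
      then show ?case using \<open>t > 0\<close> by simp
    qed
    moreover have [measurable]: "T g1 g2 \<in> borel_measurable M" by (intro T_bcs_measurable g)
    have "{x\<in>space M. norm (T g1 g2 x) > 1} \<in> sets M" by measurable
    then have "{x. norm (T g1 g2 x) > 1} \<in> sets M" by simp
    ultimately have "emeasure M {x. norm (T f1 f2 x) > t} \<le> emeasure M {x. norm (T g1 g2 x) > 1}"
      by (intro emeasure_mono_AE)
    then show ?thesis using le1 by (simp add: mult.assoc)
  qed
  then show thesis using that[of "C * 2"] C(1) by simp
qed

end

section \<open>Extension to integrable functions\<close>

lemma (in nonhom_space) compact_tail: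
  fixes f :: "'a \<Rightarrow> 'b::real_normed_vector" and u :: "'a \<Rightarrow> real"
  assumes [measurable]: "f \<in> borel_measurable M" and u: "integrable M u" "\<And>x. 0 \<le> u x" and "\<epsilon> > 0"
  obtains S where "compact S" "bounded (f ` S)" "(\<integral>x. indicator (- S) x * u x \<partial>M) < \<epsilon>"
proof -
  have [measurable]: "u \<in> borel_measurable M" using u(1) by simp
  \<comment> \<open>Truncation in size and in space gives sets of finite measure on which
    \<open>f\<close> and \<open>u\<close> are bounded and which exhaust the space. They need not be
    compact, which is repaired afterwards by inner regularity.\<close>
  define A where "A = (\<lambda>n::nat. {x. norm (f x) \<le> real n \<and> u x \<le> real n} \<inter> ball undefined (real n))"
  have Am [measurable]: "A n \<in> sets M" for n
  proof -
    have "{x\<in>space M. norm (f x) \<le> real n \<and> u x \<le> real n} \<in> sets M" by measurable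
    then show ?thesis by (simp add: A_def sets_M)
  qed
  have "(\<lambda>n. \<integral>x. indicator (- A n) x * u x \<partial>M) \<longlonglongrightarrow> (\<integral>x. 0 \<partial>M)"
  proof (rule integral_dominated_convergence[where w = u])
    show "AE x in M. (\<lambda>n. indicator (- A n) x * u x) \<longlonglongrightarrow> 0"
    proof (intro AE_I2 tendsto_eventually)
      fix x
      obtain n0 where n0: "max (norm (f x)) (max (u x) (dist undefined x)) < real n0"
        using reals_Archimedean2 by blast
      show "eventually (\<lambda>n. indicator (- A n) x * u x = 0) sequentially"
        using eventually_ge_at_top[of n0]
      proof eventually_elim
        case (elim n)
        then have "real n0 \<le> real n" by simp
        then have "x \<in> A n" using n0 by (auto simp: A_def)
        then show ?case by simp
      qed
    qed
    show "AE x in M. norm (indicator (- A n) x * u x) \<le> u x" for n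
      using u(2) by (intro AE_I2) (auto simp: indicator_def)
  qed (use u in auto)
  then have "(\<lambda>n. \<integral>x. indicator (- A n) x * u x \<partial>M) \<longlonglongrightarrow> 0" by simp
  then have "eventually (\<lambda>n. (\<integral>x. indicator (- A n) x * u x \<partial>M) < \<epsilon> / 2) sequentially"
    using \<open>\<epsilon> > 0\<close> by (intro order_tendstoD) auto
  then obtain n where n: "(\<integral>x. indicator (- A n) x * u x \<partial>M) < \<epsilon> / 2"
    by (auto dest: eventually_happens)
  \<comment> \<open>Passing to a compact subset of \<open>A n\<close> loses measure at most
    \<open>\<delta>\<close>, where \<open>u\<close> is at most \<open>n\<close>; this costs at most
    half of \<open>\<epsilon>\<close>. The summand 1 avoids division by zero for
    \<open>n = 0\<close>.\<close>
  define \<delta> where "\<delta> = \<epsilon> / (2 * (real n + 1))"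
  have \<delta>: "\<delta> > 0" using \<open>\<epsilon> > 0\<close> by (simp add: \<delta>_def)
  have Afin: "emeasure M (A n) < \<infinity>"
  proof -
    have "emeasure M (A n) \<le> emeasure M (ball undefined (real n))"
      by (intro emeasure_mono) (auto simp: A_def sets_M)
    then show ?thesis
      unfolding infinity_ennreal_def by (rule le_less_trans[OF _ emeasure_ball_finite])
  qed
  have "A n \<in> sets borel" using Am[of n] by (simp add: sets_M)
  then obtain S where S: "compact S" "S \<subseteq> A n" "emeasure M (A n - S) \<le> ennreal \<delta>"
    using Afin \<delta> by (rule inner_finite)
  have Sm [measurable]: "S \<in> sets M" using S(1) by (simp add: sets_M borel_compact)
  have Dm: "measure M (A n - S) \<le> \<delta>" using S(3) \<delta> by (simp add: measure_def enn2real_leI)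
  have Dfin: "emeasure M (A n - S) < \<infinity>" using S(3) le_less_trans by fastforce
  have "(\<integral>x. indicator (- S) x * u x \<partial>M) \<le> (\<integral>x. indicator (- A n) x * u x + indicator (A n - S) x * real n \<partial>M)"
  proof (rule integral_mono)
    have 1: "- S \<in> sets M" "- A n \<in> sets M" using sets.compl_sets[OF Sm] sets.compl_sets[OF Am[of n]] by (simp_all add: Compl_eq_Diff_UNIV)
    show "integrable M (\<lambda>x. indicator (- S) x * u x)" using integrable_mult_indicator[OF 1(1) u(1)] by simp
    show "integrable M (\<lambda>x. indicator (- A n) x * u x + indicator (A n - S) x * real n)"
      using integrable_mult_indicator[OF 1(2) u(1)] Dfin
      by (intro Bochner_Integration.integrable_add integrable_mult_left) auto
    show "indicator (- S) x * u x \<le> indicator (- A n) x * u x + indicator (A n - S) x * real n" for x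
      using S(2) u(2)[of x] by (auto simp: indicator_def A_def)
  qed
  also have "\<dots> = (\<integral>x. indicator (- A n) x * u x \<partial>M) + measure M (A n - S) * real n"
  proof -
    have "- A n \<in> sets M" using sets.compl_sets[OF Am[of n]] by (simp add: Compl_eq_Diff_UNIV)
    then show ?thesis
      using integrable_mult_indicator[OF _ u(1), of "- A n"] Dfin
      by (subst Bochner_Integration.integral_add) (auto intro!: integrable_mult_left)
  qed
  also have "\<dots> < \<epsilon> / 2 + \<epsilon> / 2"
  proof (rule add_less_le_mono[OF n])
    have "measure M (A n - S) * real n \<le> \<delta> * (real n + 1)" using Dm \<delta> by (intro mult_mono) auto
    also have "\<dots> = \<epsilon> / 2" by (auto simp: \<delta>_def divide_simps algebra_simps)
    finally show "measure M (A n - S) * real n \<le> \<epsilon> / 2" .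
  qed
  finally have "(\<integral>x. indicator (- S) x * u x \<partial>M) < \<epsilon>" by simp
  moreover have "bounded (f ` S)" using S(2) by (auto simp: bounded_iff A_def)
  ultimately show thesis using that S(1) by blast
qed

lemma (in nonhom_space) bcs_dense:
  fixes f :: "'a \<Rightarrow> 'b::{real_normed_field,banach,second_countable_topology}"
  assumes f: "f \<in> Lp_space 1 M" "f \<in> Lp_space q M" and "q > 0" "\<epsilon> > 0"
  obtains g where "g \<in> bcs M" "\<And>x. norm (g x) \<le> norm (f x)" "(\<integral>x. norm (f x - g x) \<partial>M) < \<epsilon>"
    "(\<integral>x. norm (f x - g x) powr q \<partial>M) < \<epsilon>" "\<And>x. norm (f x - g x) \<le> norm (f x)"
proof -
  have [measurable]: "f \<in> borel_measurable M" using f by (simp add: Lp_space_def)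
  have i1: "integrable M (\<lambda>x. norm (f x))" using f(1) by (simp add: Lp_space_def)
  have i2: "integrable M (\<lambda>x. norm (f x) powr q)" using f(2) by (simp add: Lp_space_def)
  define u where "u = (\<lambda>x. norm (f x) + norm (f x) powr q)"
  have u: "integrable M u" "\<And>x. 0 \<le> u x" using i1 i2 by (auto simp: u_def)
  obtain S where S: "compact S" "bounded (f ` S)" "(\<integral>x. indicator (- S) x * u x \<partial>M) < \<epsilon>"
    using compact_tail[of f u \<epsilon>] u \<open>\<epsilon> > 0\<close> by auto
  have Sm [measurable]: "S \<in> sets M" using S(1) by (simp add: sets_M borel_compact)
  have Sc: "- S \<in> sets M" using sets.compl_sets[OF Sm] by (simp add: Compl_eq_Diff_UNIV)
  define g where "g = (\<lambda>x. indicator S x *\<^sub>R f x)"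
  obtain B where B: "B > 0" "\<And>x. x \<in> S \<Longrightarrow> norm (f x) \<le> B" using S(2) by (auto simp: bounded_pos)
  have gb: "g \<in> bcs M"
  proof (rule bcsI[OF _ _ S(1)])
    show "g \<in> borel_measurable M" unfolding g_def by measurable
    show "norm (g x) \<le> B" for x using B by (auto simp: g_def indicator_def)
  qed (auto simp: g_def indicator_def)
  have iu: "integrable M (\<lambda>x. indicator (- S) x * u x)" using integrable_mult_indicator[OF Sc u(1)] by simp
  show thesis
  proof (rule that[OF gb])
    show "norm (g x) \<le> norm (f x)" "norm (f x - g x) \<le> norm (f x)" for x
      by (auto simp: g_def indicator_def)
    have "(\<integral>x. norm (f x - g x) \<partial>M) \<le> (\<integral>x. indicator (- S) x * u x \<partial>M)"
    proof (rule integral_mono[OF _ iu])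
      have "integrable M (\<lambda>x. indicator (- S) x *\<^sub>R norm (f x))" by (rule integrable_mult_indicator[OF Sc i1])
      then show "integrable M (\<lambda>x. norm (f x - g x))"
        by (rule back_subst[where P = "integrable M"]) (auto simp: g_def indicator_def)
    qed (auto simp: g_def indicator_def u_def)
    then show "(\<integral>x. norm (f x - g x) \<partial>M) < \<epsilon>" using S(3) by simp
    have "(\<integral>x. norm (f x - g x) powr q \<partial>M) \<le> (\<integral>x. indicator (- S) x * u x \<partial>M)"
    proof (rule integral_mono[OF _ iu])
      have "integrable M (\<lambda>x. indicator (- S) x *\<^sub>R (norm (f x) powr q))" by (rule integrable_mult_indicator[OF Sc i2])
      then show "integrable M (\<lambda>x. norm (f x - g x) powr q)"
        by (rule back_subst[where P = "integrable M"]) (use \<open>q > 0\<close> in \<open>auto simp: g_def indicator_def\<close>)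
    qed (use \<open>q > 0\<close> in \<open>auto simp: g_def indicator_def u_def\<close>)
    then show "(\<integral>x. norm (f x - g x) powr q \<partial>M) < \<epsilon>" using S(3) by simp
  qed
qed

text \<open>The exceptional measures are summable, so by the Borel-Cantelli lemma almost every point
  eventually satisfies the bounds \<open>(1/2)^n\<close>, and these are summable too.\<close>

lemma AE_summable_norm:
  fixes v :: "nat \<Rightarrow> 'a \<Rightarrow> 'b::{banach,second_countable_topology}"
  assumes [measurable]: "\<And>n. v n \<in> borel_measurable M"
    and le: "\<And>n. emeasure M {x\<in>space M. norm (v n x) > (1/2)^n} \<le> ennreal (c * \<theta> ^ n)"
    and "0 \<le> \<theta>" "\<theta> < 1" "c \<ge> 0"
  shows "AE x in M. summable (\<lambda>n. norm (v n x))"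
proof -
  define A where "A = (\<lambda>n. {x\<in>space M. norm (v n x) > (1/2)^n})"
  have "AE x in M. eventually (\<lambda>n. x \<in> space M - A n) sequentially"
  proof (rule borel_cantelli_AE1)
    show "A n \<in> sets M" for n unfolding A_def by measurable
    show "emeasure M (A n) < \<infinity>" for n using le[of n] le_less_trans by (fastforce simp: A_def)
    have "measure M (A n) \<le> c * \<theta> ^ n" for n
      using le[of n] assms(3,5) by (auto simp: A_def measure_def intro!: enn2real_leI)
    then show "summable (\<lambda>n. measure M (A n))"
      using assms(3,4) by (intro summable_comparison_test[OF _ summable_mult[OF summable_geometric[of \<theta>], of c]]) auto
  qed
  then show ?thesis
  proof (rule AE_mp, intro AE_I2 impI)
    fix x assume "x \<in> space M" and ev: "eventually (\<lambda>n. x \<in> space M - A n) sequentially"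
    then have "eventually (\<lambda>n. norm (norm (v n x)) \<le> (1/2)^n) sequentially"
      by (auto elim!: eventually_mono simp: A_def)
    then show "summable (\<lambda>n. norm (v n x))"
      by (rule summable_comparison_test_ev) (simp add: summable_geometric)
  qed
qed

lemma convergent_if_summable_diff:
  fixes a :: "nat \<Rightarrow> 'b::banach"
  assumes "summable (\<lambda>n. norm (a (Suc n) - a n))"
  shows "convergent a"
proof -
  have "summable (\<lambda>n. a (Suc n) - a n)" using assms by (rule summable_norm_cancel)
  then have "(\<lambda>n. \<Sum>i<n. a (Suc i) - a i) \<longlonglongrightarrow> (\<Sum>n. a (Suc n) - a n)" by (rule summable_LIMSEQ)
  then have "(\<lambda>n. (\<Sum>i<n. a (Suc i) - a i) + a 0) \<longlonglongrightarrow> (\<Sum>n. a (Suc n) - a n) + a 0"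
    by (intro tendsto_add tendsto_const)
  then show ?thesis unfolding sum_lessThan_telescope by (auto simp: convergent_def)
qed

context cz_setting
begin

text \<open>The rate 1/8 is the cube of 1/2: in \<open>weak_bound\<close> both the level
  \<open>t\<close> and the measure parameter \<open>s\<close> are to decay like
  \<open>(1/2)^n\<close>, and the product of norms is compared with
  \<open>s\<^sup>2 * t\<close>.\<close>

lemma T_fast_null:
  assumes u: "\<And>n. u n \<in> bcs M" "\<And>n. h n \<in> bcs M" and "D \<ge> 0"
    and le: "\<And>n. (\<integral>x. norm (u n x) \<partial>M) * (\<integral>x. norm (h n x) \<partial>M) \<le> D * (1/8)^n"
  shows "AE x in M. summable (\<lambda>n. norm (T (u n) (h n) x))"
proof -
  obtain C where C: "C > 0" "\<And>f1 f2 s t. f1 \<in> bcs M \<Longrightarrow> f2 \<in> bcs M \<Longrightarrow> s > 0 \<Longrightarrow> t > 0 \<Longrightarrow>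
    (\<integral>x. norm (f1 x) \<partial>M) * (\<integral>x. norm (f2 x) \<partial>M) \<le> s\<^sup>2 * t \<Longrightarrow>
    emeasure M {x. norm (T f1 f2 x) > t} \<le> ennreal (C * s)"
    by (rule weak_bound) blast
  show ?thesis
  proof (rule AE_summable_norm[where c = "C * (D + 1)" and \<theta> = "1/2"])
    show "T (u n) (h n) \<in> borel_measurable M" for n by (intro T_bcs_measurable u)
    fix n
    have "(\<integral>x. norm (u n x) \<partial>M) * (\<integral>x. norm (h n x) \<partial>M) \<le> ((D + 1) * (1/2)^n)\<^sup>2 * (1/2)^n"
    proof -
      have "((1/2)^n)\<^sup>2 * (1/2)^n = ((1/8)^n :: real)"
        unfolding power2_eq_square by (simp flip: power_mult_distrib)
      then have "((D + 1) * (1/2)^n)\<^sup>2 * (1/2)^n = (D + 1)\<^sup>2 * (1/8)^n"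
        by (simp add: power_mult_distrib mult.assoc)
      moreover have "D \<le> (D + 1)\<^sup>2" using \<open>D \<ge> 0\<close> by (simp add: power2_eq_square algebra_simps)
      then have "D * (1/8)^n \<le> (D + 1)\<^sup>2 * (1/8)^n" by (intro mult_right_mono) auto
      ultimately show ?thesis using le[of n] by linarith
    qed
    then have "emeasure M {x. norm (T (u n) (h n) x) > (1/2)^n} \<le> ennreal (C * ((D + 1) * (1/2)^n))"
      using \<open>D \<ge> 0\<close> by (intro C(2) u) auto
    then show "emeasure M {x\<in>space M. norm (T (u n) (h n) x) > (1/2)^n} \<le> ennreal (C * (D + 1) * (1/2)^n)"
      by (simp add: mult.assoc)
  qed (use C(1) \<open>D \<ge> 0\<close> in auto)
qed

text \<open>The geometric rate lets the Borel-Cantelli lemma turn the weak-type bound into convergence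
  almost everywhere of \<open>T (g n) (k n)\<close>, without passing to subsequences.\<close>

definition fast :: "('a \<Rightarrow> 'b) \<Rightarrow> (nat \<Rightarrow> 'a \<Rightarrow> 'b) \<Rightarrow> bool" where
  "fast f g \<longleftrightarrow> (\<forall>n. g n \<in> bcs M) \<and> (\<exists>c. \<forall>n. (\<integral>x. norm (f x - g n x) \<partial>M) \<le> c * (1/8)^n)"

section \<open>Approximation at a geometric rate\<close>

lemma L1_integrable: "f \<in> Lp_space 1 M \<Longrightarrow> integrable M f"
  using integrable_norm_iff[of f M] by (auto simp: Lp_space_def)

lemma L1_iff: "f \<in> Lp_space 1 M \<longleftrightarrow> integrable M f"
proof
  assume "integrable M f"
  then show "f \<in> Lp_space 1 M" using integrable_norm[of M f] by (auto simp: Lp_space_def)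
qed (rule L1_integrable)

lemma fastE:
  assumes "fast f g"
  obtains c where "c \<ge> 0" "\<And>n. g n \<in> bcs M" "\<And>n. (\<integral>x. norm (f x - g n x) \<partial>M) \<le> c * (1/8)^n"
proof -
  obtain c where c: "\<And>n. (\<integral>x. norm (f x - g n x) \<partial>M) \<le> c * (1/8)^n" using assms by (auto simp: fast_def)
  have "0 \<le> (\<integral>x. norm (f x - g 0 x) \<partial>M)" by (rule integral_nonneg_AE) simp
  also have "\<dots> \<le> c" using c[of 0] by simp
  finally show thesis using that c assms by (auto simp: fast_def)
qed

lemma fast_exists:
  assumes "f \<in> Lp_space 1 M"
  shows "\<exists>g. fast f g"
proof -
  have "\<exists>g. g \<in> bcs M \<and> (\<integral>x. norm (f x - g x) \<partial>M) \<le> 1 * (1/8)^n" for n :: nat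
  proof -
    obtain g where "g \<in> bcs M" "(\<integral>x. norm (f x - g x) \<partial>M) < (1/8)^n"
      by (rule bcs_dense[OF assms assms, of "(1/8)^n"]) auto
    then show ?thesis by (intro exI[of _ g]) simp
  qed
  then obtain g where "\<And>n. g n \<in> bcs M \<and> (\<integral>x. norm (f x - g n x) \<partial>M) \<le> 1 * (1/8)^n" by metis
  then show ?thesis unfolding fast_def by blast
qed

lemma fast_Suc:
  assumes "fast f g"
  shows "fast f (\<lambda>n. g (Suc n))"
proof -
  obtain c where c: "c \<ge> 0" "\<And>n. g n \<in> bcs M" "\<And>n. (\<integral>x. norm (f x - g n x) \<partial>M) \<le> c * (1/8)^n"
    using assms by (rule fastE) blast
  have "(\<integral>x. norm (f x - g (Suc n) x) \<partial>M) \<le> c * (1/8)^n" for n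
  proof -
    have "c * (1/8)^Suc n \<le> c * (1/8)^n" using c(1) by (intro mult_left_mono power_decreasing) auto
    then show ?thesis using c(3)[of "Suc n"] by linarith
  qed
  then show ?thesis using c(2) unfolding fast_def by blast
qed

lemma fast_add:
  assumes "fast f g" "fast f' g'" and f: "f \<in> Lp_space 1 M" "f' \<in> Lp_space 1 M"
  shows "fast (\<lambda>x. f x + f' x) (\<lambda>n x. g n x + g' n x)"
proof -
  obtain c where c: "c \<ge> 0" "\<And>n. g n \<in> bcs M" "\<And>n. (\<integral>x. norm (f x - g n x) \<partial>M) \<le> c * (1/8)^n"
    using assms(1) by (rule fastE) blast
  obtain c' where c': "c' \<ge> 0" "\<And>n. g' n \<in> bcs M" "\<And>n. (\<integral>x. norm (f' x - g' n x) \<partial>M) \<le> c' * (1/8)^n"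
    using assms(2) by (rule fastE) blast
  have "(\<integral>x. norm (f x + f' x - (g n x + g' n x)) \<partial>M) \<le> (c + c') * (1/8)^n" for n
  proof -
    note i = L1_integrable[OF f(1)] L1_integrable[OF f(2)] bcs_integrable[OF c(2)[of n]] bcs_integrable[OF c'(2)[of n]]
    have "(\<integral>x. norm (f x + f' x - (g n x + g' n x)) \<partial>M) \<le> (\<integral>x. norm (f x - g n x) + norm (f' x - g' n x) \<partial>M)"
    proof (rule integral_mono)
      show "norm (f x + f' x - (g n x + g' n x)) \<le> norm (f x - g n x) + norm (f' x - g' n x)" for x
        using norm_triangle_ineq[of "f x - g n x" "f' x - g' n x"] by (simp add: algebra_simps)
    qed (use i in auto)
    also have "\<dots> = (\<integral>x. norm (f x - g n x) \<partial>M) + (\<integral>x. norm (f' x - g' n x) \<partial>M)"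
      using i by (intro Bochner_Integration.integral_add) auto
    finally show ?thesis using c(3)[of n] c'(3)[of n] by (simp add: distrib_right)
  qed
  then show ?thesis unfolding fast_def using c(2) c'(2) bcs_add by blast
qed

lemma fast_cmult:
  assumes "fast f g"
  shows "fast (\<lambda>x. a * f x) (\<lambda>n x. a * g n x)"
proof -
  obtain c where c: "c \<ge> 0" "\<And>n. g n \<in> bcs M" "\<And>n. (\<integral>x. norm (f x - g n x) \<partial>M) \<le> c * (1/8)^n"
    using assms by (rule fastE) blast
  have "(\<integral>x. norm (a * f x - a * g n x) \<partial>M) \<le> (norm a * c) * (1/8)^n" for n
  proof -
    have "(\<integral>x. norm (a * f x - a * g n x) \<partial>M) = norm a * (\<integral>x. norm (f x - g n x) \<partial>M)"
      by (simp add: norm_mult flip: right_diff_distrib)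
    then show ?thesis using c(3)[of n] by (simp add: mult_left_mono mult.assoc)
  qed
  then show ?thesis unfolding fast_def using c(2) bcs_cmult by blast
qed

lemma fast_diff:
  assumes "fast f g" "fast f g'" and f: "f \<in> Lp_space 1 M"
  obtains c where "c \<ge> 0" "\<And>n. (\<integral>x. norm (g n x - g' n x) \<partial>M) \<le> c * (1/8)^n"
proof -
  obtain c where c: "c \<ge> 0" "\<And>n. g n \<in> bcs M" "\<And>n. (\<integral>x. norm (f x - g n x) \<partial>M) \<le> c * (1/8)^n"
    using assms(1) by (rule fastE) blast
  obtain c' where c': "c' \<ge> 0" "\<And>n. g' n \<in> bcs M" "\<And>n. (\<integral>x. norm (f x - g' n x) \<partial>M) \<le> c' * (1/8)^n"
    using assms(2) by (rule fastE) blast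
  have "(\<integral>x. norm (g n x - g' n x) \<partial>M) \<le> (c + c') * (1/8)^n" for n
  proof -
    note i = L1_integrable[OF f(1)] bcs_integrable[OF c(2)[of n]] bcs_integrable[OF c'(2)[of n]]
    have "(\<integral>x. norm (g n x - g' n x) \<partial>M) \<le> (\<integral>x. norm (f x - g n x) + norm (f x - g' n x) \<partial>M)"
    proof (rule integral_mono)
      show "norm (g n x - g' n x) \<le> norm (f x - g n x) + norm (f x - g' n x)" for x
        using norm_triangle_ineq4[of "f x - g' n x" "f x - g n x"] by simp
    qed (use i in auto)
    also have "\<dots> = (\<integral>x. norm (f x - g n x) \<partial>M) + (\<integral>x. norm (f x - g' n x) \<partial>M)"
      using i by (intro Bochner_Integration.integral_add) auto
    finally show ?thesis using c(3)[of n] c'(3)[of n] by (simp add: distrib_right)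
  qed
  then show thesis using that[of "c + c'"] c(1) c'(1) by simp
qed

lemma fast_norm:
  assumes "fast f g" and f: "f \<in> Lp_space 1 M"
  obtains c where "c \<ge> 0" "\<And>n. (\<integral>x. norm (g n x) \<partial>M) \<le> (\<integral>x. norm (f x) \<partial>M) + c * (1/8)^n"
proof -
  obtain c where c: "c \<ge> 0" "\<And>n. g n \<in> bcs M" "\<And>n. (\<integral>x. norm (f x - g n x) \<partial>M) \<le> c * (1/8)^n"
    using assms(1) by (rule fastE) blast
  have "(\<integral>x. norm (g n x) \<partial>M) \<le> (\<integral>x. norm (f x) \<partial>M) + c * (1/8)^n" for n
  proof -
    note i = L1_integrable[OF f(1)] bcs_integrable[OF c(2)[of n]]
    have "(\<integral>x. norm (g n x) \<partial>M) \<le> (\<integral>x. norm (f x) + norm (f x - g n x) \<partial>M)"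
    proof (rule integral_mono)
      show "norm (g n x) \<le> norm (f x) + norm (f x - g n x)" for x
        using norm_triangle_ineq4[of "f x" "f x - g n x"] by simp
    qed (use i in auto)
    also have "\<dots> = (\<integral>x. norm (f x) \<partial>M) + (\<integral>x. norm (f x - g n x) \<partial>M)"
      using i by (intro Bochner_Integration.integral_add) auto
    finally show ?thesis using c(3)[of n] by simp
  qed
  then show thesis using that c(1) by blast
qed

lemma fast_norm_bounded:
  assumes "fast f g" and f: "f \<in> Lp_space 1 M"
  obtains b where "b \<ge> 0" "\<And>n. (\<integral>x. norm (g n x) \<partial>M) \<le> b"
proof -
  obtain c where c: "c \<ge> 0" "\<And>n. (\<integral>x. norm (g n x) \<partial>M) \<le> (\<integral>x. norm (f x) \<partial>M) + c * (1/8)^n"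
    using fast_norm[OF assms] by blast
  have "c * (1/8)^n \<le> c * 1" for n using c(1) by (intro mult_left_mono power_le_one) auto
  then have "(\<integral>x. norm (g n x) \<partial>M) \<le> (\<integral>x. norm (f x) \<partial>M) + c" for n
    using c(2)[of n] by (smt (verit) mult.right_neutral)
  then show thesis using that[of "(\<integral>x. norm (f x) \<partial>M) + c"] c(1) by (simp add: integral_nonneg_AE)
qed

text \<open>The difference is split by changing one argument at a time; each time a difference
  decaying at the fast rate meets a bounded sequence. With a shifted sequence this yields
  convergence, with another sequence independence of the choice.\<close>

lemma fast_compare:
  assumes g: "fast f g" "fast f g'" and k: "fast h k" "fast h k'"
    and L: "f \<in> Lp_space 1 M" "h \<in> Lp_space 1 M"
  shows "AE x in M. summable (\<lambda>n. norm (T (g n) (k n) x - T (g' n) (k' n) x))"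
proof -
  have bc: "\<And>n. g n \<in> bcs M" "\<And>n. g' n \<in> bcs M" "\<And>n. k n \<in> bcs M" "\<And>n. k' n \<in> bcs M"
    using g k by (auto simp: fast_def)
  obtain c where c: "c \<ge> 0" "\<And>n. (\<integral>x. norm (g n x - g' n x) \<partial>M) \<le> c * (1/8)^n"
    using fast_diff[OF g L(1)] by blast
  obtain c' where c': "c' \<ge> 0" "\<And>n. (\<integral>x. norm (k n x - k' n x) \<partial>M) \<le> c' * (1/8)^n"
    using fast_diff[OF k L(2)] by blast
  obtain b where b: "b \<ge> 0" "\<And>n. (\<integral>x. norm (k n x) \<partial>M) \<le> b" using fast_norm_bounded[OF k(1) L(2)] by blast
  obtain b' where b': "b' \<ge> 0" "\<And>n. (\<integral>x. norm (g' n x) \<partial>M) \<le> b'" using fast_norm_bounded[OF g(2) L(1)] by blast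
  have "AE x in M. summable (\<lambda>n. norm (T (\<lambda>y. g n y - g' n y) (k n) x))"
  proof (rule T_fast_null)
    show "(\<integral>x. norm (g n x - g' n x) \<partial>M) * (\<integral>x. norm (k n x) \<partial>M) \<le> (c * b) * (1/8)^n" for n
      using mult_mono[OF c(2)[of n] b(2)[of n]] c(1) by (simp add: mult_ac integral_nonneg_AE)
  qed (use bc c b in \<open>auto intro: bcs_diff\<close>)
  moreover have "AE x in M. summable (\<lambda>n. norm (T (g' n) (\<lambda>y. k n y - k' n y) x))"
  proof (rule T_fast_null)
    show "(\<integral>x. norm (g' n x) \<partial>M) * (\<integral>x. norm (k n x - k' n x) \<partial>M) \<le> (b' * c') * (1/8)^n" for n
      using mult_mono[OF b'(2)[of n] c'(2)[of n] b'(1)] by (simp add: mult_ac integral_nonneg_AE)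
  qed (use bc c' b' in \<open>auto intro: bcs_diff\<close>)
  moreover have "AE x in M. \<forall>n. T (\<lambda>y. g n y - g' n y) (k n) x = T (g n) (k n) x - T (g' n) (k n) x"
    unfolding AE_all_countable by (intro allI T_diff1 bc)
  moreover have "AE x in M. \<forall>n. T (g' n) (\<lambda>y. k n y - k' n y) x = T (g' n) (k n) x - T (g' n) (k' n) x"
    unfolding AE_all_countable by (intro allI T_diff2 bc)
  ultimately show ?thesis
  proof eventually_elim
    case (elim x)
    show ?case
    proof (rule summable_comparison_test'[OF summable_add[OF elim(1,2)]])
      fix n :: nat
      show "norm (norm (T (g n) (k n) x - T (g' n) (k' n) x))
        \<le> norm (T (\<lambda>y. g n y - g' n y) (k n) x) + norm (T (g' n) (\<lambda>y. k n y - k' n y) x)"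
        using elim(3,4) norm_triangle_ineq[of "T (g n) (k n) x - T (g' n) (k n) x" "T (g' n) (k n) x - T (g' n) (k' n) x"]
        by simp
    qed
  qed
qed

section \<open>The extended operator\<close>

definition approximants :: "('a \<Rightarrow> 'b) \<Rightarrow> nat \<Rightarrow> 'a \<Rightarrow> 'b" where
  "approximants f = (SOME g. fast f g)"

text \<open>The limit is taken pointwise along chosen approximants. Where it does not exist the
  value is whatever \<open>lim\<close> returns; for arguments in \<open>Lp_space 1 M\<close> this
  concerns a null set only.\<close>

definition T_ext :: "('a \<Rightarrow> 'b) \<Rightarrow> ('a \<Rightarrow> 'b) \<Rightarrow> 'a \<Rightarrow> 'b" where
  "T_ext f h x = lim (\<lambda>n. T (approximants f n) (approximants h n) x)"

lemma fast_approximants: "f \<in> Lp_space 1 M \<Longrightarrow> fast f (approximants f)"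
  unfolding approximants_def by (rule someI_ex[OF fast_exists])

text \<open>Any fast approximation gives the same limit almost everywhere. Bilinearity follows,
  because sums and multiples of fast approximations are again fast.\<close>

lemma T_ext_limit:
  assumes g: "fast f g" "fast h k" and L: "f \<in> Lp_space 1 M" "h \<in> Lp_space 1 M"
  shows "AE x in M. (\<lambda>n. T (g n) (k n) x) \<longlonglongrightarrow> T_ext f h x"
proof -
  note F = fast_approximants[OF L(1)] fast_approximants[OF L(2)]
  have "AE x in M. summable (\<lambda>n. norm (T (approximants f (Suc n)) (approximants h (Suc n)) x
      - T (approximants f n) (approximants h n) x))"
    by (rule fast_compare[OF fast_Suc[OF F(1)] F(1) fast_Suc[OF F(2)] F(2) L])
  moreover have "AE x in M. summable (\<lambda>n. norm (T (g n) (k n) x - T (approximants f n) (approximants h n) x))"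
    by (rule fast_compare[OF g(1) F(1) g(2) F(2) L])
  ultimately show ?thesis
  proof eventually_elim
    case (elim x)
    have "convergent (\<lambda>n. T (approximants f n) (approximants h n) x)"
      using elim(1) by (rule convergent_if_summable_diff)
    then have "(\<lambda>n. T (approximants f n) (approximants h n) x) \<longlonglongrightarrow> T_ext f h x"
      unfolding T_ext_def by (simp add: convergent_LIMSEQ_iff)
    moreover have "(\<lambda>n. T (g n) (k n) x - T (approximants f n) (approximants h n) x) \<longlonglongrightarrow> 0"
      using summable_LIMSEQ_zero[OF elim(2)] by (simp add: tendsto_norm_zero_iff)
    ultimately have "(\<lambda>n. (T (g n) (k n) x - T (approximants f n) (approximants h n) x)
        + T (approximants f n) (approximants h n) x) \<longlonglongrightarrow> 0 + T_ext f h x"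
      by (intro tendsto_add)
    then show ?case by simp
  qed
qed

lemma T_ext_measurable:
  assumes L: "f \<in> Lp_space 1 M" "h \<in> Lp_space 1 M"
  shows "T_ext f h \<in> borel_measurable M"
proof -
  have "(\<lambda>x. lim (\<lambda>n. T (approximants f n) (approximants h n) x)) \<in> borel_measurable M"
    using fast_approximants[OF L(1)] fast_approximants[OF L(2)]
    by (intro borel_measurable_lim_metric T_bcs_measurable) (auto simp: fast_def)
  then show ?thesis by (simp add: T_ext_def[abs_def])
qed

lemma L1_add: "f \<in> Lp_space 1 M \<Longrightarrow> g \<in> Lp_space 1 M \<Longrightarrow> (\<lambda>x. f x + g x) \<in> Lp_space 1 M"
  unfolding L1_iff by (rule Bochner_Integration.integrable_add)

lemma L1_cmult: "f \<in> Lp_space 1 M \<Longrightarrow> (\<lambda>x. a * f x) \<in> Lp_space 1 M"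
  unfolding L1_iff by simp

lemma T_ext_bilinear: "bilinear_ae M (Lp_space 1 M) (Lp_space 1 M) T_ext"
  unfolding bilinear_ae_def
proof (intro conjI ballI allI)
  fix f g h :: "'a \<Rightarrow> 'b" assume L: "f \<in> Lp_space 1 M" "g \<in> Lp_space 1 M" "h \<in> Lp_space 1 M"
  note F = fast_approximants[OF L(1)] fast_approximants[OF L(2)] fast_approximants[OF L(3)]
  have bc: "\<And>n. approximants f n \<in> bcs M" "\<And>n. approximants g n \<in> bcs M" "\<And>n. approximants h n \<in> bcs M"
    using F by (auto simp: fast_def)
  have "AE x in M. (\<lambda>n. T (\<lambda>y. approximants f n y + approximants g n y) (approximants h n) x) \<longlonglongrightarrow> T_ext (\<lambda>y. f y + g y) h x"
    by (intro T_ext_limit fast_add F L L1_add)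
  moreover have "AE x in M. \<forall>n. T (\<lambda>y. approximants f n y + approximants g n y) (approximants h n) x
      = T (approximants f n) (approximants h n) x + T (approximants g n) (approximants h n) x"
    unfolding AE_all_countable by (intro allI T_add1 bc)
  moreover have "AE x in M. (\<lambda>n. T (approximants f n) (approximants h n) x) \<longlonglongrightarrow> T_ext f h x"
    by (intro T_ext_limit F L)
  moreover have "AE x in M. (\<lambda>n. T (approximants g n) (approximants h n) x) \<longlonglongrightarrow> T_ext g h x"
    by (intro T_ext_limit F L)
  ultimately show "AE x in M. T_ext (\<lambda>y. f y + g y) h x = T_ext f h x + T_ext g h x"
  proof eventually_elim
    case (elim x)
    then show ?case using tendsto_add[OF elim(3,4)] by (simp add: LIMSEQ_unique)
  qed
  have "AE x in M. (\<lambda>n. T (approximants f n) (\<lambda>y. approximants g n y + approximants h n y) x) \<longlonglongrightarrow> T_ext f (\<lambda>y. g y + h y) x"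
    by (intro T_ext_limit fast_add F L L1_add)
  moreover have "AE x in M. \<forall>n. T (approximants f n) (\<lambda>y. approximants g n y + approximants h n y) x
      = T (approximants f n) (approximants g n) x + T (approximants f n) (approximants h n) x"
    unfolding AE_all_countable by (intro allI T_add2 bc)
  moreover have "AE x in M. (\<lambda>n. T (approximants f n) (approximants g n) x) \<longlonglongrightarrow> T_ext f g x"
    by (intro T_ext_limit F L)
  moreover have "AE x in M. (\<lambda>n. T (approximants f n) (approximants h n) x) \<longlonglongrightarrow> T_ext f h x"
    by (intro T_ext_limit F L)
  ultimately show "AE x in M. T_ext f (\<lambda>y. g y + h y) x = T_ext f g x + T_ext f h x"
  proof eventually_elim
    case (elim x)
    then show ?case using tendsto_add[OF elim(3,4)] by (simp add: LIMSEQ_unique)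
  qed
next
  fix a and f h :: "'a \<Rightarrow> 'b" assume L: "f \<in> Lp_space 1 M" "h \<in> Lp_space 1 M"
  note F = fast_approximants[OF L(1)] fast_approximants[OF L(2)]
  have bc: "\<And>n. approximants f n \<in> bcs M" "\<And>n. approximants h n \<in> bcs M"
    using F by (auto simp: fast_def)
  have lim: "AE x in M. (\<lambda>n. T (approximants f n) (approximants h n) x) \<longlonglongrightarrow> T_ext f h x"
    by (intro T_ext_limit F L)
  have "AE x in M. (\<lambda>n. T (\<lambda>y. a * approximants f n y) (approximants h n) x) \<longlonglongrightarrow> T_ext (\<lambda>y. a * f y) h x"
    by (intro T_ext_limit fast_cmult F L L1_cmult)
  moreover have "AE x in M. \<forall>n. T (\<lambda>y. a * approximants f n y) (approximants h n) x
      = a * T (approximants f n) (approximants h n) x"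
    unfolding AE_all_countable by (intro allI T_cmult1 bc)
  ultimately show "AE x in M. T_ext (\<lambda>y. a * f y) h x = a * T_ext f h x"
    using lim
  proof eventually_elim
    case (elim x)
    then show ?case using tendsto_mult_left[OF elim(3), of a] by (simp add: LIMSEQ_unique)
  qed
  have "AE x in M. (\<lambda>n. T (approximants f n) (\<lambda>y. a * approximants h n y) x) \<longlonglongrightarrow> T_ext f (\<lambda>y. a * h y) x"
    by (intro T_ext_limit fast_cmult F L L1_cmult)
  moreover have "AE x in M. \<forall>n. T (approximants f n) (\<lambda>y. a * approximants h n y) x
      = a * T (approximants f n) (approximants h n) x"
    unfolding AE_all_countable by (intro allI T_cmult2 bc)
  ultimately show "AE x in M. T_ext f (\<lambda>y. a * h y) x = a * T_ext f h x"
    using lim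
  proof eventually_elim
    case (elim x)
    then show ?case using tendsto_mult_left[OF elim(3), of a] by (simp add: LIMSEQ_unique)
  qed
qed

lemma Lp_diff_bcs:
  assumes f: "f \<in> Lp_space q M" and g: "g \<in> bcs M" and "q > 0" and le: "\<And>x. norm (f x - g x) \<le> norm (f x)"
  shows "(\<lambda>x. f x - g x) \<in> Lp_space q M"
proof -
  have [measurable]: "f \<in> borel_measurable M" "g \<in> borel_measurable M"
    using f bcs_measurable[OF g] by (auto simp: Lp_space_def)
  have "integrable M (\<lambda>x. norm (f x - g x) powr q)"
  proof (rule Bochner_Integration.integrable_bound)
    show "integrable M (\<lambda>x. norm (f x) powr q)" using f by (simp add: Lp_space_def)
    show "AE x in M. norm (norm (f x - g x) powr q) \<le> norm (norm (f x) powr q)"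
      using le \<open>q > 0\<close> by (intro AE_I2) (auto intro!: powr_mono2)
  qed measurable
  then show ?thesis by (simp add: Lp_space_def)
qed

text \<open>Approximants are chosen that converge fast in \<open>Lp_space 1 M\<close> and also in
  the space in which \<open>T\<close> is given. The limit along them is \<open>T_ext\<close> by the
  former property, and \<open>T\<close> by the bound on Lebesgue spaces and the Borel-Cantelli
  argument.\<close>

lemma T_ext_eq:
  assumes f1: "f1 \<in> Lp_space 1 M" "f1 \<in> Lp_space p1 M" and f2: "f2 \<in> Lp_space 1 M" "f2 \<in> Lp_space p2 M"
  shows "AE x in M. T_ext f1 f2 x = T f1 f2 x"
proof -
  have p0: "p > 0" "p1 > 0" "p2 > 0" using p by auto
  \<comment> \<open>The error has norm at most \<open>(1/4)^n\<close>. Measured at level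
    \<open>(1/2)^n\<close>, as in \<open>AE_summable_norm\<close>, this leaves a ratio of
    \<open>(1/2)^n\<close>, whose power \<open>p > 1\<close> is summable.\<close>
  define P where "P = (\<lambda>(f :: 'a \<Rightarrow> 'b) q (n::nat) (g :: 'a \<Rightarrow> 'b). g \<in> bcs M \<and> (\<forall>x. norm (g x) \<le> norm (f x)) \<and>
    (\<forall>x. norm (f x - g x) \<le> norm (f x)) \<and> (\<integral>x. norm (f x - g x) \<partial>M) \<le> 1 * (1/8)^n \<and>
    (\<integral>x. norm (f x - g x) powr q \<partial>M) \<le> ((1/4)^n) powr q)"
  have ex: "\<exists>g. P f q n g" if L: "f \<in> Lp_space 1 M" "f \<in> Lp_space q M" "q > 0" for f :: "'a \<Rightarrow> 'b" and q and n :: nat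
  proof -
    have "min ((1/8)^n) (((1/4)^n) powr q) > 0" by simp
    then obtain g where "g \<in> bcs M" "\<And>x. norm (g x) \<le> norm (f x)" "(\<integral>x. norm (f x - g x) \<partial>M) < min ((1/8)^n) (((1/4)^n) powr q)"
      "(\<integral>x. norm (f x - g x) powr q \<partial>M) < min ((1/8)^n) (((1/4)^n) powr q)" "\<And>x. norm (f x - g x) \<le> norm (f x)"
      by (rule bcs_dense[OF L]) blast
    then show ?thesis unfolding P_def by (intro exI[of _ g]) auto
  qed
  obtain g where g: "\<And>n. P f1 p1 n (g n)" using ex[OF f1 p0(2)] by metis
  obtain k where k: "\<And>n. P f2 p2 n (k n)" using ex[OF f2 p0(3)] by metis
  have bc: "g n \<in> bcs M" "k n \<in> bcs M" for n using g[of n] k[of n] by (auto simp: P_def)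
  have fast: "fast f1 g" "fast f2 k" using g k unfolding fast_def P_def by blast+
  have dL: "(\<lambda>x. f1 x - g n x) \<in> Lp_space p1 M" "(\<lambda>x. f2 x - k n x) \<in> Lp_space p2 M" for n
    using g[of n] k[of n] p0 by (auto simp: P_def intro!: Lp_diff_bcs f1 f2)
  define I1 where "I1 = (\<integral>x. norm (f1 x) powr p1 \<partial>M) powr (1 / p1)"
  define I2 where "I2 = (\<integral>x. norm (f2 x) powr p2 \<partial>M) powr (1 / p2)"
  have I: "I1 \<ge> 0" "I2 \<ge> 0" "I1 powr p1 = (\<integral>x. norm (f1 x) powr p1 \<partial>M)" "I2 powr p2 = (\<integral>x. norm (f2 x) powr p2 \<partial>M)"
    using p0 by (simp_all add: I1_def I2_def powr_powr integral_nonneg_AE)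
  have calc: "ennreal ((CT * (1/4)^n * b / (1/2)^n) powr p * 1) \<le> ennreal ((CT * b) powr p * (1/2)^n)"
    if "b \<ge> 0" for b n
  proof (rule ennreal_leI)
    have "(1/4::real)^n / (1/2)^n = (1/2)^n" by (simp flip: power_divide)
    then have "CT * (1/4)^n * b / (1/2)^n = CT * b * (1/2)^n"
      by (metis (no_types, lifting) mult.assoc mult.commute times_divide_eq_right)
    moreover have "((1/2::real)^n) powr p \<le> ((1/2)^n) powr 1"
      using p by (intro powr_mono') (auto simp: power_le_one)
    ultimately show "(CT * (1/4)^n * b / (1/2)^n) powr p * 1 \<le> (CT * b) powr p * (1/2)^n"
      using CT that by (simp add: powr_mult mult_left_mono)
  qed
  have gt: "emeasure M {x\<in>space M. norm (v x) > t} \<le> emeasure M {x. norm (v x) \<ge> t}"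
    if [measurable]: "v \<in> borel_measurable M" for v :: "'a \<Rightarrow> 'b" and t
  proof -
    have "{x\<in>space M. norm (v x) \<ge> t} \<in> sets M" by measurable
    then show ?thesis by (intro emeasure_mono) auto
  qed
  have s1: "AE x in M. summable (\<lambda>n. norm (T (\<lambda>y. f1 y - g n y) f2 x))"
  proof (rule AE_summable_norm[where c = "(CT * I2) powr p" and \<theta> = "1/2"])
    show m: "T (\<lambda>y. f1 y - g n y) f2 \<in> borel_measurable M" for n by (intro T_measurable dL f2)
    fix n
    have "emeasure M {x. norm (T (\<lambda>y. f1 y - g n y) f2 x) \<ge> (1/2)^n} \<le> ennreal ((CT * (1/4)^n * I2 / (1/2)^n) powr p * 1)"
      by (rule T_weak_bound) (use dL f2 I g[of n] in \<open>auto simp: P_def\<close>)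
    then show "emeasure M {x\<in>space M. norm (T (\<lambda>y. f1 y - g n y) f2 x) > (1/2)^n} \<le> ennreal ((CT * I2) powr p * (1/2)^n)"
      by (rule order_trans[OF gt[OF m] order_trans[OF _ calc[OF I(2)]]])
  qed auto
  have s2: "AE x in M. summable (\<lambda>n. norm (T (g n) (\<lambda>y. f2 y - k n y) x))"
  proof (rule AE_summable_norm[where c = "(CT * I1) powr p" and \<theta> = "1/2"])
    show m: "T (g n) (\<lambda>y. f2 y - k n y) \<in> borel_measurable M" for n by (intro T_measurable dL bcs_Lp1 bc)
    fix n
    have "(\<integral>x. norm (g n x) powr p1 \<partial>M) \<le> (\<integral>x. norm (f1 x) powr p1 \<partial>M)"
    proof (rule integral_mono)
      show "integrable M (\<lambda>x. norm (g n x) powr p1)" by (rule bcs_powr_integrable[OF bc(1) p0(2)])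
      show "integrable M (\<lambda>x. norm (f1 x) powr p1)" using f1(2) by (simp add: Lp_space_def)
      show "norm (g n x) powr p1 \<le> norm (f1 x) powr p1" for x
        using g[of n] p0(2) by (intro powr_mono2) (auto simp: P_def)
    qed
    then have "emeasure M {x. norm (T (g n) (\<lambda>y. f2 y - k n y) x) \<ge> (1/2)^n} \<le> ennreal ((CT * I1 * (1/4)^n / (1/2)^n) powr p * 1)"
      by (intro T_weak_bound) (use dL bcs_Lp1[OF bc(1)] I k[of n] in \<open>auto simp: P_def\<close>)
    also have "CT * I1 * (1/4)^n / (1/2)^n = CT * (1/4)^n * I1 / (1/2)^n" by (simp only: mult_ac)
    finally show "emeasure M {x\<in>space M. norm (T (g n) (\<lambda>y. f2 y - k n y) x) > (1/2)^n} \<le> ennreal ((CT * I1) powr p * (1/2)^n)"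
      by (rule order_trans[OF gt[OF m] order_trans[OF _ calc[OF I(1)]]])
  qed auto
  have b1: "AE x in M. \<forall>n. T f1 f2 x = T (g n) f2 x + T (\<lambda>y. f1 y - g n y) f2 x"
    unfolding AE_all_countable
  proof
    fix n
    have "AE x in M. T (\<lambda>y. g n y + (f1 y - g n y)) f2 x = T (g n) f2 x + T (\<lambda>y. f1 y - g n y) f2 x"
      by (rule T_bilinear[unfolded bilinear_ae_def, THEN conjunct1, rule_format, OF bcs_Lp1[OF bc(1)] dL(1) f2(2)])
    then show "AE x in M. T f1 f2 x = T (g n) f2 x + T (\<lambda>y. f1 y - g n y) f2 x" by simp
  qed
  have b2: "AE x in M. \<forall>n. T (g n) f2 x = T (g n) (k n) x + T (g n) (\<lambda>y. f2 y - k n y) x"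
    unfolding AE_all_countable
  proof
    fix n
    have "AE x in M. T (g n) (\<lambda>y. k n y + (f2 y - k n y)) x = T (g n) (k n) x + T (g n) (\<lambda>y. f2 y - k n y) x"
      by (rule T_bilinear[unfolded bilinear_ae_def, THEN conjunct2, THEN conjunct2, THEN conjunct1, rule_format,
            OF bcs_Lp1[OF bc(1)] bcs_Lp2[OF bc(2)] dL(2)])
    then show "AE x in M. T (g n) f2 x = T (g n) (k n) x + T (g n) (\<lambda>y. f2 y - k n y) x" by simp
  qed
  have lim: "AE x in M. (\<lambda>n. T (g n) (k n) x) \<longlonglongrightarrow> T_ext f1 f2 x"
    by (rule T_ext_limit[OF fast f1(1) f2(1)])
  show ?thesis
    using s1 s2 b1 b2 lim
  proof eventually_elim
    case (elim x)
    have z: "(\<lambda>n. T (\<lambda>y. f1 y - g n y) f2 x) \<longlonglongrightarrow> 0" "(\<lambda>n. T (g n) (\<lambda>y. f2 y - k n y) x) \<longlonglongrightarrow> 0"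
      using summable_LIMSEQ_zero[OF elim(1)] summable_LIMSEQ_zero[OF elim(2)] by (simp_all add: tendsto_norm_zero_iff)
    have "(\<lambda>n. T f1 f2 x - T (\<lambda>y. f1 y - g n y) f2 x - T (g n) (\<lambda>y. f2 y - k n y) x) \<longlonglongrightarrow> T f1 f2 x - 0 - 0"
      by (intro tendsto_diff tendsto_const z)
    moreover have "T f1 f2 x - T (\<lambda>y. f1 y - g n y) f2 x - T (g n) (\<lambda>y. f2 y - k n y) x = T (g n) (k n) x" for n
    proof -
      have "T f1 f2 x = T (g n) (k n) x + T (g n) (\<lambda>y. f2 y - k n y) x + T (\<lambda>y. f1 y - g n y) f2 x"
        using elim(3,4) by metis
      then show ?thesis by simp
    qed
    ultimately have "(\<lambda>n. T (g n) (k n) x) \<longlonglongrightarrow> T f1 f2 x" by simp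
    then show ?case using elim(5) LIMSEQ_unique by blast
  qed
qed

lemma Lp_norm_1: "Lp_norm 1 M f = (\<integral>x. norm (f x) \<partial>M)"
  by (simp add: Lp_norm_def integral_nonneg_AE)

text \<open>The bound passes to the limit by Fatou's lemma, applied to indicators of the strict
  level sets. It requires the condition on norms for the approximants eventually, hence a strict
  inequality for the limit functions.\<close>

lemma T_ext_weak:
  "\<exists>C. \<forall>f1\<in>Lp_space 1 M. \<forall>f2\<in>Lp_space 1 M.
    weak_L_half_norm M (T_ext f1 f2) \<le> ennreal (C * Lp_norm 1 M f1 * Lp_norm 1 M f2)"
proof -
  obtain C where C: "C > 0" "\<And>f1 f2 s t. f1 \<in> bcs M \<Longrightarrow> f2 \<in> bcs M \<Longrightarrow> s > 0 \<Longrightarrow> t > 0 \<Longrightarrow>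
    (\<integral>x. norm (f1 x) \<partial>M) * (\<integral>x. norm (f2 x) \<partial>M) \<le> s\<^sup>2 * t \<Longrightarrow>
    emeasure M {x. norm (T f1 f2 x) > t} \<le> ennreal (C * s)"
    by (rule weak_bound) blast
  have "weak_L_half_norm M (T_ext f1 f2) \<le> ennreal (4 * C\<^sup>2 * Lp_norm 1 M f1 * Lp_norm 1 M f2)"
    if L: "f1 \<in> Lp_space 1 M" "f2 \<in> Lp_space 1 M" for f1 f2
  proof -
    define N1 where "N1 = (\<integral>x. norm (f1 x) \<partial>M)"
    define N2 where "N2 = (\<integral>x. norm (f2 x) \<partial>M)"
    have N0: "N1 \<ge> 0" "N2 \<ge> 0" by (auto simp: N1_def N2_def integral_nonneg_AE)
    define g where "g = approximants f1"
    define k where "k = approximants f2"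
    have fast: "fast f1 g" "fast f2 k" unfolding g_def k_def by (intro fast_approximants L)+
    have bc: "\<And>n. g n \<in> bcs M" "\<And>n. k n \<in> bcs M" using fast by (auto simp: fast_def)
    obtain c where c: "c \<ge> 0" "\<And>n. (\<integral>x. norm (g n x) \<partial>M) \<le> N1 + c * (1/8)^n"
      using fast_norm[OF fast(1) L(1)] unfolding N1_def by blast
    obtain c' where c': "c' \<ge> 0" "\<And>n. (\<integral>x. norm (k n x) \<partial>M) \<le> N2 + c' * (1/8)^n"
      using fast_norm[OF fast(2) L(2)] unfolding N2_def by blast
    have [measurable]: "T_ext f1 f2 \<in> borel_measurable M" "\<And>n. T (g n) (k n) \<in> borel_measurable M"
      by (intro T_ext_measurable T_bcs_measurable L bc)+
    define A where "A = (\<lambda>t. {x\<in>space M. norm (T_ext f1 f2 x) > t})"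
    have key: "emeasure M (A t) \<le> ennreal (C * s)" if "t > 0" "s > 0" "N1 * N2 < s\<^sup>2 * t" for s t
    proof -
      have "(\<lambda>n. (N1 + c * (1/8)^n) * (N2 + c' * (1/8)^n)) \<longlonglongrightarrow> (N1 + c * 0) * (N2 + c' * 0)"
        by (intro tendsto_intros LIMSEQ_power_zero) auto
      then have "eventually (\<lambda>n. (N1 + c * (1/8)^n) * (N2 + c' * (1/8)^n) < s\<^sup>2 * t) sequentially"
        using that(3) by (intro order_tendstoD) auto
      then have ev: "eventually (\<lambda>n. emeasure M {x. norm (T (g n) (k n) x) > t} \<le> ennreal (C * s)) sequentially"
      proof eventually_elim
        case (elim n)
        have "(\<integral>x. norm (g n x) \<partial>M) * (\<integral>x. norm (k n x) \<partial>M) \<le> (N1 + c * (1/8)^n) * (N2 + c' * (1/8)^n)"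
          using c c' N0 by (intro mult_mono) (auto simp: integral_nonneg_AE)
        then show ?case using elim that by (intro C(2) bc) auto
      qed
      define An where "An = (\<lambda>n. {x\<in>space M. norm (T (g n) (k n) x) > t})"
      have [measurable]: "An n \<in> sets M" "A t \<in> sets M" for n unfolding An_def A_def by measurable
      have "emeasure M (A t) = (\<integral>\<^sup>+x. indicator (A t) x \<partial>M)" by simp
      also have "\<dots> \<le> (\<integral>\<^sup>+x. liminf (\<lambda>n. indicator (An n) x) \<partial>M)"
      proof (rule nn_integral_mono_AE)
        show "AE x in M. indicator (A t) x \<le> (liminf (\<lambda>n. indicator (An n) x) :: ennreal)"
          using T_ext_limit[OF fast L]
        proof eventually_elim
          case (elim x)
          show ?case
          proof (cases "x \<in> A t")
            case True
            then have "eventually (\<lambda>n. norm (T (g n) (k n) x) > t) sequentially"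
              using order_tendstoD(1)[OF tendsto_norm[OF elim]] by (simp add: A_def)
            then have "eventually (\<lambda>n. (1::ennreal) \<le> indicator (An n) x) sequentially"
              by eventually_elim (simp add: An_def)
            then have "(1::ennreal) \<le> liminf (\<lambda>n. indicator (An n) x)" by (rule Liminf_bounded)
            then show ?thesis using True by simp
          qed simp
        qed
      qed
      also have "\<dots> \<le> liminf (\<lambda>n. \<integral>\<^sup>+x. indicator (An n) x \<partial>M)"
        by (rule nn_integral_liminf) measurable
      also have "\<dots> = liminf (\<lambda>n. emeasure M {x. norm (T (g n) (k n) x) > t})" by (simp add: An_def)
      also have "\<dots> \<le> liminf (\<lambda>n. ennreal (C * s))" using ev by (rule Liminf_mono)
      also have "\<dots> = ennreal (C * s)" by (simp add: Liminf_const)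
      finally show ?thesis .
    qed
    have "ennreal t * (emeasure M (A t))\<^sup>2 \<le> ennreal (4 * C\<^sup>2 * N1 * N2)" if "t > 0" for t
    proof (cases "N1 * N2 = 0")
      \<comment> \<open>The parameter \<open>s\<close> may be arbitrarily small here, so the level
        set is null.\<close>
      case True
      have "emeasure M (A t) \<le> 0"
      proof (rule ennreal_le_epsilon)
        fix e :: real assume "e > 0"
        then show "emeasure M (A t) \<le> 0 + ennreal e"
          using key[of t "e / C"] True \<open>t > 0\<close> C(1) by simp
      qed
      then show ?thesis by simp
    next
      case False
      \<comment> \<open>The factor 2 makes the condition \<open>N1 * N2 < s\<^sup>2 * t\<close>
        strict; its square is the 4 in the constant.\<close>
      define s where "s = 2 * sqrt (N1 * N2 / t)"
      have pos: "N1 * N2 > 0" using False N0 by (metis mult_nonneg_nonneg order_le_less)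
      have s: "s > 0" "s\<^sup>2 * t = 4 * (N1 * N2)"
        using pos \<open>t > 0\<close> by (auto simp: s_def power_mult_distrib)
      then have "emeasure M (A t) \<le> ennreal (C * s)" using pos \<open>t > 0\<close> by (intro key) auto
      then have "ennreal t * (emeasure M (A t))\<^sup>2 \<le> ennreal t * (ennreal (C * s))\<^sup>2"
        by (intro mult_left_mono power_mono) auto
      also have "\<dots> = ennreal (t * (C * s)\<^sup>2)"
        using \<open>t > 0\<close> C(1) s(1) by (simp add: ennreal_power flip: ennreal_mult)
      also have "t * (C * s)\<^sup>2 = 4 * C\<^sup>2 * N1 * N2"
        using s(2) by (simp add: power_mult_distrib mult_ac)
      finally show ?thesis .
    qed
    then show ?thesis
      unfolding weak_L_half_norm_def Lp_norm_1 N1_def[symmetric] N2_def[symmetric] A_def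
      by (intro SUP_least) auto
  qed
  then show ?thesis by blast
qed

lemma extends_boundedly: "extends_boundedly_L1_weak_L_half M p1 p2 T"
  unfolding extends_boundedly_L1_weak_L_half_def bounded_bilinear_L1_weak_L_half_def
  using T_ext_bilinear T_ext_measurable T_ext_weak T_ext_eq by (intro exI[of _ T_ext]) blast

end

text \<open>The complement of the diagonal is a countable union of products of balls with centres in
  a countable dense set, each contained in an open set on which the kernel is integrable.
  Measurability is checked on these pieces and on the remaining set.\<close>

lemma (in nonhom_space) off_diagonal_measurable:
  fixes K :: "'a \<Rightarrow> 'a \<Rightarrow> 'a \<Rightarrow> 'b::{real_normed_field,banach,second_countable_topology}"
  assumes loc: "\<forall>q\<in>- range (\<lambda>z. (z, z, z)). \<exists>U\<subseteq>- range (\<lambda>z. (z, z, z)). open U \<and> q \<in> U \<and>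
    set_integrable (M \<Otimes>\<^sub>M M \<Otimes>\<^sub>M M) U (\<lambda>(x, y1, y2). K x y1 y2)"
  shows "(\<lambda>(x, y1, y2). if x = y1 \<and> x = y2 then 0 else K x y1 y2) \<in> borel_measurable (M \<Otimes>\<^sub>M M \<Otimes>\<^sub>M M)"
    (is "?F \<in> borel_measurable ?P")
proof -
  define D where "D = range (\<lambda>z::'a. (z, z, z))"
  obtain Q :: "'a set" where Q: "countable Q" "\<And>x \<epsilon>. \<epsilon> > 0 \<Longrightarrow> \<exists>q\<in>Q. dist q x < \<epsilon>"
    by (rule countable_dense) blast
  define R where "R = (\<lambda>(a::'a, b::'a, c::'a, n::nat). ball a (1 / real (Suc n)) \<times> ball b (1 / real (Suc n)) \<times> ball c (1 / real (Suc n)))"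
  define good where "good = (\<lambda>U. U \<subseteq> - D \<and> set_integrable ?P U (\<lambda>(x, y1, y2). K x y1 y2))"
  define I where "I = {i \<in> Q \<times> Q \<times> Q \<times> UNIV. \<exists>U. good U \<and> R i \<subseteq> U}"
  have cI: "countable I" unfolding I_def
    by (rule countable_subset[of _ "Q \<times> Q \<times> Q \<times> (UNIV::nat set)"]) (use Q(1) in auto)
  have Rm: "R i \<in> sets ?P" for i
    unfolding R_def by (cases i) (auto simp: sets_M intro!: pair_measureI)
  have cover: "q \<in> (\<Union>i\<in>I. R i)" if "q \<notin> D" for q
  proof -
    obtain x y1 y2 where q: "q = (x, y1, y2)" by (cases q) auto
    from bspec[OF loc, of q] that obtain U where U: "U \<subseteq> - D" "open U" "q \<in> U"
      "set_integrable ?P U (\<lambda>(x, y1, y2). K x y1 y2)"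
      unfolding D_def[symmetric] by auto
    obtain X Y where X: "open X" "open Y" "q \<in> X \<times> Y" "X \<times> Y \<subseteq> U" using open_prod_elim[OF U(2,3)] by blast
    obtain Y1 Y2 where Y: "open Y1" "open Y2" "(y1, y2) \<in> Y1 \<times> Y2" "Y1 \<times> Y2 \<subseteq> Y"
      using open_prod_elim[of Y "(y1, y2)"] X(2,3) q by auto
    obtain e0 where e0: "e0 > 0" "ball x e0 \<subseteq> X" using X q by (auto simp: open_contains_ball)
    obtain e1 where e1: "e1 > 0" "ball y1 e1 \<subseteq> Y1" using Y by (auto simp: open_contains_ball)
    obtain e2 where e2: "e2 > 0" "ball y2 e2 \<subseteq> Y2" using Y by (auto simp: open_contains_ball)
    define e where "e = min e0 (min e1 e2)"
    have e: "e > 0" "ball x e \<subseteq> X" "ball y1 e \<subseteq> Y1" "ball y2 e \<subseteq> Y2"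
      using e0 e1 e2 by (auto simp: e_def)
    obtain n where n: "1 / real (Suc n) < e / 2" using nat_approx_posE[of "e / 2"] e(1) by auto
    define \<delta> where "\<delta> = 1 / real (Suc n)"
    have \<delta>: "\<delta> > 0" "2 * \<delta> < e" using n by (auto simp: \<delta>_def simp del: of_nat_Suc)
    obtain a b c where abc: "a \<in> Q" "dist a x < \<delta>" "b \<in> Q" "dist b y1 < \<delta>" "c \<in> Q" "dist c y2 < \<delta>"
      using Q(2)[OF \<delta>(1)] by metis
    have sub: "ball a' \<delta> \<subseteq> ball x' e" if "dist a' x' < \<delta>" for a' x' :: 'a
    proof
      fix y assume "y \<in> ball a' \<delta>"
      then show "y \<in> ball x' e" using that \<delta>(2) dist_triangle[of x' y a'] by (simp add: dist_commute)
    qed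
    have "R (a, b, c, n) \<subseteq> X \<times> Y1 \<times> Y2"
      using sub[OF abc(2)] sub[OF abc(4)] sub[OF abc(6)] e unfolding R_def \<delta>_def by auto
    then have "R (a, b, c, n) \<subseteq> U" using X(4) Y(4) by blast
    then have "(a, b, c, n) \<in> I" using abc U unfolding I_def good_def by blast
    moreover have "q \<in> R (a, b, c, n)" using abc by (auto simp: R_def q \<delta>_def)
    ultimately show ?thesis by blast
  qed
  \<comment> \<open>The complement of the union of the product balls consists of diagonal points,
    where the modified kernel is 0. Being the complement of a countable union of measurable boxes,
    it is measurable for the product measure.\<close>
  define \<C> where "\<C> = insert (- (\<Union>i\<in>I. R i)) (R ` I)"
  have Um: "(\<Union>i\<in>I. R i) \<in> sets ?P" using cI Rm by (intro sets.countable_UN') auto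
  have sp: "space ?P = UNIV" by (simp add: space_pair_measure)
  have eqF: "?F \<in> borel_measurable (restrict_space ?P \<Omega>)" if \<Omega>: "\<Omega> \<in> sets ?P"
    and h: "h \<in> borel_measurable ?P" "\<And>z. z \<in> \<Omega> \<Longrightarrow> ?F z = h z" for \<Omega> and h :: "'a \<times> 'a \<times> 'a \<Rightarrow> 'b"
  proof -
    have "h \<in> borel_measurable (restrict_space ?P \<Omega>)" by (rule measurable_restrict_space1[OF h(1)])
    then show ?thesis by (rule measurable_cong[THEN iffD2, rotated]) (simp add: space_restrict_space h(2))
  qed
  show ?thesis
  proof (rule measurable_piecewise_restrict[of \<C>])
    show "countable \<C>" using cI by (simp add: \<C>_def)
    show "space ?P \<subseteq> \<Union> \<C>" by (auto simp: \<C>_def)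
    have Cm: "\<Omega> \<in> sets ?P" if "\<Omega> \<in> \<C>" for \<Omega>
      using that Rm sets.compl_sets[OF Um] by (auto simp: \<C>_def sp Compl_eq_Diff_UNIV)
    then show "\<Omega> \<inter> space ?P \<in> sets ?P" if "\<Omega> \<in> \<C>" for \<Omega> using that sp by simp
    show "?F \<in> borel_measurable (restrict_space ?P \<Omega>)" if "\<Omega> \<in> \<C>" for \<Omega>
    proof (cases "\<Omega> = - (\<Union>i\<in>I. R i)")
      case True
      have "?F z = 0" if "z \<in> \<Omega>" for z
      proof -
        have "z \<in> D" using cover[of z] that True by blast
        then show ?thesis by (auto simp: D_def)
      qed
      then show ?thesis using Cm[OF that] by (intro eqF[of _ "\<lambda>_. 0"]) auto
    next
      case False
      then have "\<Omega> \<in> R ` I" using that unfolding \<C>_def by blast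
      then obtain i where i: "i \<in> I" "\<Omega> = R i" by blast
      obtain U where U: "U \<subseteq> - D" "set_integrable ?P U (\<lambda>(x, y1, y2). K x y1 y2)" "R i \<subseteq> U"
        using i(1) unfolding I_def good_def by blast
      define h where "h = (\<lambda>z. indicator U z *\<^sub>R (case z of (x, y1, y2) \<Rightarrow> K x y1 y2))"
      have "h \<in> borel_measurable ?P"
        using U(2) unfolding set_integrable_def h_def by (rule borel_measurable_integrable)
      moreover have "?F z = h z" if "z \<in> \<Omega>" for z
      proof -
        have "z \<in> U" "z \<notin> D" using that U i by auto
        then show ?thesis by (auto simp: h_def D_def split: prod.splits)
      qed
      ultimately show ?thesis using Cm[OF that] by (intro eqF[of _ h])
    qed
  qed
qed

theorem theorem2p8:
  fixes M :: "'a::metric_space measure"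
    and lam :: "'a \<Rightarrow> real \<Rightarrow> real"
    and T :: "('a \<Rightarrow> 'b::{real_normed_field,banach,second_countable_topology}) \<Rightarrow> ('a \<Rightarrow> 'b) \<Rightarrow> 'a \<Rightarrow> 'b"
    and p1 p2 p :: real
  assumes "non_homogeneous_space M lam"
    and "compact_inner_regular M"
    and "1 < p" and "1 < p1" and "1 < p2"
    and "1 / p = 1 / p1 + 1 / p2"
    and "bilinear_cz_operator M lam p1 p2 p T"
  shows "extends_boundedly_L1_weak_L_half M p1 p2 T"
proof -
  have sM: "sets M = sets borel" and ud: "upper_doubling M lam" and gd: "geometrically_doubling TYPE('a)"
    using assms(1) by (auto simp: non_homogeneous_space_def)
  obtain Cl where Cl: "Cl > 0" "\<And>x r. r > 0 \<Longrightarrow> lam x r \<le> Cl * lam x (r / 2)"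
    using ud unfolding upper_doubling_def by blast
  obtain N :: nat where N: "\<forall>x::'a. \<forall>r>0. \<forall>Y. Y \<subseteq> ball x r \<and> disjoint_family_on (\<lambda>y. ball y (r / 4)) Y
        \<longrightarrow> finite Y \<and> card Y \<le> N"
    using gd unfolding geometrically_doubling_def by blast
  interpret nonhom_space M lam Cl N
  proof
    show "sets M = sets borel" by (rule sM)
    show "lam x r > 0" "emeasure M (ball x r) \<le> ennreal (lam x r)" if "r > 0" for x r
      using ud that unfolding upper_doubling_def by blast+
    show "lam x r \<le> lam x s" if "0 < r" "r \<le> s" for x r s
    proof -
      have "mono_on {0<..} (lam x)" using ud unfolding upper_doubling_def by blast
      then show ?thesis by (rule mono_onD) (use that in auto)
    qed
    show "lam x r \<le> Cl * lam x (r / 2)" if "r > 0" for x r by (rule Cl(2)[OF that])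
    show "finite Y \<and> card Y \<le> N" if "r > 0" "Y \<subseteq> ball x r" "disjoint_family_on (\<lambda>y. ball y (r / 4)) Y" for r and x :: 'a and Y
      by (rule N[THEN spec, THEN spec, THEN mp, THEN spec, THEN mp, OF that(1) conjI[OF that(2,3)]])
    show "emeasure M A = (SUP S\<in>{S. compact S \<and> S \<subseteq> A}. emeasure M S)" if "A \<in> sets borel" for A
      using assms(2) that sM unfolding compact_inner_regular_def by blast
  qed
  obtain K where K: "cz_kernel M lam K" "associated_with M T K" and bd: "bounded_bilinear_Lp M p1 p2 p T"
    using assms(7) unfolding bilinear_cz_operator_def by blast
  obtain CT0 where CT0: "\<forall>f1\<in>Lp_space p1 M. \<forall>f2\<in>Lp_space p2 M.
      Lp_norm p M (T f1 f2) \<le> CT0 * Lp_norm p1 M f1 * Lp_norm p2 M f2"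
    using bd unfolding bounded_bilinear_Lp_def by blast
  from K(1)[unfolded cz_kernel_def, THEN conjunct2] obtain CK \<omega> where CK: "CK > 0" "dini_modulus \<omega>"
    and est0: "\<forall>x y1 y2. x \<noteq> y1 \<or> x \<noteq> y2 \<longrightarrow>
           norm (K x y1 y2) \<le> CK / (lam_sum lam x y1 y2)\<^sup>2 \<and>
           (\<forall>x'. dist x x' \<le> max (dist x y1) (dist x y2) / 2 \<longrightarrow>
              norm (K x y1 y2 - K x' y1 y2)
                \<le> CK / (lam_sum lam x y1 y2)\<^sup>2 * \<omega> (dist x x' / (dist x y1 + dist x y2))) \<and>
           (\<forall>y1'. dist y1 y1' \<le> max (dist x y1) (dist x y2) / 2 \<longrightarrow>
              norm (K x y1 y2 - K x y1' y2)
                \<le> CK / (lam_sum lam x y1 y2)\<^sup>2 * \<omega> (dist y1 y1' / (dist x y1 + dist x y2))) \<and>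
           (\<forall>y2'. dist y2 y2' \<le> max (dist x y1) (dist x y2) / 2 \<longrightarrow>
              norm (K x y1 y2 - K x y1 y2')
                \<le> CK / (lam_sum lam x y1 y2)\<^sup>2 * \<omega> (dist y2 y2' / (dist x y1 + dist x y2)))"
    by (elim exE conjE) (rule that)
  have est: "norm (K x y1 y2) \<le> CK / (lam_sum lam x y1 y2)\<^sup>2 \<and>
           (\<forall>y1'. dist y1 y1' \<le> max (dist x y1) (dist x y2) / 2 \<longrightarrow>
              norm (K x y1 y2 - K x y1' y2)
                \<le> CK / (lam_sum lam x y1 y2)\<^sup>2 * \<omega> (dist y1 y1' / (dist x y1 + dist x y2))) \<and>
           (\<forall>y2'. dist y2 y2' \<le> max (dist x y1) (dist x y2) / 2 \<longrightarrow>
              norm (K x y1 y2 - K x y1 y2')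
                \<le> CK / (lam_sum lam x y1 y2)\<^sup>2 * \<omega> (dist y2 y2' / (dist x y1 + dist x y2)))"
    if "x \<noteq> y1 \<or> x \<noteq> y2" for x y1 y2
    using est0[rule_format, OF that] by simp
  \<comment> \<open>Values on the diagonal are arbitrary in the definition of a kernel; setting them
    to 0 makes the kernel measurable on the whole product.\<close>
  define K0 where "K0 = (\<lambda>x y1 y2. if x = y1 \<and> x = y2 then 0 else K x y1 y2)"
  \<comment> \<open>The term of the larger distance is one of the two summands of
    \<open>lam_sum\<close>, and the other is nonnegative under the convention that it is 0 at
    distance 0.\<close>
  have lam_le: "CK / (lam_sum lam x y1 y2)\<^sup>2 \<le> CK / (lam x (max (dist x y1) (dist x y2)))\<^sup>2"
    if "max (dist x y1) (dist x y2) > 0" for x y1 y2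
  proof -
    have pos: "0 \<le> (if x = y then 0 else lam x (dist x y))" for y
      using lam_pos[of "dist x y" x] by (auto intro: less_imp_le)
    have "lam x (max (dist x y1) (dist x y2)) \<le> lam_sum lam x y1 y2"
    proof (cases "dist x y1 \<le> dist x y2")
      case True
      then have "x \<noteq> y2" using that by auto
      then show ?thesis using True pos[of y1] by (simp add: lam_sum_def max_def)
    next
      case False
      then have "x \<noteq> y1" by auto
      then show ?thesis using False pos[of y2] by (simp add: lam_sum_def max_def)
    qed
    then show ?thesis
      using lam_pos[OF that, of x] CK(1)
      by (intro divide_left_mono power_mono mult_pos_pos zero_less_power) (auto intro: less_imp_le)
  qed
  have off: "K0 x y1 y2 = K x y1 y2" "x \<noteq> y1 \<or> x \<noteq> y2" if "max (dist x y1) (dist x y2) > 0" for x y1 y2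
    using that by (auto simp: K0_def)
  have om_le: "CK / (lam_sum lam x y1 y2)\<^sup>2 * \<omega> (d / (dist x y1 + dist x y2))
      \<le> CK / (lam x (max (dist x y1) (dist x y2)))\<^sup>2 * \<omega> (d / max (dist x y1) (dist x y2))"
    if m: "max (dist x y1) (dist x y2) > 0" and "d \<ge> 0" for x y1 y2 d
  proof (intro mult_mono lam_le[OF m] dini_mono[OF CK(2)])
    show "d / (dist x y1 + dist x y2) \<le> d / max (dist x y1) (dist x y2)"
      using m \<open>d \<ge> 0\<close> by (intro divide_left_mono) (auto simp: max_def add_pos_nonneg add_nonneg_pos)
    show "0 \<le> \<omega> (d / (dist x y1 + dist x y2))" using \<open>d \<ge> 0\<close> by (intro dini_nonneg[OF CK(2)]) simp
  qed (use \<open>d \<ge> 0\<close> CK(1) in auto)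
  have "cz_setting M lam Cl N T K0 p1 p2 p (max CT0 1) CK \<omega>"
  proof
    show "1 < p" "1 < p1" "1 < p2" "1 / p = 1 / p1 + 1 / p2" "0 < max CT0 1" "CK > 0" "dini_modulus \<omega>"
      using assms CK by auto
    show "bilinear_ae M (Lp_space p1 M) (Lp_space p2 M) T"
      using bd unfolding bounded_bilinear_Lp_def by blast
    show "T f g \<in> Lp_space p M" if "f \<in> Lp_space p1 M" "g \<in> Lp_space p2 M" for f g
      using bd that unfolding bounded_bilinear_Lp_def by blast
    show "Lp_norm p M (T f g) \<le> max CT0 1 * Lp_norm p1 M f * Lp_norm p2 M g"
      if "f \<in> Lp_space p1 M" "g \<in> Lp_space p2 M" for f g
    proof -
      have "CT0 * Lp_norm p1 M f * Lp_norm p2 M g \<le> max CT0 1 * Lp_norm p1 M f * Lp_norm p2 M g"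
        by (intro mult_right_mono) (auto simp: Lp_norm_def)
      then show ?thesis using CT0 that by (meson order_trans)
    qed
    show "(\<lambda>(x, y1, y2). K0 x y1 y2) \<in> borel_measurable (M \<Otimes>\<^sub>M M \<Otimes>\<^sub>M M)"
      unfolding K0_def using K(1) unfolding cz_kernel_def by (intro off_diagonal_measurable) blast
    show "norm (K0 x y1 y2) \<le> CK / (lam x (max (dist x y1) (dist x y2)))\<^sup>2"
      if "max (dist x y1) (dist x y2) > 0" for x y1 y2
      using est[OF off(2)[OF that]] lam_le[OF that] off(1)[OF that] by fastforce
    show "norm (K0 x y1 y2 - K0 x y1' y2) \<le> CK / (lam x (max (dist x y1) (dist x y2)))\<^sup>2
        * \<omega> (dist y1 y1' / max (dist x y1) (dist x y2))"
      if m: "max (dist x y1) (dist x y2) > 0" and d: "dist y1 y1' \<le> max (dist x y1) (dist x y2) / 2" for x y1 y1' y2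
    proof -
      \<comment> \<open>If the moved triple were on the diagonal, the larger distance would equal
        \<open>dist y1 y1'\<close>, which is at most half of it.\<close>
      have n: "\<not> (x = y1' \<and> x = y2)" using m d by (auto simp: dist_commute)
      have "K0 x y1' y2 = K x y1' y2" unfolding K0_def by (rule if_not_P[OF n])
      then have "norm (K0 x y1 y2 - K0 x y1' y2)
          \<le> CK / (lam_sum lam x y1 y2)\<^sup>2 * \<omega> (dist y1 y1' / (dist x y1 + dist x y2))"
        using est[OF off(2)[OF m]] off(1)[OF m] d by simp
      also have "\<dots> \<le> CK / (lam x (max (dist x y1) (dist x y2)))\<^sup>2 * \<omega> (dist y1 y1' / max (dist x y1) (dist x y2))"
        by (rule om_le[OF m]) simp
      finally show ?thesis .
    qed
    show "norm (K0 x y1 y2 - K0 x y1 y2') \<le> CK / (lam x (max (dist x y1) (dist x y2)))\<^sup>2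
        * \<omega> (dist y2 y2' / max (dist x y1) (dist x y2))"
      if m: "max (dist x y1) (dist x y2) > 0" and d: "dist y2 y2' \<le> max (dist x y1) (dist x y2) / 2" for x y1 y2 y2'
    proof -
      have n: "\<not> (x = y1 \<and> x = y2')" using m d by (auto simp: dist_commute)
      have "K0 x y1 y2' = K x y1 y2'" unfolding K0_def by (rule if_not_P[OF n])
      then have "norm (K0 x y1 y2 - K0 x y1 y2')
          \<le> CK / (lam_sum lam x y1 y2)\<^sup>2 * \<omega> (dist y2 y2' / (dist x y1 + dist x y2))"
        using est[OF off(2)[OF m]] off(1)[OF m] d by simp
      also have "\<dots> \<le> CK / (lam x (max (dist x y1) (dist x y2)))\<^sup>2 * \<omega> (dist y2 y2' / max (dist x y1) (dist x y2))"
        by (rule om_le[OF m]) simp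
      finally show ?thesis .
    qed
    show "AE x in M. x \<notin> supp f1 \<inter> supp f2 \<longrightarrow>
        T f1 f2 x = (\<integral>(y1, y2). K0 x y1 y2 * f1 y1 * f2 y2 \<partial>(M \<Otimes>\<^sub>M M))"
      if "f1 \<in> bcs M" "f2 \<in> bcs M" for f1 f2
    proof -
      have "AE x in M. x \<notin> supp f1 \<inter> supp f2 \<longrightarrow>
        T f1 f2 x = (\<integral>(y1, y2). K x y1 y2 * f1 y1 * f2 y2 \<partial>(M \<Otimes>\<^sub>M M))"
        using K(2) that unfolding associated_with_def bcs_def by blast
      then show ?thesis
      proof (rule AE_mp, intro AE_I2 impI)
        fix x assume eq: "x \<notin> supp f1 \<inter> supp f2 \<longrightarrow>
            T f1 f2 x = (\<integral>(y1, y2). K x y1 y2 * f1 y1 * f2 y2 \<partial>(M \<Otimes>\<^sub>M M))"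
          and x: "x \<notin> supp f1 \<inter> supp f2"
        \<comment> \<open>The two kernels differ at \<open>y1 = y2 = x\<close> only, and there the
          product \<open>f1 y1 * f2 y2\<close> vanishes.\<close>
        have "f1 x = 0 \<or> f2 x = 0" using x supp_subset[of f1] supp_subset[of f2] by blast
        then have eqK: "K0 x y1 y2 * f1 y1 * f2 y2 = K x y1 y2 * f1 y1 * f2 y2" for y1 y2
          by (auto simp: K0_def)
        show "T f1 f2 x = (\<integral>(y1, y2). K0 x y1 y2 * f1 y1 * f2 y2 \<partial>(M \<Otimes>\<^sub>M M))"
          unfolding eqK by (rule eq[rule_format, OF x])
      qed
    qed
  qed
  then show ?thesis by (rule cz_setting.extends_boundedly)
qed

end
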